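(* Let $1<q\le p<\infty$ and let $a\colon\mathbb{R}^n\times\mathbb{R}^n\to\mathbb{R}$ be a (measurable) function, continuous in the second variable, such that for some constants $a_-,a_+$, $$0<a_-\le a(x,y)\le a_+<\infty\quad\text{for any }(x,y)\in\mathbb{R}^n\times\mathbb{R}^n.$$ For $s\in(0,1)$ set $$\mathcal{J}_{s,p,q}(u)=\iint_{\mathbb{R}^n\times\mathbb{R}^n}\left(\frac{|u(x)-u(y)|^q}{|x-y|^{n+sq}}+a(x,y)\frac{|u(x)-u(y)|^p}{|x-y|^{n+sp}}\right)dx\,dy.$$ Let $u\in W^{1,p}(\mathbb{R}^n)\cap W^{1,q}(\mathbb{R}^n)$. Then $$\lim_{s\uparrow1}(1-s)\,\mathcal{J}_{s,p,q}(u)=\mathcal{K}_{n,q}\int_{\mathbb{R}^n}|\nabla u(x)|^q\,dx+\mathcal{K}_{n,p}\int_{\mathbb{R}^n}a(x,x)|\nabla u(x)|^p\,dx,$$ where $$\mathcal{K}_{n,\kappa}=\frac1\kappa\int_{\mathbb{S}^{n-1}}|w_n|^\kappa\,dS_w,\qquad\kappa>1.$$ Conversely, if $u\in L^p(\mathbb{R}^n)\cap L^q(\mathbb{R}^n)$ is such that $$\liminf_{s\uparrow1}(1-s)\,\mathcal{J}_{s,p,q}(u)<\infty,$$ then $u\in W^{1,p}(\mathbb{R}^n)\cap W^{1,q}(\mathbb{R}^n)$.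
   Context: $n\ge1$ is an integer, $\mathbb{S}^{n-1}$ is the unit sphere of $\mathbb{R}^n$, $dS$ is its $(n-1)$-dimensional Hausdorff (surface) measure, and $w_n$ is the $n$-th coordinate of $w\in\mathbb{S}^{n-1}$. $W^{1,p}(\mathbb{R}^n)$ is the usual Sobolev space of real-valued functions. $\mathcal{J}_{s,p,q}(u)$ takes values in $[0,\infty]$. "Continuous in the second variable" means that $y\mapsto a(x,y)$ is continuous for every $x\in\mathbb{R}^n$. *)

theory Defs
  imports "HOL-Analysis.Analysis"
begin

section \<open>Hausdorff measure\<close>

(* The normalisation unit_ball_vol m / 2^m is the one that makes the m-dimensional Hausdorff measure
   agree with Lebesgue measure on R^m and with surface area on smooth m-dimensional surfaces.
   Since 0^0 = 1, the empty set is treated separately, so that m = 0 gives counting measure.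
   "bounded" is required because the library's diameter of an unbounded set is unspecified. *)
definition hausdorff_pre :: "nat \<Rightarrow> real \<Rightarrow> 'a::metric_space set \<Rightarrow> ennreal" where
  "hausdorff_pre m \<delta> A =
     (INF U \<in> {U :: nat \<Rightarrow> 'a set. A \<subseteq> (\<Union>i. U i) \<and> (\<forall>i. bounded (U i) \<and> diameter (U i) \<le> \<delta>)}.
        \<Sum>i. if U i = {} then 0
            else ennreal (unit_ball_vol (real m) * (diameter (U i) / 2) ^ m))"

definition hausdorff_outer :: "nat \<Rightarrow> 'a::metric_space set \<Rightarrow> ennreal" where
  "hausdorff_outer m A = (SUP \<delta> \<in> {0<..}. hausdorff_pre m \<delta> A)"

definition hausdorff_measure :: "nat \<Rightarrow> 'a::metric_space measure" where
  "hausdorff_measure m = measure_of UNIV (sets borel) (hausdorff_outer m)"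

section \<open>Lebesgue and Sobolev spaces on \<open>\<real>\<^sup>n\<close>\<close>

definition in_Lp :: "real \<Rightarrow> (real ^ 'n \<Rightarrow> 'b::euclidean_space) \<Rightarrow> bool" where
  "in_Lp p f \<longleftrightarrow>
     f \<in> borel_measurable lebesgue \<and> integrable lebesgue (\<lambda>x. norm (f x) powr p)"

definition partial_deriv :: "'n \<Rightarrow> (real ^ 'n \<Rightarrow> real) \<Rightarrow> real ^ 'n \<Rightarrow> real" where
  "partial_deriv i f x = frechet_derivative f (at x) (axis i 1)"

fun Ck :: "nat \<Rightarrow> (real ^ 'n \<Rightarrow> real) \<Rightarrow> bool" where
  "Ck 0 f \<longleftrightarrow> continuous_on UNIV f"
| "Ck (Suc k) f \<longleftrightarrow> (\<forall>x. f differentiable (at x)) \<and> (\<forall>i. Ck k (partial_deriv i f))"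

definition test_function :: "(real ^ 'n \<Rightarrow> real) \<Rightarrow> bool" where
  "test_function \<phi> \<longleftrightarrow> (\<forall>k. Ck k \<phi>) \<and> compact (closure {x. \<phi> x \<noteq> 0})"

definition locally_integrable :: "(real ^ 'n \<Rightarrow> 'b::euclidean_space) \<Rightarrow> bool" where
  "locally_integrable f \<longleftrightarrow> (\<forall>K. compact K \<longrightarrow> f absolutely_integrable_on K)"

definition weak_gradient :: "(real ^ 'n \<Rightarrow> real) \<Rightarrow> (real ^ 'n \<Rightarrow> real ^ 'n) \<Rightarrow> bool" where
  "weak_gradient u g \<longleftrightarrow>
     locally_integrable u \<and> locally_integrable g \<and>
     (\<forall>\<phi> i. test_function \<phi> \<longrightarrow>
        (LINT x|lebesgue. u x * partial_deriv i \<phi> x) = - (LINT x|lebesgue. g x $ i * \<phi> x))"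

definition in_W1 :: "real \<Rightarrow> (real ^ 'n \<Rightarrow> real) \<Rightarrow> bool" where
  "in_W1 p u \<longleftrightarrow> in_Lp p u \<and> (\<exists>g. weak_gradient u g \<and> in_Lp p g)"

section \<open>The functional and the constant\<close>

(* Lebesgue measure is that of the product space. On the null set x = y the integrand is 0,
   because x / 0 = 0. *)
definition J_functional ::
  "(real ^ 'n \<Rightarrow> real ^ 'n \<Rightarrow> real) \<Rightarrow> real \<Rightarrow> real \<Rightarrow> real \<Rightarrow> (real ^ 'n \<Rightarrow> real) \<Rightarrow> ennreal" where
  "J_functional a s p q u =
     (\<integral>\<^sup>+ (x, y). ennreal
        (\<bar>u x - u y\<bar> powr q / norm (x - y) powr (real CARD('n) + s * q)
         + a x y * (\<bar>u x - u y\<bar> powr p / norm (x - y) powr (real CARD('n) + s * p)))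
      \<partial>lebesgue)"

(* The coordinate type 'n carries no distinguished last element, so the coordinate playing
   the role of w_n is a parameter k. *)
definition K_const :: "'n::finite \<Rightarrow> real \<Rightarrow> ennreal" where
  "K_const k \<kappa> =
     ennreal (1 / \<kappa>) *
     (\<integral>\<^sup>+ w \<in> sphere (0 :: real ^ 'n) 1. ennreal (\<bar>w $ k\<bar> powr \<kappa>)
        \<partial>hausdorff_measure (CARD('n) - 1))"

end

theory Submission
  imports Defs
begin

text \<open>
  Substituting \<open>y = x + z\<close> turns either summand of \<open>(1 - s) J\<close> into an integral of the increments
  \<open>\<integral> \<bar>u (x + z) - u x\<bar> powr r dx\<close> against the kernel \<open>(1 - s) \<bar>z\<bar> powr (- n - s r)\<close>. Multiplied by
  \<open>\<bar>z\<bar> powr r\<close>, this kernel becomes an approximate identity at the origin: as \<open>s\<close> increases to 1, its mass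
  in every ball tends to the area of the sphere divided by \<open>r\<close>, and increments with \<open>\<bar>z\<bar>\<close> bounded away from 0
  contribute nothing in the limit (\<open>far_energy_tendsto_0\<close>). Near the origin \<open>u (x + z) - u x\<close> may be
  replaced by \<open>\<nabla>u(x) \<bullet> z\<close>, with an error of order \<open>o(\<bar>z\<bar>)\<close> in \<open>L\<^sup>r\<close> (\<open>sobolev_taylor_remainder\<close>), and
  polar coordinates and the rotation invariance of the sphere turn \<open>\<bar>\<nabla>u(x) \<bullet> z\<bar> powr r\<close> into
  \<open>K \<bar>\<nabla>u(x)\<bar> powr r\<close>. This gives the limit when the coefficient depends on \<open>x\<close> only
  (\<open>weighted_energy_tendsto\<close>). A coefficient \<open>a x y\<close> lies, for \<open>y\<close> close to \<open>x\<close>, between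
  two weights depending on \<open>x\<close> only, and by continuity in \<open>y\<close> both weights tend to \<open>a x x\<close> as the distance
  allowed shrinks (\<open>upper_envelope\<close>, \<open>variable_energy_tendsto\<close>).

  For the converse, bounded energies with \<open>s\<close> arbitrarily close to 1 force the average of the increments over the ball of
  radius \<open>t\<close> to be at most a constant times \<open>t powr r\<close> for some arbitrarily small \<open>t\<close> (\<open>energy_ge_radial\<close>). By the quasi-subadditivity
  of the increments in \<open>z\<close> the same bound holds for every single \<open>z\<close> of length \<open>t\<close>. Hence the
  difference quotients with these steps are bounded in \<open>L\<^sup>r\<close>, and a weak limit of them is
  the weak gradient (\<open>Lr_weak_limit\<close>, \<open>sobolev_pair_of_energy_bound\<close>).

  The constant is defined by the Hausdorff measure of the sphere, whereas polar coordinates produce the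
  cone measure, \<open>n\<close> times the volume of the cone over a set. That the two agree
  (\<open>hausdorff_measure_sphere_eq_cone\<close>) is an isodiametric inequality: a set of small diameter on the
  sphere has no more cone measure than the flat ball of the same diameter, up to a factor close to 1, and small
  caps, with which the sphere can be covered efficiently by Vitali's theorem, attain equality in the limit.
\<close>

text \<open>The companion of the notation \<open>LBINT\<close> for nonnegative integrands.\<close>

abbreviation nn_lborel :: "('a::euclidean_space \<Rightarrow> ennreal) \<Rightarrow> ennreal" (binder "NBINT " 10) where
  "nn_lborel f \<equiv> nn_integral lborel f"

section \<open>Hausdorff measure as a metric outer measure\<close>

definition hausdorff_cost :: "nat \<Rightarrow> 'a::metric_space set \<Rightarrow> ennreal" where
  "hausdorff_cost m U =
     (if U = {} then 0 else ennreal (unit_ball_vol (real m) * (diameter U / 2) ^ m))"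

lemma hausdorff_cost_empty [simp]: "hausdorff_cost m {} = 0"
  by (simp add: hausdorff_cost_def)

lemma hausdorff_pre_le_cover:
  assumes "A \<subseteq> (\<Union>i. U i)" "\<And>i::nat. bounded (U i)" "\<And>i. diameter (U i) \<le> \<delta>"
  shows "hausdorff_pre m \<delta> A \<le> (\<Sum>i. hausdorff_cost m (U i))"
  unfolding hausdorff_pre_def hausdorff_cost_def
  by (rule INF_lower) (use assms in auto)

lemma hausdorff_pre_ge:
  assumes "\<And>U::nat \<Rightarrow> 'a::metric_space set. A \<subseteq> (\<Union>i. U i) \<Longrightarrow> (\<And>i. bounded (U i)) \<Longrightarrow>
     (\<And>i. diameter (U i) \<le> \<delta>) \<Longrightarrow> c \<le> (\<Sum>i. hausdorff_cost m (U i))"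
  shows "c \<le> hausdorff_pre m \<delta> A"
  unfolding hausdorff_pre_def
  by (rule INF_greatest) (use assms in \<open>auto simp: hausdorff_cost_def\<close>)

lemma hausdorff_pre_less_obtain:
  assumes "hausdorff_pre m \<delta> A < c"
  obtains U :: "nat \<Rightarrow> 'a::metric_space set" where "A \<subseteq> (\<Union>i. U i)" "\<And>i. bounded (U i)"
    "\<And>i. diameter (U i) \<le> \<delta>" "(\<Sum>i. hausdorff_cost m (U i)) < c"
  using assms unfolding hausdorff_pre_def INF_less_iff hausdorff_cost_def by auto

lemma hausdorff_pre_mono: "A \<subseteq> B \<Longrightarrow> hausdorff_pre m \<delta> A \<le> hausdorff_pre m \<delta> B"
  by (rule hausdorff_pre_ge, rule hausdorff_pre_le_cover) auto

lemma hausdorff_pre_antimono: "\<delta> \<le> \<delta>' \<Longrightarrow> hausdorff_pre m \<delta>' A \<le> hausdorff_pre m \<delta> A"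
  by (rule hausdorff_pre_ge, rule hausdorff_pre_le_cover) (auto intro: order_trans)

lemma hausdorff_pre_empty [simp]: "0 \<le> \<delta> \<Longrightarrow> hausdorff_pre m \<delta> {} = 0"
  using hausdorff_pre_le_cover[of "{}" "\<lambda>_. {}" \<delta> m] by auto

lemma ennreal_less_add_pos:
  fixes x :: ennreal
  assumes "x < top" "0 < c"
  shows "x < x + ennreal c"
  using assms by (cases x) (auto simp: ennreal_less_iff simp flip: ennreal_plus)

text \<open>Covers of the pieces, each optimal up to \<open>e / 2 ^ i\<close>, are joined into one sequence
  through a pairing of the natural numbers.\<close>

lemma hausdorff_pre_UN_le:
  fixes A :: "nat \<Rightarrow> 'a::metric_space set"
  shows "hausdorff_pre m \<delta> (\<Union>i. A i) \<le> (\<Sum>i. hausdorff_pre m \<delta> (A i))"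
proof (rule ennreal_le_epsilon)
  fix e :: real assume e: "0 < e" and fin: "(\<Sum>i. hausdorff_pre m \<delta> (A i)) < top"
  have fin': "hausdorff_pre m \<delta> (A i) < top" for i
  proof -
    have "sum (\<lambda>i. hausdorff_pre m \<delta> (A i)) {i} \<le> (\<Sum>i. hausdorff_pre m \<delta> (A i))"
      by (intro sum_le_suminf) auto
    then show ?thesis using fin by (simp add: order_le_less_trans)
  qed
  have "\<exists>U::nat \<Rightarrow> 'a set. A i \<subseteq> (\<Union>j. U j) \<and> (\<forall>j. bounded (U j) \<and> diameter (U j) \<le> \<delta>) \<and>
      (\<Sum>j. hausdorff_cost m (U j)) \<le> hausdorff_pre m \<delta> (A i) + ennreal (e * (1/2)^Suc i)" for i
  proof -
    have "hausdorff_pre m \<delta> (A i) < hausdorff_pre m \<delta> (A i) + ennreal (e * (1/2)^Suc i)"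
      using fin'[of i] e by (intro ennreal_less_add_pos) auto
    then show ?thesis
      by (rule hausdorff_pre_less_obtain) (meson less_imp_le)
  qed
  then obtain U :: "nat \<Rightarrow> nat \<Rightarrow> 'a set"
    where U: "\<And>i. A i \<subseteq> (\<Union>j. U i j)" "\<And>i j. bounded (U i j)" "\<And>i j. diameter (U i j) \<le> \<delta>"
      and Ule: "\<And>i. (\<Sum>j. hausdorff_cost m (U i j)) \<le> hausdorff_pre m \<delta> (A i) + ennreal (e * (1/2)^Suc i)"
    by metis
  define V where "V n = (case prod_decode n of (i, j) \<Rightarrow> U i j)" for n
  have "hausdorff_pre m \<delta> (\<Union>i. A i) \<le> (\<Sum>n. hausdorff_cost m (V n))"
  proof (rule hausdorff_pre_le_cover)
    have "\<exists>n. x \<in> V n" if xA: "x \<in> A i" for x i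
    proof -
      obtain j where "x \<in> U i j" using xA U(1)[of i] by blast
      then show ?thesis by (intro exI[of _ "prod_encode (i, j)"]) (simp add: V_def)
    qed
    then show "(\<Union>i. A i) \<subseteq> (\<Union>n. V n)" by blast
  qed (auto simp: V_def U split: prod.split)
  also have "(\<Sum>n. hausdorff_cost m (V n)) = (\<Sum>i. \<Sum>j. hausdorff_cost m (U i j))"
    unfolding V_def
    using suminf_ennreal_2dimen[of "\<lambda>i. \<Sum>j. hausdorff_cost m (U i j)"
        "\<lambda>(i,j). hausdorff_cost m (U i j)"]
    by (simp add: case_prod_unfold)
  also have "\<dots> \<le> (\<Sum>i. hausdorff_pre m \<delta> (A i) + ennreal (e * (1/2)^Suc i))"
    by (intro suminf_le Ule) auto
  also have "\<dots> = (\<Sum>i. hausdorff_pre m \<delta> (A i)) + (\<Sum>i. ennreal (e * (1/2)^Suc i))"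
    by (rule suminf_add[symmetric]) auto
  also have "(\<Sum>i. ennreal (e * (1/2)^Suc i)) = ennreal e"
    using sums_mult[OF power_half_series, of e] e
    by (intro suminf_ennreal_eq) auto
  finally show "hausdorff_pre m \<delta> (\<Union>i. A i) \<le> (\<Sum>i. hausdorff_pre m \<delta> (A i)) + ennreal e" .
qed

lemma hausdorff_pre_Un_le:
  assumes "0 \<le> \<delta>"
  shows "hausdorff_pre m \<delta> (A \<union> B) \<le> hausdorff_pre m \<delta> A + hausdorff_pre m \<delta> B"
proof -
  have "A \<union> B = (\<Union>i. binaryset A B i)"
    by (simp add: UN_binaryset_eq)
  also have "hausdorff_pre m \<delta> \<dots> \<le> (\<Sum>i. hausdorff_pre m \<delta> (binaryset A B i))"
    by (rule hausdorff_pre_UN_le)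
  also have "\<dots> = hausdorff_pre m \<delta> A + hausdorff_pre m \<delta> B"
    using suminf_binaryset_eq[of "hausdorff_pre m \<delta>" A B] assms by simp
  finally show ?thesis .
qed

lemma hausdorff_outer_mono: "A \<subseteq> B \<Longrightarrow> hausdorff_outer m A \<le> hausdorff_outer m B"
  unfolding hausdorff_outer_def by (intro SUP_mono) (blast intro: hausdorff_pre_mono)

lemma hausdorff_outer_empty [simp]: "hausdorff_outer m {} = 0"
  unfolding hausdorff_outer_def by (intro antisym SUP_least) (auto simp: hausdorff_pre_empty)

lemma hausdorff_pre_le_outer: "0 < \<delta> \<Longrightarrow> hausdorff_pre m \<delta> A \<le> hausdorff_outer m A"
  unfolding hausdorff_outer_def by (rule SUP_upper) auto

lemma hausdorff_outer_UN_le: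
  fixes A :: "nat \<Rightarrow> 'a::metric_space set"
  shows "hausdorff_outer m (\<Union>i. A i) \<le> (\<Sum>i. hausdorff_outer m (A i))"
  unfolding hausdorff_outer_def[of m "\<Union>i. A i"]
proof (rule SUP_least)
  fix \<delta> :: real assume "\<delta> \<in> {0<..}"
  then have "(\<Sum>i. hausdorff_pre m \<delta> (A i)) \<le> (\<Sum>i. hausdorff_outer m (A i))"
    by (intro suminf_le hausdorff_pre_le_outer) auto
  with hausdorff_pre_UN_le[of m \<delta> A]
  show "hausdorff_pre m \<delta> (\<Union>i. A i) \<le> (\<Sum>i. hausdorff_outer m (A i))"
    by (rule order_trans)
qed

lemma hausdorff_outer_Un_le:
  "hausdorff_outer m (A \<union> B) \<le> hausdorff_outer m A + hausdorff_outer m B"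
  using hausdorff_outer_UN_le[of m "binaryset A B"] suminf_binaryset_eq[of "hausdorff_outer m" A B]
  by (simp add: UN_binaryset_eq)

lemma hausdorff_outer_space: "outer_measure_space UNIV (hausdorff_outer m)"
  unfolding outer_measure_space_def positive_def increasing_def countably_subadditive_def
  by (auto intro: hausdorff_outer_mono hausdorff_outer_UN_le)

text \<open>A covering set of diameter less than the distance of two sets meets at most one of them,
  so that a cover of the union splits into a cover of each.\<close>

lemma hausdorff_pre_separated:
  fixes A B :: "'a::metric_space set"
  assumes sep: "\<And>x y. x \<in> A \<Longrightarrow> y \<in> B \<Longrightarrow> e \<le> dist x y" and "0 \<le> \<delta>" "\<delta> < e"
  shows "hausdorff_pre m \<delta> A + hausdorff_pre m \<delta> B \<le> hausdorff_pre m \<delta> (A \<union> B)"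
proof (rule hausdorff_pre_ge)
  fix U :: "nat \<Rightarrow> 'a set"
  assume U: "A \<union> B \<subseteq> (\<Union>i. U i)" "\<And>i. bounded (U i)" "\<And>i. diameter (U i) \<le> \<delta>"
  define V where "V X i = (if U i \<inter> X = {} then {} else U i)" for X i
  have V: "hausdorff_pre m \<delta> X \<le> (\<Sum>i. hausdorff_cost m (V X i))" if "X \<subseteq> A \<union> B" for X
  proof (rule hausdorff_pre_le_cover)
    show "X \<subseteq> (\<Union>i. V X i)" using that U(1) by (fastforce simp: V_def)
  qed (use U \<open>0 \<le> \<delta>\<close> in \<open>auto simp: V_def\<close>)
  have "hausdorff_cost m (V A i) + hausdorff_cost m (V B i) \<le> hausdorff_cost m (U i)" for i
  proof (cases "U i \<inter> A = {} \<or> U i \<inter> B = {}")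
    case False
    then obtain x y where "x \<in> U i" "x \<in> A" "y \<in> U i" "y \<in> B" by auto
    then have "e \<le> \<delta>"
      using sep[of x y] diameter_bounded_bound[OF U(2)[of i], of x y] U(3)[of i] by auto
    then show ?thesis using \<open>\<delta> < e\<close> by auto
  qed (auto simp: V_def)
  then have "(\<Sum>i. hausdorff_cost m (V A i) + hausdorff_cost m (V B i)) \<le> (\<Sum>i. hausdorff_cost m (U i))"
    by (intro suminf_le) auto
  moreover have "(\<Sum>i. hausdorff_cost m (V A i) + hausdorff_cost m (V B i)) =
      (\<Sum>i. hausdorff_cost m (V A i)) + (\<Sum>i. hausdorff_cost m (V B i))"
    by (rule suminf_add[symmetric]) auto
  ultimately show "hausdorff_pre m \<delta> A + hausdorff_pre m \<delta> B \<le> (\<Sum>i. hausdorff_cost m (U i))"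
    using add_mono[OF V[of A] V[of B]] by (auto intro: order_trans)
qed

lemma hausdorff_outer_separated:
  fixes A B :: "'a::metric_space set"
  assumes sep: "\<And>x y. x \<in> A \<Longrightarrow> y \<in> B \<Longrightarrow> e \<le> dist x y" and "0 < e"
  shows "hausdorff_outer m A + hausdorff_outer m B \<le> hausdorff_outer m (A \<union> B)"
proof -
  have "hausdorff_outer m A + hausdorff_outer m B =
      (SUP \<delta>\<in>{0<..}. hausdorff_pre m \<delta> A + hausdorff_pre m \<delta> B)"
    unfolding hausdorff_outer_def
  proof (rule SUP_add_directed_ennreal[symmetric])
    fix i j :: real assume "i \<in> {0<..}" "j \<in> {0<..}"
    then show "\<exists>k\<in>{0<..}. hausdorff_pre m i A + hausdorff_pre m j B \<le> hausdorff_pre m k A + hausdorff_pre m k B"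
      by (intro bexI[of _ "min i j"] add_mono hausdorff_pre_antimono) auto
  qed
  also have "\<dots> \<le> hausdorff_outer m (A \<union> B)"
  proof (rule SUP_least)
    fix \<delta> :: real assume \<delta>: "\<delta> \<in> {0<..}"
    let ?d = "min \<delta> (e / 2)"
    have "hausdorff_pre m \<delta> A + hausdorff_pre m \<delta> B \<le> hausdorff_pre m ?d A + hausdorff_pre m ?d B"
      by (intro add_mono hausdorff_pre_antimono) auto
    also have "\<dots> \<le> hausdorff_pre m ?d (A \<union> B)"
      using \<delta> \<open>0 < e\<close> by (intro hausdorff_pre_separated[OF sep]) auto
    also have "\<dots> \<le> hausdorff_outer m (A \<union> B)"
      using \<delta> \<open>0 < e\<close> by (intro hausdorff_pre_le_outer) auto
    finally show "hausdorff_pre m \<delta> A + hausdorff_pre m \<delta> B \<le> hausdorff_outer m (A \<union> B)" .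
  qed
  finally show ?thesis .
qed

lemma ennreal_suminf_tail_tendsto_0:
  fixes f :: "nat \<Rightarrow> ennreal"
  assumes "suminf f < top"
  shows "(\<lambda>n. \<Sum>i. f (i + n)) \<longlonglongrightarrow> 0"
proof -
  have fin: "f i < top" for i
  proof -
    have "sum f {i} \<le> suminf f" by (intro sum_le_suminf) auto
    then show ?thesis using assms by (simp add: order_le_less_trans)
  qed
  define g where "g i = enn2real (f i)" for i
  have fg: "f i = ennreal (g i)" for i using fin by (simp add: g_def)
  have g0: "0 \<le> g i" for i by (simp add: g_def)
  have sg: "summable g"
    using assms unfolding fg by (intro summable_suminf_not_top g0) auto
  have "(\<lambda>n. ennreal (\<Sum>i. g (i + n))) \<longlonglongrightarrow> ennreal 0"
    using suminf_exist_split2[OF sg] by (rule tendsto_ennrealI)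
  moreover have "(\<Sum>i. f (i + n)) = ennreal (\<Sum>i. g (i + n))" for n
    unfolding fg using sg by (intro suminf_ennreal2 g0) (simp add: summable_iff_shift)
  ultimately show ?thesis by simp
qed

text \<open>Caratheodory's criterion. The shells between consecutive distances from the closed set
  are pairwise separated once every other one is dropped, so that their measures are summable,
  and hence the part of the set within a small distance of \<open>F\<close> (and outside \<open>F\<close>) has small measure.\<close>

lemma hausdorff_outer_closed_split:
  fixes F X :: "'a::metric_space set"
  assumes "closed F"
  shows "hausdorff_outer m (F \<inter> X) + hausdorff_outer m (X - F) \<le> hausdorff_outer m X"
proof (cases "F = {} \<or> hausdorff_outer m X = top")
  case True
  then show ?thesis by auto
next
  case False
  then have Fne: "F \<noteq> {}" and fin: "hausdorff_outer m X < top" by (auto simp: less_top)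
  let ?h = "hausdorff_outer m"
  define Y where "Y n = {x \<in> X. 1 / real (Suc n) \<le> infdist x F}" for n
  define D where "D n = Y (Suc n) - Y n" for n
  have Ymono: "Y n \<subseteq> Y k" if "n \<le> k" for n k
  proof -
    have "1 / real (Suc k) \<le> 1 / real (Suc n)" using that by (intro divide_left_mono) auto
    then show ?thesis by (auto simp: Y_def)
  qed
  have YX: "Y n \<subseteq> X - F" for n
    by (auto simp: Y_def infdist_zero)
  have Yun: "\<exists>n. x \<in> Y n" if "x \<in> X - F" for x
  proof -
    have "0 < infdist x F"
      using that assms Fne by (metis DiffD2 in_closed_iff_infdist_zero infdist_nonneg order_less_le)
    then obtain n where "inverse (real (Suc n)) < infdist x F" using reals_Archimedean by blast
    then show ?thesis using that by (auto simp: Y_def inverse_eq_divide intro!: exI[of _ n])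
  qed
  have DY: "?h (Y n) + ?h (D (Suc n)) \<le> ?h (Y n \<union> D (Suc n))" for n
  proof (rule hausdorff_outer_separated)
    fix x y assume x: "x \<in> Y n" and y: "y \<in> D (Suc n)"
    have "infdist x F \<le> infdist y F + dist x y" by (rule infdist_triangle)
    then show "1 / real (Suc n) - 1 / real (Suc (Suc n)) \<le> dist x y"
      using x y by (auto simp: D_def Y_def)
  next
    have "1 / real (Suc (Suc n)) < 1 / real (Suc n)" by (intro divide_strict_left_mono) auto
    then show "0 < 1 / real (Suc n) - 1 / real (Suc (Suc n))" by simp
  qed
  have sumD: "(\<Sum>k<n. ?h (D (2 * k + 1 + j))) \<le> ?h (Y (2 * n + j))" for n j
  proof (induction n)
    case (Suc n)
    have "(\<Sum>k<Suc n. ?h (D (2 * k + 1 + j))) \<le> ?h (Y (2 * n + j)) + ?h (D (Suc (2 * n + j)))"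
      using Suc.IH by (simp add: add_right_mono)
    also have "\<dots> \<le> ?h (Y (2 * n + j) \<union> D (Suc (2 * n + j)))" by (rule DY)
    also have "\<dots> \<le> ?h (Y (2 * Suc n + j))"
      using Ymono[of "2 * n + j" "2 * Suc n + j"] by (intro hausdorff_outer_mono) (auto simp: D_def)
    finally show ?case .
  qed simp
  have sumD_le: "(\<Sum>i<n. ?h (D (Suc i))) \<le> 2 * ?h X" for n
  proof -
    have "(\<Sum>i<n. ?h (D (Suc i))) \<le> (\<Sum>i<2 * n. ?h (D (Suc i)))"
      by (intro sum_mono2) auto
    also have "\<dots> = (\<Sum>k<n. ?h (D (2 * k + 1 + 0))) + (\<Sum>k<n. ?h (D (2 * k + 1 + 1)))"
      by (induction n) (auto simp: add_ac)
    also have "\<dots> \<le> ?h (Y (2 * n + 0)) + ?h (Y (2 * n + 1))"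
      by (intro add_mono sumD)
    also have "\<dots> \<le> ?h X + ?h X"
      using YX by (intro add_mono hausdorff_outer_mono) blast+
    finally show ?thesis by (simp add: mult_2)
  qed
  have "(\<Sum>i. ?h (D (Suc i))) \<le> 2 * ?h X"
    using sumD_le by (intro suminf_le_const) auto
  also have "\<dots> < top" using fin by (simp add: ennreal_mult_less_top)
  finally have lim: "(\<lambda>n. \<Sum>i. ?h (D (Suc (i + n)))) \<longlonglongrightarrow> 0"
    by (rule ennreal_suminf_tail_tendsto_0)
  have main: "?h (F \<inter> X) + ?h (X - F) \<le> ?h X + (\<Sum>i. ?h (D (Suc (i + n))))" for n
  proof -
    have "X - F \<subseteq> Y (Suc n) \<union> (\<Union>i. D (Suc (i + n)))"
    proof
      fix x assume "x \<in> X - F"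
      then obtain k where k: "x \<in> Y k" using Yun by blast
      define l where "l = (LEAST k. x \<in> Y k)"
      have l: "x \<in> Y l" unfolding l_def using k by (rule LeastI)
      show "x \<in> Y (Suc n) \<union> (\<Union>i. D (Suc (i + n)))"
      proof (cases "l \<le> Suc n")
        case True
        then show ?thesis using Ymono l by blast
      next
        case False
        then obtain i where i: "l = Suc (Suc (i + n))"
          by (metis Suc_leI add_Suc less_Suc_eq_le not_le le_Suc_ex add.commute)
        have "x \<notin> Y (Suc (i + n))" using i unfolding l_def by (intro not_less_Least) simp
        then show ?thesis using l i by (auto simp: D_def)
      qed
    qed
    then have "?h (X - F) \<le> ?h (Y (Suc n) \<union> (\<Union>i. D (Suc (i + n))))"
      by (rule hausdorff_outer_mono)
    also have "\<dots> \<le> ?h (Y (Suc n)) + ?h (\<Union>i. D (Suc (i + n)))"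
      by (rule hausdorff_outer_Un_le)
    also have "\<dots> \<le> ?h (Y (Suc n)) + (\<Sum>i. ?h (D (Suc (i + n))))"
      by (intro add_left_mono hausdorff_outer_UN_le)
    finally have "?h (F \<inter> X) + ?h (X - F) \<le>
        (?h (F \<inter> X) + ?h (Y (Suc n))) + (\<Sum>i. ?h (D (Suc (i + n))))"
      by (simp add: add_left_mono add.assoc)
    also have "?h (F \<inter> X) + ?h (Y (Suc n)) \<le> ?h (F \<inter> X \<union> Y (Suc n))"
    proof (rule hausdorff_outer_separated)
      fix x y assume x: "x \<in> F \<inter> X" and y: "y \<in> Y (Suc n)"
      have "infdist y F \<le> dist y x" using x by (intro infdist_le) auto
      then show "1 / real (Suc (Suc n)) \<le> dist x y" using y by (auto simp: Y_def dist_commute)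
    qed simp
    also have "\<dots> \<le> ?h X" using YX by (intro hausdorff_outer_mono) blast
    finally show ?thesis by (simp add: add_right_mono)
  qed
  have "(\<lambda>n. ?h X + (\<Sum>i. ?h (D (Suc (i + n))))) \<longlonglongrightarrow> ?h X + 0"
    by (intro tendsto_add tendsto_const lim)
  then show ?thesis
    using main by (intro LIMSEQ_le_const[of _ "?h X"]) auto
qed

lemma sets_hausdorff_measure [simp, measurable_cong]: "sets (hausdorff_measure m) = sets borel"
  unfolding hausdorff_measure_def using sets.sigma_sets_eq[of borel] by simp

lemma space_hausdorff_measure [simp]: "space (hausdorff_measure m) = UNIV"
  unfolding hausdorff_measure_def by simp

text \<open>Closed sets are Caratheodory measurable and generate the Borel sets, so that the outer measure is a
  measure on them.\<close>

theorem emeasure_hausdorff_measure: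
  assumes "A \<in> sets borel"
  shows "emeasure (hausdorff_measure m) A = hausdorff_outer m A"
proof -
  let ?L = "lambda_system UNIV UNIV (hausdorff_outer m :: 'a set \<Rightarrow> ennreal)"
  interpret sigma_algebra UNIV "UNIV :: 'a set set"
    by (simp add: sigma_algebra_iff2 flip: Pow_UNIV)
  have L: "measure_space UNIV ?L (hausdorff_outer m)"
    by (rule caratheodory_lemma[OF hausdorff_outer_space])
  have "F \<in> ?L" if "closed F" for F
  proof -
    have "hausdorff_outer m (F \<inter> X) + hausdorff_outer m ((UNIV - F) \<inter> X) = hausdorff_outer m X" for X
    proof (rule antisym)
      have e: "(UNIV - F) \<inter> X = X - F" by auto
      show "hausdorff_outer m (F \<inter> X) + hausdorff_outer m ((UNIV - F) \<inter> X) \<le> hausdorff_outer m X"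
        unfolding e by (rule hausdorff_outer_closed_split[OF that])
      have "X = F \<inter> X \<union> (X - F)" by auto
      then show "hausdorff_outer m X \<le> hausdorff_outer m (F \<inter> X) + hausdorff_outer m ((UNIV - F) \<inter> X)"
        unfolding e by (metis hausdorff_outer_Un_le)
    qed
    then show ?thesis by (simp add: lambda_system_def)
  qed
  then have "sigma_sets UNIV (Collect closed) \<subseteq> ?L"
    using L by (intro sigma_algebra.sigma_sets_subset) (auto simp: measure_space_def)
  then have sub: "sets borel \<subseteq> ?L"
    by (simp add: borel_eq_closed)
  have "measure_space UNIV (sets borel) (hausdorff_outer m :: 'a set \<Rightarrow> ennreal)"
    using measure_down[OF L _ sub] sets.sigma_algebra_axioms[of borel] by simp
  then show ?thesis
    using assms unfolding hausdorff_measure_def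
    by (intro emeasure_measure_of_sigma) (auto simp: measure_space_def)
qed

section \<open>Translations and orthogonal maps\<close>

lemma nn_integral_lborel_translate:
  fixes c :: "'a::euclidean_space"
  assumes [measurable]: "f \<in> borel_measurable borel"
  shows "(NBINT x. f (c + x)) = (NBINT x. f x)"
proof -
  have "(NBINT x. f x) = (\<integral>\<^sup>+x. f x \<partial>distr lborel borel ((+) c))"
    by (simp only: lborel_distr_plus)
  also have "\<dots> = (NBINT x. f (c + x))"
    by (rule nn_integral_distr) auto
  finally show ?thesis ..
qed

lemma borel_measurable_orthogonal:
  fixes T :: "'a::euclidean_space \<Rightarrow> 'a"
  assumes "orthogonal_transformation T"
  shows "T \<in> borel_measurable borel"
  using orthogonal_transformation_linear[OF assms]
  by (intro borel_measurable_continuous_onI linear_continuous_on) (simp add: linear_conv_bounded_linear)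

text \<open>Integrate the indicator of \<open>A\<close> at \<open>T x\<close> times that of the unit ball at \<open>y - T x\<close> in both orders:
  by translation invariance, and since \<open>T\<close> preserves the ball, the results are the two measures
  of \<open>A\<close> times the volume of the ball.\<close>

lemma lborel_distr_orthogonal:
  fixes T :: "'a::euclidean_space \<Rightarrow> 'a"
  assumes T: "orthogonal_transformation T"
  shows "distr lborel borel T = lborel"
proof (rule measure_eqI)
  fix A assume "A \<in> sets (distr lborel borel T)"
  then have A[measurable]: "A \<in> sets borel" by simp
  have lin: "linear T" using T by (rule orthogonal_transformation_linear)
  have [measurable]: "T \<in> borel_measurable borel"
    using T by (rule borel_measurable_orthogonal)
  obtain R where R: "\<And>y. T (R y) = y"
    using orthogonal_transformation_surj[OF T] by (metis surj_def)
  define B :: "'a set" where "B = ball 0 1"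
  have [measurable]: "B \<in> sets borel" by (simp add: B_def)
  let ?I = "\<lambda>x y. indicator A (T x) * indicator B (y - T x) :: ennreal"
  have "emeasure (distr lborel borel T) A * emeasure lborel B
      = (NBINT x. indicator A (T x)) * emeasure lborel B"
    by (subst nn_integral_distr[symmetric, of T lborel borel "indicator A"]) auto
  also have "\<dots> = (NBINT x. indicator A (T x) * emeasure lborel B)"
    by (subst nn_integral_multc) auto
  also have "\<dots> = (NBINT x. (NBINT y. ?I x y))"
  proof (rule nn_integral_cong)
    fix x :: 'a
    have "(NBINT y. indicator B (y - T x)) = (NBINT y. indicator B (- T x + y))"
      by (simp add: algebra_simps)
    also have "\<dots> = emeasure lborel B"
      using nn_integral_lborel_translate[of "indicator B" "- T x"] by simp
    finally show "indicator A (T x) * emeasure lborel B = (NBINT y. ?I x y)"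
      by (subst nn_integral_cmult) simp_all
  qed
  also have "\<dots> = (NBINT y. (NBINT x. ?I x y))"
    by (rule lborel_pair.Fubini') measurable
  also have "\<dots> = (NBINT y. (NBINT x. indicator A (T x + y) * indicator B (- T x)))"
  proof (rule nn_integral_cong)
    fix y :: 'a
    have "(NBINT x. ?I x y) = (NBINT x. ?I (R y + x) y)"
      by (subst nn_integral_lborel_translate) auto
    then show "(NBINT x. ?I x y) = (NBINT x. indicator A (T x + y) * indicator B (- T x))"
      by (simp add: linear_add[OF lin] R add.commute)
  qed
  also have "\<dots> = (NBINT x. (NBINT y. indicator A (T x + y) * indicator B (- T x)))"
    by (rule lborel_pair.Fubini') measurable
  also have "\<dots> = (NBINT x. emeasure lborel A * indicator B x)"
  proof (rule nn_integral_cong)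
    fix x :: 'a
    have "(NBINT y. indicator A (T x + y) * indicator B (- T x)) =
        (NBINT y. indicator A (T x + y)) * indicator B (- T x)"
      by (subst nn_integral_multc) auto
    also have "(NBINT y. indicator A (T x + y)) = emeasure lborel A"
      by (subst nn_integral_lborel_translate) auto
    finally have e: "(NBINT y. indicator A (T x + y) * indicator B (- T x)) =
        emeasure lborel A * indicator B (- T x)" .
    have "(indicator B (- T x) :: ennreal) = indicator B x"
      using orthogonal_transformation_norm[OF T, of x] by (auto simp: indicator_def B_def)
    with e show "(NBINT y. indicator A (T x + y) * indicator B (- T x)) = emeasure lborel A * indicator B x"
      by (simp only:)
  qed
  also have "\<dots> = emeasure lborel A * emeasure lborel B"
    by (subst nn_integral_cmult) auto
  finally have "emeasure (distr lborel borel T) A * emeasure lborel B = emeasure lborel A * emeasure lborel B" .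
  moreover have "emeasure lborel B \<noteq> 0" "emeasure lborel B \<noteq> top"
    using unit_ball_vol_pos[of "real DIM('a)"] by (auto simp: emeasure_ball B_def simp del: unit_ball_vol_pos)
  ultimately show "emeasure (distr lborel borel T) A = emeasure lborel A"
    by (simp add: ennreal_mult_cancel_left mult.commute[of _ "emeasure lborel B"])
qed simp

lemma nn_integral_lborel_orthogonal:
  fixes T :: "'a::euclidean_space \<Rightarrow> 'a"
  assumes T: "orthogonal_transformation T" and [measurable]: "f \<in> borel_measurable borel"
  shows "(NBINT x. f (T x)) = (NBINT x. f x)"
proof -
  have [measurable]: "T \<in> borel_measurable borel"
    using T by (rule borel_measurable_orthogonal)
  have "(NBINT x. f x) = (\<integral>\<^sup>+x. f x \<partial>distr lborel borel T)"
    by (simp only: lborel_distr_orthogonal[OF T])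
  also have "\<dots> = (NBINT x. f (T x))"
    by (rule nn_integral_distr) auto
  finally show ?thesis ..
qed

section \<open>Steiner symmetrization\<close>

text \<open>The sections are replaced by open intervals centred at the origin. With the strict inequality the
  symmetrized set is measurable as soon as the length of the sections is a measurable function, and
  sections of length 0 disappear.\<close>

definition steiner :: "'i set \<Rightarrow> 'i \<Rightarrow> ('i \<Rightarrow> real) set \<Rightarrow> ('i \<Rightarrow> real) set" where
  "steiner I i A = {f \<in> space (Pi\<^sub>M I (\<lambda>_. lborel)).
     ennreal (2 * \<bar>f i\<bar>) < emeasure lborel {t. f(i := t) \<in> A}}"

lemma measurable_section_PiM:
  assumes "i \<in> I" and [measurable]: "A \<in> sets (Pi\<^sub>M I (\<lambda>_. lborel :: real measure))"
    and f: "f \<in> space (Pi\<^sub>M I (\<lambda>_. lborel :: real measure))"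
  shows "{t. f(i := t) \<in> A} \<in> sets borel"
proof -
  have [measurable]: "(\<lambda>t. f(i := t)) \<in> lborel \<rightarrow>\<^sub>M Pi\<^sub>M I (\<lambda>_. lborel :: real measure)"
  proof (rule measurable_PiM_single'[where f="\<lambda>j t. (f(i := t)) j"])
    show "(\<lambda>t. (f(i := t)) j) \<in> lborel \<rightarrow>\<^sub>M lborel" if "j \<in> I" for j
      by (cases "j = i") auto
    show "(\<lambda>t. f(i := t)) \<in> space lborel \<rightarrow> (\<Pi>\<^sub>E i\<in>I. space lborel)"
      using f \<open>i \<in> I\<close> by (auto simp: space_PiM PiE_iff extensional_def)
  qed
  have "{t \<in> space lborel. f(i := t) \<in> A} \<in> sets lborel" by measurable
  then show ?thesis by simp
qed

lemma measurable_steiner_section: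
  assumes "finite I" "i \<in> I" and A[measurable]: "A \<in> sets (Pi\<^sub>M I (\<lambda>_. lborel :: real measure))"
  shows "(\<lambda>f. emeasure lborel {t. f(i := t) \<in> A}) \<in> borel_measurable (Pi\<^sub>M I (\<lambda>_. lborel :: real measure))"
proof -
  let ?P = "Pi\<^sub>M I (\<lambda>_. lborel :: real measure)"
  have [measurable]: "(\<lambda>(f, t). f(i := t)) \<in> ?P \<Otimes>\<^sub>M lborel \<rightarrow>\<^sub>M ?P"
  proof (rule measurable_PiM_single'[where f="\<lambda>j x. (case x of (f, t) \<Rightarrow> f(i := t)) j"])
    show "(\<lambda>x. (case x of (f, t) \<Rightarrow> f(i := t)) j) \<in> ?P \<Otimes>\<^sub>M lborel \<rightarrow>\<^sub>M lborel" if "j \<in> I" for j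
      using that by (cases "j = i") (auto simp: case_prod_unfold)
    show "(\<lambda>x j. (case x of (f, t) \<Rightarrow> f(i := t)) j) \<in> space (?P \<Otimes>\<^sub>M lborel) \<rightarrow> (\<Pi>\<^sub>E i\<in>I. space lborel)"
      using \<open>i \<in> I\<close> by (auto simp: space_pair_measure space_PiM PiE_iff extensional_def)
  qed
  have "{x \<in> space (?P \<Otimes>\<^sub>M lborel). (case x of (f, t) \<Rightarrow> f(i := t)) \<in> A} \<in> sets (?P \<Otimes>\<^sub>M (lborel :: real measure))"
    by measurable
  from lborel.measurable_emeasure_Pair[OF this]
  show ?thesis
    by (rule measurable_cong[THEN iffD1, rotated])
      (auto intro!: arg_cong[where f="emeasure lborel"] simp: space_pair_measure)
qed

lemma steiner_sets:
  assumes "finite I" "i \<in> I" "A \<in> sets (Pi\<^sub>M I (\<lambda>_. lborel :: real measure))"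
  shows "steiner I i A \<in> sets (Pi\<^sub>M I (\<lambda>_. lborel :: real measure))"
proof -
  have [measurable]: "(\<lambda>f. f i) \<in> borel_measurable (Pi\<^sub>M I (\<lambda>_. lborel :: real measure))"
    using assms(2) by measurable
  note measurable_steiner_section[OF assms, measurable]
  show ?thesis unfolding steiner_def by measurable
qed

lemma emeasure_lborel_symmetric_less: "emeasure lborel {t. ennreal (2 * \<bar>t\<bar>) < c} = c"
proof (cases c)
  case (real r)
  then have "{t. ennreal (2 * \<bar>t\<bar>) < c} = {- r / 2 <..< r / 2}"
    by (auto simp: ennreal_less_iff)
  then show ?thesis using real by simp
next
  case top
  then have "{t. ennreal (2 * \<bar>t\<bar>) < c} = UNIV" by auto
  then show ?thesis using top by simp
qed

lemma emeasure_steiner: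
  assumes I: "finite I" "i \<in> I" and A[measurable]: "A \<in> sets (Pi\<^sub>M I (\<lambda>_. lborel :: real measure))"
  shows "emeasure (Pi\<^sub>M I (\<lambda>_. lborel)) (steiner I i A) = emeasure (Pi\<^sub>M I (\<lambda>_. lborel)) A"
proof -
  interpret product_sigma_finite "\<lambda>_. lborel :: real measure" by standard
  define J where "J = I - {i}"
  have J: "I = insert i J" "i \<notin> J" "finite J" using I by (auto simp: J_def)
  let ?P = "\<lambda>I. Pi\<^sub>M I (\<lambda>_. lborel :: real measure)"
  have ext: "x(i := t) \<in> space (?P I)" if "x \<in> space (?P J)" for x t
    using that J by (auto simp: space_PiM PiE_iff extensional_def)
  have eq: "emeasure (?P I) B = (\<integral>\<^sup>+x. emeasure lborel {t. x(i := t) \<in> B} \<partial>?P J)"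
    if B: "B \<in> sets (?P I)" for B
  proof -
    have "emeasure (?P I) B = (\<integral>\<^sup>+f. indicator B f \<partial>?P I)" using B by simp
    also have "\<dots> = (\<integral>\<^sup>+x. \<integral>\<^sup>+t. indicator B (x(i := t)) \<partial>lborel \<partial>?P J)"
      unfolding J(1) using J B by (intro product_nn_integral_insert) auto
    also have "\<dots> = (\<integral>\<^sup>+x. emeasure lborel {t. x(i := t) \<in> B} \<partial>?P J)"
    proof (intro nn_integral_cong)
      fix x assume x: "x \<in> space (?P J)"
      have "{t. (x(i := 0))(i := t) \<in> B} \<in> sets borel"
        by (rule measurable_section_PiM[OF I(2) B ext[OF x]])
      then have "{t. x(i := t) \<in> B} \<in> sets lborel" by simp
      then have "emeasure lborel {t. x(i := t) \<in> B} = (NBINT t. indicator {t. x(i := t) \<in> B} t)"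
        by (rule nn_integral_indicator[symmetric])
      then show "(NBINT t. indicator B (x(i := t))) = emeasure lborel {t. x(i := t) \<in> B}"
        by (simp add: indicator_def)
    qed
    finally show ?thesis .
  qed
  show ?thesis
    unfolding eq[OF A] eq[OF steiner_sets[OF I A]]
  proof (intro nn_integral_cong)
    fix x assume x: "x \<in> space (?P J)"
    have "{t. x(i := t) \<in> steiner I i A} = {t. ennreal (2 * \<bar>t\<bar>) < emeasure lborel {t. x(i := t) \<in> A}}"
      using ext[OF x] by (auto simp: steiner_def)
    then show "emeasure lborel {t. x(i := t) \<in> steiner I i A} = emeasure lborel {t. x(i := t) \<in> A}"
      by (simp add: emeasure_lborel_symmetric_less)
  qed
qed

lemma emeasure_gt_imp_spread:
  fixes M :: "real set"
  assumes "ennreal c < emeasure lborel M" "0 \<le> c"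
  shows "\<exists>s\<in>M. \<exists>s'\<in>M. c < s' - s"
proof (rule ccontr)
  assume "\<not> ?thesis"
  then have le: "s' \<le> s + c" if "s \<in> M" "s' \<in> M" for s s'
    using that by (auto simp: not_less algebra_simps)
  have ne: "M \<noteq> {}" using assms by auto
  then obtain s0 where "s0 \<in> M" by blast
  have bdd: "bdd_below M" using le[OF _ \<open>s0 \<in> M\<close>] by (intro bdd_belowI[of _ "s0 - c"]) force
  have "M \<subseteq> {Inf M .. Inf M + c}"
  proof
    fix x assume "x \<in> M"
    have "x - c \<le> Inf M" using le[OF _ \<open>x \<in> M\<close>] by (intro cInf_greatest ne) force
    then show "x \<in> {Inf M .. Inf M + c}" using cInf_lower[OF \<open>x \<in> M\<close> bdd] by auto
  qed
  then have "emeasure lborel M \<le> emeasure lborel {Inf M .. Inf M + c}"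
    by (intro emeasure_mono) auto
  then show False using assms by auto
qed

text \<open>The two sections may be far from the origin and from each other; what counts is that the
  spans of both are controlled by the distances between a point of one and a point of the other.\<close>

lemma symmetrized_sections_close:
  fixes M N :: "real set"
  assumes M: "ennreal (2 * \<bar>a\<bar>) < emeasure lborel M" and N: "ennreal (2 * \<bar>b\<bar>) < emeasure lborel N"
    and E: "\<And>s t. s \<in> M \<Longrightarrow> t \<in> N \<Longrightarrow> \<bar>s - t\<bar> \<le> E"
  shows "\<bar>a - b\<bar> \<le> E"
proof -
  obtain s s' where s: "s \<in> M" "s' \<in> M" "2 * \<bar>a\<bar> < s' - s"
    using emeasure_gt_imp_spread[OF M] by force
  obtain t t' where t: "t \<in> N" "t' \<in> N" "2 * \<bar>b\<bar> < t' - t"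
    using emeasure_gt_imp_spread[OF N] by force
  show ?thesis using E[OF s(1) t(2)] E[OF s(2) t(1)] s t by linarith
qed

text \<open>The extent across the axis \<open>k\<close> and the one along it are bounded separately, since the
  sets to be compared are thin shells over small caps, which resemble flat discs.\<close>

definition narrow :: "'i \<Rightarrow> 'i set \<Rightarrow> real \<Rightarrow> real \<Rightarrow> ('i \<Rightarrow> real) set \<Rightarrow> bool" where
  "narrow k J D H A \<longleftrightarrow>
     (\<forall>f\<in>A. \<forall>g\<in>A. (\<Sum>j\<in>J. (f j - g j)\<^sup>2) \<le> D\<^sup>2 \<and> \<bar>f k - g k\<bar> \<le> H)"

text \<open>In the coordinate \<open>i\<close>, points of two symmetrized sections are no farther apart than some points of the
  original sections; the other coordinates are not changed.\<close>

lemma narrow_steiner: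
  assumes A: "narrow k J D H A" and "finite J" "k \<notin> J" "i \<in> insert k J"
  shows "narrow k J D H (steiner (insert k J) i A)"
  unfolding narrow_def
proof (intro ballI)
  fix f g assume f: "f \<in> steiner (insert k J) i A" and g: "g \<in> steiner (insert k J) i A"
  let ?M = "{t. f(i := t) \<in> A}" and ?N = "{t. g(i := t) \<in> A}"
  have fM: "ennreal (2 * \<bar>f i\<bar>) < emeasure lborel ?M" and gN: "ennreal (2 * \<bar>g i\<bar>) < emeasure lborel ?N"
    using f g by (auto simp: steiner_def)
  obtain s0 where s0: "s0 \<in> ?M" using fM by (metis emeasure_empty ex_in_conv not_less_zero)
  obtain t0 where t0: "t0 \<in> ?N" using gN by (metis emeasure_empty ex_in_conv not_less_zero)
  have nar: "(\<Sum>j\<in>J. ((f(i := s)) j - (g(i := t)) j)\<^sup>2) \<le> D\<^sup>2" "\<bar>(f(i := s)) k - (g(i := t)) k\<bar> \<le> H"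
    if "s \<in> ?M" "t \<in> ?N" for s t
    using A that unfolding narrow_def by blast+
  show "(\<Sum>j\<in>J. (f j - g j)\<^sup>2) \<le> D\<^sup>2 \<and> \<bar>f k - g k\<bar> \<le> H"
  proof (cases "i = k")
    case True
    have "\<bar>f i - g i\<bar> \<le> H"
      by (rule symmetrized_sections_close[OF fM gN]) (use nar True in auto)
    moreover have "(\<Sum>j\<in>J. (f j - g j)\<^sup>2) = (\<Sum>j\<in>J. ((f(i := s0)) j - (g(i := t0)) j)\<^sup>2)"
      using True \<open>k \<notin> J\<close> by (intro sum.cong) auto
    ultimately show ?thesis using nar[OF s0 t0] True by simp
  next
    case False
    then have iJ: "i \<in> J" using assms by auto
    let ?r = "\<Sum>j\<in>J - {i}. (f j - g j)\<^sup>2"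
    have sum_i: "(\<Sum>j\<in>J. ((f(i := s)) j - (g(i := t)) j)\<^sup>2) = (s - t)\<^sup>2 + ?r" for s t
      by (subst sum.remove[OF \<open>finite J\<close> iJ]) (auto intro!: sum.cong)
    have r: "(s - t)\<^sup>2 \<le> D\<^sup>2 - ?r" if "s \<in> ?M" "t \<in> ?N" for s t
      using nar(1)[OF that] unfolding sum_i by simp
    have r0: "0 \<le> D\<^sup>2 - ?r" using r[OF s0 t0] zero_le_power2[of "s0 - t0"] by linarith
    have "\<bar>f i - g i\<bar> \<le> sqrt (D\<^sup>2 - ?r)"

    proof (rule symmetrized_sections_close[OF fM gN])
      fix s t assume "s \<in> ?M" "t \<in> ?N"
      from real_sqrt_le_mono[OF r[OF this]] show "\<bar>s - t\<bar> \<le> sqrt (D\<^sup>2 - ?r)" by simp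
    qed
    then have "(f i - g i)\<^sup>2 \<le> D\<^sup>2 - ?r"
      using r0 power_mono[of "\<bar>f i - g i\<bar>" "sqrt (D\<^sup>2 - ?r)" 2] by simp
    then show ?thesis using sum_i[of "f i" "g i"] nar(2)[OF s0 t0] False by simp
  qed
qed

definition reflection_closed :: "'i set \<Rightarrow> ('i \<Rightarrow> real) set \<Rightarrow> bool" where
  "reflection_closed T A \<longleftrightarrow> (\<forall>i\<in>T. \<forall>f\<in>A. f(i := - f i) \<in> A)"

lemma reflection_closed_steiner:
  assumes A: "reflection_closed T A" and T: "T \<subseteq> I" "i \<in> I"
  shows "reflection_closed (insert i T) (steiner I i A)"
  unfolding reflection_closed_def
proof (intro ballI)
  fix j f assume j: "j \<in> insert i T" and f: "f \<in> steiner I i A"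
  then have jI: "j \<in> I" using T by auto
  have sp: "f(j := - f j) \<in> space (Pi\<^sub>M I (\<lambda>_. lborel :: real measure))"
    using f jI by (auto simp: steiner_def space_PiM PiE_iff extensional_def)
  have "{t. (f(j := - f j))(i := t) \<in> A} = {t. f(i := t) \<in> A}"
  proof (cases "j = i")
    case False
    then have jT: "j \<in> T" using j by simp
    have 1: "(f(j := - f j))(i := t) = (f(i := t))(j := - (f(i := t)) j)" for t
      using False by (auto simp: fun_eq_iff)
    have 2: "f(i := t) = ((f(j := - f j))(i := t))(j := - ((f(j := - f j))(i := t)) j)" for t
      using False by (auto simp: fun_eq_iff)
    show ?thesis
      using A jT unfolding reflection_closed_def by (metis 1 2)
  qed auto
  then show "f(j := - f j) \<in> steiner I i A"
    using f sp by (auto simp: steiner_def)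
qed

text \<open>Symmetrizing in one coordinate after the other preserves the symmetries obtained before.\<close>

lemma symmetrization_exists:
  assumes J: "finite J" "k \<notin> J" and A: "A \<in> sets (Pi\<^sub>M (insert k J) (\<lambda>_. lborel :: real measure))"
    and nar: "narrow k J D H A"
  obtains B where "B \<in> sets (Pi\<^sub>M (insert k J) (\<lambda>_. lborel))" "narrow k J D H B"
    "reflection_closed (insert k J) B"
    "emeasure (Pi\<^sub>M (insert k J) (\<lambda>_. lborel)) B = emeasure (Pi\<^sub>M (insert k J) (\<lambda>_. lborel)) A"
proof -
  let ?I = "insert k J"
  have "\<exists>B\<in>sets (Pi\<^sub>M ?I (\<lambda>_. lborel)). narrow k J D H B \<and> reflection_closed T B \<and>
      emeasure (Pi\<^sub>M ?I (\<lambda>_. lborel)) B = emeasure (Pi\<^sub>M ?I (\<lambda>_. lborel)) A"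
    if "finite T" "T \<subseteq> ?I" for T
    using that
  proof induction
    case empty
    then show ?case using A nar by (auto simp: reflection_closed_def)
  next
    case (insert i T)
    then obtain B where B: "B \<in> sets (Pi\<^sub>M ?I (\<lambda>_. lborel))" "narrow k J D H B" "reflection_closed T B"
      "emeasure (Pi\<^sub>M ?I (\<lambda>_. lborel)) B = emeasure (Pi\<^sub>M ?I (\<lambda>_. lborel)) A" by auto
    have i: "i \<in> ?I" "finite ?I" using insert J by auto
    show ?case
      using B i J insert steiner_sets[OF i(2,1) B(1)] emeasure_steiner[OF i(2,1) B(1)]
        narrow_steiner[OF B(2) J i(1)] reflection_closed_steiner[OF B(3) _ i(1)]
      by (intro bexI[of _ "steiner ?I i B"]) auto
  qed
  from this[of ?I] show ?thesis using J that by auto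
qed

lemma emeasure_cylinder_PiM:
  assumes J: "finite J" "k \<notin> J" and "0 < r" "\<alpha> \<le> \<beta>"
  shows "emeasure (Pi\<^sub>M (insert k J) (\<lambda>_. lborel))
     {f \<in> space (Pi\<^sub>M (insert k J) (\<lambda>_. lborel)). (\<Sum>j\<in>J. (f j)\<^sup>2) \<le> r\<^sup>2 \<and> \<alpha> \<le> f k \<and> f k \<le> \<beta>} =
     ennreal ((\<beta> - \<alpha>) * unit_ball_vol (real (card J)) * r ^ card J)"
proof -
  interpret product_sigma_finite "\<lambda>_. lborel :: real measure" by standard
  let ?P = "\<lambda>I. Pi\<^sub>M I (\<lambda>_. lborel :: real measure)"
  let ?C = "{f \<in> space (?P (insert k J)). (\<Sum>j\<in>J. (f j)\<^sup>2) \<le> r\<^sup>2 \<and> \<alpha> \<le> f k \<and> f k \<le> \<beta>}"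
  let ?B = "{f. sqrt (\<Sum>i\<in>J. (f i)\<^sup>2) \<le> r} \<inter> space (?P J)"
  have C: "?C \<in> sets (?P (insert k J))" by measurable
  have B: "?B \<in> sets (?P J)" by measurable
  have sq: "sqrt s \<le> r \<longleftrightarrow> s \<le> r\<^sup>2" if "0 \<le> s" for s
    using that \<open>0 < r\<close> by (metis real_sqrt_le_iff real_sqrt_unique less_imp_le)
  have "emeasure (?P (insert k J)) ?C = (\<integral>\<^sup>+f. indicator ?C f \<partial>?P (insert k J))"
    using C by simp
  also have "\<dots> = (\<integral>\<^sup>+x. \<integral>\<^sup>+t. indicator ?C (x(k := t)) \<partial>lborel \<partial>?P J)"
    using J C by (intro product_nn_integral_insert) auto
  also have "\<dots> = (\<integral>\<^sup>+x. ennreal (\<beta> - \<alpha>) * indicator ?B x \<partial>?P J)"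
  proof (intro nn_integral_cong)
    fix x assume x: "x \<in> space (?P J)"
    have s: "(\<Sum>j\<in>J. ((x(k := t)) j)\<^sup>2) = (\<Sum>j\<in>J. (x j)\<^sup>2)" for t
      using J by (intro sum.cong) auto
    have sp: "x(k := t) \<in> space (?P (insert k J))" for t
      using x by (auto simp: space_PiM PiE_iff extensional_def)
    have "indicator ?C (x(k := t)) = (indicator ?B x * indicator {\<alpha>..\<beta>} t :: ennreal)" for t
      using sp x sq[of "\<Sum>j\<in>J. (x j)\<^sup>2"] unfolding s by (auto simp: indicator_def s sum_nonneg simp del: fun_upd_apply) (auto simp: )
    then have "(NBINT t. indicator ?C (x(k := t))) = indicator ?B x * (NBINT t. indicator {\<alpha>..\<beta>} t)"
      by (simp add: nn_integral_cmult)
    then show "(NBINT t. indicator ?C (x(k := t))) = ennreal (\<beta> - \<alpha>) * indicator ?B x"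
      using \<open>\<alpha> \<le> \<beta>\<close> by (simp add: mult.commute)
  qed
  also have "\<dots> = ennreal (\<beta> - \<alpha>) * emeasure (?P J) ?B"
    using B by (subst nn_integral_cmult) auto
  also have "\<dots> = ennreal ((\<beta> - \<alpha>) * unit_ball_vol (real (card J)) * r ^ card J)"
    using J \<open>0 < r\<close> \<open>\<alpha> \<le> \<beta>\<close> by (subst emeasure_cball_aux) (auto simp: ennreal_mult' mult.assoc)
  finally show ?thesis .
qed

text \<open>A set that is symmetric under all reflections contains with \<open>f\<close> also \<open>-
  f\<close>; so a bound on the differences bounds the points themselves by half of it, and the set
  lies in a cylinder of radius \<open>D / 2\<close> and height \<open>H\<close>.\<close>

lemma isodiametric_PiM:
  assumes J: "finite J" "k \<notin> J" and A: "A \<in> sets (Pi\<^sub>M (insert k J) (\<lambda>_. lborel :: real measure))"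
    and nar: "narrow k J D H A" and "0 < D" "0 \<le> H"
  shows "emeasure (Pi\<^sub>M (insert k J) (\<lambda>_. lborel)) A \<le>
    ennreal (H * unit_ball_vol (real (card J)) * (D / 2) ^ card J)"
proof -
  let ?I = "insert k J"
  obtain B where B: "B \<in> sets (Pi\<^sub>M ?I (\<lambda>_. lborel))" "narrow k J D H B"
    "reflection_closed ?I B" "emeasure (Pi\<^sub>M ?I (\<lambda>_. lborel)) B = emeasure (Pi\<^sub>M ?I (\<lambda>_. lborel)) A"
    using symmetrization_exists[OF J A nar] by blast
  have neg: "(\<lambda>j. if j \<in> T then - f j else f j) \<in> B" if "f \<in> B" "finite T" "T \<subseteq> ?I" for f T
    using that(2,3)
  proof induction
    case (insert i T)
    then have "(\<lambda>j. if j \<in> T then - f j else f j)(i := - (if i \<in> T then - f i else f i)) \<in> B"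
      using B(3)[unfolded reflection_closed_def, rule_format, of i "\<lambda>j. if j \<in> T then - f j else f j"] by auto
    also have "(\<lambda>j. if j \<in> T then - f j else f j)(i := - (if i \<in> T then - f i else f i)) =
        (\<lambda>j. if j \<in> insert i T then - f j else f j)"
      using insert by auto
    finally show ?case .
  qed (use that in auto)
  have "B \<subseteq> {f \<in> space (Pi\<^sub>M ?I (\<lambda>_. lborel)). (\<Sum>j\<in>J. (f j)\<^sup>2) \<le> (D / 2)\<^sup>2 \<and> - (H / 2) \<le> f k \<and> f k \<le> H / 2}"
  proof
    fix f assume f: "f \<in> B"
    let ?g = "\<lambda>j. if j \<in> ?I then - f j else f j"
    have "?g \<in> B" using neg[OF f, of ?I] J by auto
    from B(2)[unfolded narrow_def, rule_format, OF f this]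
    have n: "(\<Sum>j\<in>J. (f j - ?g j)\<^sup>2) \<le> D\<^sup>2" "\<bar>f k - ?g k\<bar> \<le> H" by blast+
    have "(\<Sum>j\<in>J. (f j - ?g j)\<^sup>2) = 4 * (\<Sum>j\<in>J. (f j)\<^sup>2)"
      unfolding sum_distrib_left by (intro sum.cong) (auto simp: power2_eq_square)
    then show "f \<in> {f \<in> space (Pi\<^sub>M ?I (\<lambda>_. lborel)). (\<Sum>j\<in>J. (f j)\<^sup>2) \<le> (D / 2)\<^sup>2 \<and> - (H / 2) \<le> f k \<and> f k \<le> H / 2}"
      using n f sets.sets_into_space[OF B(1)] by (auto simp: power_divide)
  qed
  then have "emeasure (Pi\<^sub>M ?I (\<lambda>_. lborel)) B \<le> emeasure (Pi\<^sub>M ?I (\<lambda>_. lborel))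
      {f \<in> space (Pi\<^sub>M ?I (\<lambda>_. lborel)). (\<Sum>j\<in>J. (f j)\<^sup>2) \<le> (D / 2)\<^sup>2 \<and> - (H / 2) \<le> f k \<and> f k \<le> H / 2}"
    by (intro emeasure_mono) measurable
  also have "\<dots> = ennreal ((H / 2 - - (H / 2)) * unit_ball_vol (real (card J)) * (D / 2) ^ card J)"
    using \<open>0 < D\<close> \<open>0 \<le> H\<close> by (intro emeasure_cylinder_PiM J) auto
  finally show ?thesis using B(4) by simp
qed

section \<open>Transfer to Euclidean space\<close>

lemma emeasure_lborel_PiM_Basis:
  fixes C :: "'a::euclidean_space set"
  assumes [measurable]: "C \<in> sets borel"
  shows "{f \<in> space (Pi\<^sub>M Basis (\<lambda>_. lborel)). (\<Sum>b\<in>Basis. f b *\<^sub>R b) \<in> C} \<in> sets (Pi\<^sub>M Basis (\<lambda>_. lborel))"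
    "emeasure lborel C = emeasure (Pi\<^sub>M Basis (\<lambda>_. lborel))
       {f \<in> space (Pi\<^sub>M Basis (\<lambda>_. lborel)). (\<Sum>b\<in>Basis. f b *\<^sub>R b) \<in> C}"
proof -
  show "{f \<in> space (Pi\<^sub>M Basis (\<lambda>_. lborel)). (\<Sum>b\<in>Basis. f b *\<^sub>R b) \<in> C} \<in> sets (Pi\<^sub>M Basis (\<lambda>_. lborel))"
    by measurable
  show "emeasure lborel C = emeasure (Pi\<^sub>M Basis (\<lambda>_. lborel))
       {f \<in> space (Pi\<^sub>M Basis (\<lambda>_. lborel)). (\<Sum>b\<in>Basis. f b *\<^sub>R b) \<in> C}"
    by (subst lborel_eq, subst emeasure_distr) (auto intro!: arg_cong2[where f=emeasure])
qed

lemma sum_inner_square_remove: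
  fixes x b :: "'a::euclidean_space"
  assumes "b \<in> Basis"
  shows "(\<Sum>c\<in>Basis - {b}. (x \<bullet> c)\<^sup>2) = (norm x)\<^sup>2 - (x \<bullet> b)\<^sup>2"
  using assms unfolding power2_norm_eq_inner[of x] euclidean_inner[of x x]
  by (subst sum.remove[of Basis b]) (auto simp: power2_eq_square)

lemma isodiametric_Basis:
  fixes C :: "'a::euclidean_space set" and b :: 'a
  assumes b: "b \<in> Basis" and C: "C \<in> sets borel" and "0 < D" "0 \<le> H"
    and nar: "\<And>z v. z \<in> C \<Longrightarrow> v \<in> C \<Longrightarrow> (norm (z - v))\<^sup>2 - ((z - v) \<bullet> b)\<^sup>2 \<le> D\<^sup>2 \<and> \<bar>(z - v) \<bullet> b\<bar> \<le> H"
  shows "emeasure lborel C \<le> ennreal (H * unit_ball_vol (real (DIM('a) - 1)) * (D / 2) ^ (DIM('a) - 1))"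
proof -
  let ?J = "Basis - {b}"
  have B: "insert b ?J = Basis" using b by auto
  have card: "card ?J = DIM('a) - 1" using b by simp
  let ?A = "{f \<in> space (Pi\<^sub>M Basis (\<lambda>_. lborel)). (\<Sum>b\<in>Basis. f b *\<^sub>R b) \<in> C}"
  have "narrow b ?J D H ?A"
    unfolding narrow_def
  proof (intro ballI)
    fix f g assume fg: "f \<in> ?A" "g \<in> ?A"
    let ?z = "\<Sum>b\<in>Basis. f b *\<^sub>R b" and ?v = "\<Sum>b\<in>Basis. g b *\<^sub>R b"
    have i: "(?z - ?v) \<bullet> c = f c - g c" if "c \<in> Basis" for c
      using that by (simp add: inner_diff_left inner_sum_left inner_Basis if_distrib sum.delta cong: if_cong)
    have "(\<Sum>j\<in>?J. (f j - g j)\<^sup>2) = (\<Sum>c\<in>?J. ((?z - ?v) \<bullet> c)\<^sup>2)"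
      by (intro sum.cong) (auto simp: i)
    then show "(\<Sum>j\<in>?J. (f j - g j)\<^sup>2) \<le> D\<^sup>2 \<and> \<bar>f b - g b\<bar> \<le> H"
      using nar[of ?z ?v] fg i[OF b] by (simp add: sum_inner_square_remove[OF b])
  qed
  then show ?thesis
    using isodiametric_PiM[of ?J b ?A D H] emeasure_lborel_PiM_Basis[OF C] \<open>0 < D\<close> \<open>0 \<le> H\<close>
    unfolding B card by simp
qed

lemma emeasure_cylinder_Basis:
  fixes b :: "'a::euclidean_space"
  assumes b: "b \<in> Basis" and "0 < r" "\<alpha> \<le> \<beta>"
  shows "emeasure lborel {z. (norm z)\<^sup>2 - (z \<bullet> b)\<^sup>2 \<le> r\<^sup>2 \<and> \<alpha> \<le> z \<bullet> b \<and> z \<bullet> b \<le> \<beta>} =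
     ennreal ((\<beta> - \<alpha>) * unit_ball_vol (real (DIM('a) - 1)) * r ^ (DIM('a) - 1))"
proof -
  let ?J = "Basis - {b}"
  let ?C = "{z. (norm z)\<^sup>2 - (z \<bullet> b)\<^sup>2 \<le> r\<^sup>2 \<and> \<alpha> \<le> z \<bullet> b \<and> z \<bullet> b \<le> \<beta>}"
  have B: "insert b ?J = Basis" using b by auto
  have card: "card ?J = DIM('a) - 1" using b by simp
  have C: "?C \<in> sets borel" by measurable
  have "{f \<in> space (Pi\<^sub>M Basis (\<lambda>_. lborel)). (\<Sum>b\<in>Basis. f b *\<^sub>R b) \<in> ?C} =
      {f \<in> space (Pi\<^sub>M Basis (\<lambda>_. lborel)). (\<Sum>j\<in>?J. (f j)\<^sup>2) \<le> r\<^sup>2 \<and> \<alpha> \<le> f b \<and> f b \<le> \<beta>}"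
  proof -
    have i: "(\<Sum>b\<in>Basis. f b *\<^sub>R b) \<bullet> c = f c" if "c \<in> Basis" for f and c :: 'a
      using that by (simp add: inner_sum_left inner_Basis if_distrib sum.delta cong: if_cong)
    have "(\<Sum>j\<in>?J. (f j)\<^sup>2) = (\<Sum>c\<in>?J. ((\<Sum>b\<in>Basis. f b *\<^sub>R b) \<bullet> c)\<^sup>2)" for f
      by (intro sum.cong) (auto simp: i)
    then show ?thesis unfolding sum_inner_square_remove[OF b] by (simp add: i[OF b])
  qed
  then show ?thesis
    using emeasure_cylinder_PiM[of ?J b r \<alpha> \<beta>] emeasure_lborel_PiM_Basis(2)[OF C] assms
    unfolding B card by simp
qed

lemma orthogonal_transformation_axis:
  fixes w :: "real ^ 'n" and k :: 'n
  assumes "norm w = 1"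
  shows "\<exists>T :: real ^ 'n \<Rightarrow> real ^ 'n. orthogonal_transformation T \<and> T (axis k 1) = w"
proof -
  have "norm (axis k 1 :: real ^ 'n) = norm w" using assms by simp
  then show ?thesis by (rule orthogonal_transformation_exists) blast
qed

text \<open>The version for an arbitrary axis, obtained by a rotation; the case \<open>D = 0\<close> follows by
  enlarging \<open>D\<close>.\<close>

theorem isodiametric_cylinder:
  fixes C :: "(real ^ 'n) set" and w :: "real ^ 'n"
  assumes w: "norm w = 1" and C[measurable]: "C \<in> sets borel" and D: "0 \<le> D" and H: "0 \<le> H"
    and nar: "\<And>z v. z \<in> C \<Longrightarrow> v \<in> C \<Longrightarrow> (norm (z - v))\<^sup>2 - ((z - v) \<bullet> w)\<^sup>2 \<le> D\<^sup>2 \<and> \<bar>(z - v) \<bullet> w\<bar> \<le> H"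
  shows "emeasure lborel C \<le> ennreal (H * unit_ball_vol (real (CARD('n) - 1)) * (D / 2) ^ (CARD('n) - 1))"
proof -
  obtain T :: "real ^ 'n \<Rightarrow> real ^ 'n" where T: "orthogonal_transformation T" and Tw: "T (axis undefined 1) = w"
    using orthogonal_transformation_axis[OF w, of undefined] by auto
  let ?b = "axis undefined 1 :: real ^ 'n"
  have lin: "linear T" using T by (rule orthogonal_transformation_linear)
  have [measurable]: "T \<in> borel_measurable borel"
    using T by (rule borel_measurable_orthogonal)
  have TC: "T -` C \<in> sets borel" using measurable_sets[of T borel borel C] by simp
  have "emeasure lborel C = emeasure (distr lborel borel T) C"
    by (simp add: lborel_distr_orthogonal[OF T])
  also have "\<dots> = emeasure lborel (T -` C)" by (simp add: emeasure_distr)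
  finally have eq: "emeasure lborel C = emeasure lborel (T -` C)" .
  have nar': "(norm (z - v))\<^sup>2 - ((z - v) \<bullet> ?b)\<^sup>2 \<le> D\<^sup>2 \<and> \<bar>(z - v) \<bullet> ?b\<bar> \<le> H"
    if "z \<in> T -` C" "v \<in> T -` C" for z v
  proof -
    have "norm (T z - T v) = norm (z - v)"
      using orthogonal_transformation_norm[OF T, of "z - v"] by (simp add: linear_diff[OF lin])
    moreover have "(T z - T v) \<bullet> w = (z - v) \<bullet> ?b"
      using T unfolding orthogonal_transformation_def Tw[symmetric] by (metis linear_diff lin)
    ultimately show ?thesis using nar[of "T z" "T v"] that by simp
  qed
  have bound: "emeasure lborel C \<le> ennreal (H * unit_ball_vol (real (CARD('n) - 1)) * ((D + 1 / real (Suc n)) / 2) ^ (CARD('n) - 1))" for n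
  proof -
    have "D\<^sup>2 \<le> (D + 1 / real (Suc n))\<^sup>2" using D by (intro power_mono) auto
    then have nar'': "(norm (z - v))\<^sup>2 - ((z - v) \<bullet> ?b)\<^sup>2 \<le> (D + 1 / real (Suc n))\<^sup>2 \<and> \<bar>(z - v) \<bullet> ?b\<bar> \<le> H"
      if "z \<in> T -` C" "v \<in> T -` C" for z v
      using nar'[OF that] by linarith
    have "emeasure lborel (T -` C) \<le> ennreal (H * unit_ball_vol (real (DIM(real ^ 'n) - 1)) *
        ((D + 1 / real (Suc n)) / 2) ^ (DIM(real ^ 'n) - 1))"
      by (rule isodiametric_Basis[OF _ TC _ H nar''])
        (use D in \<open>auto simp: axis_in_Basis_iff add_nonneg_pos\<close>)
    then show ?thesis unfolding eq by simp
  qed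
  have "(\<lambda>n. ennreal (H * unit_ball_vol (real (CARD('n) - 1)) * ((D + 1 / real (Suc n)) / 2) ^ (CARD('n) - 1)))
     \<longlonglongrightarrow> ennreal (H * unit_ball_vol (real (CARD('n) - 1)) * ((D + 0) / 2) ^ (CARD('n) - 1))"
    using LIMSEQ_inverse_real_of_nat by (intro tendsto_intros) (simp_all add: inverse_eq_divide)
  then show ?thesis
    using bound by (intro LIMSEQ_le_const[of _ _ "emeasure lborel C"]) auto
qed

theorem emeasure_cylinder:
  fixes w :: "real ^ 'n"
  assumes w: "norm w = 1" and "0 < r" "\<alpha> \<le> \<beta>"
  shows "emeasure lborel {z. (norm z)\<^sup>2 - (z \<bullet> w)\<^sup>2 \<le> r\<^sup>2 \<and> \<alpha> \<le> z \<bullet> w \<and> z \<bullet> w \<le> \<beta>} =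
     ennreal ((\<beta> - \<alpha>) * unit_ball_vol (real (CARD('n) - 1)) * r ^ (CARD('n) - 1))"
proof -
  obtain T :: "real ^ 'n \<Rightarrow> real ^ 'n" where T: "orthogonal_transformation T" and Tw: "T (axis undefined 1) = w"
    using orthogonal_transformation_axis[OF w, of undefined] by auto
  let ?b = "axis undefined 1 :: real ^ 'n"
  let ?C = "{z. (norm z)\<^sup>2 - (z \<bullet> w)\<^sup>2 \<le> r\<^sup>2 \<and> \<alpha> \<le> z \<bullet> w \<and> z \<bullet> w \<le> \<beta>}"
  have [measurable]: "T \<in> borel_measurable borel"
    using T by (rule borel_measurable_orthogonal)
  have [measurable]: "?C \<in> sets borel" by measurable
  have "emeasure lborel ?C = emeasure (distr lborel borel T) ?C"
    by (simp add: lborel_distr_orthogonal[OF T])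
  also have "\<dots> = emeasure lborel (T -` ?C)" by (simp add: emeasure_distr)
  also have "T -` ?C = {z. (norm z)\<^sup>2 - (z \<bullet> ?b)\<^sup>2 \<le> r\<^sup>2 \<and> \<alpha> \<le> z \<bullet> ?b \<and> z \<bullet> ?b \<le> \<beta>}"
  proof -
    have "T z \<bullet> w = z \<bullet> ?b" for z
      using T unfolding orthogonal_transformation_def Tw[symmetric] by blast
    then show ?thesis using orthogonal_transformation_norm[OF T] by auto
  qed
  also have "emeasure lborel \<dots> = ennreal ((\<beta> - \<alpha>) * unit_ball_vol (real (CARD('n) - 1)) * r ^ (CARD('n) - 1))"
    using emeasure_cylinder_Basis[of ?b r \<alpha> \<beta>] assms by (simp add: axis_in_Basis_iff)
  finally show ?thesis .
qed

section \<open>The cone measure\<close>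

text \<open>The surface measure of the sphere: a set is given \<open>n\<close> times the volume of the cone over
  it. It is defined on the whole space and is carried by the sphere.\<close>

definition cone_measure :: "'a::euclidean_space measure" where
  "cone_measure = distr (density lborel
     (\<lambda>z. ennreal (real DIM('a)) * indicator {z. 0 < norm z \<and> norm z \<le> 1} z)) borel sgn"

definition shell :: "'a::euclidean_space set \<Rightarrow> real \<Rightarrow> real \<Rightarrow> 'a set" where
  "shell A \<alpha> \<beta> = {z. \<alpha> < norm z \<and> norm z \<le> \<beta> \<and> sgn z \<in> A}"

lemma borel_measurable_sgn_vec [measurable]: "(sgn :: 'a::euclidean_space \<Rightarrow> 'a) \<in> borel_measurable borel"
  unfolding sgn_div_norm by measurable

lemma sets_shell [measurable]:
  fixes A :: "'a::euclidean_space set"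
  assumes "A \<in> sets borel"
  shows "shell A \<alpha> \<beta> \<in> sets borel"
proof -
  have [measurable]: "sgn -` A \<in> sets borel"
    using measurable_sets[OF borel_measurable_sgn_vec assms] by simp
  have "{z::'a. \<alpha> < norm z \<and> norm z \<le> \<beta>} \<in> sets borel" by measurable
  moreover have "shell A \<alpha> \<beta> = {z. \<alpha> < norm z \<and> norm z \<le> \<beta>} \<inter> sgn -` A"
    by (auto simp: shell_def)
  ultimately show ?thesis by simp
qed

lemma sets_cone_measure [simp, measurable_cong]: "sets cone_measure = sets borel"
  by (simp add: cone_measure_def)

lemma space_cone_measure [simp]: "space cone_measure = UNIV"
  by (simp add: cone_measure_def)

lemma nn_integral_cone_measure:
  fixes f :: "'a::euclidean_space \<Rightarrow> ennreal"
  assumes [measurable]: "f \<in> borel_measurable borel"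
  shows "(\<integral>\<^sup>+w. f w \<partial>cone_measure) =
    ennreal (real DIM('a)) * (NBINT z. f (sgn z) * indicator {z. 0 < norm z \<and> norm z \<le> 1} z)"
proof -
  have "(\<integral>\<^sup>+w. f w \<partial>cone_measure) = (NBINT z. (ennreal (real DIM('a)) * indicator {z. 0 < norm z \<and> norm z \<le> 1} z) * f (sgn z))"
    unfolding cone_measure_def by (subst nn_integral_distr, measurable, subst nn_integral_density, measurable)
  also have "\<dots> = (NBINT z. ennreal (real DIM('a)) * (f (sgn z) * indicator {z. 0 < norm z \<and> norm z \<le> 1} z))"
    by (simp add: mult_ac)
  also have "\<dots> = ennreal (real DIM('a)) * (NBINT z. f (sgn z) * indicator {z. 0 < norm z \<and> norm z \<le> 1} z)"
    by (rule nn_integral_cmult) measurable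
  finally show ?thesis .
qed

lemma emeasure_cone_measure:
  fixes A :: "'a::euclidean_space set"
  assumes [measurable]: "A \<in> sets borel"
  shows "emeasure cone_measure A = ennreal (real DIM('a)) * emeasure lborel (shell A 0 1)"
proof -
  have "emeasure cone_measure A = (\<integral>\<^sup>+w. indicator A w \<partial>cone_measure)" by simp
  also have "\<dots> = ennreal (real DIM('a)) *
      (NBINT z. indicator A (sgn z) * indicator {z. 0 < norm z \<and> norm z \<le> 1} z)"
    by (rule nn_integral_cone_measure) measurable
  also have "(NBINT z. indicator A (sgn z) * indicator {z. 0 < norm z \<and> norm z \<le> 1} z) =
      (NBINT z. indicator (shell A 0 1) z)"
    by (intro nn_integral_cong) (auto simp: shell_def indicator_def)
  also have "\<dots> = emeasure lborel (shell A 0 1)" by simp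
  finally show ?thesis .
qed

lemma nn_integral_lborel_scale:
  fixes f :: "'a::euclidean_space \<Rightarrow> ennreal"
  assumes [measurable]: "f \<in> borel_measurable borel" and c: "0 < c"
  shows "(NBINT x. f x) = ennreal (c ^ DIM('a)) * (NBINT x. f (c *\<^sub>R x))"
proof -
  have "(NBINT x. f x) = (\<integral>\<^sup>+x. f x \<partial>density (distr lborel borel (\<lambda>x. 0 + c *\<^sub>R x)) (\<lambda>_. \<bar>c\<bar> ^ DIM('a)))"
    using c by (subst lborel_affine[of c 0]) auto
  also have "\<dots> = (NBINT x. ennreal (c ^ DIM('a)) * f (c *\<^sub>R x))"
    using c by (subst nn_integral_density, measurable, subst nn_integral_distr, measurable)
  also have "\<dots> = ennreal (c ^ DIM('a)) * (NBINT x. f (c *\<^sub>R x))"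
    by (rule nn_integral_cmult) measurable
  finally show ?thesis .
qed

lemma emeasure_cone_measure_UNIV: "emeasure (cone_measure :: 'a::euclidean_space measure) UNIV < top"
proof -
  have "emeasure lborel (shell UNIV 0 1 :: 'a set) < top"
  proof -
    have "bounded (shell UNIV 0 1 :: 'a set)"
      by (rule bounded_subset[OF bounded_cball[of 0 1]]) (auto simp: shell_def)
    then show ?thesis using emeasure_bounded_finite by auto
  qed
  then show ?thesis by (simp add: emeasure_cone_measure ennreal_mult_less_top)
qed

interpretation cone: finite_measure "cone_measure :: 'a::euclidean_space measure"
  using emeasure_cone_measure_UNIV by (intro finite_measureI) (simp add: less_top)

text \<open>Scaling by \<open>t\<close>.\<close>

lemma emeasure_shell_0:
  fixes A :: "'a::euclidean_space set"
  assumes [measurable]: "A \<in> sets borel" and t: "0 \<le> t"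
  shows "emeasure lborel (shell A 0 t) = ennreal (t ^ DIM('a) / DIM('a) * measure cone_measure A)"
proof (cases "t = 0")
  case True
  then have "shell A 0 t = {}" by (auto simp: shell_def)
  then show ?thesis using True by simp
next
  case False
  with t have t: "0 < t" by simp
  have "emeasure lborel (shell A 0 t) = (NBINT z. indicator (shell A 0 t) z)" by simp
  also have "\<dots> = ennreal (t ^ DIM('a)) * (NBINT z. indicator (shell A 0 t) (t *\<^sub>R z))"
    using t by (intro nn_integral_lborel_scale) measurable
  also have "(NBINT z. indicator (shell A 0 t) (t *\<^sub>R z)) = (NBINT z. indicator (shell A 0 1) z)"
  proof (rule nn_integral_cong)
    fix z :: 'a
    have "sgn (t *\<^sub>R z) = sgn z" using t by (simp add: sgn_scaleR)
    then have "t *\<^sub>R z \<in> shell A 0 t \<longleftrightarrow> z \<in> shell A 0 1"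
      using t by (auto simp: shell_def zero_less_mult_iff)
    then show "indicator (shell A 0 t) (t *\<^sub>R z) = (indicator (shell A 0 1) z :: ennreal)"
      by (auto simp: indicator_def)
  qed
  also have "\<dots> = emeasure lborel (shell A 0 1)" by simp
  finally have eq: "emeasure lborel (shell A 0 t) = ennreal (t ^ DIM('a)) * emeasure lborel (shell A 0 1)" .
  have "ennreal (measure cone_measure A) = ennreal (real DIM('a)) * emeasure lborel (shell A 0 1)"
    using emeasure_cone_measure[of A] cone.emeasure_eq_measure[of A] by simp
  then have "ennreal (1 / DIM('a)) * ennreal (measure cone_measure A) =
      (ennreal (1 / DIM('a)) * ennreal (real DIM('a))) * emeasure lborel (shell A 0 1)"
    by (simp only: mult.assoc)
  also have "ennreal (1 / DIM('a)) * ennreal (real DIM('a)) = 1"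
    by (subst ennreal_mult[symmetric]) auto
  finally have "emeasure lborel (shell A 0 1) = ennreal (1 / DIM('a) * measure cone_measure A)"
    by (subst ennreal_mult) auto
  then show ?thesis
    unfolding eq using t by (simp add: ennreal_mult'[symmetric])
qed

lemma emeasure_shell:
  fixes A :: "'a::euclidean_space set"
  assumes [measurable]: "A \<in> sets borel" and "0 \<le> \<alpha>" "\<alpha> \<le> \<beta>"
  shows "emeasure lborel (shell A \<alpha> \<beta>) = ennreal ((\<beta> ^ DIM('a) - \<alpha> ^ DIM('a)) / DIM('a) * measure cone_measure A)"
proof -
  have "shell A \<alpha> \<beta> = shell A 0 \<beta> - shell A 0 \<alpha>"
    using assms by (auto simp: shell_def)
  also have "emeasure lborel \<dots> = emeasure lborel (shell A 0 \<beta>) - emeasure lborel (shell A 0 \<alpha>)"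
    using assms emeasure_shell_0[OF assms(1,2)] by (intro emeasure_Diff) (auto simp: shell_def)
  also have "\<dots> = ennreal (\<beta> ^ DIM('a) / DIM('a) * measure cone_measure A - \<alpha> ^ DIM('a) / DIM('a) * measure cone_measure A)"
    using assms by (simp add: emeasure_shell_0 ennreal_minus)
  finally show ?thesis by (simp add: algebra_simps diff_divide_distrib)
qed

lemma power_diff_bounds:
  fixes a b :: real
  assumes "0 \<le> a" "a \<le> b"
  shows "real (Suc m) * (b - a) * a ^ m \<le> b ^ Suc m - a ^ Suc m"
    and "b ^ Suc m - a ^ Suc m \<le> real (Suc m) * (b - a) * b ^ m"
proof -
  have "real (Suc m) * (b - a) * a ^ m \<le> b ^ Suc m - a ^ Suc m \<and>
      b ^ Suc m - a ^ Suc m \<le> real (Suc m) * (b - a) * b ^ m"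
  proof (induction m)
    case (Suc m)
    have e: "b ^ Suc (Suc m) - a ^ Suc (Suc m) = b * (b ^ Suc m - a ^ Suc m) + a ^ Suc m * (b - a)"
      by (simp add: algebra_simps)
    have p: "a ^ Suc m \<le> b ^ Suc m" using assms by (intro power_mono) auto
    have "a * (real (Suc m) * (b - a) * a ^ m) \<le> b * (b ^ Suc m - a ^ Suc m)"
      using assms Suc.IH by (intro mult_mono) (auto intro: power_mono)
    moreover have "b * (b ^ Suc m - a ^ Suc m) \<le> b * (real (Suc m) * (b - a) * b ^ m)"
      using assms Suc.IH by (intro mult_left_mono) auto
    moreover have "a ^ Suc m * (b - a) \<le> b ^ Suc m * (b - a)"
      using assms p by (intro mult_right_mono) auto
    moreover have "a * (real (Suc m) * (b - a) * a ^ m) + a ^ Suc m * (b - a) = real (Suc (Suc m)) * (b - a) * a ^ Suc m"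
      by (simp add: algebra_simps)
    moreover have "b * (real (Suc m) * (b - a) * b ^ m) + b ^ Suc m * (b - a) = real (Suc (Suc m)) * (b - a) * b ^ Suc m"
      by (simp add: algebra_simps)
    ultimately show ?case unfolding e by linarith
  qed simp
  then show "real (Suc m) * (b - a) * a ^ m \<le> b ^ Suc m - a ^ Suc m"
    "b ^ Suc m - a ^ Suc m \<le> real (Suc m) * (b - a) * b ^ m" by blast+
qed

section \<open>Comparison of the cone measure with the cost of small sets\<close>

lemma norm_perp_power2:
  fixes w x :: "'a::real_inner"
  assumes "norm w = 1"
  shows "(norm (x - (x \<bullet> w) *\<^sub>R w))\<^sup>2 = (norm x)\<^sup>2 - (x \<bullet> w)\<^sup>2"
proof -
  have "w \<bullet> w = 1" using assms by (simp add: dot_square_norm)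
  then show ?thesis
    unfolding power2_norm_eq_inner
    by (simp add: inner_diff_left inner_diff_right inner_commute power2_eq_square)
qed

lemma inner_unit_vectors:
  fixes w v :: "'a::real_inner"
  assumes "norm w = 1" "norm v = 1"
  shows "v \<bullet> w = 1 - (norm (v - w))\<^sup>2 / 2"
  using assms unfolding power2_norm_eq_inner norm_eq_1
  by (simp add: inner_diff_left inner_diff_right inner_commute field_simps)

text \<open>The difference of two points of the shell is split into a multiple of the difference of their
  directions and a radial part of length at most \<open>\<delta>\<close>, whose component across
  \<open>w\<close> is again controlled by the diameter. Along \<open>w\<close>, the height of the
  shell over \<open>U\<close> is its thickness plus the sagitta.\<close>

lemma shell_narrow:
  fixes w z v :: "'a::euclidean_space"
  assumes U: "U \<subseteq> sphere 0 1" "bounded U" and w: "w \<in> U" and \<delta>: "0 < \<delta>" "\<delta> < 1"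
    and z: "z \<in> shell U (1 - \<delta>) 1" and v: "v \<in> shell U (1 - \<delta>) 1"
  shows "(norm (z - v))\<^sup>2 - ((z - v) \<bullet> w)\<^sup>2 \<le> (diameter U * (1 + \<delta>))\<^sup>2 \<and>
    \<bar>(z - v) \<bullet> w\<bar> \<le> \<delta> + (diameter U)\<^sup>2 / 2"
proof
  let ?d = "diameter U"
  let ?P = "\<lambda>x. x - (x \<bullet> w) *\<^sub>R w"
  have nw: "norm w = 1" using U w by auto
  have d0: "0 \<le> ?d" using U(2) by (rule diameter_ge_0)
  have dd: "norm (x - y) \<le> ?d" if "x \<in> U" "y \<in> U" for x y
    using diameter_bounded_bound[OF U(2) that] by (simp add: dist_norm)
  have P: "norm (?P x) \<le> norm x" for x
  proof (rule power2_le_imp_le)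
    show "(norm (?P x))\<^sup>2 \<le> (norm x)\<^sup>2" unfolding norm_perp_power2[OF nw] by simp
  qed simp
  define t s where "t = norm z" and "s = norm v"
  have ts: "1 - \<delta> < t" "t \<le> 1" "1 - \<delta> < s" "s \<le> 1"
    using z v by (auto simp: shell_def t_def s_def)
  have z': "z = t *\<^sub>R sgn z" and v': "v = s *\<^sub>R sgn v"
  proof -
    have "norm z \<noteq> 0" "norm v \<noteq> 0" using ts \<delta> unfolding t_def s_def by linarith+
    then show "z = t *\<^sub>R sgn z" "v = s *\<^sub>R sgn v" by (simp_all add: sgn_div_norm t_def s_def)
  qed
  have sU: "sgn z \<in> U" "sgn v \<in> U" using z v by (auto simp: shell_def)
  have "?P (z - v) = t *\<^sub>R ?P (sgn z - sgn v) + (t - s) *\<^sub>R ?P (sgn v - w)"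
  proof -
    have ww: "w \<bullet> w = 1" using nw by (simp add: dot_square_norm)
    have "z - v = t *\<^sub>R (sgn z - sgn v) + (t - s) *\<^sub>R sgn v"
    proof -
      have "z - v = t *\<^sub>R sgn z - s *\<^sub>R sgn v" by (simp only: z'[symmetric] v'[symmetric])
      then show ?thesis by (simp add: algebra_simps)
    qed
    then have "?P (z - v) = ?P (t *\<^sub>R (sgn z - sgn v) + (t - s) *\<^sub>R sgn v)" by simp
    also have "\<dots> = t *\<^sub>R ?P (sgn z - sgn v) + (t - s) *\<^sub>R ?P (sgn v)"
      by (simp add: inner_add_left algebra_simps)
    also have "?P (sgn v) = ?P (sgn v - w)"
      using ww by (simp add: inner_diff_left algebra_simps)
    finally show ?thesis .
  qed
  then have "norm (?P (z - v)) \<le> norm (t *\<^sub>R ?P (sgn z - sgn v)) + norm ((t - s) *\<^sub>R ?P (sgn v - w))"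
    by (simp only: norm_triangle_ineq)
  also have "\<dots> \<le> 1 * ?d + \<delta> * ?d"
    unfolding norm_scaleR
    using ts \<delta> P[of "sgn z - sgn v"] P[of "sgn v - w"] dd[OF sU] dd[OF sU(2) w]
    by (intro add_mono mult_mono) auto
  finally have "norm (?P (z - v)) \<le> ?d * (1 + \<delta>)" by (simp add: algebra_simps)
  then have "(norm (?P (z - v)))\<^sup>2 \<le> (?d * (1 + \<delta>))\<^sup>2" by (intro power_mono) auto
  then show "(norm (z - v))\<^sup>2 - ((z - v) \<bullet> w)\<^sup>2 \<le> (?d * (1 + \<delta>))\<^sup>2"
    by (simp add: norm_perp_power2[OF nw])
  have ax: "1 - \<delta> - ?d\<^sup>2 / 2 \<le> x \<bullet> w \<and> x \<bullet> w \<le> 1" if "x \<in> shell U (1 - \<delta>) 1" for x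
  proof -
    have x: "sgn x \<in> U" "1 - \<delta> < norm x" "norm x \<le> 1" using that by (auto simp: shell_def)
    have "norm x \<noteq> 0" using x \<delta> by linarith
    then have x': "x = norm x *\<^sub>R sgn x" by (simp add: sgn_div_norm)
    have ns: "norm (sgn x) = 1" using x U by auto
    have e: "sgn x \<bullet> w = 1 - (norm (sgn x - w))\<^sup>2 / 2" by (rule inner_unit_vectors[OF nw ns])
    have "(norm (sgn x - w))\<^sup>2 \<le> ?d\<^sup>2" using dd[OF x(1) w] by (intro power_mono) auto
    then have "1 - ?d\<^sup>2 / 2 \<le> sgn x \<bullet> w" "sgn x \<bullet> w \<le> 1" unfolding e by auto
    then have "norm x * (1 - ?d\<^sup>2 / 2) \<le> norm x * (sgn x \<bullet> w)" "norm x * (sgn x \<bullet> w) \<le> norm x * 1"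
      by (intro mult_left_mono; simp)+
    moreover have "x \<bullet> w = norm x * (sgn x \<bullet> w)"
    proof -
      have "x \<bullet> w = (norm x *\<^sub>R sgn x) \<bullet> w" by (simp only: x'[symmetric])
      then show ?thesis by simp
    qed
    moreover have "norm x * (?d\<^sup>2 / 2) \<le> ?d\<^sup>2 / 2" using x by (intro mult_left_le_one_le) auto
    ultimately show ?thesis using x by (simp add: algebra_simps)
  qed
  show "\<bar>(z - v) \<bullet> w\<bar> \<le> \<delta> + ?d\<^sup>2 / 2"
    using ax[OF z] ax[OF v] unfolding inner_diff_left by linarith
qed

text \<open>The quotient of the cone measure of a closed set of diameter at most \<open>\<delta>\<close> by its
  cost is at most this, and \<open>cap_factor\<close> bounds the cost of a small cap from above by
  its cone measure. Both tend to 1 as \<open>\<delta>\<close> tends to 0.\<close>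

definition cover_factor :: "nat \<Rightarrow> real \<Rightarrow> real" where
  "cover_factor m \<delta> = (1 + \<delta> / 2) * ((1 + \<delta>) / (1 - \<delta>)) ^ m"

definition cap_factor :: "nat \<Rightarrow> real \<Rightarrow> real" where
  "cap_factor m \<delta> = (1 + 2 * \<delta>) * ((1 + \<delta>\<^sup>2) / (1 - \<delta>)) ^ m"

text \<open>Compare the volume of the shell of thickness \<open>\<delta>\<close> over \<open>U\<close>, which is
  about \<open>\<delta>\<close> times the cone measure, with that of the cylinder that the
  isodiametric inequality assigns to it.\<close>

lemma cone_measure_le_cost:
  fixes U :: "(real ^ 'n) set"
  assumes U: "U \<subseteq> sphere 0 1" "closed U" and \<delta>: "0 < \<delta>" "\<delta> < 1" "diameter U \<le> \<delta>"
  shows "emeasure cone_measure U \<le> ennreal (cover_factor (CARD('n) - 1) \<delta>) * hausdorff_cost (CARD('n) - 1) U"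
proof (cases "U = {}")
  case False
  then obtain w where w: "w \<in> U" by blast
  define m where "m = CARD('n) - 1"
  have m: "CARD('n) = Suc m" by (simp add: m_def)
  let ?d = "diameter U" and ?\<sigma> = "measure cone_measure U" and ?\<omega> = "unit_ball_vol (real m)"
  have bU: "bounded U" using U(1) by (rule bounded_subset[OF bounded_cball[of 0 1] order_trans]) auto
  have [measurable]: "U \<in> sets borel" using U(2) by auto
  have d0: "0 \<le> ?d" using bU by (rule diameter_ge_0)
  have nw: "norm w = 1" using U w by auto
  have \<omega>: "0 \<le> ?\<omega>" by simp
  have "emeasure lborel (shell U (1 - \<delta>) 1) \<le>
      ennreal ((\<delta> + ?d\<^sup>2 / 2) * unit_ball_vol (real (CARD('n) - 1)) * (?d * (1 + \<delta>) / 2) ^ (CARD('n) - 1))"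
    using d0 \<delta> shell_narrow[OF U(1) bU w \<delta>(1,2)]
    by (intro isodiametric_cylinder[OF nw]) auto
  then have "ennreal ((1 ^ Suc m - (1 - \<delta>) ^ Suc m) / real (Suc m) * ?\<sigma>) \<le>
      ennreal ((\<delta> + ?d\<^sup>2 / 2) * ?\<omega> * (?d * (1 + \<delta>) / 2) ^ m)"
    using \<delta> by (subst (asm) emeasure_shell) (auto simp: m)
  then have le: "(1 ^ Suc m - (1 - \<delta>) ^ Suc m) / real (Suc m) * ?\<sigma> \<le> (\<delta> + ?d\<^sup>2 / 2) * ?\<omega> * (?d * (1 + \<delta>) / 2) ^ m"
    using \<delta> d0 by (subst (asm) ennreal_le_iff) auto
  have "\<delta> * (1 - \<delta>) ^ m * ?\<sigma> \<le> (1 ^ Suc m - (1 - \<delta>) ^ Suc m) / real (Suc m) * ?\<sigma>"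
    using power_diff_bounds(1)[of "1 - \<delta>" 1 m] \<delta> by (intro mult_right_mono) (auto simp: field_simps)
  also note le
  also have "(\<delta> + ?d\<^sup>2 / 2) * ?\<omega> * (?d * (1 + \<delta>) / 2) ^ m \<le> (\<delta> * (1 + \<delta> / 2)) * ?\<omega> * (?d * (1 + \<delta>) / 2) ^ m"
  proof (intro mult_right_mono \<omega>)
    have "?d\<^sup>2 \<le> \<delta>\<^sup>2" using d0 \<delta> by (intro power_mono) auto
    then show "\<delta> + ?d\<^sup>2 / 2 \<le> \<delta> * (1 + \<delta> / 2)" by (simp add: algebra_simps power2_eq_square)
  qed (use d0 \<delta> in auto)
  also have "\<dots> = \<delta> * (1 - \<delta>) ^ m * (cover_factor m \<delta> * (?\<omega> * (?d / 2) ^ m))"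
  proof -
    have "(?d * (1 + \<delta>) / 2) ^ m = (?d / 2) ^ m * (1 + \<delta>) ^ m"
      by (simp add: power_mult_distrib[symmetric])
    moreover have "cover_factor m \<delta> = (1 + \<delta> / 2) * ((1 + \<delta>) ^ m / (1 - \<delta>) ^ m)"
      by (simp add: cover_factor_def power_divide)
    moreover have "(1 - \<delta>) ^ m \<noteq> 0" using \<delta> by simp
    ultimately show ?thesis by simp
  qed
  finally have "?\<sigma> \<le> cover_factor m \<delta> * (?\<omega> * (?d / 2) ^ m)"
    using \<delta> by (simp add: mult_le_cancel_left_pos)
  then have "ennreal ?\<sigma> \<le> ennreal (cover_factor m \<delta> * (?\<omega> * (?d / 2) ^ m))" by (rule ennreal_leI)
  also have "\<dots> = ennreal (cover_factor m \<delta>) * ennreal (?\<omega> * (?d / 2) ^ m)"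
    using d0 by (intro ennreal_mult'') auto
  finally show ?thesis
    using False by (simp add: cone.emeasure_eq_measure hausdorff_cost_def m_def)
qed simp

text \<open>The cylinder with axis \<open>w\<close>, height \<open>\<delta>\<close> and radius \<open>r * (1 -
  \<delta>)\<close> below the tangent plane lies in a shell over the cap, because the chord of an
  angle is at most its tangent.\<close>

lemma cap_cost_le:
  fixes w :: "real ^ 'n"
  assumes w: "norm w = 1" and r: "0 < r" "r \<le> \<delta>" and \<delta>: "\<delta> \<le> 1 / 2"
  defines "m \<equiv> CARD('n) - 1"
  shows "unit_ball_vol (real m) * r ^ m \<le> cap_factor m \<delta> * measure cone_measure (cball w r)"
proof -
  have m: "CARD('n) = Suc m" unfolding m_def using zero_less_card_finite[where 'a='n] by linarith
  let ?\<sigma> = "measure cone_measure (cball w r)" and ?\<omega> = "unit_ball_vol (real m)"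
  have \<delta>0: "0 < \<delta>" using r by simp
  let ?Z = "{z. (norm z)\<^sup>2 - (z \<bullet> w)\<^sup>2 \<le> (r * (1 - \<delta>))\<^sup>2 \<and> 1 - \<delta> \<le> z \<bullet> w \<and> z \<bullet> w \<le> 1}"
  have \<delta>2: "\<delta>\<^sup>2 \<le> 1 / 4" using mult_mono[OF \<delta> \<delta>] \<delta>0 by (simp add: power2_eq_square)
  have sub: "?Z \<subseteq> shell (cball w r) (1 - \<delta> - \<delta>\<^sup>2) (1 + \<delta>\<^sup>2)"
  proof
    fix z assume z: "z \<in> ?Z"
    define x \<tau> where "x = norm z" and "\<tau> = z \<bullet> w"
    have \<tau>: "0 < \<tau>" "\<tau> \<le> 1" "1 - \<delta> \<le> \<tau>" using z \<delta> by (auto simp: \<tau>_def)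
    have x\<tau>: "\<tau> \<le> x" using norm_cauchy_schwarz[of z w] w by (simp add: x_def \<tau>_def)
    have x2: "x\<^sup>2 - \<tau>\<^sup>2 \<le> (r * (1 - \<delta>))\<^sup>2" using z by (simp add: x_def \<tau>_def)
    have r2: "(r * (1 - \<delta>))\<^sup>2 \<le> \<delta>\<^sup>2"
      using r \<delta> \<delta>0 by (intro power_mono) (use r \<delta> \<delta>0 mult_mono[of r \<delta> "1 - \<delta>" 1] in auto)
    have "x\<^sup>2 \<le> 1 + \<delta>\<^sup>2" using x2 r2 power_mono[of \<tau> 1 2] \<tau> by simp
    also have "\<dots> \<le> (1 + \<delta>\<^sup>2)\<^sup>2" by (simp add: power2_sum)
    finally have xle: "x \<le> 1 + \<delta>\<^sup>2" by (rule power2_le_imp_le) simp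
    have "1 - \<delta> - \<delta>\<^sup>2 < x" using \<tau> x\<tau> \<delta>0 zero_less_power[of \<delta> 2] by linarith
    moreover have "norm (sgn z - w) \<le> r"
    proof -
      have x0: "0 < x" using \<tau> x\<tau> by simp
      have ns: "norm (sgn z) = 1" using x0 by (auto simp: x_def norm_sgn)
      have "sgn z \<bullet> w = \<tau> / x" by (simp add: sgn_div_norm x_def \<tau>_def divide_inverse mult.commute)
      with inner_unit_vectors[OF w ns] have e: "(norm (sgn z - w))\<^sup>2 = 2 - 2 * (\<tau> / x)" by simp
      \<comment> \<open>The secant of the angle; its square minus 1 is the squared tangent.\<close>
      define y where "y = x / \<tau>"
      have y: "1 \<le> y" "\<tau> / x = 1 / y" using \<tau> x\<tau> by (auto simp: y_def)
      have "0 \<le> (y - 1)\<^sup>2 * (y + 2)" using y by (intro mult_nonneg_nonneg) auto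
      also have "\<dots> = (y\<^sup>2 - 1 - (2 - 2 * (1 / y))) * y"
        using y by (simp add: field_simps power2_eq_square)
      finally have "2 - 2 * (1 / y) \<le> y\<^sup>2 - 1" using y by (simp add: zero_le_mult_iff)
      also have "y\<^sup>2 - 1 = (x\<^sup>2 - \<tau>\<^sup>2) / \<tau>\<^sup>2" using \<tau> by (simp add: y_def power_divide diff_divide_distrib)
      also have "\<dots> \<le> (r * (1 - \<delta>))\<^sup>2 / \<tau>\<^sup>2" by (intro divide_right_mono x2) auto
      also have "\<dots> \<le> (r * \<tau>)\<^sup>2 / \<tau>\<^sup>2"
        using \<tau> r \<delta> by (intro divide_right_mono power_mono mult_left_mono) auto
      also have "\<dots> = r\<^sup>2" using \<tau> by (simp add: power_mult_distrib)
      finally have "(norm (sgn z - w))\<^sup>2 \<le> r\<^sup>2" unfolding e y(2) .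
      then show ?thesis using r by (elim power2_le_imp_le) auto
    qed
    ultimately show "z \<in> shell (cball w r) (1 - \<delta> - \<delta>\<^sup>2) (1 + \<delta>\<^sup>2)"
      using xle by (simp add: shell_def x_def dist_norm norm_minus_commute)
  qed
  have "ennreal ((1 - (1 - \<delta>)) * unit_ball_vol (real (CARD('n) - 1)) * (r * (1 - \<delta>)) ^ (CARD('n) - 1)) = emeasure lborel ?Z"
    using r \<delta> by (intro emeasure_cylinder[OF w, symmetric]) auto
  also have "\<dots> \<le> emeasure lborel (shell (cball w r) (1 - \<delta> - \<delta>\<^sup>2) (1 + \<delta>\<^sup>2))"
    by (intro emeasure_mono sub) auto
  also have "\<dots> = ennreal (((1 + \<delta>\<^sup>2) ^ DIM(real ^ 'n) - (1 - \<delta> - \<delta>\<^sup>2) ^ DIM(real ^ 'n)) / DIM(real ^ 'n) * ?\<sigma>)"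
    using \<delta> \<delta>2 \<delta>0 zero_le_power2[of \<delta>] by (intro emeasure_shell; (simp; fail)?; linarith)
  finally have "ennreal (\<delta> * ?\<omega> * (r * (1 - \<delta>)) ^ m) \<le>
      ennreal (((1 + \<delta>\<^sup>2) ^ Suc m - (1 - \<delta> - \<delta>\<^sup>2) ^ Suc m) / real (Suc m) * ?\<sigma>)"
    by (simp add: m)
  moreover have "(1 - \<delta> - \<delta>\<^sup>2) ^ Suc m \<le> (1 + \<delta>\<^sup>2) ^ Suc m"
    using \<delta> \<delta>2 \<delta>0 zero_le_power2[of \<delta>] by (intro power_mono; linarith)
  ultimately have "\<delta> * ?\<omega> * (r * (1 - \<delta>)) ^ m \<le> ((1 + \<delta>\<^sup>2) ^ Suc m - (1 - \<delta> - \<delta>\<^sup>2) ^ Suc m) / real (Suc m) * ?\<sigma>"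
    by (subst (asm) ennreal_le_iff) auto
  also have "\<dots> \<le> (\<delta> * (1 + 2 * \<delta>)) * (1 + \<delta>\<^sup>2) ^ m * ?\<sigma>"
  proof (intro mult_right_mono)
    have "(1 + \<delta>\<^sup>2) ^ Suc m - (1 - \<delta> - \<delta>\<^sup>2) ^ Suc m \<le> real (Suc m) * ((1 + \<delta>\<^sup>2) - (1 - \<delta> - \<delta>\<^sup>2)) * (1 + \<delta>\<^sup>2) ^ m"
      using \<delta> \<delta>2 \<delta>0 zero_le_power2[of \<delta>] by (intro power_diff_bounds(2); linarith)
    also have "(1 + \<delta>\<^sup>2) - (1 - \<delta> - \<delta>\<^sup>2) = \<delta> * (1 + 2 * \<delta>)" by (simp add: power2_eq_square algebra_simps)
    finally show "((1 + \<delta>\<^sup>2) ^ Suc m - (1 - \<delta> - \<delta>\<^sup>2) ^ Suc m) / real (Suc m) \<le> \<delta> * (1 + 2 * \<delta>) * (1 + \<delta>\<^sup>2) ^ m"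
      by (simp add: divide_le_eq mult_ac)
  qed simp
  finally have fin: "\<delta> * ?\<omega> * (r * (1 - \<delta>)) ^ m \<le> \<delta> * (1 + 2 * \<delta>) * (1 + \<delta>\<^sup>2) ^ m * ?\<sigma>" .
  have "\<delta> * (1 - \<delta>) ^ m * (?\<omega> * r ^ m) \<le> \<delta> * (1 - \<delta>) ^ m * (cap_factor m \<delta> * ?\<sigma>)"
  proof -
    have "(r * (1 - \<delta>)) ^ m = r ^ m * (1 - \<delta>) ^ m" by (rule power_mult_distrib)
    moreover have "cap_factor m \<delta> = (1 + 2 * \<delta>) * ((1 + \<delta>\<^sup>2) ^ m / (1 - \<delta>) ^ m)"
      by (simp add: cap_factor_def power_divide)
    moreover have "(1 - \<delta>) ^ m \<noteq> 0" using \<delta> by simp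
    ultimately show ?thesis using fin by (simp add: mult_ac)
  qed
  then show ?thesis using \<delta> \<delta>0 by (simp add: mult_le_cancel_left_pos)
qed

lemma cover_factor_tendsto: "((\<lambda>\<delta>. cover_factor m \<delta>) \<longlongrightarrow> 1) (at_right 0)"
proof -
  have "((\<lambda>\<delta>. cover_factor m \<delta>) \<longlongrightarrow> (1 + 0 / 2) * ((1 + 0) / (1 - 0)) ^ m) (at_right 0)"
    unfolding cover_factor_def by (intro tendsto_intros) auto
  then show ?thesis by simp
qed

lemma cap_factor_tendsto: "((\<lambda>\<delta>. cap_factor m \<delta>) \<longlongrightarrow> 1) (at_right 0)"
proof -
  have "((\<lambda>\<delta>. cap_factor m \<delta>) \<longlongrightarrow> (1 + 2 * 0) * ((1 + 0\<^sup>2) / (1 - 0)) ^ m) (at_right 0)"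
    unfolding cap_factor_def by (intro tendsto_intros) auto
  then show ?thesis by simp
qed

lemma cover_factor_ge_1: "0 \<le> \<delta> \<Longrightarrow> \<delta> < 1 \<Longrightarrow> 1 \<le> cover_factor m \<delta>"
  unfolding cover_factor_def using mult_mono[of 1 "1 + \<delta> / 2" 1 "((1 + \<delta>) / (1 - \<delta>)) ^ m"] by simp

lemma cap_factor_ge_1: "0 \<le> \<delta> \<Longrightarrow> \<delta> < 1 \<Longrightarrow> 1 \<le> cap_factor m \<delta>"
proof -
  assume \<delta>: "0 \<le> \<delta>" "\<delta> < 1"
  have "1 \<le> (1 + \<delta>\<^sup>2) / (1 - \<delta>)" using \<delta> zero_le_power2[of \<delta>] by (subst le_divide_eq_1_pos; linarith)
  then have "1 \<le> ((1 + \<delta>\<^sup>2) / (1 - \<delta>)) ^ m" by (rule one_le_power)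
  then show "1 \<le> cap_factor m \<delta>"
    unfolding cap_factor_def using mult_mono[of 1 "1 + 2 * \<delta>" 1 "((1 + \<delta>\<^sup>2) / (1 - \<delta>)) ^ m"] \<delta> by simp
qed

lemma hausdorff_cost_closure_Int_le:
  assumes "bounded U"
  shows "hausdorff_cost m (closure U \<inter> C) \<le> hausdorff_cost m U"
proof (cases "closure U \<inter> C = {}")
  case False
  have "diameter (closure U \<inter> C) \<le> diameter (closure U)"
    using assms by (intro diameter_subset) auto
  also have "\<dots> = diameter U" using assms by (rule diameter_closure)
  finally have "(diameter (closure U \<inter> C) / 2) ^ m \<le> (diameter U / 2) ^ m"
    using assms by (intro power_mono) (auto intro!: diameter_ge_0 bounded_Int bounded_closure)
  then show ?thesis
    using False by (auto simp: hausdorff_cost_def intro!: ennreal_leI mult_left_mono)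
qed (auto simp: hausdorff_cost_def)

lemma cone_measure_le_pre:
  fixes A :: "(real ^ 'n) set"
  assumes A: "A \<subseteq> sphere 0 1" "A \<in> sets borel" and \<delta>: "0 < \<delta>" "\<delta> < 1"
  shows "emeasure cone_measure A \<le>
    ennreal (cover_factor (CARD('n) - 1) \<delta>) * hausdorff_pre (CARD('n) - 1) \<delta> A"
proof -
  define m where "m = CARD('n) - 1"
  let ?F = "cover_factor m \<delta>"
  have F: "1 \<le> ?F" using \<delta> by (intro cover_factor_ge_1) auto
  have "ennreal (1 / ?F) * emeasure cone_measure A \<le> hausdorff_pre m \<delta> A"
  proof (rule hausdorff_pre_ge)
    fix U :: "nat \<Rightarrow> (real ^ 'n) set"
    assume U: "A \<subseteq> (\<Union>i. U i)" "\<And>i. bounded (U i)" "\<And>i. diameter (U i) \<le> \<delta>"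
    let ?V = "\<lambda>i. closure (U i) \<inter> sphere 0 1"
    have "emeasure cone_measure A \<le> emeasure cone_measure (\<Union>i. ?V i)"
    proof (rule emeasure_mono)
      show "A \<subseteq> (\<Union>i. ?V i)"
      proof
        fix v assume v: "v \<in> A"
        then obtain i where "v \<in> U i" using U(1) by blast
        then have "v \<in> ?V i" using v A(1) closure_subset[of "U i"] by blast
        then show "v \<in> (\<Union>i. ?V i)" by blast
      qed
    qed auto
    also have "\<dots> \<le> (\<Sum>i. emeasure cone_measure (?V i))"
      by (rule emeasure_subadditive_countably) auto
    also have "\<dots> \<le> (\<Sum>i. ennreal ?F * hausdorff_cost m (U i))"
    proof (rule suminf_le)
      fix i
      have "diameter (?V i) \<le> diameter (closure (U i))"
        using U(2) by (intro diameter_subset) auto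
      also have "\<dots> \<le> \<delta>" using U(2,3) by (simp add: diameter_closure)
      finally have "emeasure cone_measure (?V i) \<le> ennreal ?F * hausdorff_cost m (?V i)"
        unfolding m_def by (intro cone_measure_le_cost \<delta>) auto
      also have "\<dots> \<le> ennreal ?F * hausdorff_cost m (U i)"
        by (intro mult_left_mono hausdorff_cost_closure_Int_le U(2)) auto
      finally show "emeasure cone_measure (?V i) \<le> ennreal ?F * hausdorff_cost m (U i)" .
    qed auto
    also have "\<dots> = ennreal ?F * (\<Sum>i. hausdorff_cost m (U i))" by simp
    finally have "ennreal (1 / ?F) * emeasure cone_measure A \<le>
        ennreal (1 / ?F) * (ennreal ?F * (\<Sum>i. hausdorff_cost m (U i)))"
      by (rule mult_left_mono) simp
    also have "\<dots> = (\<Sum>i. hausdorff_cost m (U i))"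
      using F by (simp add: mult.assoc[symmetric] ennreal_mult[symmetric])
    finally show "ennreal (1 / ?F) * emeasure cone_measure A \<le> (\<Sum>i. hausdorff_cost m (U i))" .
  qed
  then have "ennreal ?F * (ennreal (1 / ?F) * emeasure cone_measure A) \<le> ennreal ?F * hausdorff_pre m \<delta> A"
    by (rule mult_left_mono) simp
  then show ?thesis
    using F by (simp add: mult.assoc[symmetric] ennreal_mult[symmetric] m_def)
qed

lemma cone_measure_le_hausdorff:
  fixes A :: "(real ^ 'n) set"
  assumes A: "A \<subseteq> sphere 0 1" "A \<in> sets borel"
  shows "emeasure cone_measure A \<le> hausdorff_outer (CARD('n) - 1) A"
proof -
  let ?h = "hausdorff_outer (CARD('n) - 1) A"
  have "((\<lambda>\<delta>. ennreal (cover_factor (CARD('n) - 1) \<delta>) * ?h) \<longlongrightarrow> ennreal 1 * ?h) (at_right 0)"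
    by (intro tendsto_mult_ennreal tendsto_ennrealI cover_factor_tendsto tendsto_const) auto
  moreover have "\<forall>\<^sub>F \<delta> in at_right 0. emeasure cone_measure A \<le> ennreal (cover_factor (CARD('n) - 1) \<delta>) * ?h"
    unfolding eventually_at_right_field
  proof (intro exI[of _ "1::real"] conjI allI impI)
    fix \<delta> :: real assume \<delta>: "0 < \<delta>" "\<delta> < 1"
    have "emeasure cone_measure A \<le> ennreal (cover_factor (CARD('n) - 1) \<delta>) * hausdorff_pre (CARD('n) - 1) \<delta> A"
      by (rule cone_measure_le_pre[OF A \<delta>])
    also have "\<dots> \<le> ennreal (cover_factor (CARD('n) - 1) \<delta>) * ?h"
      using \<delta> by (intro mult_left_mono hausdorff_pre_le_outer) auto
    finally show "emeasure cone_measure A \<le> ennreal (cover_factor (CARD('n) - 1) \<delta>) * ?h" .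
  qed simp
  ultimately have "emeasure cone_measure A \<le> ennreal 1 * ?h"
    by (intro tendsto_lowerbound[of _ "ennreal 1 * ?h" "at_right 0"]) auto
  then show ?thesis by simp
qed

section \<open>The Hausdorff measure of the sphere\<close>

lemma Vitali_caps:
  fixes V :: "(real ^ 'n) set"
  assumes V: "V = sphere 0 1 \<inter> W" "open W" and \<delta>: "0 < \<delta>"
  obtains I :: "nat set" and x r where
    "\<And>i. i \<in> I \<Longrightarrow> norm (x i) = 1" "\<And>i. i \<in> I \<Longrightarrow> 0 < r i" "\<And>i. i \<in> I \<Longrightarrow> 10 * r i \<le> \<delta>"
    "\<And>i. i \<in> I \<Longrightarrow> cball (x i) (r i) \<subseteq> W"
    "\<And>i j. i \<in> I \<Longrightarrow> j \<in> I \<Longrightarrow> i \<noteq> j \<Longrightarrow> cball (x i) (r i) \<inter> cball (x j) (r j) = {}"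
    "V \<subseteq> (\<Union>i\<in>I. cball (x i) (5 * r i))"
proof -
  let ?K = "{(x, r). x \<in> V \<and> 0 < r \<and> 10 * r \<le> \<delta> \<and> cball x r \<subseteq> W}"
  have "\<exists>r. (x, r) \<in> ?K" if x: "x \<in> V" for x
  proof -
    obtain e where e: "0 < e" "cball x e \<subseteq> W" using V x open_contains_cball by blast
    have "cball x (min e (\<delta> / 10)) \<subseteq> cball x e" by (rule subset_cball) simp
    then show ?thesis using e x \<delta> by (intro exI[of _ "min e (\<delta> / 10)"]) auto
  qed
  then have "V \<subseteq> (\<Union>k\<in>?K. cball (fst k) (snd k))" by fastforce
  moreover have "0 < snd k \<and> snd k \<le> \<delta>" if "k \<in> ?K" for k using that by auto
  ultimately obtain C where C: "countable C" "C \<subseteq> ?K"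
     "pairwise (\<lambda>i j. disjnt (cball (fst i) (snd i)) (cball (fst j) (snd j))) C"
     "V \<subseteq> (\<Union>k\<in>C. cball (fst k) (5 * snd k))"
    by (rule Vitali_covering_lemma_cballs)
  let ?f = "from_nat_into C" and ?I = "to_nat_on C ` C"
  have f: "?f i \<in> C" "to_nat_on C (?f i) = i" if "i \<in> ?I" for i
    using that C(1) by auto
  show ?thesis
  proof (rule that[of ?I "\<lambda>i. fst (?f i)" "\<lambda>i. snd (?f i)"])
    fix i assume i: "i \<in> ?I"
    then have "?f i \<in> ?K" by (rule subsetD[OF C(2) f(1)])
    then show "norm (fst (?f i)) = 1" "0 < snd (?f i)" "10 * snd (?f i) \<le> \<delta>"
      "cball (fst (?f i)) (snd (?f i)) \<subseteq> W"
      using V by auto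
    fix j assume j: "j \<in> ?I" "i \<noteq> j"
    then have "?f i \<noteq> ?f j" using f(2)[OF i] f(2)[OF j(1)] by metis
    then show "cball (fst (?f i)) (snd (?f i)) \<inter> cball (fst (?f j)) (snd (?f j)) = {}"
      using pairwiseD[OF C(3) f(1)[OF i] f(1)[OF j(1)]] unfolding disjnt_def by simp
  next
    show "V \<subseteq> (\<Union>i\<in>?I. cball (fst (?f i)) (5 * snd (?f i)))"
    proof
      fix v assume "v \<in> V"
      then obtain k where k: "k \<in> C" "v \<in> cball (fst k) (5 * snd k)" using C(4) by blast
      then show "v \<in> (\<Union>i\<in>?I. cball (fst (?f i)) (5 * snd (?f i)))"
        using C(1) by (intro UN_I[of "to_nat_on C k"]) auto
    qed
  qed
qed

lemma hausdorff_cost_le_radius: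
  fixes U :: "'a::euclidean_space set"
  assumes "U \<subseteq> cball x r" "0 \<le> r"
  shows "hausdorff_cost m U \<le> ennreal (unit_ball_vol (real m) * r ^ m)"
proof (cases "U = {}")
  case False
  have b: "bounded U" using assms bounded_subset bounded_cball by blast
  have "diameter U \<le> 2 * r"
  proof (rule diameter_le)
    fix y z assume "y \<in> U" "z \<in> U"
    then have "dist x y \<le> r" "dist x z \<le> r" using assms by auto
    then show "norm (y - z) \<le> 2 * r"
      using dist_triangle3[of y z x] by (simp add: dist_norm)
  qed (use assms in auto)
  then have "(diameter U / 2) ^ m \<le> r ^ m"
    using b by (intro power_mono) (auto intro: diameter_ge_0)
  then show ?thesis using False by (auto simp: hausdorff_cost_def intro!: ennreal_leI mult_left_mono)
qed simp

lemma hausdorff_pre_finite_UN_le: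
  fixes A :: "nat \<Rightarrow> 'a::metric_space set"
  assumes "0 \<le> \<delta>" "finite J"
    and "\<And>i. i \<in> J \<Longrightarrow> bounded (A i) \<and> diameter (A i) \<le> \<delta>"
  shows "hausdorff_pre m \<delta> (\<Union>i\<in>J. A i) \<le> (\<Sum>i\<in>J. hausdorff_cost m (A i))"
proof -
  have "hausdorff_pre m \<delta> (\<Union>i\<in>J. A i) \<le> (\<Sum>i. hausdorff_cost m (if i \<in> J then A i else {}))"
    by (rule hausdorff_pre_le_cover) (use assms in auto)
  also have "\<dots> = (\<Sum>i\<in>J. hausdorff_cost m (A i))"
    using assms by (subst suminf_finite[of J]) auto
  finally show ?thesis .
qed

text \<open>The relatively open subsets of the sphere form a class that contains the sphere and is closed under
  removal of finitely many closed caps; this permits an iterative improvement of the factor.\<close>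

definition valid_factor :: "'n::finite itself \<Rightarrow> real \<Rightarrow> real \<Rightarrow> bool" where
  "valid_factor _ \<delta> K \<longleftrightarrow> (\<forall>W :: (real ^ 'n) set. open W \<longrightarrow>
     hausdorff_pre (CARD('n) - 1) \<delta> (sphere 0 1 \<inter> W) \<le> ennreal (K * measure cone_measure (sphere 0 1 \<inter> W)))"

text \<open>Vitali's lemma gives disjoint caps in the open set whose fivefold enlargements cover it. The
  enlargements alone give the crude factor \<open>Q\<close>. The open set has at most
  \<open>cover_factor m \<delta> * Q\<close> times the total measure of the caps, so that finitely
  many caps carry the fraction \<open>c\<close> of its measure. These are charged with the good
  factor \<open>G\<close>, and the open remainder with the factor \<open>K\<close> known before.\<close>

lemma valid_factor_step:
  assumes \<delta>: "0 < \<delta>" "\<delta> \<le> 1 / 2"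
  defines "m \<equiv> CARD('n::finite) - 1"
  defines "G \<equiv> cap_factor m \<delta>"
  defines "Q \<equiv> 5 ^ m * G"
  defines "c \<equiv> 1 / (2 * (cover_factor m \<delta> * Q))"
  shows "valid_factor TYPE('n) \<delta> Q"
    and "G \<le> K \<Longrightarrow> valid_factor TYPE('n) \<delta> K \<Longrightarrow> valid_factor TYPE('n) \<delta> (K - (K - G) * c)"
proof -
  let ?S = "sphere 0 1 :: (real ^ 'n) set" and ?F = "cover_factor m \<delta>" and ?\<omega> = "unit_ball_vol (real m)"
  let ?\<sigma> = "measure cone_measure :: (real ^ 'n) set \<Rightarrow> real"
  have G1: "1 \<le> G" using \<delta> unfolding G_def by (intro cap_factor_ge_1) auto
  have F1: "1 \<le> ?F" using \<delta> by (intro cover_factor_ge_1) auto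
  have Q0: "0 < Q" using G1 by (simp add: Q_def)
  have *: "hausdorff_pre m \<delta> (?S \<inter> W) \<le> ennreal (Q * ?\<sigma> (?S \<inter> W)) \<and>
     (G \<le> K \<longrightarrow> valid_factor TYPE('n) \<delta> K \<longrightarrow>
        hausdorff_pre m \<delta> (?S \<inter> W) \<le> ennreal ((K - (K - G) * c) * ?\<sigma> (?S \<inter> W)))"
    if W: "open W" for W K
  proof -
    define V where "V = ?S \<inter> W"
    obtain I :: "nat set" and x r where I: "\<And>i. i \<in> I \<Longrightarrow> norm (x i) = 1" "\<And>i. i \<in> I \<Longrightarrow> 0 < r i"
      "\<And>i. i \<in> I \<Longrightarrow> 10 * r i \<le> \<delta>" "\<And>i. i \<in> I \<Longrightarrow> cball (x i) (r i) \<subseteq> W"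
      "\<And>i j. i \<in> I \<Longrightarrow> j \<in> I \<Longrightarrow> i \<noteq> j \<Longrightarrow> cball (x i) (r i) \<inter> cball (x j) (r j) = {}"
      "V \<subseteq> (\<Union>i\<in>I. cball (x i) (5 * r i))"
      by (rule Vitali_caps[OF V_def W \<delta>(1)], rule that)
    define cap where "cap i = (if i \<in> I then cball (x i) (r i) \<inter> ?S else {})" for i
    define big where "big i = (if i \<in> I then cball (x i) (5 * r i) \<inter> ?S else {})" for i
    have [measurable]: "cap i \<in> sets borel" "big i \<in> sets borel" for i by (auto simp: cap_def big_def)
    have [measurable]: "V \<in> sets borel" using W by (auto simp: V_def)
    have capV: "cap i \<subseteq> V" for i using I(4) by (auto simp: cap_def V_def)
    have Vbig: "V \<subseteq> (\<Union>i. big i)"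
    proof
      fix v assume v: "v \<in> V"
      then obtain i where "i \<in> I" "v \<in> cball (x i) (5 * r i)" using I(6) by blast
      then show "v \<in> (\<Union>i. big i)" using v by (intro UN_I[of i]) (auto simp: big_def V_def)
    qed
    have disj: "disjoint_family cap"
      unfolding disjoint_family_on_def cap_def using I(5) by auto
    have diam: "bounded (cap i)" "diameter (cap i) \<le> \<delta>" "bounded (big i)" "diameter (big i) \<le> \<delta>" for i
    proof -
      have dle: "diameter U \<le> \<delta>" if "U \<subseteq> cball y s" "2 * s \<le> \<delta>" for U and y :: "real ^ 'n" and s
      proof (rule diameter_le)
        fix a b assume "a \<in> U" "b \<in> U"
        then have "dist y a \<le> s" "dist y b \<le> s" using that by auto
        then show "norm (a - b) \<le> \<delta>" using dist_triangle3[of a b y] that(2) by (simp add: dist_norm)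
      qed (use \<delta> in auto)
      show "bounded (cap i)" "bounded (big i)" by (auto simp: cap_def big_def)
      show "diameter (cap i) \<le> \<delta>"
        using \<delta> I(2)[of i] I(3)[of i] by (auto simp: cap_def intro!: dle[of _ "x i" "r i"])
      show "diameter (big i) \<le> \<delta>"
        using \<delta> I(2)[of i] I(3)[of i] by (auto simp: big_def intro!: dle[of _ "x i" "5 * r i"])
    qed
    have cball_sphere: "?\<sigma> (cball y s) = ?\<sigma> (cball y s \<inter> ?S)" for y s
    proof -
      have "shell (cball y s) 0 1 = shell (cball y s \<inter> ?S) 0 1"
        by (auto simp: shell_def norm_sgn)
      then show ?thesis by (simp add: measure_def emeasure_cone_measure)
    qed
    have capc: "?\<omega> * r i ^ m \<le> G * ?\<sigma> (cap i)" if "i \<in> I" for i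
      using cap_cost_le[of "x i" "r i" \<delta>] I(1-3)[OF that] \<delta> that cball_sphere[of "x i" "r i"]
      unfolding m_def G_def cap_def by (simp add: Int_commute)
    have ccap: "hausdorff_cost m (cap i) \<le> ennreal (G * ?\<sigma> (cap i))" for i
    proof (cases "i \<in> I")
      case True
      have "hausdorff_cost m (cap i) \<le> ennreal (?\<omega> * r i ^ m)"
        using True I(2)[OF True] by (intro hausdorff_cost_le_radius[of _ "x i"]) (auto simp: cap_def)
      also have "\<dots> \<le> ennreal (G * ?\<sigma> (cap i))" by (intro ennreal_leI capc True)
      finally show ?thesis .
    qed (simp add: cap_def)
    have cbig: "hausdorff_cost m (big i) \<le> ennreal (Q * ?\<sigma> (cap i))" for i
    proof (cases "i \<in> I")
      case True
      have "hausdorff_cost m (big i) \<le> ennreal (?\<omega> * (5 * r i) ^ m)"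
        using True I(2)[OF True] by (intro hausdorff_cost_le_radius[of _ "x i"]) (auto simp: big_def)
      also have "?\<omega> * (5 * r i) ^ m = 5 ^ m * (?\<omega> * r i ^ m)" by (simp add: power_mult_distrib)
      also have "\<dots> \<le> 5 ^ m * (G * ?\<sigma> (cap i))" by (intro mult_left_mono capc True) simp
      finally show ?thesis by (simp add: Q_def mult_ac ennreal_leI)
    qed (simp add: big_def)
    have sumcap: "(\<Sum>i. ennreal (?\<sigma> (cap i))) \<le> ennreal (?\<sigma> V)"
    proof -
      have "(\<Sum>i. emeasure cone_measure (cap i)) = emeasure cone_measure (\<Union>i. cap i)"
        by (rule suminf_emeasure) (use disj in auto)
      also have "\<dots> \<le> emeasure cone_measure V" using capV by (intro emeasure_mono) auto
      finally show ?thesis by (simp add: cone.emeasure_eq_measure)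
    qed
    have pre1: "hausdorff_pre m \<delta> V \<le> ennreal (Q * ?\<sigma> V)"
    proof -
      have "hausdorff_pre m \<delta> V \<le> (\<Sum>i. hausdorff_cost m (big i))"
        by (rule hausdorff_pre_le_cover[OF Vbig diam(3,4)])
      also have "\<dots> \<le> (\<Sum>i. ennreal (Q * ?\<sigma> (cap i)))" by (intro suminf_le cbig) auto
      also have "\<dots> = ennreal Q * (\<Sum>i. ennreal (?\<sigma> (cap i)))" using Q0 by (simp add: ennreal_mult)
      also have "\<dots> \<le> ennreal Q * ennreal (?\<sigma> V)" by (intro mult_left_mono sumcap) simp
      finally show ?thesis using Q0 by (simp add: ennreal_mult)
    qed
    have pre2: "hausdorff_pre m \<delta> V \<le> ennreal ((K - (K - G) * c) * ?\<sigma> V)"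
      if K: "G \<le> K" "valid_factor TYPE('n) \<delta> K"
    proof (cases "?\<sigma> V = 0")
      case True
      then show ?thesis using pre1 by simp
    next
      case False
      then have \<sigma>V: "0 < ?\<sigma> V" by (simp add: zero_less_measure_iff)
      have \<sigma>big: "emeasure cone_measure (big i) \<le> ennreal (?F * Q) * ennreal (?\<sigma> (cap i))" for i
      proof -
        have "emeasure cone_measure (big i) \<le> ennreal ?F * hausdorff_cost m (big i)"
          unfolding m_def using \<delta> diam by (intro cone_measure_le_cost) (auto simp: big_def)
        also have "\<dots> \<le> ennreal ?F * ennreal (Q * ?\<sigma> (cap i))" by (intro mult_left_mono cbig) simp
        finally show ?thesis using Q0 F1 by (simp add: ennreal_mult mult.assoc)
      qed
      have "ennreal (?\<sigma> V) = emeasure cone_measure V" by (simp add: cone.emeasure_eq_measure)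
      also have "\<dots> \<le> emeasure cone_measure (\<Union>i. big i)" using Vbig by (intro emeasure_mono) auto
      also have "\<dots> \<le> (\<Sum>i. emeasure cone_measure (big i))"
        by (rule emeasure_subadditive_countably) auto
      also have "\<dots> \<le> (\<Sum>i. ennreal (?F * Q) * ennreal (?\<sigma> (cap i)))" by (intro suminf_le \<sigma>big) auto
      also have "\<dots> = ennreal (?F * Q) * (\<Sum>i. ennreal (?\<sigma> (cap i)))" by simp
      finally have le: "ennreal (?\<sigma> V) \<le> ennreal (?F * Q) * (\<Sum>i. ennreal (?\<sigma> (cap i)))" .
      have FQ: "0 < ?F * Q" using F1 Q0 by simp
      have c0: "0 < c" using FQ by (simp add: c_def)
      have "\<exists>N. c * ?\<sigma> V \<le> (\<Sum>i<N. ?\<sigma> (cap i))"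
      proof (rule ccontr)
        assume "\<not> ?thesis"
        then have "(\<Sum>i<N. ?\<sigma> (cap i)) \<le> c * ?\<sigma> V" for N by (auto simp: not_le intro: less_imp_le)
        then have "(\<Sum>i<N. ennreal (?\<sigma> (cap i))) \<le> ennreal (c * ?\<sigma> V)" for N
          by (simp add: sum_ennreal ennreal_leI)
        then have "(\<Sum>i. ennreal (?\<sigma> (cap i))) \<le> ennreal (c * ?\<sigma> V)"
          by (intro suminf_le_const) auto
        then have "ennreal (?F * Q) * (\<Sum>i. ennreal (?\<sigma> (cap i))) \<le> ennreal (?F * Q) * ennreal (c * ?\<sigma> V)"
          by (intro mult_left_mono) auto
        with le have "ennreal (?\<sigma> V) \<le> ennreal (?F * Q * (c * ?\<sigma> V))"
          using FQ c0 \<sigma>V by (simp add: ennreal_mult)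
        also have "?F * Q * (c * ?\<sigma> V) = ?\<sigma> V / 2" using F1 Q0 by (simp add: c_def)
        finally show False using \<sigma>V by simp
      qed
      then obtain N where N: "c * ?\<sigma> V \<le> (\<Sum>i<N. ?\<sigma> (cap i))" by blast
      define X where "X = (\<Union>i<N. cap i)"
      have [measurable]: "X \<in> sets borel" unfolding X_def by auto
      have XV: "X \<subseteq> V" using capV by (auto simp: X_def)
      have \<sigma>X: "?\<sigma> X = (\<Sum>i<N. ?\<sigma> (cap i))"
        unfolding X_def
        by (intro cone.finite_measure_finite_Union disjoint_family_on_mono[OF _ disj]) auto
      have VX: "V - X = ?S \<inter> (W - (\<Union>i\<in>{i\<in>I. i < N}. cball (x i) (r i)))"
        by (auto simp: V_def X_def cap_def split: if_splits)
      have "open (W - (\<Union>i\<in>{i\<in>I. i < N}. cball (x i) (r i)))"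
        by (intro open_Diff W closed_UN) auto
      then have preVX: "hausdorff_pre m \<delta> (V - X) \<le> ennreal (K * ?\<sigma> (V - X))"
        using K(2) unfolding valid_factor_def VX m_def by blast
      have "hausdorff_pre m \<delta> X \<le> (\<Sum>i<N. hausdorff_cost m (cap i))"
        unfolding X_def using \<delta> diam by (intro hausdorff_pre_finite_UN_le) auto
      also have "\<dots> \<le> (\<Sum>i<N. ennreal (G * ?\<sigma> (cap i)))" by (intro sum_mono ccap)
      also have "\<dots> = ennreal (G * ?\<sigma> X)"
        using G1 by (subst sum_ennreal) (auto simp: \<sigma>X sum_distrib_left)
      finally have preX: "hausdorff_pre m \<delta> X \<le> ennreal (G * ?\<sigma> X)" .
      have "hausdorff_pre m \<delta> V = hausdorff_pre m \<delta> (X \<union> (V - X))" using XV by (simp add: Un_absorb1)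
      also have "\<dots> \<le> hausdorff_pre m \<delta> X + hausdorff_pre m \<delta> (V - X)"
        using \<delta> by (intro hausdorff_pre_Un_le) auto
      also have "\<dots> \<le> ennreal (G * ?\<sigma> X) + ennreal (K * ?\<sigma> (V - X))" by (intro add_mono preX preVX)
      also have "\<dots> = ennreal (G * ?\<sigma> X + K * ?\<sigma> (V - X))" using G1 K(1) by (intro ennreal_plus[symmetric]) auto
      also have "G * ?\<sigma> X + K * ?\<sigma> (V - X) = K * ?\<sigma> V - (K - G) * ?\<sigma> X"
        using XV by (subst cone.finite_measure_Diff) (auto simp: algebra_simps)
      also have "\<dots> \<le> (K - (K - G) * c) * ?\<sigma> V"
        using mult_left_mono[OF N, of "K - G"] K(1) unfolding \<sigma>X by (simp add: algebra_simps)
      finally show ?thesis by (simp add: ennreal_leI)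
    qed
    show ?thesis using pre1 pre2 by (simp add: V_def)
  qed
  show "valid_factor TYPE('n) \<delta> Q" unfolding valid_factor_def using * m_def by auto
  show "valid_factor TYPE('n) \<delta> (K - (K - G) * c)" if "G \<le> K" "valid_factor TYPE('n) \<delta> K"
    using * that unfolding valid_factor_def[of _ _ "K - (K - G) * c"] m_def by auto
qed

text \<open>Iterating the step reduces the excess over \<open>G\<close> by the factor \<open>1 - c\<close> each
  time.\<close>

lemma valid_factor_cap_factor:
  assumes \<delta>: "0 < \<delta>" "\<delta> \<le> 1 / 2"
  shows "valid_factor TYPE('n::finite) \<delta> (cap_factor (CARD('n) - 1) \<delta>)"
proof -
  define m where "m = CARD('n) - 1"
  define G Q c where "G = cap_factor m \<delta>" and "Q = 5 ^ m * G" and "c = 1 / (2 * (cover_factor m \<delta> * Q))"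
  note step = valid_factor_step[OF \<delta>, where 'n='n, folded m_def, folded G_def, folded Q_def, folded c_def]
  have G1: "1 \<le> G" using \<delta> unfolding G_def by (intro cap_factor_ge_1) auto
  have F1: "1 \<le> cover_factor m \<delta>" using \<delta> by (intro cover_factor_ge_1) auto
  have QG: "G \<le> Q" using G1 mult_right_mono[of 1 "5 ^ m" G] by (simp add: Q_def)
  have FQ: "1 \<le> cover_factor m \<delta> * Q" using F1 QG G1 mult_mono[of 1 "cover_factor m \<delta>" 1 Q] by simp
  have c: "0 < c" "c < 1" using FQ by (auto simp: c_def)
  have val: "valid_factor TYPE('n) \<delta> (G + (Q - G) * (1 - c) ^ j)" for j
  proof (induction j)
    case 0
    then show ?case using step(1) by simp
  next
    case (Suc j)
    have "0 \<le> (Q - G) * (1 - c) ^ j" using QG c by (intro mult_nonneg_nonneg) auto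
    with step(2)[OF _ Suc.IH] show ?case by (simp add: algebra_simps)
  qed
  have lim: "(\<lambda>j. G + (Q - G) * (1 - c) ^ j) \<longlonglongrightarrow> G + (Q - G) * 0"
    using c by (intro tendsto_intros LIMSEQ_realpow_zero) auto
  show ?thesis
    unfolding valid_factor_def m_def[symmetric] G_def[symmetric]
  proof (intro allI impI)
    fix W :: "(real ^ 'n) set" assume W: "open W"
    let ?s = "measure cone_measure (sphere 0 1 \<inter> W)"
    have "(\<lambda>j. ennreal ((G + (Q - G) * (1 - c) ^ j) * ?s)) \<longlonglongrightarrow> ennreal ((G + (Q - G) * 0) * ?s)"
      by (intro tendsto_ennrealI tendsto_mult lim tendsto_const)
    then show "hausdorff_pre m \<delta> (sphere 0 1 \<inter> W) \<le> ennreal (G * ?s)"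
      using val W unfolding valid_factor_def m_def[symmetric]
      by (intro LIMSEQ_le_const[of _ "ennreal (G * ?s)"]) auto
  qed
qed

lemma hausdorff_sphere_le:
  "hausdorff_outer (CARD('n::finite) - 1) (sphere 0 1 :: (real ^ 'n) set) \<le> emeasure cone_measure (sphere 0 1 :: (real ^ 'n) set)"
  unfolding hausdorff_outer_def
proof (rule SUP_least)
  let ?S = "sphere 0 1 :: (real ^ 'n) set" and ?m = "CARD('n) - 1"
  fix \<delta>0 :: real assume "\<delta>0 \<in> {0<..}"
  then have \<delta>0: "0 < \<delta>0" by simp
  have "((\<lambda>\<delta>. ennreal (cap_factor ?m \<delta> * measure cone_measure ?S)) \<longlongrightarrow> ennreal (1 * measure cone_measure ?S)) (at_right 0)"
    by (intro tendsto_intros tendsto_ennrealI cap_factor_tendsto)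
  moreover have "\<forall>\<^sub>F \<delta> in at_right 0. hausdorff_pre ?m \<delta>0 ?S \<le> ennreal (cap_factor ?m \<delta> * measure cone_measure ?S)"
    unfolding eventually_at_right_field
  proof (intro exI[of _ "min \<delta>0 (1/2)"] conjI allI impI)
    fix \<delta> :: real assume \<delta>: "0 < \<delta>" "\<delta> < min \<delta>0 (1/2)"
    have "hausdorff_pre ?m \<delta>0 ?S \<le> hausdorff_pre ?m \<delta> ?S" using \<delta> by (intro hausdorff_pre_antimono) auto
    also have "\<dots> \<le> ennreal (cap_factor ?m \<delta> * measure cone_measure ?S)"
      using valid_factor_cap_factor[of \<delta>, where 'n='n] \<delta> unfolding valid_factor_def
      by (auto dest: spec[of _ UNIV])
    finally show "hausdorff_pre ?m \<delta>0 ?S \<le> ennreal (cap_factor ?m \<delta> * measure cone_measure ?S)" .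
  qed (use \<delta>0 in auto)
  ultimately have "hausdorff_pre ?m \<delta>0 ?S \<le> ennreal (1 * measure cone_measure ?S)"
    by (intro tendsto_lowerbound[of _ "ennreal (1 * measure cone_measure ?S)" "at_right 0"]) auto
  then show "hausdorff_pre ?m \<delta>0 ?S \<le> emeasure cone_measure ?S"
    by (simp add: cone.emeasure_eq_measure)
qed

lemma emeasure_cone_measure_sphere:
  fixes A :: "'a::euclidean_space set"
  assumes "A \<in> sets borel"
  shows "emeasure cone_measure (A \<inter> sphere 0 1) = emeasure cone_measure A"
proof -
  have "shell A 0 1 = shell (A \<inter> sphere 0 1) 0 1" by (auto simp: shell_def norm_sgn)
  then show ?thesis using assms by (simp add: emeasure_cone_measure)
qed

text \<open>Covers give one inequality for all Borel sets, caps the other one for the whole sphere. Since the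
  total mass is finite, the inequalities for a set and its complement are both equalities.\<close>

theorem hausdorff_measure_sphere_eq_cone:
  "density (hausdorff_measure (CARD('n::finite) - 1)) (indicator (sphere 0 1)) = (cone_measure :: (real ^ 'n) measure)"
proof (rule measure_eqI)
  let ?H = "hausdorff_measure (CARD('n) - 1) :: (real ^ 'n) measure" and ?S = "sphere 0 1 :: (real ^ 'n) set"
  show "sets (density ?H (indicator ?S)) = sets (cone_measure :: (real ^ 'n) measure)" by simp
  fix A assume "A \<in> sets (density ?H (indicator ?S))"
  then have A: "A \<in> sets borel" by simp
  have S: "?S \<in> sets borel" by simp
  have fin: "emeasure cone_measure B < top" for B :: "(real ^ 'n) set"
    by (simp add: cone.emeasure_eq_measure)
  have ge: "emeasure cone_measure B \<le> emeasure ?H (B \<inter> ?S)" if B: "B \<in> sets borel" for B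
  proof -
    have "emeasure cone_measure B = emeasure cone_measure (B \<inter> ?S)"
      by (rule emeasure_cone_measure_sphere[OF B, symmetric])
    also have "\<dots> \<le> hausdorff_outer (CARD('n) - 1) (B \<inter> ?S)"
      using B by (intro cone_measure_le_hausdorff) auto
    also have "\<dots> = emeasure ?H (B \<inter> ?S)" using B by (intro emeasure_hausdorff_measure[symmetric]) auto
    finally show ?thesis .
  qed
  have "emeasure ?H ?S \<le> emeasure cone_measure ?S"
    using hausdorff_sphere_le[where 'n='n] by (simp add: emeasure_hausdorff_measure)
  also have "\<dots> = emeasure cone_measure (UNIV :: (real ^ 'n) set)"
    using emeasure_cone_measure_sphere[of "UNIV :: (real ^ 'n) set"] by simp
  also have "\<dots> = emeasure cone_measure A + emeasure cone_measure (UNIV - A)"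
    using A by (subst plus_emeasure) (auto simp: Un_absorb1)
  finally have le: "emeasure ?H ?S \<le> emeasure cone_measure A + emeasure cone_measure (UNIV - A)" .
  have "emeasure ?H ?S = emeasure ?H (A \<inter> ?S) + emeasure ?H ((UNIV - A) \<inter> ?S)"
    using A by (subst plus_emeasure) (auto intro!: arg_cong[where f="emeasure _"])
  with le have "emeasure ?H (A \<inter> ?S) + emeasure ?H ((UNIV - A) \<inter> ?S) \<le> emeasure cone_measure A + emeasure cone_measure (UNIV - A)"
    by simp
  also have "\<dots> \<le> emeasure cone_measure A + emeasure ?H ((UNIV - A) \<inter> ?S)"
    using A by (intro add_left_mono ge) auto
  finally have le2: "emeasure ?H (A \<inter> ?S) + emeasure ?H ((UNIV - A) \<inter> ?S) \<le> emeasure cone_measure A + emeasure ?H ((UNIV - A) \<inter> ?S)" .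
  have "emeasure ?H ((UNIV - A) \<inter> ?S) \<le> emeasure ?H ?S" using A by (intro emeasure_mono) auto
  also have "\<dots> < top" using \<open>emeasure ?H ?S \<le> emeasure cone_measure ?S\<close> fin[of ?S] by (rule order_le_less_trans)
  finally have "emeasure ?H (A \<inter> ?S) \<le> emeasure cone_measure A"
    using le2 by (simp add: add.commute[of _ "emeasure ?H ((UNIV - A) \<inter> ?S)"] ennreal_add_left_cancel_le) auto
  then have "emeasure ?H (A \<inter> ?S) = emeasure cone_measure A" using ge[OF A] by (rule antisym)
  moreover have "emeasure (density ?H (indicator ?S)) A = emeasure ?H (A \<inter> ?S)"
  proof -
    have S': "?S \<in> sets ?H" "A \<in> sets ?H" using S A by simp_all
    have "emeasure (density ?H (indicator ?S)) A = (\<integral>\<^sup>+ x. indicator ?S x * indicator A x \<partial>?H)"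
      using S' by (intro emeasure_density borel_measurable_indicator)
    also have "\<dots> = (\<integral>\<^sup>+ x. indicator (A \<inter> ?S) x \<partial>?H)"
      by (intro nn_integral_cong) (auto simp: indicator_def)
    also have "\<dots> = emeasure ?H (A \<inter> ?S)"
      using S' by (intro nn_integral_indicator) (rule sets.Int)
    finally show ?thesis .
  qed
  ultimately show "emeasure (density ?H (indicator ?S)) A = emeasure cone_measure A" by simp
qed

lemma nn_integral_hausdorff_sphere:
  fixes f :: "real ^ 'n \<Rightarrow> ennreal"
  assumes f: "f \<in> borel_measurable borel"
  shows "(\<integral>\<^sup>+ w \<in> sphere 0 1. f w \<partial>hausdorff_measure (CARD('n) - 1)) = (\<integral>\<^sup>+ w. f w \<partial>cone_measure)"
proof -
  have "(\<integral>\<^sup>+ w. f w \<partial>cone_measure) = (\<integral>\<^sup>+ w. indicator (sphere 0 1) w * f w \<partial>hausdorff_measure (CARD('n) - 1))"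
    unfolding hausdorff_measure_sphere_eq_cone[symmetric]
  proof (rule nn_integral_density)
    show "f \<in> borel_measurable (hausdorff_measure (CARD('n) - 1))" using f by simp
    have "sphere 0 1 \<in> sets (hausdorff_measure (CARD('n) - 1) :: (real ^ 'n) measure)" by simp
    then show "indicator (sphere 0 1) \<in> borel_measurable (hausdorff_measure (CARD('n) - 1) :: (real ^ 'n) measure)"
      by (rule borel_measurable_indicator)
  qed
  then show ?thesis by (simp add: mult.commute)
qed

section \<open>Polar coordinates\<close>

text \<open>Both sides are integrals of \<open>h\<close> for measures on the half-line. By scaling they agree on
  all intervals, hence everywhere.\<close>

lemma nn_integral_polar:
  fixes f :: "'a::euclidean_space \<Rightarrow> ennreal" and h :: "real \<Rightarrow> ennreal"
  assumes f[measurable]: "f \<in> borel_measurable borel" and h[measurable]: "h \<in> borel_measurable borel"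
    and fin: "(\<integral>\<^sup>+ w. f w \<partial>cone_measure) < top" and R: "0 \<le> R"
  shows "(NBINT z. h (norm z) * f (sgn z) * indicator {z. 0 < norm z \<and> norm z \<le> R} z) =
     (NBINT t. h t * ennreal (t ^ (DIM('a) - 1)) * indicator {0<..R} t) * (\<integral>\<^sup>+ w. f w \<partial>cone_measure)"
proof -
  let ?n = "DIM('a)" and ?c = "\<integral>\<^sup>+ w. f w \<partial>cone_measure"
  let ?g = "\<lambda>z::'a. f (sgn z) * indicator {z. 0 < norm z \<and> norm z \<le> R} z"
  let ?k = "\<lambda>t. ?c * (ennreal (t ^ (?n - 1)) * indicator {0<..R} t)"
  define M where "M = distr (density lborel ?g) borel norm"
  define N where "N = density lborel ?k"
  have ball: "(NBINT z. f (sgn z) * indicator {z. 0 < norm z \<and> norm z \<le> t} z) = ennreal (t ^ ?n / ?n) * ?c"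
    if t: "0 \<le> t" for t
  proof (cases "t = 0")
    case True
    have "(NBINT z. f (sgn z) * indicator {z. 0 < norm z \<and> norm z \<le> t} z) = (\<integral>\<^sup>+ z. 0 \<partial>(lborel :: 'a measure))"
      using True by (intro nn_integral_cong) (auto simp: indicator_def)
    then show ?thesis using True by simp
  next
    case False
    with t have t: "0 < t" by simp
    have "(NBINT z. f (sgn z) * indicator {z. 0 < norm z \<and> norm z \<le> t} z) =
        ennreal (t ^ ?n) * (NBINT z. f (sgn (t *\<^sub>R z)) * indicator {z. 0 < norm z \<and> norm z \<le> t} (t *\<^sub>R z))"
      using t by (intro nn_integral_lborel_scale) measurable
    also have "(NBINT z. f (sgn (t *\<^sub>R z)) * indicator {z. 0 < norm z \<and> norm z \<le> t} (t *\<^sub>R z)) =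
        (NBINT z. f (sgn z) * indicator {z. 0 < norm z \<and> norm z \<le> 1} z)"
      using t by (intro nn_integral_cong) (auto simp: sgn_scaleR indicator_def)
    finally have e: "(NBINT z. f (sgn z) * indicator {z. 0 < norm z \<and> norm z \<le> t} z) =
        ennreal (t ^ ?n) * (NBINT z. f (sgn z) * indicator {z. 0 < norm z \<and> norm z \<le> 1} z)" .
    have "ennreal (t ^ ?n / ?n) * ?c = (ennreal (t ^ ?n / ?n) * ennreal (real ?n)) *
        (NBINT z. f (sgn z) * indicator {z. 0 < norm z \<and> norm z \<le> 1} z)"
      by (simp add: nn_integral_cone_measure[OF f] mult.assoc)
    also have "ennreal (t ^ ?n / ?n) * ennreal (real ?n) = ennreal (t ^ ?n)"
      using t by (subst ennreal_mult[symmetric]) auto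
    finally show ?thesis using e by simp
  qed
  have rad: "(NBINT t. ennreal (t ^ (?n - 1)) * indicator {\<alpha><..R} t) = ennreal ((R ^ ?n - \<alpha> ^ ?n) / ?n)"
    if "0 \<le> \<alpha>" "\<alpha> \<le> R" for \<alpha>
  proof -
    have "(NBINT t. ennreal (t ^ (?n - 1)) * indicator {\<alpha><..R} t) = (NBINT t. ennreal (t ^ (?n - 1)) * indicator {\<alpha>..R} t)"
      by (intro nn_integral_cong_AE AE_I[where N="{\<alpha>}"]) (auto simp: indicator_def)
    also have "\<dots> = ennreal (R ^ ?n / ?n - \<alpha> ^ ?n / ?n)"
    proof (rule nn_integral_FTC_Icc[where F="\<lambda>t. t ^ ?n / ?n" and f="\<lambda>t. t ^ (?n - 1)"])
      fix t assume "t \<in> {\<alpha>..R}"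
      show "((\<lambda>t. t ^ ?n / ?n) has_real_derivative t ^ (?n - 1)) (at t)"
        by (auto intro!: derivative_eq_intros)
    qed (use that in auto)
    finally show ?thesis by (simp add: diff_divide_distrib)
  qed
  have M: "emeasure M {a<..} = (NBINT z. ?g z * indicator {a<..} (norm z))" for a
    unfolding M_def by (subst emeasure_distr, measurable, subst emeasure_density, measurable)
      (auto intro!: nn_integral_cong simp: indicator_def)
  have N: "emeasure N {a<..} = (NBINT t. ?k t * indicator {a<..} t)" for a
    unfolding N_def by (subst emeasure_density) auto
  have eq: "emeasure M {a<..} = ennreal ((R ^ ?n - (max 0 (min a R)) ^ ?n) / ?n) * ?c"
       "emeasure N {a<..} = ennreal ((R ^ ?n - (max 0 (min a R)) ^ ?n) / ?n) * ?c" for a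
  proof -
    define b where "b = max 0 (min a R)"
    have b: "0 \<le> b" "b \<le> R" using R by (auto simp: b_def)
    have "ennreal (b ^ ?n / ?n) * ?c + emeasure M {a<..} =
        (NBINT z. f (sgn z) * indicator {z. 0 < norm z \<and> norm z \<le> b} z + ?g z * indicator {a<..} (norm z))"
      unfolding M ball[OF b(1), symmetric] by (rule nn_integral_add[symmetric]) measurable
    also have "\<dots> = (NBINT z. ?g z)"
    proof (rule nn_integral_cong)
      fix z :: 'a
      show "f (sgn z) * indicator {z. 0 < norm z \<and> norm z \<le> b} z + ?g z * indicator {a<..} (norm z) = ?g z"
        using R norm_ge_zero[of z]
        by (auto simp: indicator_def b_def max_def min_def simp del: norm_ge_zero split: if_splits)
    qed
    also have "\<dots> = ennreal (R ^ ?n / ?n) * ?c" by (rule ball[OF R])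
    also have "\<dots> = ennreal (b ^ ?n / ?n) * ?c + ennreal ((R ^ ?n - b ^ ?n) / ?n) * ?c"
    proof -
      have "b ^ ?n \<le> R ^ ?n" using b by (intro power_mono)
      then show ?thesis using b unfolding distrib_right[symmetric]
        by (subst ennreal_plus[symmetric]) (auto simp: diff_divide_distrib divide_right_mono)
    qed
    finally show "emeasure M {a<..} = ennreal ((R ^ ?n - (max 0 (min a R)) ^ ?n) / ?n) * ?c"
      using fin unfolding b_def[symmetric]
      by (subst (asm) ennreal_add_left_cancel) (auto simp: ennreal_mult_eq_top_iff)
    have "emeasure N {a<..} = (NBINT t. ?c * (ennreal (t ^ (?n - 1)) * indicator {b<..R} t))"
      unfolding N using R by (intro nn_integral_cong) (auto simp: indicator_def b_def max_def min_def split: if_splits)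
    also have "\<dots> = ?c * ennreal ((R ^ ?n - b ^ ?n) / ?n)"
      unfolding rad[OF b, symmetric] by (rule nn_integral_cmult) measurable
    finally show "emeasure N {a<..} = ennreal ((R ^ ?n - (max 0 (min a R)) ^ ?n) / ?n) * ?c"
      unfolding b_def[symmetric] by (simp add: mult.commute)
  qed
  have MN: "M = N"
  proof (rule measure_eqI_lessThan)
    show "emeasure M {x<..} < \<infinity>" for x
      using fin by (simp add: eq ennreal_mult_less_top)
    show "emeasure M {x<..} = emeasure N {x<..}" for x by (simp only: eq)
  qed (auto simp: M_def N_def)
  have "(NBINT z. h (norm z) * f (sgn z) * indicator {z. 0 < norm z \<and> norm z \<le> R} z) = (NBINT z. ?g z * h (norm z))"
    by (simp add: mult_ac)
  also have "\<dots> = (\<integral>\<^sup>+ t. h t \<partial>M)"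
    unfolding M_def by (subst nn_integral_distr, measurable, subst nn_integral_density, measurable)
  also have "\<dots> = (NBINT t. ?k t * h t)"
    unfolding MN N_def by (rule nn_integral_density) measurable
  also have "\<dots> = (NBINT t. ?c * (h t * ennreal (t ^ (?n - 1)) * indicator {0<..R} t))"
    by (simp add: mult_ac)
  also have "\<dots> = ?c * (NBINT t. h t * ennreal (t ^ (?n - 1)) * indicator {0<..R} t)"
    by (rule nn_integral_cmult) measurable
  finally show ?thesis by (simp add: mult.commute)
qed

lemma nn_integral_polar_powr:
  fixes f :: "'a::euclidean_space \<Rightarrow> ennreal" and \<beta> R :: real
  assumes f[measurable]: "f \<in> borel_measurable borel" and fin: "(\<integral>\<^sup>+ w. f w \<partial>cone_measure) < top"
    and "0 < \<beta>" "0 \<le> R"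
  shows "(NBINT z. ennreal (norm z powr (\<beta> - DIM('a))) * f (sgn z) * indicator {z. 0 < norm z \<and> norm z \<le> R} z) =
     ennreal (R powr \<beta> / \<beta>) * (\<integral>\<^sup>+ w. f w \<partial>cone_measure)"
proof -
  have "(NBINT t. ennreal (t powr (\<beta> - DIM('a))) * ennreal (t ^ (DIM('a) - 1)) * indicator {0<..R} t) =
      (NBINT t. ennreal (t powr (\<beta> - 1)) * indicator {0..R} t)"
  proof (rule nn_integral_cong)
    fix t :: real
    have "t powr (\<beta> - DIM('a)) * t ^ (DIM('a) - 1) = t powr (\<beta> - 1)" if "0 < t"
      using that by (simp add: powr_realpow[symmetric] powr_add[symmetric] of_nat_diff)
    then show "ennreal (t powr (\<beta> - DIM('a))) * ennreal (t ^ (DIM('a) - 1)) * indicator {0<..R} t =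
        ennreal (t powr (\<beta> - 1)) * indicator {0..R} t"
      by (auto simp: indicator_def ennreal_mult[symmetric])
  qed
  also have "\<dots> = ennreal (R powr \<beta> / \<beta>)"
    using has_integral_powr_from_0[of "\<beta> - 1" R] assms
    by (intro nn_integral_has_integral_lebesgue') auto
  finally show ?thesis
    using nn_integral_polar[OF f _ fin, of "\<lambda>t. ennreal (t powr (\<beta> - DIM('a)))" R] assms by simp
qed

text \<open>Polar coordinates on balls of increasing radius.\<close>

lemma nn_integral_norm_powr_outside:
  fixes \<alpha> \<delta> :: real
  assumes "0 < \<alpha>" "0 < \<delta>"
  shows "(\<integral>\<^sup>+ z. ennreal (norm z powr (- DIM('a) - \<alpha>)) * indicator {z. \<delta> < norm z} z \<partial>(lborel :: 'a::euclidean_space measure)) < top"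
proof -
  let ?c = "\<integral>\<^sup>+ w. 1 \<partial>(cone_measure :: 'a measure)"
  have c: "?c < top" using emeasure_cone_measure_UNIV[where 'a='a] by simp
  let ?h = "\<lambda>t. ennreal (t powr (- DIM('a) - \<alpha>)) * indicator {\<delta><..} t"
  let ?B = "ennreal (\<delta> powr (- \<alpha>) / \<alpha>) * ?c"
  have R: "(\<integral>\<^sup>+ z. ?h (norm z) * 1 * indicator {z. 0 < norm z \<and> norm z \<le> real R} z \<partial>(lborel :: 'a measure)) \<le> ?B" for R :: nat
  proof -
    have "(\<integral>\<^sup>+ z. ?h (norm z) * 1 * indicator {z. 0 < norm z \<and> norm z \<le> real R} z \<partial>(lborel :: 'a measure)) =
        (NBINT t. ?h t * ennreal (t ^ (DIM('a) - 1)) * indicator {0<..real R} t) * ?c"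
      using c by (intro nn_integral_polar) auto
    also have "(NBINT t. ?h t * ennreal (t ^ (DIM('a) - 1)) * indicator {0<..real R} t) \<le>
        (NBINT t. ennreal (t powr (- \<alpha> - 1)) * indicator {\<delta>..} t)"
    proof (rule nn_integral_mono)
      fix t :: real
      have "t powr (- DIM('a) - \<alpha>) * t ^ (DIM('a) - 1) = t powr (- \<alpha> - 1)" if "0 < t"
        using that by (simp add: powr_realpow[symmetric] powr_add[symmetric] of_nat_diff)
      then show "?h t * ennreal (t ^ (DIM('a) - 1)) * indicator {0<..real R} t \<le>
          ennreal (t powr (- \<alpha> - 1)) * indicator {\<delta>..} t"
        using assms by (auto simp: indicator_def ennreal_mult[symmetric])
    qed
    also have "\<dots> = ennreal (\<delta> powr (- \<alpha>) / \<alpha>)"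
      using has_integral_powr_to_inf[of "- \<alpha> - 1" \<delta>] assms
      by (intro nn_integral_has_integral_lebesgue') auto
    finally show ?thesis by (simp add: mult_right_mono)
  qed
  have "(\<integral>\<^sup>+ z. ennreal (norm z powr (- DIM('a) - \<alpha>)) * indicator {z. \<delta> < norm z} z \<partial>(lborel :: 'a measure)) =
      (\<integral>\<^sup>+ z. (SUP R. ?h (norm z) * 1 * indicator {z. 0 < norm z \<and> norm z \<le> real R} z) \<partial>(lborel :: 'a measure))"
  proof (rule nn_integral_cong)
    fix z :: 'a
    obtain R where R: "norm z \<le> real R" using real_arch_simple by blast
    show "ennreal (norm z powr (- DIM('a) - \<alpha>)) * indicator {z. \<delta> < norm z} z =
        (SUP R. ?h (norm z) * 1 * indicator {z. 0 < norm z \<and> norm z \<le> real R} z)"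
      using assms R by (intro antisym SUP_least SUP_upper2[of R]) (auto simp: indicator_def)
  qed
  also have "\<dots> = (SUP R. \<integral>\<^sup>+ z. ?h (norm z) * 1 * indicator {z. 0 < norm z \<and> norm z \<le> real R} z \<partial>(lborel :: 'a measure))"
    by (intro nn_integral_monotone_convergence_SUP) (auto simp: incseq_def le_fun_def indicator_def)
  also have "\<dots> \<le> ?B" by (intro SUP_least R)
  also have "\<dots> < top" using c by (simp add: ennreal_mult_less_top)
  finally show ?thesis .
qed

section \<open>Smooth functions vanishing on a half-line\<close>

text \<open>Differentiation leads from \<open>exp (- 1 / t)\<close> to its products with powers of \<open>1 /
  t\<close>; including these makes the family closed under derivatives.\<close>

definition flat :: "nat \<Rightarrow> real \<Rightarrow> real" where
  "flat j t = (if 0 < t then (1 / t) ^ j * exp (- (1 / t)) else 0)"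

lemma flat_nonneg: "0 \<le> flat j t"
  by (simp add: flat_def)

lemma flat_0_le_1: "flat 0 t \<le> 1"
  by (simp add: flat_def)

lemma flat_tendsto_0: "(flat j \<longlongrightarrow> 0) (at 0)"
proof -
  have "((\<lambda>y::real. y ^ j / exp y) \<longlongrightarrow> 0) at_top"
    by (rule tendsto_power_div_exp_0)
  then have "((\<lambda>t::real. (inverse t) ^ j / exp (inverse t)) \<longlongrightarrow> 0) (at_right 0)"
    by (rule filterlim_compose[OF _ filterlim_inverse_at_top_right])
  moreover have "\<forall>\<^sub>F t in at_right 0. (inverse t) ^ j / exp (inverse t) = flat j t"
    using eventually_at_right_less[of "0::real"]
    by eventually_elim (simp add: flat_def exp_minus divide_inverse)
  ultimately have r: "(flat j \<longlongrightarrow> 0) (at_right 0)"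
    by (simp add: tendsto_cong)
  have "\<forall>\<^sub>F t in at_left (0::real). 0 = flat j t"
    by (auto simp: eventually_at_left_field flat_def intro!: exI[of _ "-1"])
  then have l: "(flat j \<longlongrightarrow> 0) (at_left 0)"
    by (rule tendsto_cong[THEN iffD1]) simp
  show ?thesis using filterlim_split_at[OF l r] .
qed

lemma flat_has_real_derivative:
  "(flat j has_real_derivative (flat (j + 2) t - real j * flat (j + 1) t)) (at t)"
proof (cases "t = 0")
  case True
  have "((\<lambda>h. (flat j (0 + h) - flat j 0) / h) \<longlongrightarrow> 0) (at 0)"
  proof (rule tendsto_cong[THEN iffD1])
    show "(flat (j + 1) \<longlongrightarrow> 0) (at 0)" by (rule flat_tendsto_0)
    show "\<forall>\<^sub>F h in at 0. flat (j + 1) h = (flat j (0 + h) - flat j 0) / h"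
      by (intro always_eventually allI) (auto simp: flat_def)
  qed
  then show ?thesis using True by (simp add: has_field_derivative_iff flat_def)
next
  case False
  show ?thesis
  proof (cases "0 < t")
    case True
    have "((\<lambda>t. (1 / t) ^ j * exp (- (1 / t))) has_real_derivative (flat (j + 2) t - real j * flat (j + 1) t)) (at t)"
    proof -
      have i: "((\<lambda>t. 1 / t) has_real_derivative - ((1 / t) * (1 / t))) (at t)"
        using True by (auto intro!: derivative_eq_intros)
      have e: "((\<lambda>t. exp (- (1 / t))) has_real_derivative exp (- (1 / t)) * ((1 / t) * (1 / t))) (at t)"
        using DERIV_fun_exp[OF DERIV_minus[OF i]] by simp
      have eq: "(real j * (- (y * y) * y ^ (j - Suc 0))) * E + (E * (y * y)) * y ^ j =
          y ^ (j + 2) * E - real j * (y ^ (j + 1) * E)" for y E :: real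
        by (cases j) (simp_all add: algebra_simps)
      have "((\<lambda>t. (1 / t) ^ j * exp (- (1 / t))) has_real_derivative
          (1 / t) ^ (j + 2) * exp (- (1 / t)) - real j * ((1 / t) ^ (j + 1) * exp (- (1 / t)))) (at t)"
        using DERIV_mult[OF DERIV_power[OF i, of j] e] unfolding eq .
      then show ?thesis using True by (simp only: flat_def if_True)
    qed
    then show ?thesis
    proof (rule has_field_derivative_transform_within_open[where S="{0<..}"])
      fix x :: real assume "x \<in> {0<..}"
      then show "(1 / x) ^ j * exp (- (1 / x)) = flat j x" by (simp add: flat_def)
    qed (use True in auto)
  next
    case neg: False
    have "((\<lambda>t. 0) has_real_derivative (flat (j + 2) t - real j * flat (j + 1) t)) (at t)"
      using neg by (simp add: flat_def)
    then show ?thesis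
      by (rule has_field_derivative_transform_within_open[where S="{..<0}"])
        (use neg False in \<open>auto simp: flat_def\<close>)
  qed
qed

text \<open>A class of functions that is visibly closed under partial differentiation, so that its
  members are smooth.\<close>

inductive flat_algebra :: "(real ^ 'n \<Rightarrow> real) \<Rightarrow> bool" where
  flat_algebra_const: "flat_algebra (\<lambda>x. c)"
| flat_algebra_flat: "flat_algebra (\<lambda>x. flat j (a * (x $ i) + b))"
| flat_algebra_add: "flat_algebra f \<Longrightarrow> flat_algebra g \<Longrightarrow> flat_algebra (\<lambda>x. f x + g x)"
| flat_algebra_mult: "flat_algebra f \<Longrightarrow> flat_algebra g \<Longrightarrow> flat_algebra (\<lambda>x. f x * g x)"

lemma flat_algebra_has_derivative:
  assumes "flat_algebra f"
  shows "\<exists>D. (\<forall>x. (f has_derivative (\<lambda>h. \<Sum>i\<in>UNIV. D i x * h $ i)) (at x)) \<and> (\<forall>i. flat_algebra (D i))"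
  using assms
proof induction
  case (flat_algebra_const c)
  show ?case
    by (rule exI[of _ "\<lambda>i x. 0"]) (auto intro: flat_algebra.flat_algebra_const)
next
  case (flat_algebra_flat j a i b)
  let ?d = "\<lambda>x. a * (flat (j + 2) (a * x $ i + b) + (- real j) * flat (j + 1) (a * x $ i + b))"
  have "((\<lambda>x. flat j (a * x $ i + b)) has_derivative (\<lambda>h. \<Sum>l\<in>UNIV. (if l = i then ?d x else 0) * h $ l)) (at x)" for x
  proof -
    have "((\<lambda>x. a * x $ i + b) has_derivative (\<lambda>h. a * h $ i)) (at x)"
      by (auto intro!: derivative_eq_intros bounded_linear_imp_has_derivative bounded_linear_vec_nth)
    moreover have "(flat j has_derivative (*) (flat (j + 2) (a * x $ i + b) - real j * flat (j + 1) (a * x $ i + b))) (at (a * x $ i + b))"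
      using flat_has_real_derivative[of j "a * x $ i + b"] by (simp add: has_field_derivative_def)
    ultimately have "((\<lambda>x. flat j (a * x $ i + b)) has_derivative
        (\<lambda>h. (flat (j + 2) (a * x $ i + b) - real j * flat (j + 1) (a * x $ i + b)) * (a * h $ i))) (at x)"
      by (rule has_derivative_compose)
    moreover have "(\<Sum>l\<in>UNIV. (if l = i then ?d x else 0) * h $ l) =
        (flat (j + 2) (a * x $ i + b) - real j * flat (j + 1) (a * x $ i + b)) * (a * h $ i)" for h :: "real ^ 'a"
      by (subst sum.remove[of _ i]) (auto simp: algebra_simps)
    ultimately show ?thesis by simp
  qed
  moreover have "flat_algebra (\<lambda>x. if l = i then ?d x else 0)" for l
  proof -
    have d: "flat_algebra ?d" by (intro flat_algebra.intros)
    show ?thesis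
    proof (cases "l = i")
      case True
      show ?thesis by (simp only: True refl if_True d)
    qed (simp add: flat_algebra.flat_algebra_const)
  qed
  ultimately show ?case by (intro exI[of _ "\<lambda>l x. if l = i then ?d x else 0"]) auto
next
  case (flat_algebra_add f g)
  then obtain D E where D: "\<And>x. (f has_derivative (\<lambda>h. \<Sum>i\<in>UNIV. D i x * h $ i)) (at x)" "\<And>i. flat_algebra (D i)"
    and E: "\<And>x. (g has_derivative (\<lambda>h. \<Sum>i\<in>UNIV. E i x * h $ i)) (at x)" "\<And>i. flat_algebra (E i)"
    by blast
  have "((\<lambda>x. f x + g x) has_derivative (\<lambda>h. \<Sum>i\<in>UNIV. (D i x + E i x) * h $ i)) (at x)" for x
    using has_derivative_add[OF D(1)[of x] E(1)[of x]] by (simp add: sum.distrib algebra_simps)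
  then show ?case
    using D(2) E(2) by (intro exI[of _ "\<lambda>i x. D i x + E i x"]) (auto intro: flat_algebra.intros)
next
  case (flat_algebra_mult f g)
  then obtain D E where D: "\<And>x. (f has_derivative (\<lambda>h. \<Sum>i\<in>UNIV. D i x * h $ i)) (at x)" "\<And>i. flat_algebra (D i)"
    and E: "\<And>x. (g has_derivative (\<lambda>h. \<Sum>i\<in>UNIV. E i x * h $ i)) (at x)" "\<And>i. flat_algebra (E i)"
    by blast
  have "((\<lambda>x. f x * g x) has_derivative (\<lambda>h. \<Sum>i\<in>UNIV. (f x * E i x + D i x * g x) * h $ i)) (at x)" for x
    using has_derivative_mult[OF D(1)[of x] E(1)[of x]]
    by (simp add: sum.distrib algebra_simps sum_distrib_left sum_distrib_right)
  then show ?case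
    using D(2) E(2) flat_algebra_mult(1,2)
    by (intro exI[of _ "\<lambda>i x. f x * E i x + D i x * g x"]) (auto intro!: flat_algebra.intros)
qed

lemma partial_deriv_eq:
  assumes "(f has_derivative (\<lambda>h. \<Sum>i\<in>UNIV. D i * h $ i)) (at x)"
  shows "partial_deriv i f x = D i"
proof -
  have "frechet_derivative f (at x) = (\<lambda>h. \<Sum>i\<in>UNIV. D i * h $ i)"
    by (rule frechet_derivative_at[OF assms, symmetric])
  then have "partial_deriv i f x = (\<Sum>l\<in>UNIV. D l * (axis i 1 :: real ^ 'a) $ l)"
    by (simp add: partial_deriv_def)
  also have "\<dots> = D i"
    by (subst sum.remove[of _ i]) (auto simp: axis_def)
  finally show ?thesis .
qed

lemma flat_algebra_Ck: "flat_algebra f \<Longrightarrow> Ck k f"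
proof (induction k arbitrary: f)
  case 0
  then obtain D where "\<And>x. (f has_derivative (\<lambda>h. \<Sum>i\<in>UNIV. D i x * h $ i)) (at x)"
    using flat_algebra_has_derivative by blast
  then have "continuous (at x) f" for x by (meson has_derivative_continuous)
  then show ?case by (simp add: continuous_at_imp_continuous_on)
next
  case (Suc k)
  then obtain D where D: "\<And>x. (f has_derivative (\<lambda>h. \<Sum>i\<in>UNIV. D i x * h $ i)) (at x)" "\<And>i. flat_algebra (D i)"
    using flat_algebra_has_derivative by blast
  have "f differentiable (at x)" for x using D(1) differentiable_def by blast
  moreover have "partial_deriv i f = D i" for i
    using partial_deriv_eq[OF D(1)] by (intro ext)
  ultimately show ?case using Suc.IH D(2) by simp
qed

text \<open>Every factor is a flat function of an affine function of one coordinate; for large \<open>m\<close>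
  the product tends to the indicator of the box.\<close>

definition box_bump :: "real ^ 'n \<Rightarrow> real ^ 'n \<Rightarrow> nat \<Rightarrow> real ^ 'n \<Rightarrow> real" where
  "box_bump a b m x = (\<Prod>i\<in>UNIV. flat 0 (real m * (x $ i) + (- real m * a $ i)) * flat 0 (- real m * (x $ i) + real m * b $ i))"

lemma flat_algebra_prod:
  "finite A \<Longrightarrow> (\<And>i. i \<in> A \<Longrightarrow> flat_algebra (f i)) \<Longrightarrow> flat_algebra (\<lambda>x. \<Prod>i\<in>A. f i x)"
  by (induction A rule: finite_induct) (auto intro: flat_algebra.intros)

lemma flat_algebra_box_bump: "flat_algebra (box_bump a b m)"
  unfolding box_bump_def by (intro flat_algebra_prod flat_algebra.intros) simp

lemma box_bump_nonneg: "0 \<le> box_bump a b m x"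
  unfolding box_bump_def by (intro prod_nonneg) (auto intro!: mult_nonneg_nonneg flat_nonneg)

lemma box_bump_le_1: "box_bump a b m x \<le> 1"
  unfolding box_bump_def
  by (intro prod_le_1) (auto intro!: mult_nonneg_nonneg flat_nonneg mult_le_one flat_0_le_1)

lemma box_bump_outside:
  assumes "x \<notin> box a b"
  shows "box_bump a b m x = 0"
proof -
  obtain i where "\<not> (a $ i < x $ i \<and> x $ i < b $ i)"
    using assms by (auto simp: mem_box_cart)
  then have "flat 0 (real m * (x $ i) + (- real m * a $ i)) * flat 0 (- real m * (x $ i) + real m * b $ i) = 0"
    by (auto simp: flat_def not_less zero_less_mult_iff simp flip: right_diff_distrib)
  then show ?thesis unfolding box_bump_def by (intro prod_zero) auto
qed

lemma box_bump_tendsto: "(\<lambda>m. box_bump a b m x) \<longlonglongrightarrow> indicator (box a b) x"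
proof (cases "x \<in> box a b")
  case True
  have fl: "(\<lambda>m. flat 0 (real m * t)) \<longlonglongrightarrow> 1" if "0 < t" for t
  proof -
    have "(\<lambda>m. exp (- (inverse (real m) * (1 / t)))) \<longlonglongrightarrow> exp (- (0 * (1 / t)))"
      by (intro tendsto_intros lim_inverse_n)
    moreover have "\<forall>\<^sub>F m in sequentially. exp (- (inverse (real m) * (1 / t))) = flat 0 (real m * t)"
      using eventually_gt_at_top[of "0::nat"]
      by eventually_elim (use that in \<open>simp add: flat_def field_simps\<close>)
    ultimately show ?thesis by (simp add: tendsto_cong)
  qed
  have "(\<lambda>m. box_bump a b m x) \<longlonglongrightarrow> (\<Prod>i\<in>(UNIV :: 'a set). 1 * 1)"
    unfolding box_bump_def
  proof (intro tendsto_prod tendsto_mult)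
    fix i
    have "0 < x $ i - a $ i" "0 < b $ i - x $ i" using True by (auto simp: mem_box_cart)
    from fl[OF this(1)] fl[OF this(2)]
    show "(\<lambda>m. flat 0 (real m * x $ i + - real m * a $ i)) \<longlonglongrightarrow> 1"
      "(\<lambda>m. flat 0 (- real m * x $ i + real m * b $ i)) \<longlonglongrightarrow> 1"
      by (simp_all add: algebra_simps)
  qed
  then show ?thesis using True by simp
qed (simp add: box_bump_outside)

lemma test_function_box_bump: "test_function (box_bump a b m)"
  unfolding test_function_def
proof
  show "\<forall>k. Ck k (box_bump a b m)" using flat_algebra_Ck[OF flat_algebra_box_bump] by blast
  have "{x. box_bump a b m x \<noteq> 0} \<subseteq> cbox a b" using box_bump_outside box_subset_cbox by blast
  then have "bounded {x. box_bump a b m x \<noteq> 0}" by (rule bounded_subset[OF bounded_cbox])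
  then show "compact (closure {x. box_bump a b m x \<noteq> 0})" by (simp add: compact_closure)
qed

section \<open>The fundamental lemma of the calculus of variations\<close>

text \<open>Lebesgue differentiation on cubes.\<close>

lemma zero_box_integrals_imp_zero:
  fixes f :: "'a::euclidean_space \<Rightarrow> real"
  assumes "\<And>a b. (f has_integral 0) (cbox a b)"
  shows "\<exists>N. negligible N \<and> (\<forall>x. x \<notin> N \<longrightarrow> f x = 0)"
proof -
  have "f integrable_on cbox a b" for a b using assms by blast
  from this obtain N where N: "negligible N"
    "\<And>x e. \<lbrakk>x \<notin> N; 0 < e\<rbrakk> \<Longrightarrow> \<exists>d>0. \<forall>h. 0 < h \<and> h < d \<longrightarrow>
        norm (integral (cbox x (x + h *\<^sub>R One)) f /\<^sub>R h ^ DIM('a) - f x) < e"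
    by - (rule integrable_ccontinuous_explicit[where f=f], blast, rule that)
  have "f x = 0" if xN: "x \<notin> N" for x
  proof (rule ccontr)
    assume "f x \<noteq> 0"
    then obtain d where d: "0 < d" "\<And>h. 0 < h \<and> h < d \<Longrightarrow>
        norm (integral (cbox x (x + h *\<^sub>R One)) f /\<^sub>R h ^ DIM('a) - f x) < \<bar>f x\<bar>"
      using N(2)[OF xN, of "\<bar>f x\<bar>"] by auto
    have "integral (cbox x (x + (d / 2) *\<^sub>R One)) f = 0" using assms by blast
    then show False using d(2)[of "d / 2"] d(1) by simp
  qed
  then show ?thesis using N(1) by blast
qed

lemma locally_integrableD:
  assumes "locally_integrable f" "compact K"
  shows "integrable lebesgue (\<lambda>x. indicator K x *\<^sub>R f x)"
  using assms by (simp add: locally_integrable_def set_integrable_def)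

text \<open>Bump functions tend boundedly to the indicators of boxes, so that all integrals over boxes vanish.\<close>

theorem fundamental_lemma:
  fixes f :: "real ^ 'n \<Rightarrow> real"
  assumes f: "locally_integrable f"
    and zero: "\<And>\<phi>. test_function \<phi> \<Longrightarrow> (LINT x|lebesgue. f x * \<phi> x) = 0"
  shows "\<exists>N. negligible N \<and> (\<forall>x. x \<notin> N \<longrightarrow> f x = 0)"
proof (rule zero_box_integrals_imp_zero)
  fix a b :: "real ^ 'n"
  have int: "integrable lebesgue (\<lambda>x. indicator (cbox a b) x * f x)"
    using locally_integrableD[OF f compact_cbox] by simp
  have meas [measurable]: "(\<lambda>x. indicator (cbox a b) x * f x) \<in> borel_measurable lebesgue"
    using int by auto
  have bm: "box_bump a b m \<in> borel_measurable lebesgue" for m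
  proof -
    have "Ck 0 (box_bump a b m)" by (rule flat_algebra_Ck[OF flat_algebra_box_bump])
    then have "box_bump a b m \<in> borel_measurable borel" by (simp add: borel_measurable_continuous_onI)
    then show ?thesis by (simp add: measurable_completion)
  qed
  have lim: "(\<lambda>m. LINT x|lebesgue. (indicator (cbox a b) x * f x) * box_bump a b m x) \<longlonglongrightarrow>
     (LINT x|lebesgue. (indicator (cbox a b) x * f x) * indicator (box a b) x)"
  proof (rule integral_dominated_convergence[where w="\<lambda>x. \<bar>indicator (cbox a b) x * f x\<bar>"])
    show "integrable lebesgue (\<lambda>x. \<bar>indicator (cbox a b) x * f x\<bar>)" using int by (rule integrable_abs)
    show "AE x in lebesgue. (\<lambda>m. (indicator (cbox a b) x * f x) * box_bump a b m x) \<longlonglongrightarrow>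
        (indicator (cbox a b) x * f x) * indicator (box a b) x"
      by (intro AE_I2 tendsto_mult tendsto_const box_bump_tendsto)
    show "AE x in lebesgue. norm ((indicator (cbox a b) x * f x) * box_bump a b m x) \<le> \<bar>indicator (cbox a b) x * f x\<bar>" for m
      using box_bump_nonneg[of a b m] box_bump_le_1[of a b m]
      by (intro AE_I2) (auto simp: abs_mult intro!: mult_left_le)
    show "(\<lambda>x. (indicator (cbox a b) x * f x) * indicator (box a b) x) \<in> borel_measurable lebesgue"
      by (rule borel_measurable_times[OF meas borel_measurable_indicator]) simp
    show "(\<lambda>x. (indicator (cbox a b) x * f x) * box_bump a b m x) \<in> borel_measurable lebesgue" for m
      by (rule borel_measurable_times[OF meas bm])
  qed
  have "(LINT x|lebesgue. (indicator (cbox a b) x * f x) * box_bump a b m x) = 0" for m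
  proof -
    have "(indicator (cbox a b) x * f x) * box_bump a b m x = f x * box_bump a b m x" for x
      using box_bump_outside[of x a b m] box_subset_cbox[of a b] by (cases "x \<in> cbox a b") auto
    then show ?thesis by (simp only: zero[OF test_function_box_bump])
  qed
  with lim have z: "(LINT x|lebesgue. (indicator (cbox a b) x * f x) * indicator (box a b) x) = 0"
    by (simp add: LIMSEQ_const_iff)
  have eq: "(indicator (cbox a b) x * f x) * indicator (box a b) x = indicator (box a b) x *\<^sub>R f x" for x
    using box_subset_cbox[of a b] by (auto simp: indicator_def)
  have si: "set_integrable lebesgue (box a b) f"
  proof -
    have "integrable lebesgue (\<lambda>x. indicator (box a b) x *\<^sub>R (indicator (cbox a b) x * f x))"
      by (rule integrable_mult_indicator[OF _ int]) simp
    moreover have "(\<lambda>x. indicator (box a b) x *\<^sub>R (indicator (cbox a b) x * f x)) = (\<lambda>x. indicator (box a b) x *\<^sub>R f x)"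
    proof
      fix x
      show "indicator (box a b) x *\<^sub>R (indicator (cbox a b) x * f x) = indicator (box a b) x *\<^sub>R f x"
        using box_subset_cbox[of a b] by (cases "x \<in> box a b") auto
    qed
    ultimately show ?thesis by (simp add: set_integrable_def)
  qed
  have "(f has_integral (LINT x:box a b|lebesgue. f x)) (box a b)"
    using si by (rule has_integral_set_lebesgue)
  then have "(f has_integral 0) (box a b)"
    using z unfolding set_lebesgue_integral_def eq by simp
  then show "(f has_integral 0) (cbox a b)"
    using has_integral_open_interval by blast
qed

section \<open>Calculus of test functions\<close>

lemma Ck_translate:
  "Ck k f \<Longrightarrow> Ck k (\<lambda>x. f (x - z))"
proof (induction k arbitrary: f)
  case 0
  then have "continuous_on UNIV f" by simp
  then have "continuous_on UNIV (\<lambda>x. f (x - z))"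
    by (rule continuous_on_compose2) (auto intro: continuous_intros)
  then show ?case by simp
next
  case (Suc k)
  have der: "((\<lambda>x. f (x - z)) has_derivative frechet_derivative f (at (x - z))) (at x)" for x
  proof -
    have "(f has_derivative frechet_derivative f (at (x - z))) (at (x - z))"
      using Suc.prems frechet_derivative_works by auto
    moreover have "((\<lambda>x. x - z) has_derivative (\<lambda>h. h)) (at x)" by (auto intro!: derivative_eq_intros)
    ultimately show ?thesis using has_derivative_compose by blast
  qed
  have "partial_deriv i (\<lambda>x. f (x - z)) = (\<lambda>x. partial_deriv i f (x - z))" for i
    unfolding partial_deriv_def using frechet_derivative_at[OF der] by auto
  moreover have "(\<lambda>x. f (x - z)) differentiable (at x)" for x using der differentiable_def by blast
  ultimately show ?case using Suc by simp
qed

lemma partial_deriv_translate: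
  assumes "\<And>x. f differentiable (at x)"
  shows "partial_deriv i (\<lambda>x. f (x - z)) x = partial_deriv i f (x - z)"
proof -
  have "(f has_derivative frechet_derivative f (at (x - z))) (at (x - z))"
    using assms frechet_derivative_works by auto
  moreover have "((\<lambda>x. x - z) has_derivative (\<lambda>h. h)) (at x)" by (auto intro!: derivative_eq_intros)
  ultimately have "((\<lambda>x. f (x - z)) has_derivative frechet_derivative f (at (x - z))) (at x)"
    using has_derivative_compose by blast
  then show ?thesis
    unfolding partial_deriv_def using frechet_derivative_at by fastforce
qed

lemma test_function_translate:
  assumes "test_function \<phi>"
  shows "test_function (\<lambda>x. \<phi> (x - z))"
  unfolding test_function_def
proof
  show "\<forall>k. Ck k (\<lambda>x. \<phi> (x - z))" using assms Ck_translate by (auto simp: test_function_def)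
  have "{x. \<phi> (x - z) \<noteq> 0} = (+) z ` {x. \<phi> x \<noteq> 0}"
    by (auto simp: image_iff) (metis add_diff_cancel_left' diff_add_cancel add.commute)
  moreover have "bounded {x. \<phi> x \<noteq> 0}"
    using assms by (auto simp: test_function_def)
  ultimately have "bounded {x. \<phi> (x - z) \<noteq> 0}" by (simp add: bounded_translation)
  then show "compact (closure {x. \<phi> (x - z) \<noteq> 0})" by (simp add: compact_closure)
qed

lemma test_function_props:
  assumes "test_function \<phi>"
  shows "\<phi> differentiable (at x)" "continuous_on UNIV \<phi>" "continuous_on UNIV (partial_deriv i \<phi>)"
  using assms unfolding test_function_def
proof -
  have "Ck 0 \<phi>" "Ck (Suc 0) \<phi>" using assms unfolding test_function_def by blast+
  then show "\<phi> differentiable (at x)" "continuous_on UNIV \<phi>" "continuous_on UNIV (partial_deriv i \<phi>)" by auto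
qed

lemma test_function_support:
  assumes "test_function \<phi>"
  obtains R where "0 < R" "\<And>x. R < norm x \<Longrightarrow> \<phi> x = 0" "\<And>x i. R < norm x \<Longrightarrow> partial_deriv i \<phi> x = 0"
proof -
  have "bounded {x. \<phi> x \<noteq> 0}" using assms by (auto simp: test_function_def)
  then obtain R where R: "0 < R" "\<And>x. \<phi> x \<noteq> 0 \<Longrightarrow> norm x \<le> R" by (auto simp: bounded_pos)
  have z: "\<phi> x = 0" if "R < norm x" for x using R(2)[of x] that by force
  have "partial_deriv i \<phi> x = 0" if x: "R < norm x" for x i
  proof -
    have "open {x::real^'a. R < norm x}" by (intro open_Collect_less continuous_intros)
    then have "(\<phi> has_derivative (\<lambda>h. 0)) (at x)"
      by (intro has_derivative_transform_within_open[of "\<lambda>_. 0" "\<lambda>h. 0" x UNIV "{x. R < norm x}" \<phi>])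
        (use x z in auto)
    then have "(\<phi> has_derivative (\<lambda>h. \<Sum>i\<in>UNIV. 0 * h $ i)) (at x)" by simp
    from partial_deriv_eq[OF this] show ?thesis .
  qed
  with R(1) z that show thesis by blast
qed

lemma test_function_bounded:
  assumes "test_function \<phi>"
  obtains M where "0 < M" "\<And>x. \<bar>\<phi> x\<bar> \<le> M" "\<And>x i. \<bar>partial_deriv i \<phi> x\<bar> \<le> M"
proof -
  obtain R where R: "0 < R" "\<And>x. R < norm x \<Longrightarrow> \<phi> x = 0" "\<And>x i. R < norm x \<Longrightarrow> partial_deriv i \<phi> x = 0"
    by (rule test_function_support[OF assms], rule that)
  have b: "\<exists>M>0. \<forall>x. \<bar>f x\<bar> \<le> M" if f: "continuous_on UNIV f" "\<And>x. R < norm x \<Longrightarrow> f x = 0"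
    for f :: "real ^ 'a \<Rightarrow> real"
  proof -
    have "compact (f ` cball 0 R)"
      using f(1) by (intro compact_continuous_image) (auto intro: continuous_on_subset)
    then obtain M where M: "0 < M" "\<And>x. x \<in> cball 0 R \<Longrightarrow> \<bar>f x\<bar> \<le> M"
      using compact_imp_bounded[of "f ` cball 0 R"] by (auto simp: bounded_pos)
    have "\<bar>f x\<bar> \<le> M" for x using M f(2)[of x] by (cases "norm x \<le> R") auto
    then show ?thesis using M(1) by blast
  qed
  obtain M0 where M0: "0 < M0" "\<And>x. \<bar>\<phi> x\<bar> \<le> M0"
    using b[OF test_function_props(2)[OF assms] R(2)] by blast
  have "\<forall>i. \<exists>M>0. \<forall>x. \<bar>partial_deriv i \<phi> x\<bar> \<le> M"
    using b[OF test_function_props(3)[OF assms] R(3)] by blast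
  then obtain M1 where M1: "\<And>i. 0 < M1 i" "\<And>i x. \<bar>partial_deriv i \<phi> x\<bar> \<le> M1 i" by metis
  have "M1 i \<le> (\<Sum>i\<in>UNIV. M1 i)" for i
    using M1(1) by (intro member_le_sum) (auto intro: less_imp_le)
  then have "\<bar>partial_deriv i \<phi> x\<bar> \<le> M0 + (\<Sum>i\<in>UNIV. M1 i)" for x i
    using M1(2)[of i x] M0(1) by (smt (verit))
  moreover have "\<bar>\<phi> x\<bar> \<le> M0 + (\<Sum>i\<in>UNIV. M1 i)" for x
    using M0(2)[of x] M1(1) by (smt (verit) sum_nonneg)
  moreover have "0 < M0 + (\<Sum>i\<in>UNIV. M1 i)" using M0(1) M1(1) by (smt (verit) sum_nonneg)
  ultimately show thesis using that by blast
qed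

lemma test_function_has_derivative:
  fixes \<phi> :: "real ^ 'n \<Rightarrow> real"
  assumes "test_function \<phi>"
  shows "(\<phi> has_derivative (\<lambda>h. \<Sum>i\<in>UNIV. partial_deriv i \<phi> x * h $ i)) (at x)"
proof -
  let ?D = "frechet_derivative \<phi> (at x)"
  have D: "(\<phi> has_derivative ?D) (at x)"
    using test_function_props(1)[OF assms] frechet_derivative_works by blast
  then have lin: "linear ?D" by (rule has_derivative_linear)
  have "?D h = (\<Sum>i\<in>UNIV. partial_deriv i \<phi> x * h $ i)" for h
  proof -
    have "?D h = ?D (\<Sum>i\<in>UNIV. h $ i *s axis i 1)" by (simp add: basis_expansion)
    also have "\<dots> = (\<Sum>i\<in>UNIV. ?D (h $ i *s axis i 1))" by (rule linear_sum[OF lin])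
    also have "\<dots> = (\<Sum>i\<in>UNIV. partial_deriv i \<phi> x * h $ i)"
      by (simp add: partial_deriv_def linear_cmul[OF lin] scalar_mult_eq_scaleR mult.commute)
    finally show ?thesis .
  qed
  then have "?D = (\<lambda>h. \<Sum>i\<in>UNIV. partial_deriv i \<phi> x * h $ i)" by (rule ext)
  with D show ?thesis by simp
qed

lemma test_function_line_derivative:
  fixes \<phi> :: "real ^ 'n \<Rightarrow> real"
  assumes "test_function \<phi>"
  shows "((\<lambda>t. \<phi> (y - t *\<^sub>R z)) has_real_derivative - (\<Sum>i\<in>UNIV. partial_deriv i \<phi> (y - t *\<^sub>R z) * z $ i)) (at t)"
proof -
  have "((\<lambda>t. y - t *\<^sub>R z) has_derivative (\<lambda>h. - h *\<^sub>R z)) (at t)"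
    by (auto intro!: derivative_eq_intros)
  from has_derivative_compose[OF this test_function_has_derivative[OF assms]]
  have "((\<lambda>t. \<phi> (y - t *\<^sub>R z)) has_derivative (\<lambda>h. \<Sum>i\<in>UNIV. partial_deriv i \<phi> (y - t *\<^sub>R z) * (- h *\<^sub>R z) $ i)) (at t)" .
  moreover have "(\<lambda>h. \<Sum>i\<in>UNIV. partial_deriv i \<phi> (y - t *\<^sub>R z) * (- h *\<^sub>R z) $ i) =
      (*) (- (\<Sum>i\<in>UNIV. partial_deriv i \<phi> (y - t *\<^sub>R z) * z $ i))"
    by (rule ext) (simp add: sum_distrib_left sum_distrib_right sum_negf mult_ac)
  ultimately show ?thesis by (simp add: has_field_derivative_def)
qed

section \<open>Powers and integrals\<close>

text \<open>Convexity of the power, applied to \<open>a + b = (1 - \<theta>) * (a / (1 - \<theta>)) + \<theta> *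
  (b / \<theta>)\<close>. For small \<open>\<theta>\<close> the first constant is close to 1, which
  is what makes the second summand negligible.\<close>

lemma powr_add_le:
  fixes a b r \<theta> :: real
  assumes "0 \<le> a" "0 \<le> b" "1 < r" "0 < \<theta>" "\<theta> < 1"
  shows "(a + b) powr r \<le> (1 - \<theta>) powr (1 - r) * a powr r + \<theta> powr (1 - r) * b powr r"
proof (cases "a = 0 \<or> b = 0")
  case True
  have "1 \<le> (1 - \<theta>) powr (1 - r)" "1 \<le> \<theta> powr (1 - r)"
    using assms powr_mono2'[of "1 - r" "1 - \<theta>" 1] powr_mono2'[of "1 - r" "\<theta>" 1] by auto
  then have "a powr r \<le> (1 - \<theta>) powr (1 - r) * a powr r" "b powr r \<le> \<theta> powr (1 - r) * b powr r"
    using mult_right_mono[of 1 _ "a powr r"] mult_right_mono[of 1 _ "b powr r"] by auto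
  then show ?thesis using True assms by auto
next
  case False
  then have "0 < a" "0 < b" using assms by auto
  have c: "convex_on {0<..} (\<lambda>x::real. x powr r)" using assms(3) by (intro powr_convex) simp
  have "((1 - \<theta>) *\<^sub>R (a / (1 - \<theta>)) + \<theta> *\<^sub>R (b / \<theta>)) powr r \<le> (1 - \<theta>) * (a / (1 - \<theta>)) powr r + \<theta> * (b / \<theta>) powr r"
    using assms \<open>0 < a\<close> \<open>0 < b\<close> by (intro convex_onD[OF c]) auto
  moreover have "(1 - \<theta>) * (a / (1 - \<theta>)) powr r = (1 - \<theta>) powr (1 - r) * a powr r"
    using assms by (simp add: powr_divide powr_diff)
  moreover have "\<theta> * (b / \<theta>) powr r = \<theta> powr (1 - r) * b powr r"
    using assms by (simp add: powr_divide powr_diff)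
  moreover have "(1 - \<theta>) *\<^sub>R (a / (1 - \<theta>)) + \<theta> *\<^sub>R (b / \<theta>) = a + b" using assms by simp
  ultimately show ?thesis by simp
qed

lemma powr_add_le_2:
  fixes a b r :: real
  assumes "0 \<le> a" "0 \<le> b" "0 \<le> r"
  shows "(a + b) powr r \<le> 2 powr r * (a powr r + b powr r)"
proof -
  have "(a + b) powr r \<le> (2 * max a b) powr r" using assms by (intro powr_mono2) auto
  also have "\<dots> = 2 powr r * max a b powr r" using assms by (simp add: powr_mult)
  also have "max a b powr r \<le> a powr r + b powr r" by (auto simp: max_def)
  finally show ?thesis by simp
qed

lemma norm_diff_powr_le:
  fixes x y :: "'a::real_normed_vector"
  assumes "0 \<le> r"
  shows "norm (x - y) powr r \<le> 2 powr r * (norm x powr r + norm y powr r)"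
proof -
  have "norm (x - y) powr r \<le> (norm x + norm y) powr r"
    using assms by (intro powr_mono2 norm_triangle_ineq4) auto
  also have "\<dots> \<le> 2 powr r * (norm x powr r + norm y powr r)" using assms by (intro powr_add_le_2) auto
  finally show ?thesis .
qed

lemma le_one_plus_powr:
  fixes x r :: real
  assumes "0 \<le> x" "1 \<le> r"
  shows "x \<le> 1 + x powr r"
proof (cases "x \<le> 1")
  case False
  then have "x powr 1 \<le> x powr r" using assms by (intro powr_mono) auto
  then show ?thesis using False by simp
qed (use powr_ge_zero[of x r] in linarith)

text \<open>Jensen's inequality, obtained by integrating Young's inequality for \<open>\<bar>h t\<bar>\<close> and \<open>I powr (r - 1)\<close>,
  where \<open>I\<close> is the integral of \<open>\<bar>h\<bar>\<close>.\<close>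

lemma powr_integral_unit_interval_le:
  fixes h :: "real \<Rightarrow> real"
  assumes r: "1 < r" and h: "integrable lborel (\<lambda>t. indicator {0..1} t * h t)"
  shows "ennreal (\<bar>LBINT t. indicator {0..1} t * h t\<bar> powr r) \<le>
    (NBINT t. ennreal (\<bar>h t\<bar> powr r) * indicator {0..1} t)"
proof -
  let ?h = "\<lambda>t. indicator {0..1} t * \<bar>h t\<bar>"
  have habs: "integrable lborel ?h"
    using integrable_abs[OF h] by (simp add: abs_mult)
  define I where "I = (LBINT t. ?h t)"
  have I0: "0 \<le> I" unfolding I_def by (intro integral_nonneg_AE) auto
  have "\<bar>LBINT t. indicator {0..1} t * h t\<bar> \<le> (LBINT t. \<bar>indicator {0..1} t * h t\<bar>)"
    by (rule integral_abs_bound)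
  also have "\<dots> = I" unfolding I_def by (simp add: abs_mult)
  finally have le: "\<bar>LBINT t. indicator {0..1} t * h t\<bar> powr r \<le> I powr r"
    using r by (intro powr_mono2) auto
  have meas: "(\<lambda>t. ennreal (\<bar>h t\<bar> powr r) * indicator {0..1} t) \<in> borel_measurable lborel"
  proof -
    have "(\<lambda>t. ennreal (\<bar>indicator {0..1} t * h t\<bar> powr r)) \<in> borel_measurable lborel"
      using borel_measurable_integrable[OF h] by measurable
    moreover have "(\<lambda>t. ennreal (\<bar>indicator {0..1} t * h t\<bar> powr r)) = (\<lambda>t. ennreal (\<bar>h t\<bar> powr r) * indicator {0..1} t)"
      using r by (auto simp: indicator_def)
    ultimately show ?thesis by simp
  qed
  let ?J = "NBINT t. ennreal (\<bar>h t\<bar> powr r) * indicator {0..1} t"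
  have "ennreal (I powr r) \<le> ?J"
  proof (cases "I = 0")
    case False
    then have I: "0 < I" using I0 by simp
    define s where "s = r / (r - 1)"
    have s: "1 < s" "1 / r + 1 / s = 1" using r by (auto simp: s_def field_simps)
    have sr: "(r - 1) * s = r" using r by (simp add: s_def)
    have "ennreal (I powr (r - 1)) * ennreal I = ennreal (I powr (r - 1)) * (NBINT t. ennreal (?h t))"
      unfolding I_def using habs by (subst nn_integral_eq_integral[OF habs]) auto
    also have "\<dots> = (NBINT t. ennreal (I powr (r - 1)) * ennreal (?h t))"
      using borel_measurable_integrable[OF habs] by (intro nn_integral_cmult[symmetric]) auto
    also have "\<dots> \<le> (NBINT t. ennreal (1 / r) * (ennreal (\<bar>h t\<bar> powr r) * indicator {0..1} t) + ennreal (I powr r / s) * indicator {0..1} t)"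
    proof (rule nn_integral_mono)
      fix t :: real
      have "\<bar>h t\<bar> * I powr (r - 1) \<le> \<bar>h t\<bar> powr r / r + (I powr (r - 1)) powr s / s"
        using r s by (intro Youngs_inequality) auto
      then have "I powr (r - 1) * \<bar>h t\<bar> \<le> 1 / r * \<bar>h t\<bar> powr r + I powr r / s"
        using sr by (simp add: powr_powr mult.commute)
      then have "ennreal (I powr (r - 1) * \<bar>h t\<bar>) \<le> ennreal (1 / r * \<bar>h t\<bar> powr r + I powr r / s)"
        by (rule ennreal_leI)
      also have "\<dots> = ennreal (1 / r) * ennreal (\<bar>h t\<bar> powr r) + ennreal (I powr r / s)"
        using r s by (simp add: ennreal_plus ennreal_mult[symmetric])
      finally show "ennreal (I powr (r - 1)) * ennreal (?h t) \<le> ennreal (1 / r) * (ennreal (\<bar>h t\<bar> powr r) * indicator {0..1} t) + ennreal (I powr r / s) * indicator {0..1} t"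
        by (auto simp: indicator_def ennreal_mult)
    qed
    also have "\<dots> = ennreal (1 / r) * ?J + ennreal (I powr r / s)"
      using meas by (simp add: nn_integral_add nn_integral_cmult)
    finally have main: "ennreal (I powr (r - 1)) * ennreal I \<le> ennreal (1 / r) * ?J + ennreal (I powr r / s)" .
    have II: "ennreal (I powr (r - 1)) * ennreal I = ennreal (I powr r)"
      using I r by (subst ennreal_mult[symmetric]) (auto simp: powr_diff)
    show ?thesis
    proof (cases "?J = top")
      case False
      then obtain j where j: "?J = ennreal j" "0 \<le> j" by (cases ?J) auto
      have "ennreal (1 / r) * ?J + ennreal (I powr r / s) = ennreal (1 / r * j + I powr r / s)"
        unfolding j(1) using r s j(2) by (subst ennreal_plus, simp, simp, subst ennreal_mult) auto
      then have "ennreal (I powr r) \<le> ennreal (1 / r * j + I powr r / s)"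
        using main unfolding II by simp
      then have "I powr r \<le> 1 / r * j + I powr r / s"
        using r s j by (subst (asm) ennreal_le_iff) auto
      moreover have "I powr r / s = I powr r - I powr r / r"
      proof -
        have e: "1 / s = 1 - 1 / r" using s by simp
        have "I powr r / s = I powr r * (1 / s)" by simp
        then show ?thesis unfolding e by (simp add: algebra_simps)
      qed
      ultimately have "I powr r / r \<le> j / r" by simp
      then have "I powr r \<le> j" using r by (simp add: divide_le_cancel)
      then show ?thesis unfolding j(1) by (rule ennreal_leI)
    qed simp
  qed simp
  with le show ?thesis by (meson ennreal_leI order_trans)
qed

section \<open>Continuity of translation in \<open>L\<^sup>r\<close>\<close>

text \<open>The retraction onto the ball of radius \<open>M\<close>. It is continuous and does not increase the
  norm, so that truncation keeps functions measurable and dominated.\<close>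

definition clip :: "real \<Rightarrow> 'b::euclidean_space \<Rightarrow> 'b" where
  "clip M y = (M / max M (norm y)) *\<^sub>R y"

lemma norm_clip_le: "0 < M \<Longrightarrow> norm (clip M y) \<le> M"
  by (auto simp: clip_def max_def divide_simps)

lemma norm_clip_le_norm: "0 < M \<Longrightarrow> norm (clip M y) \<le> norm y"
  by (auto simp: clip_def max_def divide_simps mult_left_le)

lemma clip_id: "norm y \<le> M \<Longrightarrow> 0 < M \<Longrightarrow> clip M y = y"
  by (simp add: clip_def max_def)

lemma continuous_on_clip: "0 < M \<Longrightarrow> continuous_on UNIV (clip M)"
  unfolding clip_def by (intro continuous_intros) auto

definition cutoff :: "real \<Rightarrow> 'a::euclidean_space \<Rightarrow> real" where
  "cutoff M x = max 0 (min 1 (M + 1 - norm x))"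

lemma cutoff_bounds: "0 \<le> cutoff M x" "cutoff M x \<le> 1"
  by (auto simp: cutoff_def)

lemma cutoff_one: "norm x \<le> M \<Longrightarrow> cutoff M x = 1"
  by (auto simp: cutoff_def)

lemma cutoff_zero: "M + 1 \<le> norm x \<Longrightarrow> cutoff M x = 0"
  by (auto simp: cutoff_def)

lemma continuous_on_cutoff: "continuous_on UNIV (cutoff M)"
  unfolding cutoff_def by (intro continuous_intros)

lemma tendsto_powr_norm_diff_0:
  fixes f :: "nat \<Rightarrow> 'b::real_normed_vector"
  assumes "f \<longlonglongrightarrow> l" "0 < r"
  shows "(\<lambda>k. norm (f k - l) powr r) \<longlonglongrightarrow> 0"
proof -
  have "(\<lambda>k. norm (f k - l)) \<longlonglongrightarrow> 0" using assms(1) by (simp add: LIM_zero tendsto_norm_zero)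
  then have "(\<lambda>k. norm (f k - l) powr r) \<longlonglongrightarrow> 0 powr r"
    using assms(2) by (intro tendsto_powr') auto
  then show ?thesis using assms(2) by simp
qed

lemma nn_integral_lborel_translate':
  fixes c :: "'a::euclidean_space"
  assumes "f \<in> borel_measurable borel"
  shows "(NBINT x. f (x + c)) = (NBINT x. f x)"
  using nn_integral_lborel_translate[OF assms, of c] by (simp add: add.commute)

lemma integrable_tendsto_0_ex:
  fixes F :: "nat \<Rightarrow> 'a \<Rightarrow> real"
  assumes meas: "\<And>k. F k \<in> borel_measurable M" and w: "integrable M w"
    and lim: "AE x in M. (\<lambda>k. F k x) \<longlonglongrightarrow> 0" and dom: "\<And>k. AE x in M. norm (F k x) \<le> w x"
    and nonneg: "\<And>k x. 0 \<le> F k x" and e: "0 < (e::real)"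
  shows "\<exists>k. (\<integral>\<^sup>+x. ennreal (F k x) \<partial>M) \<le> ennreal e"
proof -
  have "(\<lambda>k. LINT x|M. F k x) \<longlonglongrightarrow> (LINT x|M. 0)"
    by (rule integral_dominated_convergence[where w=w]) (use assms in auto)
  then have "\<forall>\<^sub>F k in sequentially. (LINT x|M. F k x) < e"
    using e by (intro order_tendstoD) auto
  then obtain k where k: "(LINT x|M. F k x) < e" by (auto simp: eventually_sequentially)
  have "integrable M (F k)"
    by (rule Bochner_Integration.integrable_bound[OF w meas]) (use dom[of k] in \<open>auto elim!: eventually_mono\<close>)
  then have "(\<integral>\<^sup>+x. ennreal (F k x) \<partial>M) = ennreal (LINT x|M. F k x)"
    using nonneg by (intro nn_integral_eq_integral) auto
  then show ?thesis using k by (intro exI[of _ k]) (simp add: ennreal_leI)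
qed

text \<open>After truncation in the domain and in the range, the function is a limit almost everywhere of
  continuous functions; these are truncated in the same way, and dominated convergence applies.\<close>

lemma Lr_approx_continuous:
  fixes g :: "'a::euclidean_space \<Rightarrow> 'b::euclidean_space"
  assumes g[measurable]: "g \<in> borel_measurable borel" and int: "integrable lborel (\<lambda>x. norm (g x) powr r)"
    and r: "1 < r" and e: "0 < e"
  obtains c R where "continuous_on UNIV c" "0 < R" "\<And>x. R \<le> norm x \<Longrightarrow> c x = 0"
    "(NBINT x. ennreal (norm (g x - c x) powr r)) \<le> ennreal e"
proof -
  define e' where "e' = e / (2 * 2 powr r)"
  have e': "0 < e'" using e by (simp add: e'_def)
  have "\<exists>k. (NBINT x. ennreal (norm (cutoff (real (Suc k)) x *\<^sub>R clip (real (Suc k)) (g x) - g x) powr r)) \<le> ennreal e'"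
  proof (rule integrable_tendsto_0_ex)
    show "integrable lborel (\<lambda>x. 2 powr r * (norm (g x) powr r + norm (g x) powr r))"
      using int by simp
    show "(\<lambda>x. norm (cutoff (real (Suc k)) x *\<^sub>R clip (real (Suc k)) (g x) - g x) powr r) \<in> borel_measurable lborel" for k
    proof -
      have [measurable]: "clip (real (Suc k)) \<in> borel_measurable (borel :: 'b measure)" "cutoff (real (Suc k)) \<in> borel_measurable (borel :: 'a measure)"
        by (intro borel_measurable_continuous_onI continuous_on_clip continuous_on_cutoff; simp)+
      show ?thesis by measurable
    qed
    show "AE x in lborel. (\<lambda>k. norm (cutoff (real (Suc k)) x *\<^sub>R clip (real (Suc k)) (g x) - g x) powr r) \<longlonglongrightarrow> 0"
    proof (intro AE_I2)
      fix x
      obtain N :: nat where N: "max (norm x) (norm (g x)) \<le> real N" using real_arch_simple by blast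
      have "\<forall>\<^sub>F k in sequentially. 0 = norm (cutoff (real (Suc k)) x *\<^sub>R clip (real (Suc k)) (g x) - g x) powr r"
        using eventually_ge_at_top[of N]
      proof eventually_elim
        case (elim k)
        then have "max (norm x) (norm (g x)) \<le> real (Suc k)" using N by linarith
        then show ?case by (simp add: cutoff_one clip_id del: of_nat_Suc)
      qed
      then show "(\<lambda>k. norm (cutoff (real (Suc k)) x *\<^sub>R clip (real (Suc k)) (g x) - g x) powr r) \<longlonglongrightarrow> 0"
        by (rule tendsto_cong[THEN iffD1]) simp
    qed
    show "AE x in lborel. norm (norm (cutoff (real (Suc k)) x *\<^sub>R clip (real (Suc k)) (g x) - g x) powr r)
        \<le> 2 powr r * (norm (g x) powr r + norm (g x) powr r)" for k
    proof (intro AE_I2)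
      fix x
      let ?a = "cutoff (real (Suc k)) x *\<^sub>R clip (real (Suc k)) (g x)"
      have "norm ?a \<le> 1 * norm (g x)"
        unfolding norm_scaleR using cutoff_bounds[of "real (Suc k)" x]
        by (intro mult_mono norm_clip_le_norm) auto
      then have "norm ?a powr r \<le> norm (g x) powr r" using r by (intro powr_mono2) auto
      moreover have "norm (?a - g x) powr r \<le> 2 powr r * (norm ?a powr r + norm (g x) powr r)"
        using r by (intro norm_diff_powr_le) auto
      ultimately have "norm (?a - g x) powr r \<le> 2 powr r * (norm (g x) powr r + norm (g x) powr r)"
        by (smt (verit) mult_left_mono powr_ge_zero)
      then show "norm (norm (?a - g x) powr r) \<le> 2 powr r * (norm (g x) powr r + norm (g x) powr r)" by simp
    qed
  qed (use e' in auto)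
  then obtain M where M: "0 < M" "(NBINT x. ennreal (norm (cutoff M x *\<^sub>R clip M (g x) - g x) powr r)) \<le> ennreal e'"
    using of_nat_0_less_iff by blast
  have [measurable]: "clip M \<in> borel_measurable (borel :: 'b measure)" "cutoff M \<in> borel_measurable (borel :: 'a measure)"
    using M(1) by (auto intro!: borel_measurable_continuous_onI continuous_on_clip continuous_on_cutoff)
  have "g measurable_on UNIV"
    by (rule lebesgue_measurable_imp_measurable_on) (auto intro: measurable_completion)
  then obtain N G where N: "negligible N" and G: "\<And>k. continuous_on UNIV (G k)" "\<And>x. x \<notin> N \<Longrightarrow> (\<lambda>k. G k x) \<longlonglongrightarrow> g x"
    unfolding measurable_on_def by auto
  have AEN: "AE x in lborel. x \<notin> N"
    using N unfolding negligible_iff_null_sets by (metis AE_completion_iff AE_not_in)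
  have [measurable]: "G k \<in> borel_measurable borel" for k using G(1) by (rule borel_measurable_continuous_onI)
  have contc: "continuous_on UNIV (\<lambda>x. cutoff M x *\<^sub>R clip M (G k x))" for k
    using continuous_on_compose2[OF continuous_on_clip[OF M(1)] G(1)] continuous_on_cutoff
    by (intro continuous_on_scaleR) auto
  have "\<exists>k. (NBINT x. ennreal (norm (cutoff M x *\<^sub>R clip M (G k x) - cutoff M x *\<^sub>R clip M (g x)) powr r)) \<le> ennreal e'"
  proof (rule integrable_tendsto_0_ex)
    show "integrable lborel (\<lambda>x::'a. indicator (cball 0 (M + 1)) x * (2 * M) powr r)"
      using emeasure_compact_finite[OF compact_cball[of "0::'a" "M + 1"]]
      by (intro integrable_mult_left integrable_real_indicator) auto
    show "(\<lambda>x. norm (cutoff M x *\<^sub>R clip M (G k x) - cutoff M x *\<^sub>R clip M (g x)) powr r) \<in> borel_measurable lborel" for k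
      by measurable
    show "AE x in lborel. (\<lambda>k. norm (cutoff M x *\<^sub>R clip M (G k x) - cutoff M x *\<^sub>R clip M (g x)) powr r) \<longlonglongrightarrow> 0"
      using AEN
    proof eventually_elim
      case (elim x)
      have "continuous_on UNIV (clip M :: 'b \<Rightarrow> 'b)" by (rule continuous_on_clip[OF M(1)])
      then have "isCont (clip M) (g x)" by (simp add: continuous_on_eq_continuous_at)
      then have "(\<lambda>k. clip M (G k x)) \<longlonglongrightarrow> clip M (g x)" using G(2)[OF elim] by (rule isCont_tendsto_compose)
      then show ?case using r by (intro tendsto_powr_norm_diff_0 tendsto_scaleR tendsto_const) auto
    qed
    show "AE x in lborel. norm (norm (cutoff M x *\<^sub>R clip M (G k x) - cutoff M x *\<^sub>R clip M (g x)) powr r)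
        \<le> indicator (cball 0 (M + 1)) x * (2 * M) powr r" for k
    proof (intro AE_I2)
      fix x
      show "norm (norm (cutoff M x *\<^sub>R clip M (G k x) - cutoff M x *\<^sub>R clip M (g x)) powr r)
        \<le> indicator (cball 0 (M + 1)) x * (2 * M) powr r"
      proof (cases "x \<in> cball 0 (M + 1)")
        case True
        have "norm (clip M (G k x) - clip M (g x)) \<le> M + M"
          by (rule order_trans[OF norm_triangle_ineq4]) (intro add_mono norm_clip_le M)
        then have "cutoff M x * norm (clip M (G k x) - clip M (g x)) \<le> 1 * (2 * M)"
          using cutoff_bounds[of M x] by (intro mult_mono) auto
        moreover have "norm (cutoff M x *\<^sub>R clip M (G k x) - cutoff M x *\<^sub>R clip M (g x)) =
            cutoff M x * norm (clip M (G k x) - clip M (g x))"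
          using cutoff_bounds[of M x] by (simp add: scaleR_diff_right[symmetric])
        ultimately have "norm (cutoff M x *\<^sub>R clip M (G k x) - cutoff M x *\<^sub>R clip M (g x)) powr r \<le> (2 * M) powr r"
          using r cutoff_bounds[of M x] by (intro powr_mono2) (auto intro!: mult_nonneg_nonneg)
        then show ?thesis using True by simp
      next
        case False
        then show ?thesis using r cutoff_zero[of M x] by simp
      qed
    qed
  qed (use e' in auto)
  then obtain k where k: "(NBINT x. ennreal (norm (cutoff M x *\<^sub>R clip M (G k x) - cutoff M x *\<^sub>R clip M (g x)) powr r)) \<le> ennreal e'"
    by blast
  let ?c = "\<lambda>x. cutoff M x *\<^sub>R clip M (G k x)" and ?d = "\<lambda>x. cutoff M x *\<^sub>R clip M (g x)"
  have "(NBINT x. ennreal (norm (g x - ?c x) powr r)) \<le>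
      (NBINT x. ennreal (2 powr r) * (ennreal (norm (?d x - g x) powr r) + ennreal (norm (?c x - ?d x) powr r)))"
  proof (rule nn_integral_mono)
    fix x
    have "norm (g x - ?c x) powr r \<le> (norm (?d x - g x) + norm (?c x - ?d x)) powr r"
      using r norm_triangle_ineq[of "?d x - g x" "?c x - ?d x"]
      by (intro powr_mono2) (auto simp: norm_minus_commute)
    also have "\<dots> \<le> 2 powr r * (norm (?d x - g x) powr r + norm (?c x - ?d x) powr r)"
      using r by (intro powr_add_le_2) auto
    finally have "ennreal (norm (g x - ?c x) powr r) \<le> ennreal (2 powr r * (norm (?d x - g x) powr r + norm (?c x - ?d x) powr r))"
      by (rule ennreal_leI)
    also have "\<dots> = ennreal (2 powr r) * (ennreal (norm (?d x - g x) powr r) + ennreal (norm (?c x - ?d x) powr r))"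
      by (simp add: ennreal_mult ennreal_plus)
    finally show "ennreal (norm (g x - ?c x) powr r) \<le> ennreal (2 powr r) * (ennreal (norm (?d x - g x) powr r) + ennreal (norm (?c x - ?d x) powr r))" .
  qed
  also have "\<dots> = ennreal (2 powr r) * ((NBINT x. ennreal (norm (?d x - g x) powr r)) + (NBINT x. ennreal (norm (?c x - ?d x) powr r)))"
    by (subst nn_integral_cmult, measurable, subst nn_integral_add, measurable)
  also have "\<dots> \<le> ennreal (2 powr r) * (ennreal e' + ennreal e')"
    by (intro mult_left_mono add_mono M k) auto
  also have "\<dots> = ennreal (2 powr r * (e' + e'))"
    using e' by (simp add: ennreal_mult[symmetric] ennreal_plus[symmetric] del: ennreal_plus)
  also have "2 powr r * (e' + e') = e" by (simp add: e'_def)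
  finally have fin: "(NBINT x. ennreal (norm (g x - ?c x) powr r)) \<le> ennreal e" .
  show thesis
    by (rule that[OF contc[of k], of "M + 1"]) (use M(1) fin cutoff_zero[of M] in auto)
qed

text \<open>Uniform continuity settles the case of continuous functions of compact support.\<close>

theorem Lr_translation_continuous:
  fixes g :: "'a::euclidean_space \<Rightarrow> 'b::euclidean_space"
  assumes g[measurable]: "g \<in> borel_measurable borel" and int: "integrable lborel (\<lambda>x. norm (g x) powr r)"
    and r: "1 < r" and e: "0 < e"
  shows "\<exists>\<delta>>0. \<forall>h. norm h < \<delta> \<longrightarrow> (NBINT x. ennreal (norm (g (x + h) - g x) powr r)) \<le> ennreal e"
proof -
  define e' where "e' = e / (3 * 3 powr r)"
  have e': "0 < e'" using e by (simp add: e'_def)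
  obtain c R where c: "continuous_on UNIV c" "0 < R" "\<And>x. R \<le> norm x \<Longrightarrow> c x = 0"
    "(NBINT x. ennreal (norm (g x - c x) powr r)) \<le> ennreal e'"
    by (rule Lr_approx_continuous[OF g int r e'], rule that)
  have [measurable]: "c \<in> borel_measurable borel" using c(1) by (rule borel_measurable_continuous_onI)
  define V where "V = measure lborel (cball (0::'a) (R + 1))"
  have V: "emeasure lborel (cball (0::'a) (R + 1)) = ennreal V"
    unfolding V_def using emeasure_compact_finite[of "cball (0::'a) (R + 1)"]
    by (intro emeasure_eq_ennreal_measure) auto
  have V0: "0 \<le> V" by (simp add: V_def)
  define \<eta> where "\<eta> = (e' / (V + 1)) powr (1 / r)"
  have \<eta>: "0 < \<eta>" "\<eta> powr r = e' / (V + 1)" using e' V0 r by (auto simp: \<eta>_def powr_powr)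
  have "uniformly_continuous_on (cball 0 (R + 2)) c"
    using c(1) by (intro compact_uniformly_continuous) (auto intro: continuous_on_subset)
  then obtain d where d: "0 < d" "\<And>x y. x \<in> cball 0 (R + 2) \<Longrightarrow> y \<in> cball 0 (R + 2) \<Longrightarrow> dist y x < d \<Longrightarrow> dist (c y) (c x) < \<eta>"
    using \<eta>(1) unfolding uniformly_continuous_on_def by metis
  show ?thesis
  proof (intro exI[of _ "min d 1"] conjI allI impI)
    show "0 < min d 1" using d by simp
    fix h :: 'a assume h: "norm h < min d 1"
    have close: "ennreal (norm (c (x + h) - c x) powr r) \<le> ennreal (\<eta> powr r) * indicator (cball 0 (R + 1)) x" for x
    proof (cases "x \<in> cball 0 (R + 1)")
      case True
      then have "x + h \<in> cball 0 (R + 2)" using h norm_triangle_ineq[of x h] by auto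
      then have "dist (c (x + h)) (c x) < \<eta>" using True h by (intro d(2)) (auto simp: dist_norm)
      then have "norm (c (x + h) - c x) powr r \<le> \<eta> powr r" using r by (intro powr_mono2) (auto simp: dist_norm)
      then show ?thesis using True by (simp add: ennreal_leI)
    next
      case False
      then have "R \<le> norm x" "R \<le> norm (x + h)" using h norm_triangle_ineq4[of "x + h" h] by auto
      then show ?thesis using c(3) r by simp
    qed
    have "(NBINT x. ennreal (norm (g (x + h) - g x) powr r)) \<le>
      (NBINT x. ennreal (3 powr r) * (ennreal (norm (g (x + h) - c (x + h)) powr r) + (ennreal (norm (c (x + h) - c x) powr r) + ennreal (norm (g x - c x) powr r))))"
    proof (rule nn_integral_mono)
      fix x
      let ?a = "norm (g (x + h) - c (x + h))" and ?b = "norm (c (x + h) - c x)" and ?m = "norm (g x - c x)"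
      have "norm (g (x + h) - g x) \<le> ?a + ?b + ?m"
        using norm_triangle_ineq[of "g (x + h) - c (x + h)" "c (x + h) - c x"]
          norm_triangle_ineq[of "(g (x + h) - c (x + h)) + (c (x + h) - c x)" "c x - g x"]
        by (simp add: norm_minus_commute)
      also have "\<dots> \<le> 3 * max ?a (max ?b ?m)" by (auto simp: max_def)
      finally have "norm (g (x + h) - g x) powr r \<le> (3 * max ?a (max ?b ?m)) powr r"
        using r by (intro powr_mono2) auto
      also have "\<dots> = 3 powr r * max ?a (max ?b ?m) powr r" by (simp add: powr_mult)
      also have "\<dots> \<le> 3 powr r * (?a powr r + (?b powr r + ?m powr r))"
        by (intro mult_left_mono) (auto simp: max_def)
      finally have "ennreal (norm (g (x + h) - g x) powr r) \<le> ennreal (3 powr r * (?a powr r + (?b powr r + ?m powr r)))"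
        by (rule ennreal_leI)
      then show "ennreal (norm (g (x + h) - g x) powr r) \<le> ennreal (3 powr r) * (ennreal (?a powr r) + (ennreal (?b powr r) + ennreal (?m powr r)))"
        by (simp add: ennreal_mult ennreal_plus)
    qed
    also have "\<dots> = ennreal (3 powr r) * ((NBINT x. ennreal (norm (g (x + h) - c (x + h)) powr r)) +
        ((NBINT x. ennreal (norm (c (x + h) - c x) powr r)) + (NBINT x. ennreal (norm (g x - c x) powr r))))"
      by (subst nn_integral_cmult, measurable, subst nn_integral_add, measurable, subst nn_integral_add, measurable)
    also have "(NBINT x. ennreal (norm (g (x + h) - c (x + h)) powr r)) = (NBINT x. ennreal (norm (g x - c x) powr r))"
      by (rule nn_integral_lborel_translate') measurable
    also have "ennreal (3 powr r) * ((NBINT x. ennreal (norm (g x - c x) powr r)) +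
        ((NBINT x. ennreal (norm (c (x + h) - c x) powr r)) + (NBINT x. ennreal (norm (g x - c x) powr r)))) \<le>
        ennreal (3 powr r) * (ennreal e' + (ennreal e' + ennreal e'))"
    proof (intro mult_left_mono add_mono c(4))
      have "(NBINT x. ennreal (norm (c (x + h) - c x) powr r)) \<le> (\<integral>\<^sup>+x. ennreal (\<eta> powr r) * indicator (cball 0 (R + 1)) x \<partial>(lborel :: 'a measure))"
        by (rule nn_integral_mono) (rule close)
      also have "\<dots> = ennreal (\<eta> powr r) * ennreal V" by (subst nn_integral_cmult_indicator) (auto simp: V)
      also have "\<dots> = ennreal (e' / (V + 1) * V)" using V0 e' unfolding \<eta>(2) by (intro ennreal_mult[symmetric]) auto
      also have "\<dots> \<le> ennreal e'" using V0 e' by (intro ennreal_leI) (simp add: field_simps)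
      finally show "(NBINT x. ennreal (norm (c (x + h) - c x) powr r)) \<le> ennreal e'" .
    qed simp
    also have "\<dots> = ennreal (3 powr r * (e' + (e' + e')))"
      using e' by (simp add: ennreal_mult[symmetric] ennreal_plus[symmetric] del: ennreal_plus)
    also have "3 powr r * (e' + (e' + e')) = e" by (simp add: e'_def)
    finally show "(NBINT x. ennreal (norm (g (x + h) - g x) powr r)) \<le> ennreal e" .
  qed
qed

section \<open>Borel representatives of Sobolev functions\<close>

text \<open>Functions that are Borel, not only Lebesgue, measurable, together with a weak gradient: composition
  with translations and the use of product measures then preserve measurability. All integrals are
  taken for the Borel measure.\<close>

definition sobolev_pair :: "real \<Rightarrow> (real ^ 'n \<Rightarrow> real) \<Rightarrow> (real ^ 'n \<Rightarrow> real ^ 'n) \<Rightarrow> bool" where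
  "sobolev_pair r u g \<longleftrightarrow> u \<in> borel_measurable borel \<and> g \<in> borel_measurable borel \<and>
     integrable lborel (\<lambda>x. \<bar>u x\<bar> powr r) \<and> integrable lborel (\<lambda>x. norm (g x) powr r) \<and>
     (\<forall>\<phi> i. test_function \<phi> \<longrightarrow>
        (LBINT x. u x * partial_deriv i \<phi> x) = - (LBINT x. g x $ i * \<phi> x))"

lemma integrable_on_bounded:
  fixes f :: "'a::euclidean_space \<Rightarrow> 'b::euclidean_space"
  assumes [measurable]: "f \<in> borel_measurable borel" and int: "integrable lborel (\<lambda>x. norm (f x) powr r)"
    and r: "1 \<le> r" and B[measurable]: "B \<in> sets borel" "bounded B"
  shows "integrable lborel (\<lambda>x. indicator B x * norm (f x))"
proof (rule Bochner_Integration.integrable_bound)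
  have "integrable lborel (indicator B :: 'a \<Rightarrow> real)"
    using emeasure_bounded_finite[OF B(2)] by (intro integrable_real_indicator) auto
  then show "integrable lborel (\<lambda>x. indicator B x + norm (f x) powr r)"
    using int by (rule Bochner_Integration.integrable_add)
  show "AE x in lborel. norm (indicator B x * norm (f x)) \<le> norm (indicator B x + norm (f x) powr r)"
    using le_one_plus_powr[OF norm_ge_zero r] by (intro AE_I2) (auto simp: indicator_def)
qed measurable

lemma locally_integrable_Lr:
  fixes f :: "real ^ 'n \<Rightarrow> 'b::euclidean_space"
  assumes [measurable]: "f \<in> borel_measurable borel" and int: "integrable lborel (\<lambda>x. norm (f x) powr r)"
    and r: "1 \<le> r"
  shows "locally_integrable f"
  unfolding locally_integrable_def
proof (intro allI impI)
  fix K :: "(real ^ 'n) set" assume K: "compact K"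
  then have [measurable]: "K \<in> sets borel" and bK: "bounded K" by (auto intro: borel_compact compact_imp_bounded)
  have "integrable lborel (\<lambda>x. indicator K x * norm (f x))" by (rule integrable_on_bounded[OF _ int r _ bK]) auto
  then have "integrable lborel (\<lambda>x. indicator K x *\<^sub>R f x)"
    by (rule Bochner_Integration.integrable_bound) (auto simp: indicator_def)
  then show "f absolutely_integrable_on K"
    unfolding set_integrable_def by (subst integrable_completion) auto
qed

lemma test_function_borel [measurable]:
  assumes "test_function \<phi>"
  shows "\<phi> \<in> borel_measurable borel" "partial_deriv i \<phi> \<in> borel_measurable borel"
  using test_function_props[OF assms] by (auto intro: borel_measurable_continuous_onI)

section \<open>The fundamental theorem of calculus along a direction\<close>

lemma integral_lborel_translate:
  fixes f :: "'a::euclidean_space \<Rightarrow> 'b::{banach, second_countable_topology}"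
  assumes [measurable]: "f \<in> borel_measurable borel"
  shows "(LBINT x. f (x + c)) = (LBINT x. f x)"
proof -
  have "(LBINT x. f x) = (LINT x|distr lborel borel ((+) c). f x)" by (simp only: lborel_distr_plus)
  also have "\<dots> = (LBINT x. f (c + x))" by (rule integral_distr) auto
  finally show ?thesis by (simp add: add.commute)
qed

lemma integrable_lborel_translate:
  fixes f :: "'a::euclidean_space \<Rightarrow> 'b::{banach, second_countable_topology}"
  assumes "integrable lborel f"
  shows "integrable lborel (\<lambda>x. f (x + c))"
proof -
  have [measurable]: "f \<in> borel_measurable borel" using assms by simp
  have "integrable (distr lborel borel ((+) c)) f" using assms by (simp only: lborel_distr_plus)
  then have "integrable lborel (\<lambda>x. f (c + x))" by (subst (asm) integrable_distr_eq) auto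
  then show ?thesis by (simp add: add.commute)
qed

lemma integrable_lborel_pair_slab:
  fixes h :: "real \<Rightarrow> 'a::euclidean_space \<Rightarrow> real"
  assumes [measurable]: "(\<lambda>(t, x). h t x) \<in> borel_measurable (borel \<Otimes>\<^sub>M borel)"
    and fin: "\<And>t. (NBINT x. ennreal \<bar>h t x\<bar>) \<le> C" and C: "C < top"
  shows "integrable (lborel \<Otimes>\<^sub>M lborel) (\<lambda>(t, x). indicator {0..1} t * h t x)"
proof (rule integrableI_bounded)
  have [measurable]: "(\<lambda>p. h (fst p) (snd p)) \<in> borel_measurable (borel \<Otimes>\<^sub>M borel)"
    using assms(1) by (simp add: case_prod_beta')
  show m: "(\<lambda>(t, x). indicator {0..1} t * h t x) \<in> borel_measurable (lborel \<Otimes>\<^sub>M lborel)"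
    unfolding case_prod_beta' by measurable
  have "(\<integral>\<^sup>+p. ennreal (norm (case p of (t, x) \<Rightarrow> indicator {0..1} t * h t x)) \<partial>(lborel \<Otimes>\<^sub>M lborel)) =
      (NBINT t. NBINT x. ennreal (norm (indicator {0..1} t * h t x)))"
    using m by (subst lborel.nn_integral_fst[symmetric]) auto
  also have "\<dots> \<le> (NBINT t. C * indicator {0..1::real} t)"
  proof (rule nn_integral_mono)
    fix t :: real
    show "(NBINT x. ennreal (norm (indicator {0..1} t * h t x))) \<le> C * indicator {0..1} t"
      using fin[of t] by (auto simp: indicator_def)
  qed
  also have "\<dots> = C" by (simp add: nn_integral_cmult)
  finally show "(\<integral>\<^sup>+p. ennreal (norm (case p of (t, x) \<Rightarrow> indicator {0..1} t * h t x)) \<partial>(lborel \<Otimes>\<^sub>M lborel)) < \<infinity>"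
    using C by (simp add: order_le_less_trans)
qed

lemma integral_slab_swap:
  fixes h :: "real \<Rightarrow> 'a::euclidean_space \<Rightarrow> real"
  assumes "(\<lambda>(t, x). h t x) \<in> borel_measurable (borel \<Otimes>\<^sub>M borel)"
    and "\<And>t. (NBINT x. ennreal \<bar>h t x\<bar>) \<le> C" and "C < top"
  shows "(LBINT t. indicator {0..1} t * (LBINT x. h t x)) = (LBINT x. (LBINT t. indicator {0..1} t * h t x))"
    "integrable lborel (\<lambda>x. LBINT t. indicator {0..1} t * h t x)"
    "AE x in lborel. integrable lborel (\<lambda>t. indicator {0..1} t * h t x)"
proof -
  note int = integrable_lborel_pair_slab[OF assms]
  have "(LBINT x. (LBINT t. indicator {0..1} t * h t x)) = (LBINT t. (LBINT x. indicator {0..1} t * h t x))"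
    by (rule lborel_pair.Fubini_integral[OF int])
  then show "(LBINT t. indicator {0..1} t * (LBINT x. h t x)) = (LBINT x. (LBINT t. indicator {0..1} t * h t x))"
    by simp
  show "integrable lborel (\<lambda>x. LBINT t. indicator {0..1} t * h t x)"
    by (rule lborel_pair.integrable_snd[OF int])
  show "AE x in lborel. integrable lborel (\<lambda>t. indicator {0..1} t * h t x)"
    by (rule lborel_pair.AE_integrable_snd[OF int])
qed

lemma sobolev_line_integrand:
  fixes g :: "real ^ 'n \<Rightarrow> real ^ 'n"
  assumes [measurable]: "g \<in> borel_measurable borel" and int: "integrable lborel (\<lambda>x. norm (g x) powr r)"
    and r: "1 \<le> r" and B[measurable]: "B \<in> sets borel" and bB: "bounded B"
  shows "\<exists>C<top. \<forall>t. (NBINT x. ennreal \<bar>indicator B x * (g (x + t *\<^sub>R z) \<bullet> z)\<bar>) \<le> C"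
proof (intro exI conjI allI)
  let ?C = "ennreal (norm z) * (emeasure lborel B + (NBINT x. ennreal (norm (g x) powr r)))"
  show "?C < top"
    using emeasure_bounded_finite[OF bB] nn_integral_eq_integral[OF int]
    by (auto simp: ennreal_mult_less_top less_top)
  fix t :: real
  have "(NBINT x. ennreal \<bar>indicator B x * (g (x + t *\<^sub>R z) \<bullet> z)\<bar>) \<le>
      (NBINT x. ennreal (norm z) * (indicator B x + ennreal (norm (g (x + t *\<^sub>R z)) powr r)))"
  proof (rule nn_integral_mono)
    fix x
    show "ennreal \<bar>indicator B x * (g (x + t *\<^sub>R z) \<bullet> z)\<bar> \<le> ennreal (norm z) * (indicator B x + ennreal (norm (g (x + t *\<^sub>R z)) powr r))"
    proof (cases "x \<in> B")
      case True
      have "\<bar>g (x + t *\<^sub>R z) \<bullet> z\<bar> \<le> norm (g (x + t *\<^sub>R z)) * norm z" by (rule Cauchy_Schwarz_ineq2)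
      also have "\<dots> \<le> (1 + norm (g (x + t *\<^sub>R z)) powr r) * norm z"
        using r by (intro mult_right_mono le_one_plus_powr) auto
      finally have "ennreal \<bar>g (x + t *\<^sub>R z) \<bullet> z\<bar> \<le> ennreal (norm z * (1 + norm (g (x + t *\<^sub>R z)) powr r))"
        by (intro ennreal_leI) (simp add: mult.commute)
      then show ?thesis using True by (simp add: ennreal_mult ennreal_plus)
    qed simp
  qed
  also have "\<dots> = ennreal (norm z) * (emeasure lborel B + (NBINT x. ennreal (norm (g (x + t *\<^sub>R z)) powr r)))"
  proof -
    have F: "(\<lambda>x. ennreal (norm (g (x + t *\<^sub>R z)) powr r)) \<in> borel_measurable lborel" by measurable
    have I: "(indicator B :: _ \<Rightarrow> ennreal) \<in> borel_measurable lborel" using B by simp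
    have "(NBINT x. indicator B x + ennreal (norm (g (x + t *\<^sub>R z)) powr r)) =
        (NBINT x. indicator B x) + (NBINT x. ennreal (norm (g (x + t *\<^sub>R z)) powr r))"
      by (rule nn_integral_add[OF I F])
    moreover have "(NBINT x. indicator B x) = emeasure lborel B" using B by simp
    ultimately show ?thesis
      using nn_integral_cmult[OF borel_measurable_add[OF I F], of "ennreal (norm z)"] by simp
  qed
  also have "(NBINT x. ennreal (norm (g (x + t *\<^sub>R z)) powr r)) = (NBINT x. ennreal (norm (g x) powr r))"
    by (rule nn_integral_lborel_translate') measurable
  finally show "(NBINT x. ennreal \<bar>indicator B x * (g (x + t *\<^sub>R z) \<bullet> z)\<bar>) \<le> ?C" .
qed

text \<open>Tested against \<open>\<phi>\<close>, the left side becomes the pairing of \<open>u\<close> with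
  \<open>\<phi> (x - z) - \<phi> x\<close>, which is the integral over \<open>t\<close> of a
  directional derivative of the translated test function. The weak formula and a translation back
  produce the pairing of the right side with \<open>\<phi>\<close>. The exceptional set depends on
  \<open>z\<close>.\<close>

theorem sobolev_line_formula:
  fixes u :: "real ^ 'n \<Rightarrow> real"
  assumes S: "sobolev_pair r u g" and r: "1 < r"
  shows "AE x in lborel. integrable lborel (\<lambda>t. indicator {0..1} t * (g (x + t *\<^sub>R z) \<bullet> z)) \<and>
     u (x + z) - u x = (LBINT t. indicator {0..1} t * (g (x + t *\<^sub>R z) \<bullet> z))"
proof -
  have mu[measurable]: "u \<in> borel_measurable borel" and mg[measurable]: "g \<in> borel_measurable borel"
    and intu: "integrable lborel (\<lambda>x. norm (u x) powr r)" and intg: "integrable lborel (\<lambda>x. norm (g x) powr r)"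
    and weak: "\<And>\<phi> i. test_function \<phi> \<Longrightarrow> (LBINT x. u x * partial_deriv i \<phi> x) = - (LBINT x. g x $ i * \<phi> x)"
    using S unfolding sobolev_pair_def by auto
  have r1: "1 \<le> r" using r by simp
  define G where "G x = (LBINT t. indicator {0..1} t * (g (x + t *\<^sub>R z) \<bullet> z))" for x
  have mG [measurable]: "G \<in> borel_measurable borel"
    unfolding G_def by (rule lborel.borel_measurable_lebesgue_integral) measurable
  have uB: "integrable lborel (\<lambda>x. indicator B x * u x)" if [measurable]: "B \<in> sets borel" and "bounded B" for B
    using integrable_on_bounded[OF mu intu r1 that]
    by (rule Bochner_Integration.integrable_bound) (auto simp: indicator_def)
  have uzB: "integrable lborel (\<lambda>x. indicator B x * u (x + z))" if [measurable]: "B \<in> sets borel" and "bounded B" for B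
  proof -
    have "integrable lborel (\<lambda>x. norm (u (x + z)) powr r)" using integrable_lborel_translate[OF intu] .
    from integrable_on_bounded[OF _ this r1 that] have "integrable lborel (\<lambda>x. indicator B x * norm (u (x + z)))" by simp
    then show ?thesis
      by (rule Bochner_Integration.integrable_bound) (auto simp: indicator_def)
  qed
  have hmeas: "(\<lambda>(t, x). indicator B x * (g (x + t *\<^sub>R z) \<bullet> z)) \<in> borel_measurable (borel \<Otimes>\<^sub>M borel)"
    if [measurable]: "B \<in> sets borel" for B
    by measurable
  have GB: "integrable lborel (\<lambda>x. indicator B x * G x)" "AE x in lborel. x \<in> B \<longrightarrow> integrable lborel (\<lambda>t. indicator {0..1} t * (g (x + t *\<^sub>R z) \<bullet> z))"
    if B: "B \<in> sets borel" "bounded B" for B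
  proof -
    obtain C where C: "C < top" "\<And>t. (NBINT x. ennreal \<bar>indicator B x * (g (x + t *\<^sub>R z) \<bullet> z)\<bar>) \<le> C"
      using sobolev_line_integrand[OF mg intg r1 B] by blast
    have "(\<lambda>x. LBINT t. indicator {0..1} t * (indicator B x * (g (x + t *\<^sub>R z) \<bullet> z))) = (\<lambda>x. indicator B x * G x)"
      unfolding G_def by (subst integral_mult_right_zero[symmetric]) (simp add: mult_ac)
    then show "integrable lborel (\<lambda>x. indicator B x * G x)"
      using integral_slab_swap(2)[OF hmeas[OF B(1)] C(2,1)] by simp
    show "AE x in lborel. x \<in> B \<longrightarrow> integrable lborel (\<lambda>t. indicator {0..1} t * (g (x + t *\<^sub>R z) \<bullet> z))"
      using integral_slab_swap(3)[OF hmeas[OF B(1)] C(2,1)] by eventually_elim auto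
  qed
  define f where "f x = u (x + z) - u x - G x" for x
  have [measurable]: "f \<in> borel_measurable borel" unfolding f_def by measurable
  have fB: "integrable lborel (\<lambda>x. indicator B x * f x)" if "B \<in> sets borel" "bounded B" for B
    using Bochner_Integration.integrable_diff[OF Bochner_Integration.integrable_diff[OF uzB[OF that] uB[OF that]] GB(1)[OF that]]
    by (simp add: f_def algebra_simps)
  have "locally_integrable f"
    unfolding locally_integrable_def set_integrable_def
  proof (intro allI impI)
    fix K :: "(real ^ 'n) set" assume K: "compact K"
    then have "integrable lborel (\<lambda>x. indicator K x * f x)" by (intro fB) (auto intro: borel_compact compact_imp_bounded)
    then show "integrable lebesgue (\<lambda>x. indicator K x *\<^sub>R f x)"
      using borel_compact[OF K] by (subst integrable_completion) auto
  qed
  moreover have "(LINT x|lebesgue. f x * \<phi> x) = 0" if \<phi>: "test_function \<phi>" for \<phi>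
  proof -
    note [measurable] = test_function_borel[OF \<phi>]
    obtain R where R: "0 < R" "\<And>x. R < norm x \<Longrightarrow> \<phi> x = 0" "\<And>x i. R < norm x \<Longrightarrow> partial_deriv i \<phi> x = 0"
      by (rule test_function_support[OF \<phi>], rule that)
    obtain M where M: "0 < M" "\<And>x. \<bar>\<phi> x\<bar> \<le> M" "\<And>x i. \<bar>partial_deriv i \<phi> x\<bar> \<le> M"
      by (rule test_function_bounded[OF \<phi>], rule that)
    let ?B = "cball 0 R :: (real ^ 'n) set" and ?B' = "cball 0 (R + norm z) :: (real ^ 'n) set"
    have dom: "integrable lborel (\<lambda>x. F x * \<psi> x)"
      if F: "integrable lborel (\<lambda>x. indicator B x * F x)" and \<psi>: "\<psi> \<in> borel_measurable borel" "\<And>x. \<bar>\<psi> x\<bar> \<le> K" "\<And>x. x \<notin> B \<Longrightarrow> \<psi> x = 0"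
      for F \<psi> :: "real ^ 'n \<Rightarrow> real" and B K
    proof -
      have "F x * \<psi> x = (indicator B x * F x) * \<psi> x" for x using \<psi>(3)[of x] by (auto simp: indicator_def)
      then have eq: "(\<lambda>x. F x * \<psi> x) = (\<lambda>x. (indicator B x * F x) * \<psi> x)" by blast
      have "integrable lborel (\<lambda>x. K * (indicator B x * F x))" using F by simp
      then show ?thesis unfolding eq
      proof (rule Bochner_Integration.integrable_bound)
        show "(\<lambda>x. indicator B x * F x * \<psi> x) \<in> borel_measurable lborel"
          using \<psi>(1) by (intro borel_measurable_times[OF borel_measurable_integrable[OF F]]) simp
        show "AE x in lborel. norm (indicator B x * F x * \<psi> x) \<le> norm (K * (indicator B x * F x))"
        proof (intro AE_I2)
          fix x
          have "\<bar>\<psi> x\<bar> \<le> \<bar>K\<bar>" using \<psi>(2)[of x] by linarith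
          then show "norm (indicator B x * F x * \<psi> x) \<le> norm (K * (indicator B x * F x))"
            by (simp add: abs_mult mult.commute[of "\<bar>K\<bar>"] mult_left_mono)
        qed
      qed
    qed
    have i1: "integrable lborel (\<lambda>x. u (x + z) * \<phi> x)"
      by (rule dom[OF uzB[of ?B] _ M(2)]) (use R(2) in auto)
    have i2: "integrable lborel (\<lambda>x. u x * \<phi> x)"
      by (rule dom[OF uB[of ?B] _ M(2)]) (use R(2) in auto)
    have i3: "integrable lborel (\<lambda>x. G x * \<phi> x)"
      by (rule dom[OF GB(1)[of ?B] _ M(2)]) (use R(2) in auto)
    have outside: "R < norm (y - t *\<^sub>R z)" if "y \<notin> ?B'" "t \<in> {0..1}" for y t
    proof -
      have "norm (t *\<^sub>R z) \<le> 1 * norm z" unfolding norm_scaleR using that by (intro mult_right_mono) auto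
      then show ?thesis using that norm_triangle_ineq2[of y "t *\<^sub>R z"] by auto
    qed
    have i4: "integrable lborel (\<lambda>x. u x * \<phi> (x - z))"
      by (rule dom[OF uB[of ?B'] _ M(2)]) (use R(2) outside[of _ 1] in auto)
    have "(LBINT x. f x * \<phi> x) = (LBINT x. u (x + z) * \<phi> x) - (LBINT x. u x * \<phi> x) - (LBINT x. G x * \<phi> x)"
      unfolding f_def using i1 i2 i3 by (simp add: left_diff_distrib)
    also have "(LBINT x. u (x + z) * \<phi> x) = (LBINT x. u x * \<phi> (x - z))"
      using integral_lborel_translate[of "\<lambda>x. u x * \<phi> (x - z)" z] by simp
    also have "\<dots> - (LBINT x. u x * \<phi> x) = (LBINT y. u y * (\<phi> (y - z) - \<phi> y))"
      using i4 i2 by (simp add: right_diff_distrib)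
    also have "\<dots> = (LBINT y. (LBINT t. indicator {0..1} t * (u y * - (\<Sum>i\<in>UNIV. partial_deriv i \<phi> (y - t *\<^sub>R z) * z $ i))))"
    proof (rule Bochner_Integration.integral_cong[OF refl])
      fix y
      have "(LBINT t. - (\<Sum>i\<in>UNIV. partial_deriv i \<phi> (y - t *\<^sub>R z) * z $ i) * indicator {0..1} t) = \<phi> (y - 1 *\<^sub>R z) - \<phi> (y - 0 *\<^sub>R z)"
      proof (rule integral_FTC_Icc_real)
        fix t :: real
        show "((\<lambda>t. \<phi> (y - t *\<^sub>R z)) has_real_derivative - (\<Sum>i\<in>UNIV. partial_deriv i \<phi> (y - t *\<^sub>R z) * z $ i)) (at t)"
          by (rule test_function_line_derivative[OF \<phi>])
        have "continuous_on UNIV (\<lambda>t. - (\<Sum>i\<in>UNIV. partial_deriv i \<phi> (y - t *\<^sub>R z) * z $ i))"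
          by (intro continuous_intros continuous_on_compose2[OF test_function_props(3)[OF \<phi>]]) auto
        then show "isCont (\<lambda>t. - (\<Sum>i\<in>UNIV. partial_deriv i \<phi> (y - t *\<^sub>R z) * z $ i)) t"
          by (simp add: continuous_on_eq_continuous_at)
      qed simp
      then have "\<phi> (y - z) - \<phi> y = (LBINT t. indicator {0..1} t * - (\<Sum>i\<in>UNIV. partial_deriv i \<phi> (y - t *\<^sub>R z) * z $ i))"
        by (simp add: mult.commute)
      then have "u y * (\<phi> (y - z) - \<phi> y) = (LBINT t. u y * (indicator {0..1} t * - (\<Sum>i\<in>UNIV. partial_deriv i \<phi> (y - t *\<^sub>R z) * z $ i)))"
        by (simp only: integral_mult_right_zero)
      then show "u y * (\<phi> (y - z) - \<phi> y) = (LBINT t. indicator {0..1} t * (u y * - (\<Sum>i\<in>UNIV. partial_deriv i \<phi> (y - t *\<^sub>R z) * z $ i)))"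
        by (simp only: mult.left_commute)
    qed
    also have "\<dots> = (LBINT y. (LBINT t. indicator {0..1} t * (indicator {0..1} t * (indicator ?B' y * u y) * - (\<Sum>i\<in>UNIV. partial_deriv i \<phi> (y - t *\<^sub>R z) * z $ i))))"
    proof (intro Bochner_Integration.integral_cong[OF refl])
      fix y and t :: real
      show "indicator {0..1} t * (u y * - (\<Sum>i\<in>UNIV. partial_deriv i \<phi> (y - t *\<^sub>R z) * z $ i)) =
        indicator {0..1} t * (indicator {0..1} t * (indicator ?B' y * u y) * - (\<Sum>i\<in>UNIV. partial_deriv i \<phi> (y - t *\<^sub>R z) * z $ i))"
        using outside[of y t] R(3) by (auto simp: indicator_def)
    qed
    also have "\<dots> = (LBINT t. indicator {0..1} t * (LBINT y. indicator {0..1} t * (indicator ?B' y * u y) * - (\<Sum>i\<in>UNIV. partial_deriv i \<phi> (y - t *\<^sub>R z) * z $ i)))"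
    proof (rule integral_slab_swap(1)[symmetric])
      let ?L = "M * (\<Sum>i\<in>UNIV. \<bar>z $ i\<bar>)"
      show "(\<lambda>(t, y). indicator {0..1} t * (indicator ?B' y * u y) * - (\<Sum>i\<in>UNIV. partial_deriv i \<phi> (y - t *\<^sub>R z) * z $ i)) \<in> borel_measurable (borel \<Otimes>\<^sub>M borel)"
      proof -
        have m0: "(\<lambda>p :: real \<times> (real ^ 'n). indicator {0..1} (fst p) :: real) \<in> borel_measurable (borel \<Otimes>\<^sub>M borel)"
          by measurable
        have m1: "(\<lambda>p :: real \<times> (real ^ 'n). partial_deriv i \<phi> (snd p - fst p *\<^sub>R z)) \<in> borel_measurable (borel \<Otimes>\<^sub>M borel)" for i
          by (rule measurable_compose[OF _ test_function_borel(2)[OF \<phi>]]) measurable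
        have m2: "(\<lambda>p :: real \<times> (real ^ 'n). indicator ?B' (snd p) * u (snd p)) \<in> borel_measurable (borel \<Otimes>\<^sub>M borel)"
          using borel_measurable_integrable[OF uB[of ?B']] by (intro measurable_compose[OF measurable_snd]) auto
        have m3: "(\<lambda>p :: real \<times> (real ^ 'n). \<Sum>i\<in>UNIV. partial_deriv i \<phi> (snd p - fst p *\<^sub>R z) * z $ i) \<in> borel_measurable (borel \<Otimes>\<^sub>M borel)"
          by (intro borel_measurable_sum borel_measurable_times[OF m1 borel_measurable_const])
        show ?thesis
          unfolding case_prod_beta'
          by (rule borel_measurable_times[OF borel_measurable_times[OF m0 m2] borel_measurable_uminus[OF m3]])
      qed
      have L: "\<bar>\<Sum>i\<in>UNIV. partial_deriv i \<phi> y * z $ i\<bar> \<le> ?L" for y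
        unfolding sum_distrib_left
        by (rule order_trans[OF sum_abs]) (auto intro!: sum_mono mult_right_mono M(3) simp: abs_mult)
      show "ennreal ?L * (NBINT y. ennreal \<bar>indicator ?B' y * u y\<bar>) < top"
        using uB[of ?B'] by (auto simp: integrable_iff_bounded ennreal_mult_less_top)
      fix t :: real
      have "(NBINT y. ennreal \<bar>indicator {0..1} t * (indicator ?B' y * u y) * - (\<Sum>i\<in>UNIV. partial_deriv i \<phi> (y - t *\<^sub>R z) * z $ i)\<bar>) \<le>
          (NBINT y. ennreal ?L * ennreal \<bar>indicator ?B' y * u y\<bar>)"
      proof (rule nn_integral_mono)
        fix y
        have "\<bar>indicator {0..1} t * (indicator ?B' y * u y) * - (\<Sum>i\<in>UNIV. partial_deriv i \<phi> (y - t *\<^sub>R z) * z $ i)\<bar> \<le> ?L * \<bar>indicator ?B' y * u y\<bar>"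
        proof -
          have "\<bar>indicator {0..1} t :: real\<bar> * \<bar>indicator ?B' y * u y\<bar> * \<bar>\<Sum>i\<in>UNIV. partial_deriv i \<phi> (y - t *\<^sub>R z) * z $ i\<bar> \<le>
              (1 * \<bar>indicator ?B' y * u y\<bar>) * ?L"
            by (rule mult_mono[OF mult_right_mono L]) (auto simp: indicator_def)
          then show ?thesis
            by (simp only: abs_mult abs_minus_cancel mult_1_left mult.commute[of _ ?L])
        qed
        then show "ennreal \<bar>indicator {0..1} t * (indicator ?B' y * u y) * - (\<Sum>i\<in>UNIV. partial_deriv i \<phi> (y - t *\<^sub>R z) * z $ i)\<bar> \<le> ennreal ?L * ennreal \<bar>indicator ?B' y * u y\<bar>"
          using order_trans[OF abs_ge_zero L] by (subst ennreal_mult[symmetric]) (auto intro: ennreal_leI)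
      qed
      also have "\<dots> = ennreal ?L * (NBINT y. ennreal \<bar>indicator ?B' y * u y\<bar>)"
      proof (rule nn_integral_cmult)
        have "(\<lambda>y. indicator ?B' y * u y) \<in> borel_measurable lborel"
          by (rule borel_measurable_integrable[OF uB]) auto
        then show "(\<lambda>y. ennreal \<bar>indicator ?B' y * u y\<bar>) \<in> borel_measurable lborel"
          by (intro measurable_compose[OF borel_measurable_abs measurable_ennreal])
      qed
      finally show "(NBINT y. ennreal \<bar>indicator {0..1} t * (indicator ?B' y * u y) * - (\<Sum>i\<in>UNIV. partial_deriv i \<phi> (y - t *\<^sub>R z) * z $ i)\<bar>) \<le>
          ennreal ?L * (NBINT y. ennreal \<bar>indicator ?B' y * u y\<bar>)" .
    qed
    also have "\<dots> = (LBINT t. indicator {0..1} t * (LBINT x. indicator ?B x * (g (x + t *\<^sub>R z) \<bullet> z) * \<phi> x))"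
    proof (rule Bochner_Integration.integral_cong[OF refl])
      fix t :: real
      show "indicator {0..1} t * (LBINT y. indicator {0..1} t * (indicator ?B' y * u y) * - (\<Sum>i\<in>UNIV. partial_deriv i \<phi> (y - t *\<^sub>R z) * z $ i)) =
          indicator {0..1} t * (LBINT x. indicator ?B x * (g (x + t *\<^sub>R z) \<bullet> z) * \<phi> x)"
      proof (cases "t \<in> {0..1}")
        case True
        let ?\<phi> = "\<lambda>x. \<phi> (x - t *\<^sub>R z)"
        have \<phi>t: "test_function ?\<phi>" by (rule test_function_translate[OF \<phi>])
        have pd: "partial_deriv i ?\<phi> y = partial_deriv i \<phi> (y - t *\<^sub>R z)" for i y
          by (rule partial_deriv_translate[OF test_function_props(1)[OF \<phi>]])
        have iu: "integrable lborel (\<lambda>y. u y * partial_deriv i ?\<phi> y)" for i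
        proof (rule dom[OF uB[of ?B']])
          show "\<bar>partial_deriv i ?\<phi> y\<bar> \<le> M" for y unfolding pd by (rule M(3))
          show "partial_deriv i ?\<phi> \<in> borel_measurable borel" by (rule test_function_borel(2)[OF \<phi>t])
          show "partial_deriv i ?\<phi> y = 0" if "y \<notin> ?B'" for y unfolding pd using outside[OF that True] by (rule R(3))
        qed auto
        have ginorm: "integrable lborel (\<lambda>y. indicator ?B' y * (g y $ i))" for i
        proof -
          have "integrable lborel (\<lambda>y. indicator ?B' y * norm (g y))"
            by (rule integrable_on_bounded[OF mg intg r1]) auto
          then show ?thesis
          proof (rule Bochner_Integration.integrable_bound)
            have "(\<lambda>x :: real ^ 'n. x $ i) \<in> borel_measurable borel"
              by (intro borel_measurable_continuous_onI continuous_intros)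
            then have "(\<lambda>y. g y $ i) \<in> borel_measurable borel" by (rule measurable_compose[OF mg])
            then show "(\<lambda>y. indicator ?B' y * (g y $ i)) \<in> borel_measurable lborel"
              by (intro borel_measurable_times borel_measurable_indicator) auto
          qed (auto simp: indicator_def component_le_norm_cart)
        qed
        have ig: "integrable lborel (\<lambda>y. g y $ i * ?\<phi> y)" for i
        proof (rule dom[OF ginorm[of i]])
          show "\<bar>?\<phi> y\<bar> \<le> M" for y by (rule M(2))
          show "?\<phi> \<in> borel_measurable borel" by (rule test_function_borel(1)[OF \<phi>t])
          show "?\<phi> y = 0" if "y \<notin> ?B'" for y using outside[OF that True] by (rule R(2))
        qed
        have "(LBINT y. indicator {0..1} t * (indicator ?B' y * u y) * - (\<Sum>i\<in>UNIV. partial_deriv i \<phi> (y - t *\<^sub>R z) * z $ i)) =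
            (LBINT y. (\<Sum>i\<in>UNIV. - z $ i * (u y * partial_deriv i ?\<phi> y)))"
        proof (rule Bochner_Integration.integral_cong[OF refl])
          fix y
          show "indicator {0..1} t * (indicator ?B' y * u y) * - (\<Sum>i\<in>UNIV. partial_deriv i \<phi> (y - t *\<^sub>R z) * z $ i) =
            (\<Sum>i\<in>UNIV. - z $ i * (u y * partial_deriv i ?\<phi> y))"
          proof (cases "y \<in> ?B'")
            case False
            then show ?thesis using outside[OF False True] R(3) by (simp add: pd)
          next
            case y: True
            then show ?thesis using True by (simp add: pd sum_distrib_left sum_negf mult_ac)
          qed
        qed
        also have "\<dots> = (\<Sum>i\<in>UNIV. - z $ i * (LBINT y. u y * partial_deriv i ?\<phi> y))"
          using iu by (subst Bochner_Integration.integral_sum) auto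
        also have "\<dots> = (\<Sum>i\<in>UNIV. z $ i * (LBINT y. g y $ i * ?\<phi> y))"
          by (simp add: weak[OF \<phi>t])
        also have "\<dots> = (LBINT y. (\<Sum>i\<in>UNIV. z $ i * (g y $ i * ?\<phi> y)))"
          using ig by (subst Bochner_Integration.integral_sum) auto
        also have "\<dots> = (LBINT y. (g y \<bullet> z) * ?\<phi> y)"
          by (simp add: inner_vec_def sum_distrib_right sum_distrib_left mult_ac)
        also have "\<dots> = (LBINT x. (g (x + t *\<^sub>R z) \<bullet> z) * \<phi> x)"
          using integral_lborel_translate[of "\<lambda>y. (g y \<bullet> z) * ?\<phi> y" "t *\<^sub>R z"] by simp
        also have "\<dots> = (LBINT x. indicator ?B x * (g (x + t *\<^sub>R z) \<bullet> z) * \<phi> x)"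
          by (rule Bochner_Integration.integral_cong[OF refl]) (use R(2) in \<open>auto simp: indicator_def\<close>)
        finally show ?thesis by simp
      qed simp
    qed
    also have "\<dots> = (LBINT x. (LBINT t. indicator {0..1} t * (indicator ?B x * (g (x + t *\<^sub>R z) \<bullet> z) * \<phi> x)))"
    proof -
      obtain C where C: "C < top" "\<And>t. (NBINT x. ennreal \<bar>indicator ?B x * (g (x + t *\<^sub>R z) \<bullet> z)\<bar>) \<le> C"
        using sobolev_line_integrand[OF mg intg r1, of ?B z] by auto
      show ?thesis
      proof (rule integral_slab_swap(1))
        have B: "?B \<in> sets borel" by simp
        have "(\<lambda>p :: real \<times> (real ^ 'n). \<phi> (snd p)) \<in> borel_measurable (borel \<Otimes>\<^sub>M borel)"
          by (rule measurable_compose[OF measurable_snd test_function_borel(1)[OF \<phi>]])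
        then show "(\<lambda>(t, x). indicator ?B x * (g (x + t *\<^sub>R z) \<bullet> z) * \<phi> x) \<in> borel_measurable (borel \<Otimes>\<^sub>M borel)"
          using borel_measurable_times[OF hmeas[OF B]] by (simp add: case_prod_beta')
        show "ennreal M * C < top" using C(1) by (simp add: ennreal_mult_less_top)
        fix t :: real
        have "(NBINT x. ennreal \<bar>indicator ?B x * (g (x + t *\<^sub>R z) \<bullet> z) * \<phi> x\<bar>) \<le>
            (NBINT x. ennreal M * ennreal \<bar>indicator ?B x * (g (x + t *\<^sub>R z) \<bullet> z)\<bar>)"
        proof (rule nn_integral_mono)
          fix x
          have "\<bar>indicator ?B x * (g (x + t *\<^sub>R z) \<bullet> z) * \<phi> x\<bar> \<le> M * \<bar>indicator ?B x * (g (x + t *\<^sub>R z) \<bullet> z)\<bar>"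
            unfolding abs_mult[of _ "\<phi> x"] mult.commute[of _ "\<bar>\<phi> x\<bar>"] by (intro mult_right_mono M(2)) simp
          then show "ennreal \<bar>indicator ?B x * (g (x + t *\<^sub>R z) \<bullet> z) * \<phi> x\<bar> \<le> ennreal M * ennreal \<bar>indicator ?B x * (g (x + t *\<^sub>R z) \<bullet> z)\<bar>"
            using M(1) by (subst ennreal_mult[symmetric]) (auto intro: ennreal_leI)
        qed
        also have "\<dots> = ennreal M * (NBINT x. ennreal \<bar>indicator ?B x * (g (x + t *\<^sub>R z) \<bullet> z)\<bar>)"
        proof (rule nn_integral_cmult)
          have "(\<lambda>x. (g (x + t *\<^sub>R z) \<bullet> z)) \<in> borel_measurable lborel" by measurable
          moreover have "(indicator ?B :: _ \<Rightarrow> real) \<in> borel_measurable lborel" by (rule borel_measurable_indicator) simp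
          ultimately have "(\<lambda>x. indicator ?B x * (g (x + t *\<^sub>R z) \<bullet> z)) \<in> borel_measurable lborel" by (intro borel_measurable_times)
          then show "(\<lambda>x. ennreal \<bar>indicator ?B x * (g (x + t *\<^sub>R z) \<bullet> z)\<bar>) \<in> borel_measurable lborel"
            by (intro measurable_compose[OF borel_measurable_abs measurable_ennreal])
        qed
        also have "\<dots> \<le> ennreal M * C" by (intro mult_left_mono C(2)) simp
        finally show "(NBINT x. ennreal \<bar>indicator ?B x * (g (x + t *\<^sub>R z) \<bullet> z) * \<phi> x\<bar>) \<le> ennreal M * C" .
      qed
    qed
    also have "\<dots> = (LBINT x. G x * \<phi> x)"
    proof (rule Bochner_Integration.integral_cong[OF refl])
      fix x
      have "(LBINT t. indicator {0..1} t * (indicator ?B x * (g (x + t *\<^sub>R z) \<bullet> z) * \<phi> x)) =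
          (LBINT t. (indicator ?B x * \<phi> x) * (indicator {0..1} t * (g (x + t *\<^sub>R z) \<bullet> z)))"
        by (simp add: mult_ac)
      also have "\<dots> = (indicator ?B x * \<phi> x) * G x" unfolding G_def by (rule integral_mult_right_zero)
      also have "\<dots> = G x * \<phi> x" using R(2)[of x] by (auto simp: indicator_def)
      finally show "(LBINT t. indicator {0..1} t * (indicator ?B x * (g (x + t *\<^sub>R z) \<bullet> z) * \<phi> x)) = G x * \<phi> x" .
    qed
    finally have "(LBINT x. f x * \<phi> x) = 0" by simp
    then show ?thesis by (subst integral_completion) auto
  qed
  ultimately obtain N where N: "negligible N" "\<And>x. x \<notin> N \<Longrightarrow> f x = 0"
    using fundamental_lemma[of f] by blast
  have AEN: "AE x in lborel. x \<notin> N"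
    using N(1) unfolding negligible_iff_null_sets by (metis AE_completion_iff AE_not_in)
  have "AE x in lborel. \<forall>k::nat. x \<in> cball 0 (real k) \<longrightarrow> integrable lborel (\<lambda>t. indicator {0..1} t * (g (x + t *\<^sub>R z) \<bullet> z))"
    unfolding AE_all_countable by (intro allI GB(2)) auto
  with AEN show ?thesis
  proof eventually_elim
    case (elim x)
    obtain k :: nat where "norm x \<le> real k" using real_arch_simple by blast
    then show ?case using elim N(2)[of x] by (auto simp: f_def G_def)
  qed
qed

text \<open>The first-order Taylor remainder in \<open>L\<^sup>r\<close> is an average of translates of the gradient minus
  the gradient itself.\<close>

theorem sobolev_taylor_remainder:
  fixes u :: "real ^ 'n \<Rightarrow> real"
  assumes S: "sobolev_pair r u g" and r: "1 < r" and e: "0 < e"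
  shows "\<exists>\<delta>>0. \<forall>z. norm z \<le> \<delta> \<longrightarrow>
    (NBINT x. ennreal (\<bar>u (x + z) - u x - g x \<bullet> z\<bar> powr r)) \<le> ennreal (e * norm z powr r)"
proof -
  have [measurable]: "u \<in> borel_measurable borel" and g[measurable]: "g \<in> borel_measurable borel"
    and intg: "integrable lborel (\<lambda>x. norm (g x) powr r)"
    using S unfolding sobolev_pair_def by auto
  obtain \<delta> where \<delta>: "0 < \<delta>" "\<And>h. norm h < \<delta> \<Longrightarrow> (NBINT x. ennreal (norm (g (x + h) - g x) powr r)) \<le> ennreal e"
    using Lr_translation_continuous[OF g intg r e] by blast
  show ?thesis
  proof (intro exI[of _ "\<delta> / 2"] conjI allI impI)
    show "0 < \<delta> / 2" using \<delta> by simp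
    fix z :: "real ^ 'n" assume z: "norm z \<le> \<delta> / 2"
    have "(NBINT x. ennreal (\<bar>u (x + z) - u x - g x \<bullet> z\<bar> powr r)) \<le>
        (NBINT x. (NBINT t. ennreal (norm z powr r * norm (g (x + t *\<^sub>R z) - g x) powr r) * indicator {0..1} t))"
    proof (rule nn_integral_mono_AE)
      show "AE x in lborel. ennreal (\<bar>u (x + z) - u x - g x \<bullet> z\<bar> powr r) \<le>
        (NBINT t. ennreal (norm z powr r * norm (g (x + t *\<^sub>R z) - g x) powr r) * indicator {0..1} t)"
        using sobolev_line_formula[OF S r, of z]
      proof eventually_elim
        case (elim x)
        have one: "integrable lborel (\<lambda>t::real. indicator {0..1} t * (g x \<bullet> z))"
          by (intro integrable_mult_left integrable_real_indicator) auto
        have eq: "indicator {0..1} t * ((g (x + t *\<^sub>R z) - g x) \<bullet> z) =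
            indicator {0..1} t * (g (x + t *\<^sub>R z) \<bullet> z) - indicator {0..1} t * (g x \<bullet> z)" for t :: real
          by (simp add: inner_diff_left algebra_simps)
        have int: "integrable lborel (\<lambda>t. indicator {0..1} t * ((g (x + t *\<^sub>R z) - g x) \<bullet> z))"
          unfolding eq using elim one by (intro Bochner_Integration.integrable_diff) auto
        have "(LBINT t. indicator {0..1} t * ((g (x + t *\<^sub>R z) - g x) \<bullet> z)) = u (x + z) - u x - g x \<bullet> z"
          unfolding eq using elim one by (subst Bochner_Integration.integral_diff) auto
        then have "ennreal (\<bar>u (x + z) - u x - g x \<bullet> z\<bar> powr r) \<le>
            (NBINT t. ennreal (\<bar>(g (x + t *\<^sub>R z) - g x) \<bullet> z\<bar> powr r) * indicator {0..1} t)"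
          using powr_integral_unit_interval_le[OF r int] by simp
        also have "\<dots> \<le> (NBINT t. ennreal (norm z powr r * norm (g (x + t *\<^sub>R z) - g x) powr r) * indicator {0..1} t)"
        proof (intro nn_integral_mono mult_right_mono ennreal_leI)
          fix t :: real
          have "\<bar>(g (x + t *\<^sub>R z) - g x) \<bullet> z\<bar> powr r \<le> (norm (g (x + t *\<^sub>R z) - g x) * norm z) powr r"
            using r by (intro powr_mono2 Cauchy_Schwarz_ineq2) auto
          then show "\<bar>(g (x + t *\<^sub>R z) - g x) \<bullet> z\<bar> powr r \<le> norm z powr r * norm (g (x + t *\<^sub>R z) - g x) powr r"
            by (simp add: powr_mult mult.commute)
        qed simp
        finally show ?case .
      qed
    qed
    also have "\<dots> = (NBINT t. (NBINT x. ennreal (norm z powr r * norm (g (x + t *\<^sub>R z) - g x) powr r) * indicator {0..1} t))"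
      by (rule lborel_pair.Fubini') measurable
    also have "\<dots> \<le> (NBINT t. ennreal (e * norm z powr r) * indicator {0..1::real} t)"
    proof (rule nn_integral_mono)
      fix t :: real
      show "(NBINT x. ennreal (norm z powr r * norm (g (x + t *\<^sub>R z) - g x) powr r) * indicator {0..1} t) \<le>
          ennreal (e * norm z powr r) * indicator {0..1::real} t"
      proof (cases "t \<in> {0..1}")
        case True
        have "norm (t *\<^sub>R z) \<le> 1 * norm z" unfolding norm_scaleR using True by (intro mult_right_mono) auto
        then have "norm (t *\<^sub>R z) < \<delta>" using z \<delta>(1) by simp
        from \<delta>(2)[OF this] have le: "(NBINT x. ennreal (norm (g (x + t *\<^sub>R z) - g x) powr r)) \<le> ennreal e" .
        have "(NBINT x. ennreal (norm z powr r * norm (g (x + t *\<^sub>R z) - g x) powr r) * indicator {0..1} t) =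
            (NBINT x. ennreal (norm z powr r) * ennreal (norm (g (x + t *\<^sub>R z) - g x) powr r))"
          using True by (simp add: ennreal_mult)
        also have "\<dots> = ennreal (norm z powr r) * (NBINT x. ennreal (norm (g (x + t *\<^sub>R z) - g x) powr r))"
          by (rule nn_integral_cmult) measurable
        also have "\<dots> \<le> ennreal (norm z powr r) * ennreal e" by (intro mult_left_mono le) simp
        also have "\<dots> = ennreal (e * norm z powr r)" using e by (simp add: ennreal_mult mult.commute)
        finally show ?thesis using True by simp
      qed simp
    qed
    also have "\<dots> = ennreal (e * norm z powr r)" by (simp add: nn_integral_cmult)
    finally show "(NBINT x. ennreal (\<bar>u (x + z) - u x - g x \<bullet> z\<bar> powr r)) \<le> ennreal (e * norm z powr r)" .
  qed
qed

section \<open>The kernel\<close>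

text \<open>Minus the exponent is that of \<open>\<bar>x - y\<bar>\<close> in the denominator of the functional;
  the factor is the normalization of the limit.\<close>

definition kern :: "real \<Rightarrow> real \<Rightarrow> real ^ 'n \<Rightarrow> real" where
  "kern r s z = (1 - s) * norm z powr (- real CARD('n) - s * r)"

lemma kern_measurable [measurable]: "kern r s \<in> borel_measurable borel"
  unfolding kern_def by measurable

lemma kern_nonneg: "s \<le> 1 \<Longrightarrow> 0 \<le> kern r s z"
  by (simp add: kern_def)

lemma K_const_eq_cone:
  fixes k :: "'n::finite"
  shows "K_const k r = ennreal (1 / r) * (\<integral>\<^sup>+w. ennreal (\<bar>(w :: real ^ 'n) $ k\<bar> powr r) \<partial>cone_measure)"
  unfolding K_const_def by (subst nn_integral_hausdorff_sphere) auto

lemma cone_moment_finite: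
  fixes k :: "'n::finite"
  assumes "0 \<le> r"
  shows "(\<integral>\<^sup>+w. ennreal (\<bar>(w :: real ^ 'n) $ k\<bar> powr r) \<partial>cone_measure) < top"
proof -
  have "AE w in (cone_measure :: (real ^ 'n) measure). norm w \<le> 1"
  proof -
    have "emeasure cone_measure (- sphere 0 1 :: (real ^ 'n) set) = emeasure cone_measure (- sphere 0 1 \<inter> sphere 0 1 :: (real ^ 'n) set)"
      by (rule emeasure_cone_measure_sphere[symmetric]) auto
    then have "- sphere 0 1 \<in> null_sets (cone_measure :: (real ^ 'n) measure)" by (simp add: null_sets_def)
    then have "AE w in (cone_measure :: (real ^ 'n) measure). w \<notin> - sphere 0 1" by (rule AE_not_in)
    then show ?thesis by eventually_elim auto
  qed
  then have "(\<integral>\<^sup>+w. ennreal (\<bar>(w :: real ^ 'n) $ k\<bar> powr r) \<partial>cone_measure) \<le> (\<integral>\<^sup>+w. 1 \<partial>(cone_measure :: (real ^ 'n) measure))"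
  proof (intro nn_integral_mono_AE, eventually_elim)
    case (elim w)
    have "\<bar>w $ k\<bar> \<le> 1" using component_le_norm_cart[of w k] elim by linarith
    then have "\<bar>w $ k\<bar> powr r \<le> 1 powr r" using assms by (intro powr_mono2) auto
    then show ?case by simp
  qed
  also have "\<dots> < top" using emeasure_cone_measure_UNIV[where 'a="real ^ 'n"] by simp
  finally show ?thesis .
qed

lemma K_const_finite: "1 < r \<Longrightarrow> K_const k r < top"
  using cone_moment_finite[of r k] by (simp add: K_const_eq_cone ennreal_mult_less_top)

text \<open>The integral depends on \<open>v\<close> only through its length: a rotation takes the axis
  \<open>k\<close> to the direction of \<open>v\<close>.\<close>

lemma nn_integral_directional:
  fixes v :: "real ^ 'n" and k :: 'n
  assumes [measurable]: "h \<in> borel_measurable borel" and r: "0 < r"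
  shows "(NBINT z. h (norm z) * ennreal (\<bar>v \<bullet> z\<bar> powr r)) =
    ennreal (norm v powr r) * (NBINT z. h (norm (z :: real ^ 'n)) * ennreal (\<bar>z $ k\<bar> powr r))"
proof (cases "v = 0")
  case True
  then show ?thesis using r by simp
next
  case False
  then have n: "norm (v /\<^sub>R norm v) = 1" by simp
  obtain T :: "real ^ 'n \<Rightarrow> real ^ 'n" where T: "orthogonal_transformation T" "T (axis k 1) = v /\<^sub>R norm v"
    using orthogonal_transformation_axis[OF n, of k] by auto
  have "v \<bullet> T z = norm v * z $ k" for z
  proof -
    have "v = norm v *\<^sub>R T (axis k 1)" using False T(2) by simp
    then have "v \<bullet> T z = norm v * (T (axis k 1) \<bullet> T z)" by (metis inner_scaleR_left)
    also have "T (axis k 1) \<bullet> T z = axis k 1 \<bullet> z" using T(1) unfolding orthogonal_transformation_def by blast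
    also have "\<dots> = z $ k" by (simp add: inner_axis')
    finally show ?thesis .
  qed
  then have eq: "h (norm (T z)) * ennreal (\<bar>v \<bullet> T z\<bar> powr r) = ennreal (norm v powr r) * (h (norm z) * ennreal (\<bar>z $ k\<bar> powr r))" for z
    using orthogonal_transformation_norm[OF T(1), of z] by (simp add: abs_mult powr_mult ennreal_mult mult_ac)
  have "(NBINT z. h (norm z) * ennreal (\<bar>v \<bullet> z\<bar> powr r)) = (NBINT z. h (norm (T z)) * ennreal (\<bar>v \<bullet> T z\<bar> powr r))"
    by (rule nn_integral_lborel_orthogonal[OF T(1), symmetric]) measurable
  also have "\<dots> = ennreal (norm v powr r) * (NBINT z. h (norm (z :: real ^ 'n)) * ennreal (\<bar>z $ k\<bar> powr r))"
    unfolding eq by (rule nn_integral_cmult) measurable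
  finally show ?thesis .
qed

text \<open>The origin is left out, since the kernel is defined to be 0 there.\<close>

definition near :: "real \<Rightarrow> (real ^ 'n) set" where
  "near \<delta> = {z. 0 < norm z \<and> norm z \<le> \<delta>}"

definition far :: "real \<Rightarrow> (real ^ 'n) set" where
  "far \<delta> = {z. \<delta> < norm z}"

lemma near_far_measurable [measurable]: "near \<delta> \<in> sets borel" "far \<delta> \<in> sets borel"
  unfolding near_def far_def by measurable

lemma nn_integral_near_far:
  fixes F :: "real ^ 'n \<Rightarrow> ennreal"
  assumes [measurable]: "F \<in> borel_measurable borel" and "0 < \<delta>"
  shows "(NBINT z. F z) = (NBINT z. F z * indicator (near \<delta>) z) + (NBINT z. F z * indicator (far \<delta>) z)"
proof -
  have "(NBINT z. F z) = (NBINT z. F z * indicator (near \<delta>) z + F z * indicator (far \<delta>) z)"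
    by (intro nn_integral_cong_AE AE_I[where N="{0}"]) (use assms in \<open>auto simp: near_def far_def indicator_def\<close>)
  also have "\<dots> = (NBINT z. F z * indicator (near \<delta>) z) + (NBINT z. F z * indicator (far \<delta>) z)"
    by (rule nn_integral_add) measurable
  finally show ?thesis .
qed

text \<open>In polar coordinates the radial integrand is \<open>(1 - s) * t powr (r * (1 - s) - 1)\<close>,
  whose primitive is \<open>t powr (r * (1 - s)) / r\<close>.\<close>

lemma nn_integral_kern_near:
  fixes f :: "real ^ 'n \<Rightarrow> ennreal"
  assumes [measurable]: "f \<in> borel_measurable borel" and fin: "(\<integral>\<^sup>+w. f w \<partial>cone_measure) < top"
    and r: "0 < r" and s: "s < 1" and \<delta>: "0 < \<delta>"
  shows "(NBINT z. ennreal (kern r s z) * (ennreal (norm z powr r) * f (sgn z)) * indicator (near \<delta>) z) =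
    ennreal (\<delta> powr (r * (1 - s))) * (ennreal (1 / r) * (\<integral>\<^sup>+w. f w \<partial>cone_measure))"
proof -
  let ?\<beta> = "r * (1 - s)"
  have \<beta>: "0 < ?\<beta>" using r s by simp
  have "(NBINT z. ennreal (kern r s z) * (ennreal (norm z powr r) * f (sgn z)) * indicator (near \<delta>) z) =
      (NBINT z. ennreal (1 - s) * (ennreal (norm z powr (?\<beta> - DIM(real ^ 'n))) * f (sgn z) * indicator {z. 0 < norm z \<and> norm z \<le> \<delta>} z))"
  proof (rule nn_integral_cong)
    fix z :: "real ^ 'n"
    have "norm z powr (- real CARD('n) - s * r) * norm z powr r = norm z powr (?\<beta> - real CARD('n))"
      by (simp add: powr_add[symmetric] algebra_simps)
    then have "ennreal (kern r s z) * ennreal (norm z powr r) = ennreal (1 - s) * ennreal (norm z powr (?\<beta> - real CARD('n)))"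
      using s by (simp add: kern_def ennreal_mult[symmetric] mult.assoc)
    then show "ennreal (kern r s z) * (ennreal (norm z powr r) * f (sgn z)) * indicator (near \<delta>) z =
       ennreal (1 - s) * (ennreal (norm z powr (?\<beta> - DIM(real ^ 'n))) * f (sgn z) * indicator {z. 0 < norm z \<and> norm z \<le> \<delta>} z)"
      by (simp add: near_def mult.assoc[symmetric])
  qed
  also have "\<dots> = ennreal (1 - s) * (NBINT z. ennreal (norm z powr (?\<beta> - DIM(real ^ 'n))) * f (sgn z) * indicator {z. 0 < norm z \<and> norm z \<le> \<delta>} z)"
    by (rule nn_integral_cmult) measurable
  also have "\<dots> = ennreal (1 - s) * (ennreal (\<delta> powr ?\<beta> / ?\<beta>) * (\<integral>\<^sup>+w. f w \<partial>cone_measure))"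
    using \<delta> by (subst nn_integral_polar_powr[OF _ fin \<beta>]) auto
  also have "\<dots> = (ennreal (1 - s) * ennreal (\<delta> powr ?\<beta> / ?\<beta>)) * (\<integral>\<^sup>+w. f w \<partial>cone_measure)"
    by (simp add: mult.assoc)
  also have "ennreal (1 - s) * ennreal (\<delta> powr ?\<beta> / ?\<beta>) = ennreal (\<delta> powr ?\<beta>) * ennreal (1 / r)"
    using s r by (simp add: ennreal_mult[symmetric])
  finally show ?thesis by (simp add: mult.assoc)
qed

lemma nn_integral_kern_near_norm:
  assumes "0 < r" "s < 1" "0 < \<delta>"
  shows "(\<integral>\<^sup>+z. ennreal (kern r s z) * ennreal (norm z powr r) * indicator (near \<delta>) z \<partial>(lborel :: (real ^ 'n) measure)) =
    ennreal (\<delta> powr (r * (1 - s))) * (ennreal (1 / r) * emeasure (cone_measure :: (real ^ 'n) measure) UNIV)"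
  using nn_integral_kern_near[of "\<lambda>_. 1 :: ennreal", OF _ _ assms] emeasure_cone_measure_UNIV[where 'a="real ^ 'n"]
  by simp

lemma nn_integral_kern_near_directional:
  fixes v :: "real ^ 'n" and k :: 'n
  assumes "0 < r" "s < 1" "0 < \<delta>"
  shows "(NBINT z. ennreal (kern r s z) * ennreal (\<bar>v \<bullet> z\<bar> powr r) * indicator (near \<delta>) z) =
    ennreal (\<delta> powr (r * (1 - s))) * (K_const k r * ennreal (norm v powr r))"
proof -
  let ?h = "\<lambda>t. ennreal ((1 - s) * t powr (- real CARD('n) - s * r)) * indicator {t. 0 < t \<and> t \<le> \<delta>} t"
  have h: "?h \<in> borel_measurable borel" by measurable
  have "(NBINT z. ennreal (kern r s z) * ennreal (\<bar>v \<bullet> z\<bar> powr r) * indicator (near \<delta>) z) =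
      (NBINT z. ?h (norm z) * ennreal (\<bar>v \<bullet> z\<bar> powr r))"
    by (intro nn_integral_cong) (auto simp: kern_def near_def indicator_def)
  also have "\<dots> = ennreal (norm v powr r) * (NBINT z. ?h (norm (z :: real ^ 'n)) * ennreal (\<bar>z $ k\<bar> powr r))"
    by (rule nn_integral_directional[OF h assms(1)])
  also have "(NBINT z. ?h (norm (z :: real ^ 'n)) * ennreal (\<bar>z $ k\<bar> powr r)) =
      (\<integral>\<^sup>+z. ennreal (kern r s z) * (ennreal (norm z powr r) * ennreal (\<bar>sgn z $ k\<bar> powr r)) * indicator (near \<delta>) z \<partial>(lborel :: (real ^ 'n) measure))"
  proof (rule nn_integral_cong)
    fix z :: "real ^ 'n"
    have "\<bar>z $ k\<bar> powr r = norm z powr r * \<bar>sgn z $ k\<bar> powr r" if "z \<noteq> 0"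
    proof -
      have e: "norm z *\<^sub>R sgn z = z" using that by (simp add: sgn_div_norm)
      have "(norm z *\<^sub>R sgn z) $ k = norm z * (sgn z $ k)" by simp
      then have "z $ k = norm z * (sgn z $ k)" unfolding e .
      then show ?thesis by (simp add: abs_mult powr_mult)
    qed
    then show "?h (norm z) * ennreal (\<bar>z $ k\<bar> powr r) = ennreal (kern r s z) * (ennreal (norm z powr r) * ennreal (\<bar>sgn z $ k\<bar> powr r)) * indicator (near \<delta>) z"
      by (auto simp: kern_def near_def indicator_def ennreal_mult)
  qed
  also have "\<dots> = ennreal (\<delta> powr (r * (1 - s))) * (ennreal (1 / r) * (\<integral>\<^sup>+w. ennreal (\<bar>(w :: real ^ 'n) $ k\<bar> powr r) \<partial>cone_measure))"
    using assms cone_moment_finite[of r k] by (intro nn_integral_kern_near) auto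
  finally show ?thesis by (simp add: K_const_eq_cone mult_ac)
qed

text \<open>For \<open>s \<ge> 1 / 2\<close> the kernel without the factor \<open>1 - s\<close> is dominated by
  a fixed integrable function.\<close>

lemma kern_far_le:
  fixes r :: real
  assumes r: "0 < r" and \<delta>: "0 < \<delta>" "\<delta> \<le> 1"
  obtains C where "C < top" "\<And>s. 1 / 2 \<le> s \<Longrightarrow> s \<le> 1 \<Longrightarrow>
    (\<integral>\<^sup>+z. ennreal (kern r s z) * indicator (far \<delta>) z \<partial>(lborel :: (real ^ 'n) measure)) \<le> ennreal (1 - s) * C"
proof -
  let ?I = "\<integral>\<^sup>+z. ennreal (norm z powr (- real CARD('n) - r / 2)) * indicator {z. \<delta> < norm z} z \<partial>(lborel :: (real ^ 'n) measure)"
  let ?C = "ennreal (\<delta> powr (- (r / 2))) * ?I"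
  have I: "?I < top" using nn_integral_norm_powr_outside[of "r / 2" \<delta>, where 'a="real ^ 'n"] r \<delta> by simp
  have le: "(\<integral>\<^sup>+z. ennreal (kern r s z) * indicator (far \<delta>) z \<partial>(lborel :: (real ^ 'n) measure)) \<le> ennreal (1 - s) * ?C"
    if s: "1 / 2 \<le> s" "s \<le> 1" for s
  proof -
    have "(\<integral>\<^sup>+z. ennreal (kern r s z) * indicator (far \<delta>) z \<partial>(lborel :: (real ^ 'n) measure)) \<le>
       (\<integral>\<^sup>+z. ennreal ((1 - s) * \<delta> powr (- (r / 2))) * (ennreal (norm z powr (- real CARD('n) - r / 2)) * indicator {z. \<delta> < norm z} z) \<partial>(lborel :: (real ^ 'n) measure))"
    proof (rule nn_integral_mono)
      fix z :: "real ^ 'n"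
      show "ennreal (kern r s z) * indicator (far \<delta>) z \<le> ennreal ((1 - s) * \<delta> powr (- (r / 2))) * (ennreal (norm z powr (- real CARD('n) - r / 2)) * indicator {z. \<delta> < norm z} z)"
      proof (cases "\<delta> < norm z")
        case True
        have "norm z powr (- real CARD('n) - s * r) = norm z powr (- (s - 1 / 2) * r) * norm z powr (- real CARD('n) - r / 2)"
          unfolding powr_add[symmetric] by (rule arg_cong[where f="(powr) (norm z)"]) (simp add: algebra_simps)
        also have "\<dots> \<le> \<delta> powr (- (r / 2)) * norm z powr (- real CARD('n) - r / 2)"
        proof (rule mult_right_mono)
          have "norm z powr (- (s - 1 / 2) * r) \<le> \<delta> powr (- (s - 1 / 2) * r)"
          proof (rule powr_mono2')
            show "- (s - 1 / 2) * r \<le> 0" using s r by (intro mult_nonpos_nonneg) auto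
          qed (use True \<delta> in auto)
          also have "\<dots> \<le> \<delta> powr (- (r / 2))"
          proof (rule powr_mono')
            have "(s - 1 / 2) * r \<le> 1 / 2 * r" using s r by (intro mult_right_mono) auto
            then show "- (r / 2) \<le> - (s - 1 / 2) * r" unfolding mult_minus_left by simp
          qed (use \<delta> in auto)
          finally show "norm z powr (- (s - 1 / 2) * r) \<le> \<delta> powr (- (r / 2))" .
        qed simp
        finally have "kern r s z \<le> (1 - s) * \<delta> powr (- (r / 2)) * norm z powr (- real CARD('n) - r / 2)"
          unfolding kern_def mult.assoc using s by (intro mult_left_mono) auto
        then show ?thesis using True s by (simp add: far_def ennreal_mult[symmetric] ennreal_leI)
      qed (simp add: far_def)
    qed
    also have "\<dots> = ennreal ((1 - s) * \<delta> powr (- (r / 2))) * ?I" by (rule nn_integral_cmult) measurable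
    also have "\<dots> = ennreal (1 - s) * ?C" using s by (simp add: ennreal_mult mult.assoc)
    finally show ?thesis .
  qed
  have "?C < top" using I by (simp add: ennreal_mult_less_top)
  then show thesis using that le by blast
qed

section \<open>Squeezing\<close>

text \<open>The hypothesis allows a multiplicative error \<open>(1 - \<theta>) powr (1 - r)\<close> and an
  additive error \<open>e\<close> that can be chosen independently. Both are removed after passing
  to the upper and lower limit in \<open>s\<close>.\<close>

lemma ennreal_squeeze_tendsto:
  fixes E :: "real \<Rightarrow> ennreal"
  assumes L: "L < top"
    and H: "\<And>\<theta> e. 0 < \<theta> \<Longrightarrow> \<theta> < 1 \<Longrightarrow> 0 < e \<Longrightarrow> \<exists>D F. (D \<longlongrightarrow> 1) (at_left 1) \<and> (F \<longlongrightarrow> 0) (at_left 1) \<and>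
      (\<forall>\<^sub>F s in at_left 1. E s \<le> ennreal ((1 - \<theta>) powr (1 - r)) * (ennreal (D s) * L) + ennreal e + F s \<and>
         ennreal (D s) * L \<le> ennreal ((1 - \<theta>) powr (1 - r)) * E s + ennreal e)"
  shows "(E \<longlongrightarrow> L) (at_left 1)"
proof -
  let ?c = "\<lambda>\<theta>. ennreal ((1 - \<theta>) powr (1 - r))"
  let ?S = "Limsup (at_left 1) E" and ?I = "Liminf (at_left 1) E"
  have nb: "at_left (1::real) \<noteq> bot" by simp
  have main: "?S \<le> ?c \<theta> * L \<and> L \<le> ?c \<theta> * ?I" if \<theta>: "0 < \<theta>" "\<theta> < 1" for \<theta>
  proof -
    have c: "?c \<theta> < top" by simp
    have *: "?S \<le> ?c \<theta> * L + ennreal e \<and> L \<le> ?c \<theta> * ?I + ennreal e" if e: "0 < e" for e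
    proof -
      obtain D F where D: "(D \<longlongrightarrow> 1) (at_left 1)" and F: "(F \<longlongrightarrow> 0) (at_left 1)"
        and ev: "\<forall>\<^sub>F s in at_left 1. E s \<le> ?c \<theta> * (ennreal (D s) * L) + ennreal e + F s \<and>
         ennreal (D s) * L \<le> ?c \<theta> * E s + ennreal e"
        using H[OF \<theta> e] by blast
      have DL: "((\<lambda>s. ennreal (D s) * L) \<longlongrightarrow> ennreal 1 * L) (at_left 1)"
        using L by (intro tendsto_mult_ennreal tendsto_ennrealI D tendsto_const) auto
      have "((\<lambda>s. ?c \<theta> * (ennreal (D s) * L) + ennreal e + F s) \<longlongrightarrow> ?c \<theta> * (ennreal 1 * L) + ennreal e + 0) (at_left 1)"
        using L by (intro tendsto_add tendsto_mult_ennreal DL F tendsto_const) auto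
      then have lim: "Limsup (at_left 1) (\<lambda>s. ?c \<theta> * (ennreal (D s) * L) + ennreal e + F s) = ?c \<theta> * L + ennreal e"
        using lim_imp_Limsup[OF nb] by simp
      have "?S \<le> Limsup (at_left 1) (\<lambda>s. ?c \<theta> * (ennreal (D s) * L) + ennreal e + F s)"
        by (rule Limsup_mono) (use ev in \<open>auto elim: eventually_mono\<close>)
      then have 1: "?S \<le> ?c \<theta> * L + ennreal e" unfolding lim .
      have "Liminf (at_left 1) (\<lambda>s. ennreal (D s) * L) = L"
        using lim_imp_Liminf[OF nb DL] by simp
      moreover have "Liminf (at_left 1) (\<lambda>s. ennreal (D s) * L) \<le> Liminf (at_left 1) (\<lambda>s. ?c \<theta> * E s + ennreal e)"
        by (rule Liminf_mono) (use ev in \<open>auto elim: eventually_mono\<close>)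
      moreover have "Liminf (at_left 1) (\<lambda>s. (\<lambda>x. ?c \<theta> * x + ennreal e) (E s)) = (\<lambda>x. ?c \<theta> * x + ennreal e) ?I"
      proof (rule Liminf_compose_continuous_mono[OF _ _ nb])
        show "continuous_on UNIV (\<lambda>x. ?c \<theta> * x + ennreal e)"
          by (intro continuous_on_add_ennreal ennreal_continuous_on_cmult c continuous_on_id continuous_on_const)
        show "mono (\<lambda>x. ?c \<theta> * x + ennreal e)" by (intro monoI add_right_mono mult_left_mono) auto
      qed
      ultimately have 2: "L \<le> ?c \<theta> * ?I + ennreal e" by simp
      show ?thesis using 1 2 by blast
    qed
    show ?thesis
    proof
      show "?S \<le> ?c \<theta> * L" by (rule ennreal_le_epsilon) (use * in blast)
      show "L \<le> ?c \<theta> * ?I" by (rule ennreal_le_epsilon) (use * in blast)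
    qed
  qed
  have "((\<lambda>\<theta>. (1 - \<theta>) powr (1 - r)) \<longlongrightarrow> (1 - 0) powr (1 - r)) (at_right (0::real))"
    by (intro tendsto_intros) auto
  from tendsto_ennrealI[OF this] have c1: "(?c \<longlongrightarrow> 1) (at_right 0)" by simp
  have ev: "\<forall>\<^sub>F \<theta>::real in at_right 0. 0 < \<theta> \<and> \<theta> < 1"
    by (auto simp: eventually_at_right_field intro!: exI[of _ 1])
  have up: "?S \<le> L"
  proof -
    have "((\<lambda>\<theta>. ?c \<theta> * L) \<longlongrightarrow> 1 * L) (at_right 0)"
      using L by (intro tendsto_mult_ennreal c1 tendsto_const) auto
    moreover have "\<forall>\<^sub>F \<theta> in at_right 0. ?S \<le> ?c \<theta> * L" using ev by eventually_elim (use main in auto)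
    ultimately have "?S \<le> 1 * L" by (intro tendsto_lowerbound[of _ "1 * L" "at_right 0"]) auto
    then show ?thesis by simp
  qed
  have "?I \<le> ?S" by (rule Liminf_le_Limsup[OF nb])
  then have Ifin: "?I < top" using up L by (meson order_le_less_trans order_trans)
  have lo: "L \<le> ?I"
  proof -
    have "((\<lambda>\<theta>. ?c \<theta> * ?I) \<longlongrightarrow> 1 * ?I) (at_right 0)"
      using Ifin by (intro tendsto_mult_ennreal c1 tendsto_const) auto
    moreover have "\<forall>\<^sub>F \<theta> in at_right 0. L \<le> ?c \<theta> * ?I" using ev by eventually_elim (use main in auto)
    ultimately have "L \<le> 1 * ?I" by (intro tendsto_lowerbound[of _ "1 * ?I" "at_right 0"]) auto
    then show ?thesis by simp
  qed
  have "?S = L" "?I = L" using up lo \<open>?I \<le> ?S\<close> by (auto intro: antisym order_trans)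
  then show ?thesis using tendsto_iff_Liminf_eq_Limsup[OF nb] by blast
qed

section \<open>The limit for a weight depending on one variable\<close>

definition increment :: "(real ^ 'n \<Rightarrow> real) \<Rightarrow> real \<Rightarrow> (real ^ 'n \<Rightarrow> real) \<Rightarrow> real ^ 'n \<Rightarrow> ennreal" where
  "increment b r u z = (NBINT x. ennreal (b x * \<bar>u (x + z) - u x\<bar> powr r))"

lemma increment_measurable [measurable]:
  assumes [measurable]: "b \<in> borel_measurable borel" "u \<in> borel_measurable borel"
  shows "increment b r u \<in> borel_measurable borel"
  unfolding increment_def by (rule lborel.borel_measurable_nn_integral) measurable

text \<open>Translation invariance bounds the increments uniformly in \<open>z\<close>.\<close>

lemma increment_le:
  fixes u :: "real ^ 'n \<Rightarrow> real"
  assumes [measurable]: "b \<in> borel_measurable borel" "u \<in> borel_measurable borel"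
    and b: "\<And>x. 0 \<le> b x" "\<And>x. b x \<le> B" and r: "0 \<le> r"
  shows "increment b r u z \<le> ennreal (B * 2 powr r) * (2 * (NBINT x. ennreal (\<bar>u x\<bar> powr r)))"
proof -
  have B: "0 \<le> B" using b[of 0] by linarith
  have "increment b r u z \<le> (NBINT x. ennreal (B * 2 powr r) * (ennreal (\<bar>u (x + z)\<bar> powr r) + ennreal (\<bar>u x\<bar> powr r)))"
    unfolding increment_def
  proof (rule nn_integral_mono)
    fix x
    have "b x * \<bar>u (x + z) - u x\<bar> powr r \<le> B * (2 powr r * (\<bar>u (x + z)\<bar> powr r + \<bar>u x\<bar> powr r))"
      using b norm_diff_powr_le[OF r, of "u (x + z)" "u x"] B by (intro mult_mono) auto
    then have "ennreal (b x * \<bar>u (x + z) - u x\<bar> powr r) \<le> ennreal ((B * 2 powr r) * (\<bar>u (x + z)\<bar> powr r + \<bar>u x\<bar> powr r))"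
      by (intro ennreal_leI) (simp add: mult.assoc)
    then show "ennreal (b x * \<bar>u (x + z) - u x\<bar> powr r) \<le> ennreal (B * 2 powr r) * (ennreal (\<bar>u (x + z)\<bar> powr r) + ennreal (\<bar>u x\<bar> powr r))"
      using B by (simp add: ennreal_mult ennreal_plus)
  qed
  also have "\<dots> = ennreal (B * 2 powr r) * ((NBINT x. ennreal (\<bar>u (x + z)\<bar> powr r)) + (NBINT x. ennreal (\<bar>u x\<bar> powr r)))"
    by (subst nn_integral_cmult, measurable, subst nn_integral_add, measurable)
  also have "(NBINT x. ennreal (\<bar>u (x + z)\<bar> powr r)) = (NBINT x. ennreal (\<bar>u x\<bar> powr r))"
    by (rule nn_integral_lborel_translate') measurable
  finally show ?thesis by (simp add: mult_2)
qed

lemma far_energy_tendsto_0: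
  fixes u :: "real ^ 'n \<Rightarrow> real"
  assumes [measurable]: "b \<in> borel_measurable borel" "u \<in> borel_measurable borel"
    and b: "\<And>x. 0 \<le> b x" "\<And>x. b x \<le> B" and r: "0 < r" and int: "integrable lborel (\<lambda>x. \<bar>u x\<bar> powr r)"
    and \<delta>: "0 < \<delta>" "\<delta> \<le> 1"
  shows "((\<lambda>s. \<integral>\<^sup>+z. ennreal (kern r s z) * increment b r u z * indicator (far \<delta>) z \<partial>lborel) \<longlongrightarrow> 0) (at_left 1)"
proof -
  let ?U = "ennreal (B * 2 powr r) * (2 * (NBINT x. ennreal (\<bar>u x\<bar> powr r)))"
  have U: "?U < top" using int by (simp add: integrable_iff_bounded ennreal_mult_less_top)
  obtain C where C: "C < top" "\<And>s. 1 / 2 \<le> s \<Longrightarrow> s \<le> 1 \<Longrightarrow>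
    (\<integral>\<^sup>+z. ennreal (kern r s z) * indicator (far \<delta>) z \<partial>(lborel :: (real ^ 'n) measure)) \<le> ennreal (1 - s) * C"
    by (rule kern_far_le[OF r \<delta>], rule that)
  have CU: "C * ?U < top" using C(1) U by (simp only: ennreal_mult_less_top) simp
  have "((\<lambda>s. ennreal (1 - s) * (C * ?U)) \<longlongrightarrow> ennreal (1 - 1) * (C * ?U)) (at_left 1)"
  proof (rule tendsto_mult_ennreal[OF _ tendsto_const])
    have "((\<lambda>s::real. 1 - s) \<longlongrightarrow> 1 - 1) (at_left 1)" by (intro tendsto_intros)
    then show "((\<lambda>s::real. ennreal (1 - s)) \<longlongrightarrow> ennreal (1 - 1)) (at_left 1)" by (rule tendsto_ennrealI)
  qed (use CU in \<open>auto simp del: ennreal_mult_eq_top_iff\<close>)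
  then have lim: "((\<lambda>s. ennreal (1 - s) * (C * ?U)) \<longlongrightarrow> 0) (at_left 1)" by simp
  show ?thesis
  proof (rule tendsto_sandwich[OF _ _ tendsto_const lim])
    show "\<forall>\<^sub>F s in at_left 1. (NBINT z. ennreal (kern r s z) * increment b r u z * indicator (far \<delta>) z) \<le> ennreal (1 - s) * (C * ?U)"
      unfolding eventually_at_left_field
    proof (intro exI[of _ "1 / 2"] conjI allI impI)
      fix s :: real assume s: "1 / 2 < s" "s < 1"
      have "(NBINT z. ennreal (kern r s z) * increment b r u z * indicator (far \<delta>) z) \<le>
         (\<integral>\<^sup>+z. ennreal (kern r s z) * indicator (far \<delta>) z * ?U \<partial>(lborel :: (real ^ 'n) measure))"
      proof (rule nn_integral_mono)
        fix z :: "real ^ 'n"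
        have "increment b r u z \<le> ?U" using r by (intro increment_le b) auto
        then show "ennreal (kern r s z) * increment b r u z * indicator (far \<delta>) z \<le> ennreal (kern r s z) * indicator (far \<delta>) z * ?U"
          by (auto simp: indicator_def intro: mult_left_mono)
      qed
      also have "\<dots> = (\<integral>\<^sup>+z. ennreal (kern r s z) * indicator (far \<delta>) z \<partial>(lborel :: (real ^ 'n) measure)) * ?U"
        by (rule nn_integral_multc) measurable
      also have "\<dots> \<le> (ennreal (1 - s) * C) * ?U" using s by (intro mult_right_mono C(2)) auto
      finally show "(NBINT z. ennreal (kern r s z) * increment b r u z * indicator (far \<delta>) z) \<le> ennreal (1 - s) * (C * ?U)"
        by (simp add: mult.assoc)
    qed simp
  qed simp
qed

text \<open>On a small ball the increment and its linearization differ by the Taylor remainder, which costs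
  \<open>\<epsilon>\<close> times a quantity bounded in \<open>s\<close>; the linearization is
  integrated exactly.\<close>

theorem weighted_energy_tendsto:
  fixes u :: "real ^ 'n \<Rightarrow> real" and k :: 'n
  assumes S: "sobolev_pair r u g" and r: "1 < r"
    and mb[measurable]: "b \<in> borel_measurable borel" and b: "\<And>x. 0 \<le> b x" "\<And>x. b x \<le> B"
  shows "((\<lambda>s. \<integral>\<^sup>+z. ennreal (kern r s z) * increment b r u z \<partial>lborel) \<longlongrightarrow>
     K_const k r * (NBINT x. ennreal (b x * norm (g x) powr r))) (at_left 1)"
proof (rule ennreal_squeeze_tendsto[where r=r])
  have mu[measurable]: "u \<in> borel_measurable borel" and mg[measurable]: "g \<in> borel_measurable borel"
    and intu: "integrable lborel (\<lambda>x. \<bar>u x\<bar> powr r)" and intg: "integrable lborel (\<lambda>x. norm (g x) powr r)"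
    using S unfolding sobolev_pair_def by auto
  have B: "0 \<le> B" using b[of 0] by linarith
  have r0: "0 < r" using r by simp
  let ?L = "K_const k r * (NBINT x. ennreal (b x * norm (g x) powr r))"
  have "(NBINT x. ennreal (b x * norm (g x) powr r)) \<le> (NBINT x. ennreal B * ennreal (norm (g x) powr r))"
    using b B by (intro nn_integral_mono) (auto simp: ennreal_mult[symmetric] intro!: ennreal_leI mult_right_mono)
  also have "\<dots> < top" using intg by (simp add: nn_integral_cmult integrable_iff_bounded ennreal_mult_less_top)
  finally show L: "?L < top" using K_const_finite[OF r, of k] by (simp add: ennreal_mult_less_top)
  fix \<theta> e :: real assume \<theta>: "0 < \<theta>" "\<theta> < 1" and e: "0 < e"
  let ?c1 = "(1 - \<theta>) powr (1 - r)" and ?c2 = "\<theta> powr (1 - r)"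
  define W where "W = 1 / r * measure (cone_measure :: (real ^ 'n) measure) UNIV"
  have W0: "0 \<le> W" using r by (simp add: W_def)
  have W: "ennreal (1 / r) * emeasure (cone_measure :: (real ^ 'n) measure) UNIV = ennreal W"
    using r by (simp add: W_def cone.emeasure_eq_measure ennreal_mult[symmetric])
  define \<epsilon> where "\<epsilon> = e / (?c2 * B * W + 1)"
  have den: "0 < ?c2 * B * W + 1" using B W0 by (intro add_nonneg_pos mult_nonneg_nonneg) auto
  have \<epsilon>: "0 < \<epsilon>" using e den by (simp add: \<epsilon>_def)
  have \<epsilon>le: "?c2 * B * (\<epsilon> * W) \<le> e"
  proof -
    have "?c2 * B * (\<epsilon> * W) = e * (?c2 * B * W / (?c2 * B * W + 1))" by (simp add: \<epsilon>_def)
    also have "\<dots> \<le> e * 1" using e den by (intro mult_left_mono) (auto simp: divide_le_eq)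
    finally show ?thesis by simp
  qed
  obtain \<delta>0 where \<delta>0: "0 < \<delta>0" "\<And>z. norm z \<le> \<delta>0 \<Longrightarrow>
    (NBINT x. ennreal (\<bar>u (x + z) - u x - g x \<bullet> z\<bar> powr r)) \<le> ennreal (\<epsilon> * norm z powr r)"
    using sobolev_taylor_remainder[OF S r \<epsilon>] by blast
  define \<delta> where "\<delta> = min \<delta>0 1"
  have \<delta>: "0 < \<delta>" "\<delta> \<le> 1" "\<delta> \<le> \<delta>0" using \<delta>0 by (auto simp: \<delta>_def)
  define R where "R z = (NBINT x. ennreal (\<bar>u (x + z) - u x - g x \<bullet> z\<bar> powr r))" for z
  define N where "N z = (NBINT x. ennreal (b x * \<bar>g x \<bullet> z\<bar> powr r))" for z
  have [measurable]: "R \<in> borel_measurable borel" unfolding R_def by (rule lborel.borel_measurable_nn_integral) measurable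
  have [measurable]: "N \<in> borel_measurable borel" unfolding N_def by (rule lborel.borel_measurable_nn_integral) measurable
  \<comment> \<open>Applied in both directions: the increment and its linearization exchange their roles as \<open>P\<close> and \<open>Q\<close>.\<close>
  have split: "(NBINT x. ennreal (b x * P x powr r)) \<le> ennreal ?c1 * (NBINT x. ennreal (b x * Q x powr r)) + ennreal (?c2 * B) * R z"
    if PQ: "\<And>x. 0 \<le> P x" "\<And>x. 0 \<le> Q x" "\<And>x. P x \<le> Q x + \<bar>u (x + z) - u x - g x \<bullet> z\<bar>"
      and Q[measurable]: "Q \<in> borel_measurable borel" for P Q z
  proof -
    have "(NBINT x. ennreal (b x * P x powr r)) \<le>
       (NBINT x. ennreal ?c1 * ennreal (b x * Q x powr r) + ennreal (?c2 * B) * ennreal (\<bar>u (x + z) - u x - g x \<bullet> z\<bar> powr r))"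
    proof (rule nn_integral_mono)
      fix x
      let ?d = "\<bar>u (x + z) - u x - g x \<bullet> z\<bar>"
      have "P x powr r \<le> (Q x + ?d) powr r" using r PQ by (intro powr_mono2) auto
      also have "\<dots> \<le> ?c1 * Q x powr r + ?c2 * ?d powr r" using PQ r \<theta> by (intro powr_add_le) auto
      finally have "b x * P x powr r \<le> b x * (?c1 * Q x powr r + ?c2 * ?d powr r)"
        using b(1) by (rule mult_left_mono)
      also have "\<dots> = ?c1 * (b x * Q x powr r) + b x * (?c2 * ?d powr r)" by (simp add: algebra_simps)
      also have "b x * (?c2 * ?d powr r) \<le> B * (?c2 * ?d powr r)" using b by (intro mult_right_mono) auto
      finally have "b x * P x powr r \<le> ?c1 * (b x * Q x powr r) + ?c2 * B * ?d powr r" by (simp add: mult_ac)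
      then have "ennreal (b x * P x powr r) \<le> ennreal (?c1 * (b x * Q x powr r) + ?c2 * B * ?d powr r)" by (rule ennreal_leI)
      also have "\<dots> = ennreal (?c1 * (b x * Q x powr r)) + ennreal (?c2 * B * ?d powr r)"
        using b(1)[of x] B by (intro ennreal_plus) auto
      also have "\<dots> = ennreal ?c1 * ennreal (b x * Q x powr r) + ennreal (?c2 * B) * ennreal (?d powr r)"
        using b(1)[of x] B by (simp add: ennreal_mult)
      finally show "ennreal (b x * P x powr r) \<le> ennreal ?c1 * ennreal (b x * Q x powr r) + ennreal (?c2 * B) * ennreal (?d powr r)" .
    qed
    also have "\<dots> = ennreal ?c1 * (NBINT x. ennreal (b x * Q x powr r)) + ennreal (?c2 * B) * R z"
      unfolding R_def
      by (subst nn_integral_add, measurable, subst nn_integral_cmult, measurable, subst nn_integral_cmult, measurable)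
    finally show ?thesis .
  qed
  have up: "increment b r u z \<le> ennreal ?c1 * N z + ennreal (?c2 * B) * R z" for z
    unfolding increment_def N_def by (rule split) auto
  have lo: "N z \<le> ennreal ?c1 * increment b r u z + ennreal (?c2 * B) * R z" for z
    unfolding increment_def N_def by (rule split) auto
  let ?E = "\<lambda>s. \<integral>\<^sup>+z. ennreal (kern r s z) * increment b r u z \<partial>lborel"
  let ?F = "\<lambda>s. \<integral>\<^sup>+z. ennreal (kern r s z) * increment b r u z * indicator (far \<delta>) z \<partial>lborel"
  let ?Nr = "\<lambda>s. \<integral>\<^sup>+z. ennreal (kern r s z) * increment b r u z * indicator (near \<delta>) z \<partial>lborel"
  let ?D = "\<lambda>s. \<delta> powr (r * (1 - s))"
  show "\<exists>D F. (D \<longlongrightarrow> 1) (at_left 1) \<and> (F \<longlongrightarrow> 0) (at_left 1) \<and>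
      (\<forall>\<^sub>F s in at_left 1. ?E s \<le> ennreal ?c1 * (ennreal (D s) * ?L) + ennreal e + F s \<and>
         ennreal (D s) * ?L \<le> ennreal ?c1 * ?E s + ennreal e)"
  proof (intro exI[of _ ?D] exI[of _ ?F] conjI)
    have "(?D \<longlongrightarrow> \<delta> powr (r * (1 - 1))) (at_left 1)" using \<delta> by (intro tendsto_intros) auto
    then show "(?D \<longlongrightarrow> 1) (at_left 1)" using \<delta> by simp
    show "(?F \<longlongrightarrow> 0) (at_left 1)" by (rule far_energy_tendsto_0[OF mb mu b r0 intu \<delta>(1,2)])
    show "\<forall>\<^sub>F s in at_left 1. ?E s \<le> ennreal ?c1 * (ennreal (?D s) * ?L) + ennreal e + ?F s \<and>
         ennreal (?D s) * ?L \<le> ennreal ?c1 * ?E s + ennreal e"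
      unfolding eventually_at_left_field
    proof (rule exI[of _ 0], intro conjI allI impI)
      fix s :: real assume s: "0 < s" "s < 1"
      have D1: "?D s \<le> 1"
      proof -
        have "\<delta> powr (r * (1 - s)) \<le> 1 powr (r * (1 - s))" using \<delta> r s by (intro powr_mono2) auto
        then show ?thesis by simp
      qed
      have kN: "(NBINT z. ennreal (kern r s z) * N z * indicator (near \<delta>) z) = ennreal (?D s) * ?L"
      proof -
        have "(NBINT z. ennreal (kern r s z) * N z * indicator (near \<delta>) z) =
          (NBINT z. NBINT x. ennreal (b x) * (ennreal (kern r s z) * ennreal (\<bar>g x \<bullet> z\<bar> powr r) * indicator (near \<delta>) z))"
        proof (rule nn_integral_cong)
          fix z :: "real ^ 'n"
          have "ennreal (kern r s z) * N z * indicator (near \<delta>) z = (ennreal (kern r s z) * indicator (near \<delta>) z) * N z"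
            by (simp add: mult_ac)
          also have "\<dots> = (NBINT x. (ennreal (kern r s z) * indicator (near \<delta>) z) * ennreal (b x * \<bar>g x \<bullet> z\<bar> powr r))"
            unfolding N_def by (rule nn_integral_cmult[symmetric]) measurable
          also have "\<dots> = (NBINT x. ennreal (b x) * (ennreal (kern r s z) * ennreal (\<bar>g x \<bullet> z\<bar> powr r) * indicator (near \<delta>) z))"
            using b by (simp add: ennreal_mult mult_ac)
          finally show "ennreal (kern r s z) * N z * indicator (near \<delta>) z =
            (NBINT x. ennreal (b x) * (ennreal (kern r s z) * ennreal (\<bar>g x \<bullet> z\<bar> powr r) * indicator (near \<delta>) z))" .
        qed
        also have "\<dots> = (NBINT x. NBINT z. ennreal (b x) * (ennreal (kern r s z) * ennreal (\<bar>g x \<bullet> z\<bar> powr r) * indicator (near \<delta>) z))"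
          by (rule lborel_pair.Fubini') measurable
        also have "\<dots> = (NBINT x. (ennreal (?D s) * K_const k r) * ennreal (b x * norm (g x) powr r))"
        proof (rule nn_integral_cong)
          fix x
          have "(NBINT z. ennreal (b x) * (ennreal (kern r s z) * ennreal (\<bar>g x \<bullet> z\<bar> powr r) * indicator (near \<delta>) z)) =
             ennreal (b x) * (NBINT z. ennreal (kern r s z) * ennreal (\<bar>g x \<bullet> z\<bar> powr r) * indicator (near \<delta>) z)"
            by (rule nn_integral_cmult) measurable
          also have "\<dots> = ennreal (b x) * (ennreal (?D s) * (K_const k r * ennreal (norm (g x) powr r)))"
            by (simp only: nn_integral_kern_near_directional[OF r0 s(2) \<delta>(1), where k=k])
          also have "\<dots> = (ennreal (?D s) * K_const k r) * ennreal (b x * norm (g x) powr r)"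
            using b(1)[of x] by (simp add: ennreal_mult mult_ac)
          finally show "(NBINT z. ennreal (b x) * (ennreal (kern r s z) * ennreal (\<bar>g x \<bullet> z\<bar> powr r) * indicator (near \<delta>) z)) =
            (ennreal (?D s) * K_const k r) * ennreal (b x * norm (g x) powr r)" .
        qed
        also have "\<dots> = (ennreal (?D s) * K_const k r) * (NBINT x. ennreal (b x * norm (g x) powr r))"
          by (rule nn_integral_cmult) measurable
        finally show ?thesis by (simp add: mult.assoc)
      qed
      have kR: "ennreal (?c2 * B) * (NBINT z. ennreal (kern r s z) * R z * indicator (near \<delta>) z) \<le> ennreal e"
      proof -
        have "(NBINT z. ennreal (kern r s z) * R z * indicator (near \<delta>) z) \<le>
          (\<integral>\<^sup>+z. ennreal \<epsilon> * (ennreal (kern r s z) * ennreal (norm z powr r) * indicator (near \<delta>) z) \<partial>(lborel :: (real ^ 'n) measure))"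
        proof (rule nn_integral_mono)
          fix z :: "real ^ 'n"
          show "ennreal (kern r s z) * R z * indicator (near \<delta>) z \<le> ennreal \<epsilon> * (ennreal (kern r s z) * ennreal (norm z powr r) * indicator (near \<delta>) z)"
          proof (cases "z \<in> near \<delta>")
            case True
            then have "R z \<le> ennreal (\<epsilon> * norm z powr r)" unfolding R_def using \<delta> by (intro \<delta>0(2)) (auto simp: near_def)
            then have "ennreal (kern r s z) * R z \<le> ennreal (kern r s z) * (ennreal \<epsilon> * ennreal (norm z powr r))"
              using \<epsilon> by (intro mult_left_mono) (auto simp: ennreal_mult)
            then show ?thesis using True by (simp add: mult_ac)
          qed simp
        qed
        also have "\<dots> = ennreal \<epsilon> * (ennreal (?D s) * ennreal W)"
          by (subst nn_integral_cmult, measurable) (simp add: nn_integral_kern_near_norm[OF r0 s(2) \<delta>(1)] W)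
        also have "\<dots> \<le> ennreal \<epsilon> * (ennreal 1 * ennreal W)" using D1 by (intro mult_left_mono mult_right_mono ennreal_leI) auto
        also have "\<dots> = ennreal (\<epsilon> * W)" using \<epsilon> W0 by (simp add: ennreal_mult)
        finally have "ennreal (?c2 * B) * (NBINT z. ennreal (kern r s z) * R z * indicator (near \<delta>) z) \<le> ennreal (?c2 * B) * ennreal (\<epsilon> * W)"
          by (rule mult_left_mono) simp
        also have "\<dots> = ennreal (?c2 * B * (\<epsilon> * W))" using B \<epsilon> W0 by (intro ennreal_mult[symmetric]) auto
        also have "\<dots> \<le> ennreal e" by (rule ennreal_leI[OF \<epsilon>le])
        finally show ?thesis .
      qed
      have comb: "(NBINT z. ennreal (kern r s z) * X z * indicator (near \<delta>) z) \<le>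
         ennreal ?c1 * (NBINT z. ennreal (kern r s z) * Y z * indicator (near \<delta>) z) + ennreal e"
        if XY: "\<And>z. X z \<le> ennreal ?c1 * Y z + ennreal (?c2 * B) * R z" and Y[measurable]: "Y \<in> borel_measurable borel" for X Y
      proof -
        have "(NBINT z. ennreal (kern r s z) * X z * indicator (near \<delta>) z) \<le>
          (NBINT z. ennreal ?c1 * (ennreal (kern r s z) * Y z * indicator (near \<delta>) z) + ennreal (?c2 * B) * (ennreal (kern r s z) * R z * indicator (near \<delta>) z))"
        proof (rule nn_integral_mono)
          fix z
          have "ennreal (kern r s z) * X z \<le> ennreal (kern r s z) * (ennreal ?c1 * Y z + ennreal (?c2 * B) * R z)"
            by (rule mult_left_mono[OF XY]) simp
          then show "ennreal (kern r s z) * X z * indicator (near \<delta>) z \<le> ennreal ?c1 * (ennreal (kern r s z) * Y z * indicator (near \<delta>) z) + ennreal (?c2 * B) * (ennreal (kern r s z) * R z * indicator (near \<delta>) z)"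
            by (auto simp: indicator_def distrib_left mult_ac)
        qed
        also have "\<dots> = ennreal ?c1 * (NBINT z. ennreal (kern r s z) * Y z * indicator (near \<delta>) z) +
            ennreal (?c2 * B) * (NBINT z. ennreal (kern r s z) * R z * indicator (near \<delta>) z)"
          by (subst nn_integral_add, measurable, subst nn_integral_cmult, measurable, subst nn_integral_cmult, measurable)
        finally show ?thesis using kR by (meson add_left_mono order_trans)
      qed
      have tot: "?E s = ?Nr s + ?F s" using \<delta>(1) by (intro nn_integral_near_far) measurable
      have "?Nr s \<le> ennreal ?c1 * (ennreal (?D s) * ?L) + ennreal e"
        using comb[OF up] kN by simp
      then show "?E s \<le> ennreal ?c1 * (ennreal (?D s) * ?L) + ennreal e + ?F s"
        unfolding tot by (rule add_right_mono)
      have "ennreal (?D s) * ?L \<le> ennreal ?c1 * ?Nr s + ennreal e"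
        using comb[OF lo] kN by simp
      also have "\<dots> \<le> ennreal ?c1 * ?E s + ennreal e"
        unfolding tot by (intro add_right_mono mult_left_mono) auto
      finally show "ennreal (?D s) * ?L \<le> ennreal ?c1 * ?E s + ennreal e" .
    qed simp
  qed
qed

section \<open>Weak compactness through a strictly convex functional\<close>

text \<open>A strictly convex function of linear growth. As the length of the vector \<open>(1, a)\<close> it
  admits an explicit estimate of its convexity.\<close>

definition lift :: "real \<Rightarrow> real" where
  "lift a = sqrt (1 + a\<^sup>2)"

lemma lift_ge_1: "1 \<le> lift a"
  by (simp add: lift_def)

lemma lift_le: "lift a \<le> 1 + \<bar>a\<bar>"
  unfolding lift_def by (rule real_le_lsqrt) (auto simp: power2_sum)

lemma lift_power2: "(lift a)\<^sup>2 = 1 + a\<^sup>2"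
  unfolding lift_def by (simp add: add_nonneg_nonneg)

definition midgap :: "real \<Rightarrow> real \<Rightarrow> real" where
  "midgap a b = lift a + lift b - 2 * lift ((a + b) / 2)"

text \<open>A quantitative form of the triangle inequality for the vectors \<open>(1, a)\<close> and \<open>(1,
  b)\<close>, whose determinant is \<open>b - a\<close>.\<close>

lemma midgap_ge: "(a - b)\<^sup>2 / (lift a + lift b) ^ 3 \<le> midgap a b"
proof -
  define A B C where "A = lift a" and "B = lift b" and "C = 2 * lift ((a + b) / 2)"
  have A: "1 \<le> A" "A\<^sup>2 = 1 + a\<^sup>2" and B: "1 \<le> B" "B\<^sup>2 = 1 + b\<^sup>2"
    by (simp_all add: A_def B_def lift_ge_1 lift_power2)
  have C: "2 \<le> C" "C\<^sup>2 = 4 + (a + b)\<^sup>2"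
    using lift_ge_1[of "(a + b) / 2"] by (simp_all add: C_def power_mult_distrib lift_power2 power_divide)
  have AB: "A * B \<le> (A + B)\<^sup>2 / 4" using zero_le_power2[of "A - B"] by (simp add: power2_eq_square algebra_simps)
  have prod: "(A * B)\<^sup>2 = (1 + a * b)\<^sup>2 + (a - b)\<^sup>2"
    unfolding power_mult_distrib A(2) B(2) by (simp add: power2_eq_square algebra_simps)
  have AB0: "0 < A * B" using A B by simp
  have ge: "\<bar>1 + a * b\<bar> \<le> A * B"
    by (rule power2_le_imp_le) (use prod AB0 in auto)
  have gap1: "(a - b)\<^sup>2 \<le> (A * B - (1 + a * b)) * (2 * (A * B))"
  proof -
    have "(a - b)\<^sup>2 = (A * B - (1 + a * b)) * (A * B + (1 + a * b))"
      using prod by (simp add: power2_eq_square algebra_simps)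
    also have "\<dots> \<le> (A * B - (1 + a * b)) * (2 * (A * B))"
      using ge by (intro mult_left_mono) auto
    finally show ?thesis .
  qed
  have sq: "(A + B)\<^sup>2 - C\<^sup>2 = 2 * (A * B - (1 + a * b))"
    unfolding C(2) power2_sum A(2) B(2) by (simp add: power2_eq_square algebra_simps)
  have "0 \<le> (A + B)\<^sup>2 - C\<^sup>2" unfolding sq using ge by (simp add: abs_le_iff)
  then have "C\<^sup>2 \<le> (A + B)\<^sup>2" by simp
  then have CAB: "C \<le> A + B" by (rule power2_le_imp_le) (use A B in auto)
  have "(a - b)\<^sup>2 \<le> ((A + B)\<^sup>2 - C\<^sup>2) * (A * B)" using gap1 unfolding sq by (simp add: algebra_simps)
  also have "\<dots> = (A + B - C) * ((A + B + C) * (A * B))" by (simp add: power2_eq_square algebra_simps)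
  also have "\<dots> \<le> (A + B - C) * ((2 * (A + B)) * ((A + B)\<^sup>2 / 4))"
    using CAB C A B AB AB0 by (intro mult_left_mono mult_mono) auto
  also have "\<dots> \<le> (A + B - C) * (A + B) ^ 3"
    using CAB A B by (intro mult_left_mono) (auto simp: power2_eq_square power3_eq_cube)
  finally have "(a - b)\<^sup>2 \<le> (A + B - C) * (A + B) ^ 3" .
  moreover have "0 < (A + B) ^ 3" using A B by simp
  ultimately show ?thesis
    by (simp add: midgap_def A_def[symmetric] B_def[symmetric] C_def[symmetric] divide_le_eq)
qed

text \<open>The square root of the distance is split so that one part is controlled by convexity and the other
  one is small for large \<open>l\<close>.\<close>

lemma sqrt_diff_le_midgap:
  assumes l: "0 < l"
  shows "sqrt \<bar>a - b\<bar> \<le> l ^ 3 * midgap a b + (lift a + lift b) / l"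
proof -
  define X where "X = lift a + lift b"
  have X: "2 \<le> X" using lift_ge_1[of a] lift_ge_1[of b] by (simp add: X_def)
  define p q where "p = l ^ 3 * ((a - b)\<^sup>2 / X ^ 3)" and "q = X / l"
  have p: "0 \<le> p" using l X by (simp add: p_def)
  have q: "0 \<le> q" using l X by (simp add: q_def)
  have "\<bar>a - b\<bar>\<^sup>2 = p * q ^ 3"
    using l X by (simp add: p_def q_def power_divide field_simps)
  also have "\<dots> \<le> (p + q) * (p + q) ^ 3" using p q by (intro mult_mono power_mono) auto
  also have "\<dots> = ((p + q)\<^sup>2)\<^sup>2" by (simp add: power2_eq_square power3_eq_cube algebra_simps)
  finally have "\<bar>a - b\<bar> \<le> (p + q)\<^sup>2" by (rule power2_le_imp_le) simp
  then have "sqrt \<bar>a - b\<bar> \<le> p + q" using p q by (intro real_le_lsqrt) auto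
  moreover have "p \<le> l ^ 3 * midgap a b"
    unfolding p_def X_def using l by (intro mult_left_mono midgap_ge) auto
  ultimately show ?thesis by (simp add: q_def X_def)
qed

lemma summable_sqrt_imp_convergent:
  fixes h :: "nat \<Rightarrow> real"
  assumes "summable (\<lambda>i. sqrt \<bar>h (Suc i) - h i\<bar>)"
  shows "convergent h"
proof -
  have "(\<lambda>i. sqrt \<bar>h (Suc i) - h i\<bar>) \<longlonglongrightarrow> 0" using assms by (rule summable_LIMSEQ_zero)
  then have "\<forall>\<^sub>F i in sequentially. sqrt \<bar>h (Suc i) - h i\<bar> < 1" by (rule order_tendstoD) simp
  then have "\<forall>\<^sub>F i in sequentially. norm (h (Suc i) - h i) \<le> sqrt \<bar>h (Suc i) - h i\<bar>"
  proof eventually_elim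
    case (elim i)
    define y where "y = sqrt \<bar>h (Suc i) - h i\<bar>"
    have y: "0 \<le> y" "y \<le> 1" "y * y = \<bar>h (Suc i) - h i\<bar>" using elim by (auto simp: y_def)
    have "y * y \<le> y * 1" using y by (intro mult_left_mono) auto
    then show ?case using y by (simp add: y_def)
  qed
  then have "summable (\<lambda>i. h (Suc i) - h i)" by (rule summable_comparison_test_ev[OF _ assms])
  then have "convergent (\<lambda>n. \<Sum>i<n. h (Suc i) - h i)" by (simp add: summable_iff_convergent)
  then have "convergent (\<lambda>n. h n - h 0)" by (simp add: sum_lessThan_telescope)
  then have "convergent (\<lambda>n. (h n - h 0) + h 0)" by (intro convergent_add convergent_const)
  then show ?thesis by simp
qed

text \<open>The infima of \<open>Q\<close> over the sets increase to a limit. Almost minimizers in sets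
  sufficiently far out have midpoints that are not much better. The rate \<open>1 / 32\<close> beats
  the factor \<open>8 ^ i\<close> that arises from \<open>sqrt_diff_le_midgap\<close> with \<open>l
  = 2 ^ i\<close>.\<close>

lemma decreasing_convex_sets_converging_selection:
  fixes \<C> :: "nat \<Rightarrow> ('a \<Rightarrow> real) set" and Q :: "('a \<Rightarrow> real) \<Rightarrow> real"
  assumes ne: "\<And>k. \<C> k \<noteq> {}" and dec: "\<And>j k. j \<le> k \<Longrightarrow> \<C> k \<subseteq> \<C> j"
    and mid: "\<And>k f g. f \<in> \<C> k \<Longrightarrow> g \<in> \<C> k \<Longrightarrow> (\<lambda>x. (f x + g x) / 2) \<in> \<C> k"
    and Q: "\<And>f. f \<in> \<C> 0 \<Longrightarrow> 0 \<le> Q f" "\<And>f. f \<in> \<C> 0 \<Longrightarrow> Q f \<le> K"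
  obtains h where "\<And>i. h i \<in> \<C> i"
    "\<And>i. Q (h i) + Q (h (Suc i)) - 2 * Q (\<lambda>x. (h i x + h (Suc i) x) / 2) \<le> (1 / 32) ^ i"
proof -
  define d where "d k = (INF f\<in>\<C> k. Q f)" for k
  have sub0: "\<C> k \<subseteq> \<C> 0" for k using dec by blast
  have bdd: "bdd_below (Q ` \<C> k)" for k
    using Q(1) sub0 by (intro bdd_belowI[of _ 0]) auto
  have dle: "d k \<le> Q f" if "f \<in> \<C> k" for f k
    unfolding d_def using that by (intro cINF_lower bdd)
  have dmono: "d j \<le> d k" if "j \<le> k" for j k
    unfolding d_def using dec[OF that] ne bdd by (intro cINF_superset_mono) auto
  have dK: "d k \<le> K" for k
  proof -
    obtain f where "f \<in> \<C> k" using ne by blast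
    then show ?thesis using dle[of f k] Q(2)[of f] sub0 by force
  qed
  have "incseq d" using dmono by (simp add: incseq_def)
  then obtain D where D: "d \<longlonglongrightarrow> D"
    using dK by (metis incseq_convergent)
  have dD: "d k \<le> D" for k using incseq_le[OF _ D] dmono by (simp add: incseq_def)
  have "\<exists>k\<ge>m. D - d k < (1 / 32) ^ i / 4" for i m
  proof -
    have "\<forall>\<^sub>F k in sequentially. D - (1 / 32) ^ i / 4 < d k" using D by (rule order_tendstoD) simp
    then have "\<forall>\<^sub>F k in sequentially. D - (1 / 32) ^ i / 4 < d k \<and> m \<le> k"
      using eventually_ge_at_top[of m] by eventually_elim simp
    then obtain k where "D - (1 / 32) ^ i / 4 < d k \<and> m \<le> k" by (auto simp: eventually_sequentially)
    then show ?thesis by (intro exI[of _ k]) auto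
  qed
  then have "\<forall>i m. \<exists>k. m \<le> k \<and> D - d k < (1 / 32) ^ i / 4" by blast
  then obtain \<kappa>0 where \<kappa>0: "\<And>i m. m \<le> \<kappa>0 i m" "\<And>i m. D - d (\<kappa>0 i m) < (1 / 32) ^ i / 4" by metis
  define \<kappa> where "\<kappa> = rec_nat (\<kappa>0 0 0) (\<lambda>i k. \<kappa>0 (Suc i) (Suc k))"
  have \<kappa>: "\<kappa> 0 = \<kappa>0 0 0" "\<And>i. \<kappa> (Suc i) = \<kappa>0 (Suc i) (Suc (\<kappa> i))" by (simp_all add: \<kappa>_def)
  have \<kappa>d: "D - d (\<kappa> i) < (1 / 32) ^ i / 4" for i by (cases i) (simp_all only: \<kappa> \<kappa>0(2))
  have \<kappa>s: "\<kappa> i < \<kappa> (Suc i)" for i using \<kappa>0(1)[of "Suc (\<kappa> i)" "Suc i"] by (simp add: \<kappa>)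
  have \<kappa>i: "i \<le> \<kappa> i" for i
  proof (induction i)
    case (Suc i)
    then show ?case using \<kappa>s[of i] by linarith
  qed simp
  have "\<exists>f\<in>\<C> (\<kappa> i). Q f < d (\<kappa> i) + (1 / 32) ^ i / 4" for i
  proof -
    have ne': "Q ` \<C> (\<kappa> i) \<noteq> {}" using ne by simp
    have "Inf (Q ` \<C> (\<kappa> i)) < d (\<kappa> i) + (1 / 32) ^ i / 4" by (simp add: d_def)
    from iffD1[OF cInf_less_iff[OF ne' bdd] this] show ?thesis by auto
  qed
  then obtain h where h: "\<And>i. h i \<in> \<C> (\<kappa> i)" "\<And>i. Q (h i) < d (\<kappa> i) + (1 / 32) ^ i / 4" by metis
  show thesis
  proof (rule that[of h])
    fix i
    show "h i \<in> \<C> i" using h(1) dec[OF \<kappa>i] by blast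
    have "h (Suc i) \<in> \<C> (\<kappa> i)" using h(1)[of "Suc i"] dec[of "\<kappa> i" "\<kappa> (Suc i)"] \<kappa>s[of i] by auto
    then have "d (\<kappa> i) \<le> Q (\<lambda>x. (h i x + h (Suc i) x) / 2)" by (intro dle mid h(1))
    moreover have "(1 / 32 :: real) ^ Suc i \<le> (1 / 32) ^ i" by (rule power_decreasing) auto
    ultimately show "Q (h i) + Q (h (Suc i)) - 2 * Q (\<lambda>x. (h i x + h (Suc i) x) / 2) \<le> (1 / 32) ^ i"
      using h(2)[of i] h(2)[of "Suc i"] \<kappa>d[of i] dD[of "\<kappa> (Suc i)"]
        zero_less_power[of "1 / 32 :: real" i]
      by linarith
  qed
qed

text \<open>The bound in \<open>L\<^sup>r\<close> makes the sequence uniformly integrable on bounded sets.\<close>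

lemma Lr_bounded_tendsto_pairing:
  fixes h :: "nat \<Rightarrow> 'a::euclidean_space \<Rightarrow> real"
  assumes mh[measurable]: "\<And>i. h i \<in> borel_measurable borel" and mg[measurable]: "g \<in> borel_measurable borel"
    and bound: "\<And>i. (NBINT x. ennreal (\<bar>h i x\<bar> powr r)) \<le> ennreal C"
    and boundg: "(NBINT x. ennreal (\<bar>g x\<bar> powr r)) \<le> ennreal C" and C: "0 \<le> C"
    and lim: "AE x in lborel. (\<lambda>i. h i x) \<longlonglongrightarrow> g x" and r: "1 < r"
    and m\<phi>[measurable]: "\<phi> \<in> borel_measurable borel" and \<phi>: "\<And>x. \<bar>\<phi> x\<bar> \<le> M" "\<And>x. R < norm x \<Longrightarrow> \<phi> x = 0" and M: "0 < M"
  shows "(\<lambda>i. LBINT x. h i x * \<phi> x) \<longlonglongrightarrow> (LBINT x. g x * \<phi> x)"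
proof -
  let ?B = "cball 0 R :: 'a set"
  have B: "?B \<in> sets borel" by simp
  have Bfin: "emeasure lborel ?B < \<infinity>" by (rule emeasure_compact_finite) simp
  have intB: "integrable lborel (indicator ?B :: 'a \<Rightarrow> real)" using Bfin by (intro integrable_real_indicator) auto
  have intr: "integrable lborel (\<lambda>x. \<bar>f x\<bar> powr r)"
    if "f \<in> borel_measurable borel" "(NBINT x. ennreal (\<bar>f x\<bar> powr r)) \<le> ennreal C" for f :: "'a \<Rightarrow> real"
    using that by (intro integrableI_bounded) (auto simp: order_le_less_trans)
  have int\<phi>: "integrable lborel (\<lambda>x. f x * \<phi> x)"
    if mf: "f \<in> borel_measurable borel" and bf: "(NBINT x. ennreal (\<bar>f x\<bar> powr r)) \<le> ennreal C" for f :: "'a \<Rightarrow> real"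
  proof (rule Bochner_Integration.integrable_bound)
    show "integrable lborel (\<lambda>x. M * (indicator ?B x + \<bar>f x\<bar> powr r))"
      using intB intr[OF that] by simp
    show "(\<lambda>x. f x * \<phi> x) \<in> borel_measurable lborel" using mf m\<phi> by simp
    show "AE x in lborel. norm (f x * \<phi> x) \<le> norm (M * (indicator ?B x + \<bar>f x\<bar> powr r))"
    proof (intro AE_I2)
      fix x
      show "norm (f x * \<phi> x) \<le> norm (M * (indicator ?B x + \<bar>f x\<bar> powr r))"
      proof (cases "x \<in> ?B")
        case True
        have "\<bar>f x\<bar> * \<bar>\<phi> x\<bar> \<le> (1 + \<bar>f x\<bar> powr r) * M"
          using r by (intro mult_mono \<phi>(1) le_one_plus_powr) auto
        then show ?thesis using True M by (simp add: abs_mult mult.commute)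
      qed (use \<phi>(2) in auto)
    qed
  qed
  show ?thesis
    unfolding LIMSEQ_iff
  proof (intro allI impI)
    fix e :: real assume e: "0 < e"
    define N where "N = (4 * M * 2 powr r * C / e + 1) powr (1 / (r - 1))"
    have base: "0 < 4 * M * 2 powr r * C / e + 1" using M C e by (intro add_nonneg_pos) auto
    have N: "0 < N" "N powr (r - 1) = 4 * M * 2 powr r * C / e + 1"
      using base r by (auto simp: N_def powr_powr)
    define F where "F i x = indicator ?B x * min \<bar>h i x - g x\<bar> N" for i x
    have mF: "F i \<in> borel_measurable lborel" for i
      unfolding F_def using B by (intro borel_measurable_times borel_measurable_indicator) auto
    have "(\<lambda>i. LBINT x. F i x) \<longlonglongrightarrow> (LINT x|(lborel :: 'a measure). 0)"
    proof (rule integral_dominated_convergence[where w="\<lambda>x. indicator ?B x * N"])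
      show "integrable lborel (\<lambda>x. indicator ?B x * N)" using intB by simp
      show "AE x in lborel. (\<lambda>i. F i x) \<longlonglongrightarrow> 0"
        using lim
      proof eventually_elim
        case (elim x)
        have "(\<lambda>i. \<bar>h i x - g x\<bar>) \<longlonglongrightarrow> 0" using elim by (simp add: LIM_zero tendsto_rabs_zero)
        then have "(\<lambda>i. indicator ?B x * min \<bar>h i x - g x\<bar> N) \<longlonglongrightarrow> indicator ?B x * min 0 N"
          by (intro tendsto_mult tendsto_min tendsto_const)
        then show ?case using N by (simp add: F_def)
      qed
      show "AE x in lborel. norm (F i x) \<le> indicator ?B x * N" for i
        using N by (intro AE_I2) (auto simp: F_def indicator_def)
    qed (use mF in auto)
    then have "\<forall>\<^sub>F i in sequentially. (LBINT x. F i x) < e / (2 * M)"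
      using e M by (intro order_tendstoD) auto
    then obtain n0 where n0: "\<And>i. n0 \<le> i \<Longrightarrow> (LBINT x. F i x) < e / (2 * M)"
      by (auto simp: eventually_sequentially)
    show "\<exists>n0. \<forall>i\<ge>n0. norm ((LBINT x. h i x * \<phi> x) - (LBINT x. g x * \<phi> x)) < e"
    proof (intro exI[of _ n0] allI impI)
      fix i assume i: "n0 \<le> i"
      let ?P = "\<lambda>x. 2 powr r * (\<bar>h i x\<bar> powr r + \<bar>g x\<bar> powr r)"
      have intP: "integrable lborel ?P" using intr[OF mh bound] intr[OF mg boundg] by simp
      have intF: "integrable lborel (F i)"
      proof (rule Bochner_Integration.integrable_bound[of _ "\<lambda>x. indicator ?B x * N"])
        show "integrable lborel (\<lambda>x. indicator ?B x * N)" using intB by simp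
        show "AE x in lborel. norm (F i x) \<le> norm (indicator ?B x * N)"
          using N by (intro AE_I2) (auto simp: F_def indicator_def)
      qed (rule mF)
      have Cr: "(LBINT x. \<bar>f x\<bar> powr r) \<le> C"
        if "f \<in> borel_measurable borel" "(NBINT x. ennreal (\<bar>f x\<bar> powr r)) \<le> ennreal C" for f :: "'a \<Rightarrow> real"
        using that(2) C nn_integral_eq_integral[OF intr[OF that]] by simp
      have pw: "\<bar>(h i x - g x) * \<phi> x\<bar> \<le> M * (F i x + ?P x / N powr (r - 1))" for x
      proof (cases "x \<in> ?B")
        case False
        then have "\<phi> x = 0" using \<phi>(2) by auto
        moreover have "0 \<le> ?P x / N powr (r - 1)" by simp
        ultimately show ?thesis using False M unfolding F_def by simp
      next
        case True
        let ?t = "\<bar>h i x - g x\<bar>"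
        have "?t \<le> min ?t N + ?t powr r / N powr (r - 1)"
        proof (cases "?t \<le> N")
          case False
          then have "N powr (r - 1) \<le> ?t powr (r - 1)" using N r by (intro powr_mono2) auto
          then have "?t * N powr (r - 1) \<le> ?t * ?t powr (r - 1)" by (intro mult_left_mono) auto
          also have "\<dots> = ?t powr r" using False N by (simp add: powr_mult_base)
          finally have "?t \<le> ?t powr r / N powr (r - 1)" using N(1) by (simp add: le_divide_eq)
          then show ?thesis using N by simp
        next
          case True
          then show ?thesis using N(1) by simp
        qed
        also have "?t powr r / N powr (r - 1) \<le> ?P x / N powr (r - 1)"
          using norm_diff_powr_le[of r "h i x" "g x"] r by (intro divide_right_mono) auto
        finally have "?t \<le> F i x + ?P x / N powr (r - 1)" using True by (simp add: F_def)
        then have "?t * \<bar>\<phi> x\<bar> \<le> (F i x + ?P x / N powr (r - 1)) * M"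
          using \<phi>(1)[of x] by (intro mult_mono) auto
        then show ?thesis by (simp add: abs_mult mult.commute)
      qed
      have "(LBINT x. h i x * \<phi> x) - (LBINT x. g x * \<phi> x) = (LBINT x. (h i x - g x) * \<phi> x)"
        using int\<phi>[OF mh bound] int\<phi>[OF mg boundg] by (simp add: left_diff_distrib)
      then have "norm ((LBINT x. h i x * \<phi> x) - (LBINT x. g x * \<phi> x)) = \<bar>LBINT x. (h i x - g x) * \<phi> x\<bar>" by simp
      also have "\<dots> \<le> (LBINT x. \<bar>(h i x - g x) * \<phi> x\<bar>)" by (rule integral_abs_bound)
      also have "\<dots> \<le> (LBINT x. M * (F i x + ?P x / N powr (r - 1)))"
      proof (rule integral_mono)
        show "integrable lborel (\<lambda>x. \<bar>(h i x - g x) * \<phi> x\<bar>)"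
          using Bochner_Integration.integrable_diff[OF int\<phi>[OF mh[of i] bound] int\<phi>[OF mg boundg]]
          by (intro integrable_abs) (simp add: left_diff_distrib)
        show "integrable lborel (\<lambda>x. M * (F i x + ?P x / N powr (r - 1)))"
          using intF intP by simp
      qed (rule pw)
      also have "\<dots> = M * ((LBINT x. F i x) + 2 powr r * ((LBINT x. \<bar>h i x\<bar> powr r) + (LBINT x. \<bar>g x\<bar> powr r)) / N powr (r - 1))"
        using intF intr[OF mh[of i] bound] intr[OF mg boundg] by simp
      also have "\<dots> < M * (e / (2 * M) + e / (2 * M))"
      proof (intro mult_strict_left_mono add_less_le_mono n0 i M)
        have "2 powr r * ((LBINT x. \<bar>h i x\<bar> powr r) + (LBINT x. \<bar>g x\<bar> powr r)) \<le> 2 powr r * (C + C)"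
          by (intro mult_left_mono add_mono Cr mh mg bound boundg) auto
        also have "\<dots> \<le> e / (2 * M) * N powr (r - 1)"
          using e M unfolding N(2) by (simp add: field_simps)
        finally show "2 powr r * ((LBINT x. \<bar>h i x\<bar> powr r) + (LBINT x. \<bar>g x\<bar> powr r)) / N powr (r - 1) \<le> e / (2 * M)"
          using N(1) by (simp add: pos_divide_le_eq)
      qed
      also have "\<dots> = e" using M by simp
      finally show "norm ((LBINT x. h i x * \<phi> x) - (LBINT x. g x * \<phi> x)) < e" .
    qed
  qed
qed

text \<open>An elementary substitute for the reflexivity of \<open>L\<^sup>r\<close>. Almost minimizers of a strictly convex functional
  over a decreasing sequence of convex sets converge almost everywhere; the sets are chosen such
  that the pairings of their elements with the functions in \<open>\<Phi>\<close> converge to \<open>T\<close>.\<close>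

theorem Lr_weak_limit:
  fixes f :: "nat \<Rightarrow> 'a::euclidean_space \<Rightarrow> real" and T :: "('a \<Rightarrow> real) \<Rightarrow> real"
  assumes mf: "\<And>j. f j \<in> borel_measurable borel" and r: "1 < r" and C: "0 \<le> C"
    and bound: "\<And>j. (NBINT x. ennreal (\<bar>f j x\<bar> powr r)) \<le> ennreal C"
    and \<Phi>: "\<And>\<phi>. \<phi> \<in> \<Phi> \<Longrightarrow> \<phi> \<in> borel_measurable borel \<and> (\<exists>M>0. \<forall>x. \<bar>\<phi> x\<bar> \<le> M) \<and> (\<exists>R. \<forall>x. R < norm x \<longrightarrow> \<phi> x = 0)"
    and lim: "\<And>\<phi>. \<phi> \<in> \<Phi> \<Longrightarrow> (\<lambda>j. LBINT x. f j x * \<phi> x) \<longlonglongrightarrow> T \<phi>"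
  obtains g where "g \<in> borel_measurable borel" "(NBINT x. ennreal (\<bar>g x\<bar> powr r)) \<le> ennreal C"
    "\<And>\<phi>. \<phi> \<in> \<Phi> \<Longrightarrow> (LBINT x. g x * \<phi> x) = T \<phi>"
proof -
  define bdd where "bdd f \<longleftrightarrow> f \<in> borel_measurable borel \<and> (NBINT x. ennreal (\<bar>f x\<bar> powr r)) \<le> ennreal C" for f :: "'a \<Rightarrow> real"
  obtain w :: "'a \<Rightarrow> real" where w: "w \<in> borel_measurable lborel" "\<And>x. 0 < w x" "\<And>x. w x \<le> 1" "integrable lborel w"
  proof -
    obtain v :: "'a \<Rightarrow> ennreal" where v[measurable]: "v \<in> borel_measurable lborel"
      and vfin: "(NBINT x. v x) \<noteq> \<infinity>" and vpos: "\<And>x. 0 < v x \<and> v x < \<infinity>"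
      using sigma_finite_measure.Ex_finite_integrable_function[OF sigma_finite_lborel] by force
    show thesis
    proof (rule that[of "\<lambda>x. min (enn2real (v x)) 1"])
      show "integrable lborel (\<lambda>x. min (enn2real (v x)) 1)"
      proof (rule integrableI_bounded)
        have "(NBINT x. ennreal (norm (min (enn2real (v x)) 1))) \<le> (NBINT x. v x)"
        proof (rule nn_integral_mono)
          fix x
          have "ennreal (norm (min (enn2real (v x)) 1)) \<le> ennreal (enn2real (v x))" by (intro ennreal_leI) simp
          also have "ennreal (enn2real (v x)) = v x" using vpos[of x] by (intro ennreal_enn2real) simp
          finally show "ennreal (norm (min (enn2real (v x)) 1)) \<le> v x" .
        qed
        then show "(NBINT x. ennreal (norm (min (enn2real (v x)) 1))) < \<infinity>"
          using vfin by (simp add: less_top order_le_less_trans)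
      qed measurable
      show "0 < min (enn2real (v x)) 1" for x using vpos[of x] by (simp add: enn2real_positive_iff)
    qed auto
  qed
  have [measurable]: "w \<in> borel_measurable borel" using w(1) by simp
  have intr: "integrable lborel (\<lambda>x. \<bar>f x\<bar> powr r)" "(LBINT x. \<bar>f x\<bar> powr r) \<le> C" if "bdd f" for f
  proof -
    show i: "integrable lborel (\<lambda>x. \<bar>f x\<bar> powr r)"
      using that unfolding bdd_def by (intro integrableI_bounded) (auto simp: order_le_less_trans)
    show "(LBINT x. \<bar>f x\<bar> powr r) \<le> C"
      using that C nn_integral_eq_integral[OF i] by (simp add: bdd_def)
  qed
  have lift_meas: "(\<lambda>x. lift (f x)) \<in> borel_measurable borel" if "f \<in> borel_measurable borel" for f :: "'a \<Rightarrow> real"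
    unfolding lift_def using that by measurable
  have wle: "w x * lift (f x) \<le> 2 * w x + \<bar>f x\<bar> powr r" for f :: "'a \<Rightarrow> real" and x
  proof -
    have "w x * lift (f x) \<le> w x * (1 + (1 + \<bar>f x\<bar> powr r))"
      using w(2)[of x] lift_le[of "f x"] le_one_plus_powr[of "\<bar>f x\<bar>" r] r by (intro mult_left_mono) auto
    moreover have "w x * \<bar>f x\<bar> powr r \<le> 1 * \<bar>f x\<bar> powr r" by (intro mult_right_mono w) auto
    ultimately show ?thesis by (simp add: algebra_simps)
  qed
  have intQ: "integrable lborel (\<lambda>x. w x * lift (f x))" if "bdd f" for f
  proof (rule Bochner_Integration.integrable_bound[of _ "\<lambda>x. 2 * w x + \<bar>f x\<bar> powr r"])
    show "integrable lborel (\<lambda>x. 2 * w x + \<bar>f x\<bar> powr r)" using w(4) intr(1)[OF that] by simp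
    show "(\<lambda>x. w x * lift (f x)) \<in> borel_measurable lborel" using lift_meas[of f] that by (simp add: bdd_def)
    show "AE x in lborel. norm (w x * lift (f x)) \<le> norm (2 * w x + \<bar>f x\<bar> powr r)"
    proof (intro AE_I2)
      fix x
      have "0 \<le> w x * lift (f x)" using w(2)[of x] lift_ge_1[of "f x"] by simp
      then show "norm (w x * lift (f x)) \<le> norm (2 * w x + \<bar>f x\<bar> powr r)" using wle[of x f] by simp
    qed
  qed
  \<comment> \<open>The integrable weight makes the functional finite on functions in \<open>L\<^sup>r\<close>.\<close>
  define Q where "Q f = (LBINT x. w x * lift (f x))" for f :: "'a \<Rightarrow> real"
  define K where "K = 2 * (LBINT x. w x) + C"
  have QK: "0 \<le> Q f \<and> Q f \<le> K" if "bdd f" for f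
  proof
    show "0 \<le> Q f" unfolding Q_def
      using w(2) lift_ge_1 by (intro integral_nonneg_AE AE_I2 mult_nonneg_nonneg) (auto intro: less_imp_le order_trans[OF zero_le_one])
    have "Q f \<le> (LBINT x. 2 * w x + \<bar>f x\<bar> powr r)"
      unfolding Q_def using w(4) intr(1)[OF that] intQ[OF that] wle by (intro integral_mono) auto
    also have "\<dots> \<le> K" using w(4) intr[OF that] by (simp add: K_def)
    finally show "Q f \<le> K" .
  qed
  \<comment> \<open>Stands for the convex hull of the tail of the sequence, as far as the pairings can tell.\<close>
  define \<C> where "\<C> k = {F. bdd F \<and> (\<forall>\<phi>\<in>\<Phi>. \<forall>e. (\<forall>j\<ge>k. \<bar>(LBINT x. f j x * \<phi> x) - T \<phi>\<bar> \<le> e) \<longrightarrow>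
      \<bar>(LBINT x. F x * \<phi> x) - T \<phi>\<bar> \<le> e)}" for k
  have bf: "bdd (f j)" for j using mf bound by (simp add: bdd_def)
  have int\<phi>: "integrable lborel (\<lambda>x. F x * \<phi> x)" if F: "bdd F" and \<phi>: "\<phi> \<in> \<Phi>" for F \<phi>
  proof -
    obtain M R where M: "0 < M" "\<And>x. \<bar>\<phi> x\<bar> \<le> M" and R: "\<And>x. R < norm x \<Longrightarrow> \<phi> x = 0" and m: "\<phi> \<in> borel_measurable borel"
      using \<Phi>[OF \<phi>] by blast
    have "integrable lborel (indicator (cball 0 R) :: 'a \<Rightarrow> real)"
      using emeasure_compact_finite[of "cball (0::'a) R"] by (intro integrable_real_indicator) auto
    then have "integrable lborel (\<lambda>x. M * (indicator (cball 0 R) x + \<bar>F x\<bar> powr r))" using intr(1)[OF F] by simp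
    then show ?thesis
    proof (rule Bochner_Integration.integrable_bound)
      have mF: "F \<in> borel_measurable borel" using F by (simp add: bdd_def)
      show "(\<lambda>x. F x * \<phi> x) \<in> borel_measurable lborel"
        by (rule borel_measurable_times) (use mF m in simp_all)
      show "AE x in lborel. norm (F x * \<phi> x) \<le> norm (M * (indicator (cball 0 R) x + \<bar>F x\<bar> powr r))"
      proof (intro AE_I2)
        fix x
        show "norm (F x * \<phi> x) \<le> norm (M * (indicator (cball 0 R) x + \<bar>F x\<bar> powr r))"
        proof (cases "norm x \<le> R")
          case True
          have "\<bar>F x\<bar> * \<bar>\<phi> x\<bar> \<le> (1 + \<bar>F x\<bar> powr r) * M" using r by (intro mult_mono M(2) le_one_plus_powr) auto
          then show ?thesis using True M(1) by (simp add: abs_mult mult.commute)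
        qed (use R in auto)
      qed
    qed
  qed
  have bmid: "bdd (\<lambda>x. (F x + G x) / 2)" if F: "bdd F" and G: "bdd G" for F G
  proof -
    have conv: "\<bar>(F x + G x) / 2\<bar> powr r \<le> (\<bar>F x\<bar> powr r + \<bar>G x\<bar> powr r) / 2" for x
    proof -
      have half: "(1 / 2 :: real) powr (1 - r) = 2 powr r / 2"
        by (simp add: powr_divide powr_diff)
      have "\<bar>F x + G x\<bar> powr r \<le> (\<bar>F x\<bar> + \<bar>G x\<bar>) powr r" using r by (intro powr_mono2) auto
      also have "\<dots> \<le> (1 - 1 / 2) powr (1 - r) * \<bar>F x\<bar> powr r + (1 / 2) powr (1 - r) * \<bar>G x\<bar> powr r"
        using r by (intro powr_add_le) auto
      finally have "\<bar>F x + G x\<bar> powr r \<le> 2 powr r * ((\<bar>F x\<bar> powr r + \<bar>G x\<bar> powr r) / 2)"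
        by (simp add: half algebra_simps add_divide_distrib)
      then show ?thesis by (simp add: powr_divide divide_le_eq mult.commute)
    qed
    have "(NBINT x. ennreal (\<bar>(F x + G x) / 2\<bar> powr r)) \<le> (NBINT x. ennreal ((\<bar>F x\<bar> powr r + \<bar>G x\<bar> powr r) / 2))"
      by (intro nn_integral_mono ennreal_leI conv)
    also have "\<dots> = ennreal (LBINT x. (\<bar>F x\<bar> powr r + \<bar>G x\<bar> powr r) / 2)"
      using intr(1)[OF F] intr(1)[OF G] by (intro nn_integral_eq_integral) auto
    also have "\<dots> \<le> ennreal C"
      using intr[OF F] intr[OF G] by (intro ennreal_leI) simp
    finally have i: "(NBINT x. ennreal (\<bar>(F x + G x) / 2\<bar> powr r)) \<le> ennreal C" .
    have "F \<in> borel_measurable borel" "G \<in> borel_measurable borel" using F G by (simp_all add: bdd_def)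
    then have "(\<lambda>x. (F x + G x) / 2) \<in> borel_measurable borel" by measurable
    with i show ?thesis unfolding bdd_def by blast
  qed
  have mid\<C>: "(\<lambda>x. (F x + G x) / 2) \<in> \<C> k" if F: "F \<in> \<C> k" and G: "G \<in> \<C> k" for F G k
  proof -
    have b: "bdd F" "bdd G" using F G by (auto simp: \<C>_def)
    have "\<bar>(LBINT x. (F x + G x) / 2 * \<phi> x) - T \<phi>\<bar> \<le> e"
      if \<phi>: "\<phi> \<in> \<Phi>" and e: "\<forall>j\<ge>k. \<bar>(LBINT x. f j x * \<phi> x) - T \<phi>\<bar> \<le> e" for \<phi> e
    proof -
      have 1: "\<bar>(LBINT x. F x * \<phi> x) - T \<phi>\<bar> \<le> e" "\<bar>(LBINT x. G x * \<phi> x) - T \<phi>\<bar> \<le> e"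
        using F G \<phi> e by (auto simp: \<C>_def)
      have "(\<lambda>x. (F x + G x) / 2 * \<phi> x) = (\<lambda>x. (F x * \<phi> x + G x * \<phi> x) / 2)" by (auto simp: algebra_simps)
      then have eq: "(LBINT x. (F x + G x) / 2 * \<phi> x) = ((LBINT x. F x * \<phi> x) + (LBINT x. G x * \<phi> x)) / 2"
        using int\<phi>[OF b(1) \<phi>] int\<phi>[OF b(2) \<phi>] by simp
      have "\<bar>(X + Y) / 2 - T \<phi>\<bar> \<le> e" if "\<bar>X - T \<phi>\<bar> \<le> e" "\<bar>Y - T \<phi>\<bar> \<le> e" for X Y :: real
        using that unfolding abs_le_iff by (auto simp: field_simps)
      from this[OF 1] show ?thesis unfolding eq .
    qed
    then show ?thesis using bmid[OF b] by (simp add: \<C>_def)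
  qed
  have f\<C>: "f k \<in> \<C> k" for k using bf by (auto simp: \<C>_def)
  obtain h where h: "\<And>i. h i \<in> \<C> i"
    "\<And>i. Q (h i) + Q (h (Suc i)) - 2 * Q (\<lambda>x. (h i x + h (Suc i) x) / 2) \<le> (1 / 32) ^ i"
  proof (rule decreasing_convex_sets_converging_selection[of \<C> Q K])
    show "\<C> k \<noteq> {}" for k using f\<C> by blast
    show "\<C> k \<subseteq> \<C> j" if "j \<le> k" for j k
      unfolding \<C>_def using that by (auto intro: order_trans)
    show "0 \<le> Q f" "Q f \<le> K" if "f \<in> \<C> 0" for f using QK that by (auto simp: \<C>_def)
  qed (use mid\<C> that in blast)+
  have bh: "bdd (h i)" for i using h(1) by (auto simp: \<C>_def)
  have mh[measurable]: "h i \<in> borel_measurable borel" for i using bh by (simp add: bdd_def)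
  have K0: "0 \<le> K" using QK[OF bh[of 0]] by linarith
  have step: "(NBINT x. ennreal (w x * sqrt \<bar>h (Suc i) x - h i x\<bar>)) \<le> ennreal ((1 + 2 * K) * (1 / 2) ^ i)" for i
  proof -
    let ?l = "2 ^ i :: real"
    let ?m = "\<lambda>x. (h i x + h (Suc i) x) / 2"
    let ?G = "\<lambda>x. ?l ^ 3 * (w x * lift (h i x) + w x * lift (h (Suc i) x) - 2 * (w x * lift (?m x))) + (w x * lift (h i x) + w x * lift (h (Suc i) x)) / ?l"
    have intG: "integrable lborel ?G"
      using intQ[OF bh[of i]] intQ[OF bh[of "Suc i"]] intQ[OF bmid[OF bh bh]] by simp
    have pw: "w x * sqrt \<bar>h (Suc i) x - h i x\<bar> \<le> ?G x" for x
    proof -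
      have "w x * sqrt \<bar>h i x - h (Suc i) x\<bar> \<le> w x * (?l ^ 3 * midgap (h i x) (h (Suc i) x) + (lift (h i x) + lift (h (Suc i) x)) / ?l)"
        using w(2)[of x] by (intro mult_left_mono sqrt_diff_le_midgap) auto
      also have "\<dots> = ?G x" by (simp add: midgap_def algebra_simps add_divide_distrib)
      finally show ?thesis by (simp add: abs_minus_commute)
    qed
    have "(NBINT x. ennreal (w x * sqrt \<bar>h (Suc i) x - h i x\<bar>)) \<le> (NBINT x. ennreal (?G x))"
      by (intro nn_integral_mono ennreal_leI pw)
    also have "\<dots> = ennreal (LBINT x. ?G x)"
    proof (rule nn_integral_eq_integral[OF intG], rule AE_I2)
      fix x show "0 \<le> ?G x" using w(2)[of x] by (intro order_trans[OF _ pw]) simp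
    qed
    also have "(LBINT x. ?G x) = ?l ^ 3 * (Q (h i) + Q (h (Suc i)) - 2 * Q ?m) + (Q (h i) + Q (h (Suc i))) / ?l"
      unfolding Q_def using intQ[OF bh[of i]] intQ[OF bh[of "Suc i"]] intQ[OF bmid[OF bh bh]] by simp
    also have "\<dots> \<le> ?l ^ 3 * (1 / 32) ^ i + (K + K) / ?l"
      using h(2)[of i] QK[OF bh[of i]] QK[OF bh[of "Suc i"]]
      by (intro add_mono mult_left_mono divide_right_mono) auto
    also have "?l ^ 3 * (1 / 32) ^ i = (1 / 4) ^ i"
    proof -
      have "(2 ^ 3 :: real) ^ i = ?l ^ 3" unfolding power_mult[symmetric] by (simp only: mult.commute)
      then have "?l ^ 3 = 8 ^ i" by simp
      then show ?thesis by (simp add: power_mult_distrib[symmetric])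
    qed
    also have "(1 / 4 :: real) ^ i \<le> (1 / 2) ^ i" by (intro power_mono) auto
    also have "(K + K) / ?l = 2 * K * (1 / 2) ^ i" by (simp add: power_divide)
    finally show ?thesis by (simp add: algebra_simps ennreal_leI)
  qed
  have AEsum: "AE x in lborel. (\<Sum>i. ennreal (w x * sqrt \<bar>h (Suc i) x - h i x\<bar>)) \<noteq> \<infinity>"
  proof (rule nn_integral_noteq_infinite)
    have "(NBINT x. (\<Sum>i. ennreal (w x * sqrt \<bar>h (Suc i) x - h i x\<bar>))) = (\<Sum>i. \<integral>\<^sup>+x. ennreal (w x * sqrt \<bar>h (Suc i) x - h i x\<bar>) \<partial>lborel)"
      by (rule nn_integral_suminf) measurable
    also have "\<dots> \<le> (\<Sum>i. ennreal ((1 + 2 * K) * (1 / 2) ^ i))" by (intro suminf_le step) auto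
    also have "\<dots> = ennreal (\<Sum>i. (1 + 2 * K) * (1 / 2) ^ i)"
      using K0 by (intro suminf_ennreal2 summable_mult summable_geometric) auto
    also have "\<dots> < \<infinity>" by simp
    finally show "(NBINT x. (\<Sum>i. ennreal (w x * sqrt \<bar>h (Suc i) x - h i x\<bar>))) \<noteq> \<infinity>" by simp
  qed measurable
  define g where "g x = lim (\<lambda>i. h i x)" for x
  have mg: "g \<in> borel_measurable borel" unfolding g_def by (rule borel_measurable_lim_metric) (rule mh)
  have AElim: "AE x in lborel. (\<lambda>i. h i x) \<longlonglongrightarrow> g x"
    using AEsum
  proof eventually_elim
    case (elim x)
    have "summable (\<lambda>i. w x * sqrt \<bar>h (Suc i) x - h i x\<bar>)"
      using elim w(2)[of x] by (intro summable_suminf_not_top) (auto simp: less_imp_le)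
    then have "summable (\<lambda>i. sqrt \<bar>h (Suc i) x - h i x\<bar>)" using w(2)[of x] by (simp add: summable_cmult_iff)
    then have "convergent (\<lambda>i. h i x)" by (rule summable_sqrt_imp_convergent)
    then show ?case unfolding g_def by (simp add: convergent_LIMSEQ_iff)
  qed
  have bg: "(NBINT x. ennreal (\<bar>g x\<bar> powr r)) \<le> ennreal C"
  proof -
    have "(NBINT x. ennreal (\<bar>g x\<bar> powr r)) = (NBINT x. liminf (\<lambda>i. ennreal (\<bar>h i x\<bar> powr r)))"
    proof (rule nn_integral_cong_AE, use AElim in eventually_elim)
      case (elim x)
      have "(\<lambda>i. ennreal (\<bar>h i x\<bar> powr r)) \<longlonglongrightarrow> ennreal (\<bar>g x\<bar> powr r)"
        using elim r by (intro tendsto_ennrealI tendsto_powr' tendsto_rabs tendsto_const) auto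
      from lim_imp_Liminf[OF sequentially_bot this] show ?case by (rule sym)
    qed
    also have "\<dots> \<le> liminf (\<lambda>i. \<integral>\<^sup>+x. ennreal (\<bar>h i x\<bar> powr r) \<partial>lborel)"
      by (rule nn_integral_liminf) measurable
    also have "\<dots> \<le> liminf (\<lambda>i. ennreal C)"
      using bh by (intro Liminf_mono always_eventually) (auto simp: bdd_def)
    finally show ?thesis by (simp add: Liminf_const)
  qed
  have "(LBINT x. g x * \<phi> x) = T \<phi>" if \<phi>: "\<phi> \<in> \<Phi>" for \<phi>
  proof -
    obtain M R where M: "0 < M" "\<And>x. \<bar>\<phi> x\<bar> \<le> M" and R: "\<And>x. R < norm x \<Longrightarrow> \<phi> x = 0" and m: "\<phi> \<in> borel_measurable borel"
      using \<Phi>[OF \<phi>] by blast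
    have 1: "(\<lambda>i. LBINT x. h i x * \<phi> x) \<longlonglongrightarrow> (LBINT x. g x * \<phi> x)"
      by (rule Lr_bounded_tendsto_pairing[OF mh mg _ bg C AElim r m M(2) R M(1)]) (use bh in \<open>simp add: bdd_def\<close>)
    have 2: "(\<lambda>i. LBINT x. h i x * \<phi> x) \<longlonglongrightarrow> T \<phi>"
      unfolding LIMSEQ_iff
    proof (intro allI impI)
      fix e :: real assume e: "0 < e"
      obtain n0 where n0: "\<And>j. n0 \<le> j \<Longrightarrow> norm ((LBINT x. f j x * \<phi> x) - T \<phi>) < e / 2"
        using lim[OF \<phi>] half_gt_zero[OF e] unfolding LIMSEQ_iff by blast
      show "\<exists>n0. \<forall>i\<ge>n0. norm ((LBINT x. h i x * \<phi> x) - T \<phi>) < e"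
      proof (intro exI[of _ n0] allI impI)
        fix i assume i: "n0 \<le> i"
        have "\<forall>j\<ge>i. \<bar>(LBINT x. f j x * \<phi> x) - T \<phi>\<bar> \<le> e / 2"
          using n0 i by (auto intro!: less_imp_le simp: real_norm_def[symmetric] simp del: real_norm_def)
        moreover have "(\<forall>j\<ge>i. \<bar>(LBINT x. f j x * \<phi> x) - T \<phi>\<bar> \<le> \<epsilon>) \<longrightarrow> \<bar>(LBINT x. h i x * \<phi> x) - T \<phi>\<bar> \<le> \<epsilon>" for \<epsilon>
          using h(1)[of i] \<phi> unfolding \<C>_def by blast
        ultimately have "\<bar>(LBINT x. h i x * \<phi> x) - T \<phi>\<bar> \<le> e / 2" by blast
        then show "norm ((LBINT x. h i x * \<phi> x) - T \<phi>) < e" using e by simp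
      qed
    qed
    show ?thesis by (rule LIMSEQ_unique[OF 1 2])
  qed
  with mg bg show thesis by (rule that)
qed

section \<open>From the energy bound to difference quotients\<close>

lemma nn_integral_lborel_reflect:
  fixes f :: "'a::euclidean_space \<Rightarrow> ennreal"
  assumes [measurable]: "f \<in> borel_measurable borel"
  shows "(NBINT x. f (h - x)) = (NBINT x. f x)"
proof -
  have "orthogonal_transformation (uminus :: 'a \<Rightarrow> 'a)"
    by (simp add: orthogonal_transformation_def linear_uminus)
  then have "(NBINT x. f (h + - x)) = (NBINT x. f (h + x))"
    by (rule nn_integral_lborel_orthogonal) measurable
  also have "\<dots> = (NBINT x. f x)" by (rule nn_integral_lborel_translate) measurable
  finally show ?thesis by simp
qed

abbreviation modulus :: "real \<Rightarrow> (real ^ 'n \<Rightarrow> real) \<Rightarrow> real ^ 'n \<Rightarrow> ennreal" where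
  "modulus r u \<equiv> increment (\<lambda>_. 1) r u"

text \<open>The increment over \<open>y + z\<close> is the sum of those over \<open>y\<close> and
  \<open>z\<close>, one of them translated.\<close>

lemma modulus_add_le:
  fixes u :: "real ^ 'n \<Rightarrow> real"
  assumes [measurable]: "u \<in> borel_measurable borel" and r: "0 \<le> r"
  shows "modulus r u (y + z) \<le> ennreal (2 powr r) * (modulus r u y + modulus r u z)"
proof -
  have "modulus r u (y + z) \<le> (NBINT x. ennreal (2 powr r) * (ennreal (\<bar>u ((x + z) + y) - u (x + z)\<bar> powr r) + ennreal (\<bar>u (x + z) - u x\<bar> powr r)))"
    unfolding increment_def
  proof (rule nn_integral_mono)
    fix x
    have "\<bar>u (x + (y + z)) - u x\<bar> powr r \<le> (\<bar>u ((x + z) + y) - u (x + z)\<bar> + \<bar>u (x + z) - u x\<bar>) powr r"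
      using r by (intro powr_mono2) (auto simp: add_ac)
    also have "\<dots> \<le> 2 powr r * (\<bar>u ((x + z) + y) - u (x + z)\<bar> powr r + \<bar>u (x + z) - u x\<bar> powr r)"
      using r by (intro powr_add_le_2) auto
    finally have "ennreal (1 * \<bar>u (x + (y + z)) - u x\<bar> powr r) \<le> ennreal (2 powr r * (\<bar>u ((x + z) + y) - u (x + z)\<bar> powr r + \<bar>u (x + z) - u x\<bar> powr r))"
      by (intro ennreal_leI) simp
    then show "ennreal (1 * \<bar>u (x + (y + z)) - u x\<bar> powr r) \<le> ennreal (2 powr r) * (ennreal (\<bar>u ((x + z) + y) - u (x + z)\<bar> powr r) + ennreal (\<bar>u (x + z) - u x\<bar> powr r))"
      by (simp add: ennreal_mult ennreal_plus)
  qed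
  also have "\<dots> = ennreal (2 powr r) * ((NBINT x. ennreal (\<bar>u ((x + z) + y) - u (x + z)\<bar> powr r)) + (NBINT x. ennreal (\<bar>u (x + z) - u x\<bar> powr r)))"
    by (subst nn_integral_cmult, measurable, subst nn_integral_add, measurable)
  also have "(NBINT x. ennreal (\<bar>u ((x + z) + y) - u (x + z)\<bar> powr r)) = (NBINT x. ennreal (\<bar>u (x + y) - u x\<bar> powr r))"
    by (rule nn_integral_lborel_translate'[where f="\<lambda>x. ennreal (\<bar>u (x + y) - u x\<bar> powr r)"]) measurable
  finally show ?thesis by (simp add: increment_def)
qed

definition local_modulus :: "real \<Rightarrow> (real ^ 'n \<Rightarrow> real) \<Rightarrow> real \<Rightarrow> ennreal" where
  "local_modulus r u t = (NBINT z. modulus r u z * indicator (near t) z)"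

text \<open>Write \<open>h = z + (h - z)\<close> and average over the \<open>z\<close> in the ball of radius
  \<open>t / 2\<close> about \<open>h / 2\<close>: both \<open>z\<close> and \<open>h - z\<close>
  have length at most \<open>t\<close>.\<close>

lemma modulus_le_local_modulus:
  fixes u :: "real ^ 'n \<Rightarrow> real"
  assumes [measurable]: "u \<in> borel_measurable borel" and r: "0 \<le> r" and h: "norm h = t" "0 < t"
  shows "modulus r u h * ennreal (unit_ball_vol (real CARD('n)) * (t / 2) ^ CARD('n)) \<le>
     ennreal (2 * 2 powr r) * local_modulus r u t"
proof -
  let ?B = "ball (h /\<^sub>R 2) (t / 2)"
  have B: "?B \<in> sets borel" by simp
  have IB: "(indicator ?B :: _ \<Rightarrow> ennreal) \<in> borel_measurable lborel" by (rule borel_measurable_indicator) simp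
  have inB: "z \<in> near t" "h - z \<in> near t" if "z \<in> ?B" for z
  proof -
    have d: "norm (h /\<^sub>R 2 - z) < t / 2" using that by (simp add: dist_norm)
    have n2: "norm (h /\<^sub>R 2) = t / 2" using h by simp
    have "norm z \<le> norm (h /\<^sub>R 2) + norm (h /\<^sub>R 2 - z)" using norm_triangle_ineq4[of "h /\<^sub>R 2" "h /\<^sub>R 2 - z"] by simp
    moreover have "h - z = h /\<^sub>R 2 + (h /\<^sub>R 2 - z)" by (simp add: algebra_simps flip: scaleR_add_left)
    then have "norm (h - z) \<le> norm (h /\<^sub>R 2) + norm (h /\<^sub>R 2 - z)" by (metis norm_triangle_ineq)
    moreover have "z \<noteq> 0" using d n2 by auto
    moreover have "z \<noteq> h"
    proof
      assume "z = h"
      moreover have "h = h /\<^sub>R 2 + h /\<^sub>R 2" by (simp flip: scaleR_add_left)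
      ultimately have "h /\<^sub>R 2 - z = - (h /\<^sub>R 2)" by (metis add_diff_cancel_left' minus_diff_eq)
      then have "norm (h /\<^sub>R 2 - z) = t / 2" using n2 by (metis norm_minus_cancel)
      then show False using d by linarith
    qed
    ultimately show "z \<in> near t" "h - z \<in> near t" using d n2 by (auto simp: near_def)
  qed
  have "modulus r u h * ennreal (unit_ball_vol (real CARD('n)) * (t / 2) ^ CARD('n)) = modulus r u h * emeasure lborel ?B"
    using h emeasure_ball[of "t / 2" "h /\<^sub>R 2"] by simp
  also have "\<dots> = (NBINT z. modulus r u h * indicator ?B z)"
    using B by (subst nn_integral_cmult_indicator) auto
  also have "\<dots> \<le> (NBINT z. ennreal (2 powr r) * (modulus r u (h - z) * indicator (near t) (h - z) + modulus r u z * indicator (near t) z))"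
  proof (rule nn_integral_mono)
    fix z
    show "modulus r u h * indicator ?B z \<le> ennreal (2 powr r) * (modulus r u (h - z) * indicator (near t) (h - z) + modulus r u z * indicator (near t) z)"
    proof (cases "z \<in> ?B")
      case True
      have "modulus r u ((h - z) + z) \<le> ennreal (2 powr r) * (modulus r u (h - z) + modulus r u z)"
        by (rule modulus_add_le[OF _ r]) measurable
      then show ?thesis using True inB[OF True] by simp
    qed simp
  qed
  also have "\<dots> = ennreal (2 powr r) * ((NBINT z. modulus r u (h - z) * indicator (near t) (h - z)) + local_modulus r u t)"
    unfolding local_modulus_def
    by (subst nn_integral_cmult, measurable, subst nn_integral_add, measurable)
  also have "(NBINT z. modulus r u (h - z) * indicator (near t) (h - z)) = local_modulus r u t"
    unfolding local_modulus_def
    by (rule nn_integral_lborel_reflect[where f="\<lambda>z. modulus r u z * indicator (near t) z"]) measurable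
  also have "ennreal (2 powr r) * (local_modulus r u t + local_modulus r u t) = ennreal (2 * 2 powr r) * local_modulus r u t"
    by (simp add: ennreal_mult' mult_2[symmetric] mult_ac)
  finally show ?thesis .
qed

text \<open>The kernel at \<open>z\<close> is the integral over \<open>t > \<bar>z\<bar>\<close> of minus its
  radial derivative. Exchanging the integrals expresses the energy through the integrals of the
  increments over balls. The factor \<open>1 - s\<close> cancels against the integral of \<open>t
  powr (r * (1 - s) - 1)\<close>, so that the bound does not degenerate.\<close>

lemma energy_ge_radial:
  fixes u :: "real ^ 'n \<Rightarrow> real"
  assumes mu[measurable]: "u \<in> borel_measurable borel" and r: "0 < r" and s: "0 < s" "s < 1" and t0: "0 < t0" and L: "0 \<le> L"
    and low: "\<And>t. 0 < t \<Longrightarrow> t < t0 \<Longrightarrow> ennreal (L * t powr (real CARD('n) + r)) \<le> local_modulus r u t"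
  shows "ennreal (L * real CARD('n) / r * t0 powr (r * (1 - s))) \<le> (NBINT z. ennreal (kern r s z) * modulus r u z)"
proof -
  let ?n = "real CARD('n)"
  let ?e = "- ?n - s * r"
  have n: "1 \<le> ?n" using zero_less_card_finite[where 'a='n] by linarith
  have nsr: "0 < ?n + s * r" using n r s by (intro add_pos_pos) auto
  let ?k = "\<lambda>t. ennreal ((1 - s) * (?n + s * r) * t powr (?e - 1)) * indicator {0<..<t0} t"
  have kern_ge: "(NBINT t. ?k t * indicator (near t) z) \<le> ennreal (kern r s z)" for z :: "real ^ 'n"
  proof (cases "z = 0")
    case False
    have "(NBINT t. ?k t * indicator (near t) z) \<le> (NBINT t. ennreal ((1 - s) * (?n + s * r) * t powr (?e - 1)) * indicator {norm z..} t)"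
      by (intro nn_integral_mono) (auto simp: indicator_def near_def)
    also have "\<dots> = ennreal ((1 - s) * (?n + s * r) * (- (norm z powr (?e - 1 + 1)) / (?e - 1 + 1)))"
    proof (rule nn_integral_has_integral_lebesgue')
      show "((\<lambda>t. (1 - s) * (?n + s * r) * t powr (?e - 1)) has_integral (1 - s) * (?n + s * r) * (- (norm z powr (?e - 1 + 1)) / (?e - 1 + 1))) {norm z..}"
        using False nsr by (intro has_integral_mult_right has_integral_powr_to_inf) auto
      show "0 \<le> (1 - s) * (?n + s * r) * t powr (?e - 1)" for t using nsr s by simp
    qed
    also have "(1 - s) * (?n + s * r) * (- (norm z powr (?e - 1 + 1)) / (?e - 1 + 1)) = kern r s z"
    proof -
      have e: "?e - 1 + 1 = - (?n + s * r)" by simp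
      have e2: "kern r s z = (1 - s) * norm z powr (- (?n + s * r))" unfolding kern_def
        by (rule arg_cong[where f="\<lambda>e. (1 - s) * norm z powr e"]) simp
      have "(1 - s) * m * (- X / - m) = (1 - s) * X" if "0 < m" for m X :: real using that by simp
      from this[OF nsr] show ?thesis unfolding e e2 .
    qed
    finally show ?thesis .
  qed (simp add: near_def)
  have meas: "(\<lambda>(t, z). ?k t * indicator (near t) z * modulus r u z) \<in> borel_measurable (lborel \<Otimes>\<^sub>M lborel)"
  proof -
    let ?S = "{p :: real \<times> (real ^ 'n). 0 < norm (snd p) \<and> norm (snd p) \<le> fst p}"
    have E: "(\<lambda>p :: real \<times> (real ^ 'n). indicator (near (fst p)) (snd p) :: ennreal) = indicator ?S"
      by (auto simp: fun_eq_iff near_def indicator_def)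
    have "?S \<in> sets (borel \<Otimes>\<^sub>M borel)"
      unfolding borel_prod Collect_conj_eq
      by (intro sets.Int borel_open borel_closed open_Collect_less closed_Collect_le continuous_intros)
    then have "?S \<in> sets (lborel \<Otimes>\<^sub>M lborel)" by (simp only: sets_pair_measure_cong[OF sets_lborel sets_lborel])
    then have i: "(\<lambda>p :: real \<times> (real ^ 'n). indicator (near (fst p)) (snd p) :: ennreal) \<in> borel_measurable (lborel \<Otimes>\<^sub>M lborel)"
      unfolding E by (rule borel_measurable_indicator)
    have k: "(\<lambda>p :: real \<times> (real ^ 'n). ?k (fst p)) \<in> borel_measurable (lborel \<Otimes>\<^sub>M lborel)" by measurable
    have m: "(\<lambda>p :: real \<times> (real ^ 'n). modulus r u (snd p)) \<in> borel_measurable (lborel \<Otimes>\<^sub>M lborel)" by measurable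
    show ?thesis unfolding case_prod_beta' using borel_measurable_times_ennreal[OF borel_measurable_times_ennreal[OF k i] m] by simp
  qed
  have "ennreal (L * ?n / r * t0 powr (r * (1 - s))) = ennreal ((1 - s) * ?n * L * (t0 powr (r * (1 - s)) / (r * (1 - s))))"
  proof -
    have "L * ?n / r * X = m * ?n * L * (X / (r * m))" if "m \<noteq> 0" for X m :: real using that r by simp
    then show ?thesis using s by (intro arg_cong[where f=ennreal]) simp
  qed
  also have "\<dots> = (NBINT t. ennreal ((1 - s) * ?n * L * t powr (r * (1 - s) - 1)) * indicator {0..t0} t)"
  proof (rule nn_integral_has_integral_lebesgue'[symmetric])
    have "((\<lambda>t. t powr (r * (1 - s) - 1)) has_integral (t0 powr (r * (1 - s) - 1 + 1) / (r * (1 - s) - 1 + 1))) {0..t0}"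
      using r s t0 by (intro has_integral_powr_from_0) auto
    from has_integral_mult_right[OF this, of "(1 - s) * ?n * L"]
    show "((\<lambda>t. (1 - s) * ?n * L * t powr (r * (1 - s) - 1)) has_integral (1 - s) * ?n * L * (t0 powr (r * (1 - s)) / (r * (1 - s)))) {0..t0}"
      by simp
    show "0 \<le> (1 - s) * ?n * L * t powr (r * (1 - s) - 1)" for t using s L by simp
  qed
  also have "\<dots> = (NBINT t. ennreal ((1 - s) * ?n * L * t powr (r * (1 - s) - 1)) * indicator {0<..<t0} t)"
    by (intro nn_integral_cong_AE AE_I[where N="{0, t0}"]) (auto simp: indicator_def intro!: emeasure_lborel_countable)
  also have "\<dots> \<le> (NBINT t. ?k t * local_modulus r u t)"
  proof (rule nn_integral_mono)
    fix t :: real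
    show "ennreal ((1 - s) * ?n * L * t powr (r * (1 - s) - 1)) * indicator {0<..<t0} t \<le> ?k t * local_modulus r u t"
    proof (cases "t \<in> {0<..<t0}")
      case True
      have "t powr (r * (1 - s) - 1) = t powr (?e - 1) * t powr (?n + r)"
        unfolding powr_add[symmetric] by (rule arg_cong[where f="(powr) t"]) (simp add: algebra_simps)
      then have "(1 - s) * ?n * L * t powr (r * (1 - s) - 1) = ((1 - s) * ?n * t powr (?e - 1)) * (L * t powr (?n + r))" by simp
      also have "\<dots> \<le> ((1 - s) * (?n + s * r) * t powr (?e - 1)) * (L * t powr (?n + r))"
        using s r n L by (intro mult_right_mono mult_left_mono) auto
      finally have "ennreal ((1 - s) * ?n * L * t powr (r * (1 - s) - 1)) \<le> ennreal (((1 - s) * (?n + s * r) * t powr (?e - 1)) * (L * t powr (?n + r)))"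
        by (rule ennreal_leI)
      also have "\<dots> = ennreal ((1 - s) * (?n + s * r) * t powr (?e - 1)) * ennreal (L * t powr (?n + r))"
        using s nsr L by (intro ennreal_mult) auto
      also have "\<dots> \<le> ennreal ((1 - s) * (?n + s * r) * t powr (?e - 1)) * local_modulus r u t"
        using True by (intro mult_left_mono low) auto
      finally show ?thesis using True by simp
    qed simp
  qed
  also have "\<dots> = (NBINT t. NBINT z. ?k t * indicator (near t) z * modulus r u z)"
  proof (rule nn_integral_cong)
    fix t :: real
    have "?k t * local_modulus r u t = (NBINT z. ?k t * (modulus r u z * indicator (near t) z))"
      unfolding local_modulus_def by (rule nn_integral_cmult[symmetric]) measurable
    then show "?k t * local_modulus r u t = (NBINT z. ?k t * indicator (near t) z * modulus r u z)"
      by (simp only: mult_ac)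
  qed
  also have "\<dots> = (NBINT z. NBINT t. ?k t * indicator (near t) z * modulus r u z)"
    by (rule lborel_pair.Fubini'[OF meas, symmetric])
  also have "\<dots> = (NBINT z. (NBINT t. ?k t * indicator (near t) z) * modulus r u z)"
  proof (rule nn_integral_cong)
    fix z :: "real ^ 'n"
    have "(\<lambda>t. indicator (near t) z :: ennreal) = (\<lambda>t. indicator {t. 0 < norm z \<and> norm z \<le> t} t)"
      by (auto simp: near_def indicator_def)
    then have "(\<lambda>t. indicator (near t) z :: ennreal) \<in> borel_measurable lborel" by simp
    moreover have "?k \<in> borel_measurable lborel" by measurable
    ultimately have "(\<lambda>t. ?k t * indicator (near t) z) \<in> borel_measurable lborel" by (rule borel_measurable_times_ennreal[rotated])
    then show "(NBINT t. ?k t * indicator (near t) z * modulus r u z) = (NBINT t. ?k t * indicator (near t) z) * modulus r u z"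
      by (rule nn_integral_multc)
  qed
  also have "\<dots> \<le> (NBINT z. ennreal (kern r s z) * modulus r u z)"
    by (intro nn_integral_mono mult_right_mono kern_ge) auto
  finally show ?thesis .
qed

text \<open>Otherwise the lower bound for the energies would exceed \<open>M\<close> for \<open>s\<close> close
  to 1.\<close>

lemma small_modulus_radii:
  fixes u :: "real ^ 'n \<Rightarrow> real"
  assumes mu: "u \<in> borel_measurable borel" and r: "0 < r" and M: "0 \<le> M"
    and freq: "\<exists>\<^sub>F s in at_left 1. (NBINT z. ennreal (kern r s z) * modulus r u z) \<le> ennreal M"
  shows "\<exists>L\<ge>0. \<forall>t0>0. \<exists>t. 0 < t \<and> t < t0 \<and> local_modulus r u t \<le> ennreal (L * t powr (real CARD('n) + r))"
proof -
  let ?n = "real CARD('n)"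
  have n: "1 \<le> ?n" using zero_less_card_finite[where 'a='n] by linarith
  define L where "L = 2 * r * M / ?n + 1"
  have L: "0 < L" using r M n by (simp add: L_def add_nonneg_pos)
  show ?thesis
  proof (rule exI[of _ L], intro conjI allI impI)
    show "0 \<le> L" using L by simp
    fix t0 :: real assume t0: "0 < t0"
    show "\<exists>t. 0 < t \<and> t < t0 \<and> local_modulus r u t \<le> ennreal (L * t powr (?n + r))"
    proof (rule ccontr)
      assume neg: "\<not> ?thesis"
      have low: "ennreal (L * t powr (?n + r)) \<le> local_modulus r u t" if "0 < t" "t < t0" for t
        using neg that by (auto simp: not_le less_imp_le)
      have "((\<lambda>s. t0 powr (r * (1 - s))) \<longlongrightarrow> t0 powr (r * (1 - 1))) (at_left 1)"
        using t0 by (intro tendsto_intros) auto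
      then have "\<forall>\<^sub>F s in at_left 1. 1 / 2 < t0 powr (r * (1 - s))"
        using t0 by (intro order_tendstoD) auto
      moreover have "\<forall>\<^sub>F s in at_left (1::real). 0 < s \<and> s < 1"
        by (auto simp: eventually_at_left_field intro!: exI[of _ 0])
      ultimately have "\<forall>\<^sub>F s in at_left 1. 1 / 2 < t0 powr (r * (1 - s)) \<and> 0 < s \<and> s < 1"
        by eventually_elim simp
      from frequently_eventually_frequently[OF freq this] have "\<exists>\<^sub>F s in at_left 1. (NBINT z. ennreal (kern r s z) * modulus r u z) \<le> ennreal M \<and>
          (1 / 2 < t0 powr (r * (1 - s)) \<and> 0 < s \<and> s < 1)" .
      then obtain s where s: "(NBINT z. ennreal (kern r s z) * modulus r u z) \<le> ennreal M"
          "1 / 2 < t0 powr (r * (1 - s))" "0 < s" "s < 1"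
        by (auto dest!: frequently_ex)
      have "ennreal (L * ?n / r * t0 powr (r * (1 - s))) \<le> ennreal M"
        using energy_ge_radial[OF mu r s(3,4) t0 _ low] L s(1) by (auto intro: order_trans)
      then have "L * ?n / r * t0 powr (r * (1 - s)) \<le> M" using M by simp
      moreover have "L * ?n / r * (1 / 2) < L * ?n / r * t0 powr (r * (1 - s))"
        using L n r s(2) by (intro mult_strict_left_mono) auto
      ultimately have "L * ?n / r * (1 / 2) < M" by linarith
      then have "L * ?n < 2 * r * M" using r by (simp add: field_simps)
      moreover have "L * ?n = 2 * r * M + ?n" using n by (simp add: L_def field_simps)
      ultimately show False using n by linarith
    qed
  qed
qed

lemma small_difference_quotients:
  fixes u :: "real ^ 'n \<Rightarrow> real"
  assumes mu: "u \<in> borel_measurable borel" and r: "0 < r" and M: "0 \<le> M"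
    and freq: "\<exists>\<^sub>F s in at_left 1. (NBINT z. ennreal (kern r s z) * modulus r u z) \<le> ennreal M"
  shows "\<exists>C\<ge>0. \<forall>t0>0. \<exists>t. 0 < t \<and> t < t0 \<and> (\<forall>h. norm h = t \<longrightarrow> modulus r u h \<le> ennreal (C * t powr r))"
proof -
  let ?n = "real CARD('n)" and ?\<omega> = "unit_ball_vol (real CARD('n))"
  have \<omega>: "0 < ?\<omega>" by simp
  obtain L where L: "0 \<le> L" "\<And>t0. 0 < t0 \<Longrightarrow> \<exists>t. 0 < t \<and> t < t0 \<and> local_modulus r u t \<le> ennreal (L * t powr (?n + r))"
    using small_modulus_radii[OF assms] by blast
  define C where "C = 2 * 2 powr r * L * 2 ^ CARD('n) / ?\<omega>"
  show ?thesis
  proof (rule exI[of _ C], intro conjI allI impI)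
    show "0 \<le> C" using L \<omega> by (simp add: C_def)
    fix t0 :: real assume "0 < t0"
    then obtain t where t: "0 < t" "t < t0" "local_modulus r u t \<le> ennreal (L * t powr (?n + r))" using L(2) by blast
    have "modulus r u h \<le> ennreal (C * t powr r)" if h: "norm h = t" for h
    proof -
      let ?v = "?\<omega> * (t / 2) ^ CARD('n)"
      have v: "0 < ?v" using \<omega> t by simp
      have "modulus r u h * ennreal ?v \<le> ennreal (2 * 2 powr r) * local_modulus r u t"
        by (rule modulus_le_local_modulus[OF mu _ h t(1)]) (use r in simp)
      also have "\<dots> \<le> ennreal (2 * 2 powr r) * ennreal (L * t powr (?n + r))" by (intro mult_left_mono t(3)) simp
      also have "\<dots> = ennreal (2 * 2 powr r * (L * t powr (?n + r)))" using L by (intro ennreal_mult[symmetric]) auto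
      also have "2 * 2 powr r * (L * t powr (?n + r)) = C * t powr r * ?v"
      proof -
        have "?\<omega> \<noteq> 0" using \<omega> by linarith
        moreover have "t powr (?n + r) = t ^ CARD('n) * t powr r" using t by (simp add: powr_add powr_realpow)
        ultimately show ?thesis by (simp add: C_def power_divide)
      qed
      finally have le: "modulus r u h * ennreal ?v \<le> ennreal (C * t powr r * ?v)" .
      have cancel: "X \<le> ennreal c" if "X * ennreal w \<le> ennreal (c * w)" "0 < w" "0 \<le> c" for X :: ennreal and c w :: real
      proof -
        have "ennreal w * ennreal (1 / w) = 1" using that by (simp add: ennreal_mult[symmetric])
        then have "X = X * ennreal w * ennreal (1 / w)" by (simp add: mult.assoc)
        also have "\<dots> \<le> ennreal (c * w) * ennreal (1 / w)" by (rule mult_right_mono[OF that(1)]) simp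
        also have "\<dots> = ennreal c" using that by (simp add: ennreal_mult[symmetric])
        finally show ?thesis .
      qed
      show ?thesis by (rule cancel[OF le v]) (use L \<omega> in \<open>simp add: C_def\<close>)
    qed
    then show "\<exists>t. 0 < t \<and> t < t0 \<and> (\<forall>h. norm h = t \<longrightarrow> modulus r u h \<le> ennreal (C * t powr r))"
      using t by blast
  qed
qed

text \<open>The difference quotient is moved to the test function, where it converges boundedly and with
  supports in a fixed ball.\<close>

lemma difference_quotient_pairing_tendsto:
  fixes u :: "real ^ 'n \<Rightarrow> real"
  assumes mu[measurable]: "u \<in> borel_measurable borel" and int: "integrable lborel (\<lambda>x. \<bar>u x\<bar> powr r)" and r: "1 < r"
    and t: "\<And>j. 0 < t j" "t \<longlonglongrightarrow> 0" "\<And>j. t j \<le> 1" and \<phi>: "test_function \<phi>"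
  shows "(\<lambda>j. LBINT x. (u (x + t j *\<^sub>R axis i 1) - u x) / t j * \<phi> x) \<longlonglongrightarrow> - (LBINT x. u x * partial_deriv i \<phi> x)"
proof -
  let ?e = "axis i 1 :: real ^ 'n"
  have ne: "norm ?e = 1" by simp
  note m\<phi> = test_function_borel[OF \<phi>]
  obtain R where R: "0 < R" "\<And>x. R < norm x \<Longrightarrow> \<phi> x = 0" "\<And>x i. R < norm x \<Longrightarrow> partial_deriv i \<phi> x = 0"
    by (rule test_function_support[OF \<phi>], rule that)
  obtain M where M: "0 < M" "\<And>x. \<bar>\<phi> x\<bar> \<le> M" "\<And>x i. \<bar>partial_deriv i \<phi> x\<bar> \<le> M"
    by (rule test_function_bounded[OF \<phi>], rule that)
  have line: "((\<lambda>t. \<phi> (y - t *\<^sub>R ?e)) has_real_derivative - partial_deriv i \<phi> (y - t *\<^sub>R ?e)) (at t)" for y t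
  proof -
    have "(\<Sum>l\<in>UNIV. partial_deriv l \<phi> (y - t *\<^sub>R ?e) * ?e $ l) = partial_deriv i \<phi> (y - t *\<^sub>R ?e)"
      by (subst sum.remove[of _ i]) (auto simp: axis_def)
    then show ?thesis using test_function_line_derivative[OF \<phi>, of y ?e t] by simp
  qed
  define \<psi> where "\<psi> j y = (\<phi> (y - t j *\<^sub>R ?e) - \<phi> y) / t j" for j y
  have \<psi>_lim: "(\<lambda>j. \<psi> j y) \<longlonglongrightarrow> - partial_deriv i \<phi> y" for y
  proof -
    have "((\<lambda>h. (\<phi> (y - (0 + h) *\<^sub>R ?e) - \<phi> (y - 0 *\<^sub>R ?e)) / h) \<longlongrightarrow> - partial_deriv i \<phi> (y - 0 *\<^sub>R ?e)) (at 0)"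
      using line[of y 0] by (simp add: has_field_derivative_iff)
    then have "((\<lambda>h. (\<phi> (y - h *\<^sub>R ?e) - \<phi> y) / h) \<longlongrightarrow> - partial_deriv i \<phi> y) (at 0)" by simp
    moreover have "filterlim t (at 0) sequentially"
      using t(2) t(1) by (intro filterlim_atI always_eventually) (auto simp: less_imp_neq[symmetric])
    ultimately show ?thesis unfolding \<psi>_def by (rule filterlim_compose)
  qed
  have \<psi>_bd: "\<bar>\<psi> j y\<bar> \<le> M" for j y
  proof -
    obtain z where z: "0 < z" "z < t j" "\<phi> (y - t j *\<^sub>R ?e) - \<phi> (y - 0 *\<^sub>R ?e) = (t j - 0) * - partial_deriv i \<phi> (y - z *\<^sub>R ?e)"
      using MVT2[OF t(1)[of j], of "\<lambda>t. \<phi> (y - t *\<^sub>R ?e)" "\<lambda>t. - partial_deriv i \<phi> (y - t *\<^sub>R ?e)"] line by auto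
    then have "\<psi> j y = - partial_deriv i \<phi> (y - z *\<^sub>R ?e)" using t(1)[of j] by (simp add: \<psi>_def)
    then show ?thesis using M(3) by simp
  qed
  have \<psi>_supp: "\<psi> j y = 0" if "R + 1 < norm y" for j y
  proof -
    have "norm y \<le> norm (y - t j *\<^sub>R ?e) + norm (t j *\<^sub>R ?e)" using norm_triangle_ineq[of "y - t j *\<^sub>R ?e" "t j *\<^sub>R ?e"] by simp
    also have "norm (t j *\<^sub>R ?e) \<le> 1" using t(1)[of j] t(3)[of j] ne by simp
    finally have "R < norm (y - t j *\<^sub>R ?e)" using that by simp
    then show ?thesis using R(2) that by (simp add: \<psi>_def)
  qed
  have m\<psi>: "\<psi> j \<in> borel_measurable borel" for j
  proof -
    have "(\<lambda>y. \<phi> (y - t j *\<^sub>R ?e)) \<in> borel_measurable borel"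
      by (rule measurable_compose[OF _ m\<phi>(1)]) measurable
    then show ?thesis unfolding \<psi>_def using m\<phi>(1) by measurable
  qed
  let ?B = "cball 0 (R + 1) :: (real ^ 'n) set"
  have uB: "integrable lborel (\<lambda>x. indicator ?B x * norm (u x))"
    using integrable_on_bounded[OF mu, of r ?B] int r by simp
  have dom: "integrable lborel (\<lambda>y. M * (indicator ?B y * norm (u y)))" using uB by simp
  have bound: "norm (u y * \<eta>) \<le> M * (indicator ?B y * norm (u y))" if "\<bar>\<eta>\<bar> \<le> M" "R + 1 < norm y \<Longrightarrow> \<eta> = 0" for y \<eta>
  proof (cases "norm y \<le> R + 1")
    case True
    have "\<bar>u y\<bar> * \<bar>\<eta>\<bar> \<le> \<bar>u y\<bar> * M" using that(1) by (intro mult_left_mono) auto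
    then show ?thesis using True by (simp add: abs_mult mult.commute)
  qed (use that in auto)
  have lim: "(\<lambda>j. LBINT y. u y * \<psi> j y) \<longlonglongrightarrow> (LBINT y. u y * - partial_deriv i \<phi> y)"
  proof (rule integral_dominated_convergence[where w="\<lambda>y. M * (indicator ?B y * norm (u y))"])
    show "(\<lambda>y. u y * - partial_deriv i \<phi> y) \<in> borel_measurable lborel"
      using m\<phi>(2)[of i] by simp
    show "(\<lambda>y. u y * \<psi> j y) \<in> borel_measurable lborel" for j using m\<psi>[of j] by simp
    show "AE y in lborel. (\<lambda>j. u y * \<psi> j y) \<longlonglongrightarrow> u y * - partial_deriv i \<phi> y"
      by (intro AE_I2 tendsto_mult tendsto_const \<psi>_lim)
    show "AE y in lborel. norm (u y * \<psi> j y) \<le> M * (indicator ?B y * norm (u y))" for j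
      by (intro AE_I2 bound \<psi>_bd \<psi>_supp)
  qed (rule dom)
  have eq: "(LBINT x. (u (x + t j *\<^sub>R ?e) - u x) / t j * \<phi> x) = (LBINT y. u y * \<psi> j y)" for j
  proof -
    have i1: "integrable lborel (\<lambda>y. u y * \<phi> (y - t j *\<^sub>R ?e))"
    proof (rule Bochner_Integration.integrable_bound[OF dom])
      show "(\<lambda>y. u y * \<phi> (y - t j *\<^sub>R ?e)) \<in> borel_measurable lborel"
        using measurable_compose[OF _ m\<phi>(1), of "\<lambda>y. y - t j *\<^sub>R ?e" borel] by simp
      have z: "\<phi> (y - t j *\<^sub>R ?e) = 0" if "R + 1 < norm y" for y
        using \<psi>_supp[OF that, of j] R(2)[of y] that t(1)[of j] by (auto simp: \<psi>_def)
      show "AE y in lborel. norm (u y * \<phi> (y - t j *\<^sub>R ?e)) \<le> norm (M * (indicator ?B y * norm (u y)))"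
        using bound[OF M(2) z] M(1) by (intro AE_I2) (auto intro: order_trans[OF _ abs_ge_self])
    qed
    have i2: "integrable lborel (\<lambda>y. u y * \<phi> y)"
    proof (rule Bochner_Integration.integrable_bound[OF dom])
      show "(\<lambda>y. u y * \<phi> y) \<in> borel_measurable lborel" using m\<phi>(1) by simp
      have z: "\<phi> y = 0" if "R + 1 < norm y" for y using R(2)[of y] that by simp
      show "AE y in lborel. norm (u y * \<phi> y) \<le> norm (M * (indicator ?B y * norm (u y)))"
        using bound[OF M(2) z] M(1) by (intro AE_I2) (auto intro: order_trans[OF _ abs_ge_self])
    qed
    have i3: "integrable lborel (\<lambda>x. u (x + t j *\<^sub>R ?e) * \<phi> x)"
      using integrable_lborel_translate[OF i1, of "t j *\<^sub>R ?e"] by simp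
    have "(\<lambda>x. (u (x + t j *\<^sub>R ?e) - u x) / t j * \<phi> x) = (\<lambda>x. (u (x + t j *\<^sub>R ?e) * \<phi> x - u x * \<phi> x) / t j)"
      by (auto simp: diff_divide_distrib algebra_simps)
    then have "(LBINT x. (u (x + t j *\<^sub>R ?e) - u x) / t j * \<phi> x) =
        ((LBINT x. u (x + t j *\<^sub>R ?e) * \<phi> x) - (LBINT x. u x * \<phi> x)) / t j"
      using i2 i3 by simp
    also have "(LBINT x. u (x + t j *\<^sub>R ?e) * \<phi> x) = (LBINT y. u y * \<phi> (y - t j *\<^sub>R ?e))"
      using integral_lborel_translate[of "\<lambda>y. u y * \<phi> (y - t j *\<^sub>R ?e)" "t j *\<^sub>R ?e"] borel_measurable_integrable[OF i1] by simp
    also have "((LBINT y. u y * \<phi> (y - t j *\<^sub>R ?e)) - (LBINT x. u x * \<phi> x)) / t j =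
        (LBINT y. (u y * \<phi> (y - t j *\<^sub>R ?e) - u y * \<phi> y) / t j)"
      using i1 i2 by simp
    also have "(\<lambda>y. (u y * \<phi> (y - t j *\<^sub>R ?e) - u y * \<phi> y) / t j) = (\<lambda>y. u y * \<psi> j y)"
      by (auto simp: \<psi>_def diff_divide_distrib algebra_simps)
    finally show ?thesis .
  qed
  show ?thesis using lim unfolding eq by simp
qed

lemma borel_measurable_vec_lambda:
  fixes G :: "'n::finite \<Rightarrow> 'a \<Rightarrow> real"
  assumes [measurable]: "\<And>i. G i \<in> borel_measurable N"
  shows "(\<lambda>x. \<chi> i. G i x) \<in> borel_measurable N"
proof -
  have "(\<lambda>x. \<chi> i. G i x) = (\<lambda>x. \<Sum>i\<in>UNIV. G i x *\<^sub>R (axis i 1 :: real ^ 'n))"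
  proof
    fix x show "(\<chi> i. G i x) = (\<Sum>i\<in>UNIV. G i x *\<^sub>R (axis i 1 :: real ^ 'n))"
      using basis_expansion[of "\<chi> i. G i x"] by (simp add: scalar_mult_eq_scaleR)
  qed
  then show ?thesis by simp
qed

text \<open>The components of the gradient are weak limits of the difference quotients in the coordinate
  directions.\<close>

theorem sobolev_pair_of_energy_bound:
  fixes u :: "real ^ 'n \<Rightarrow> real"
  assumes mu: "u \<in> borel_measurable borel" and int: "integrable lborel (\<lambda>x. \<bar>u x\<bar> powr r)" and r: "1 < r" and M: "0 \<le> M"
    and freq: "\<exists>\<^sub>F s in at_left 1. (NBINT z. ennreal (kern r s z) * modulus r u z) \<le> ennreal M"
  shows "\<exists>g. sobolev_pair r u g"
proof -
  have r0: "0 < r" using r by simp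
  obtain C where C: "0 \<le> C" "\<And>t0. 0 < t0 \<Longrightarrow> \<exists>t. 0 < t \<and> t < t0 \<and> (\<forall>h. norm h = t \<longrightarrow> modulus r u h \<le> ennreal (C * t powr r))"
    using small_difference_quotients[OF mu r0 M freq] by blast
  have "\<forall>j::nat. \<exists>t. 0 < t \<and> t < 1 / real (Suc j) \<and> (\<forall>h. norm h = t \<longrightarrow> modulus r u h \<le> ennreal (C * t powr r))"
    using C(2) by (intro allI) simp
  then obtain t where t: "\<And>j::nat. 0 < t j" "\<And>j. t j < 1 / real (Suc j)"
    "\<And>j h. norm h = t j \<Longrightarrow> modulus r u h \<le> ennreal (C * t j powr r)" by metis
  have t1: "t j \<le> 1" for j
  proof -
    have "1 / real (Suc j) \<le> 1" by simp
    then show ?thesis using t(2)[of j] by linarith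
  qed
  have tlim: "t \<longlonglongrightarrow> 0"
  proof (rule tendsto_sandwich[of "\<lambda>_. 0" t sequentially "\<lambda>j. inverse (real (Suc j))"])
    show "\<forall>\<^sub>F j in sequentially. t j \<le> inverse (real (Suc j))"
      using t(2) by (intro always_eventually) (auto simp: inverse_eq_divide intro: less_imp_le)
    show "\<forall>\<^sub>F j in sequentially. 0 \<le> t j" using t(1) by (intro always_eventually) (auto intro: less_imp_le)
  qed (auto intro: LIMSEQ_inverse_real_of_nat simp del: of_nat_Suc)
  define P where "P i G \<longleftrightarrow> G \<in> borel_measurable borel \<and> (NBINT x. ennreal (\<bar>G x\<bar> powr r)) \<le> ennreal C \<and>
      (\<forall>\<phi>. test_function \<phi> \<longrightarrow> (LBINT x. G x * \<phi> x) = - (LBINT x. u x * partial_deriv i \<phi> x))" for i G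
  have "\<exists>G. P i G" for i
  proof -
    let ?D = "\<lambda>j x. (u (x + t j *\<^sub>R axis i 1) - u x) / t j"
    have mS: "(\<lambda>x. u (x + t j *\<^sub>R axis i 1)) \<in> borel_measurable borel" for j
      by (rule measurable_compose[OF _ mu]) simp
    have mD: "?D j \<in> borel_measurable borel" for j
      by (intro borel_measurable_divide borel_measurable_diff mS mu) simp
    have mP: "(\<lambda>x. ennreal (1 * \<bar>u (x + t j *\<^sub>R axis i 1) - u x\<bar> powr r)) \<in> borel_measurable lborel" for j
      using borel_measurable_diff[OF mS[of j] mu] by simp
    have bD: "(NBINT x. ennreal (\<bar>?D j x\<bar> powr r)) \<le> ennreal C" for j
    proof -
      have tj: "0 < t j powr r" using t(1)[of j] by simp
      have "(NBINT x. ennreal (\<bar>?D j x\<bar> powr r)) = (NBINT x. ennreal (1 / t j powr r) * ennreal (1 * \<bar>u (x + t j *\<^sub>R axis i 1) - u x\<bar> powr r))"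
      proof (rule nn_integral_cong)
        fix x
        have "\<bar>?D j x\<bar> powr r = 1 / t j powr r * (1 * \<bar>u (x + t j *\<^sub>R axis i 1) - u x\<bar> powr r)"
          using t(1)[of j] by (simp add: powr_divide)
        then show "ennreal (\<bar>?D j x\<bar> powr r) = ennreal (1 / t j powr r) * ennreal (1 * \<bar>u (x + t j *\<^sub>R axis i 1) - u x\<bar> powr r)"
          by (simp only: ennreal_mult' powr_ge_zero divide_nonneg_nonneg zero_le_one)
      qed
      also have "\<dots> = ennreal (1 / t j powr r) * modulus r u (t j *\<^sub>R axis i 1)"
        unfolding increment_def by (rule nn_integral_cmult[OF mP])
      also have "\<dots> \<le> ennreal (1 / t j powr r) * ennreal (C * t j powr r)"
        using t(1)[of j] by (intro mult_left_mono t(3)) auto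
      also have "\<dots> = ennreal C" using C(1) tj by (simp add: ennreal_mult[symmetric])
      finally show ?thesis .
    qed
    obtain G where "G \<in> borel_measurable borel" "(NBINT x. ennreal (\<bar>G x\<bar> powr r)) \<le> ennreal C"
      "\<And>\<phi>. \<phi> \<in> Collect test_function \<Longrightarrow> (LBINT x. G x * \<phi> x) = - (LBINT x. u x * partial_deriv i \<phi> x)"
    proof (rule Lr_weak_limit[where f="?D" and T="\<lambda>\<phi>. - (LBINT x. u x * partial_deriv i \<phi> x)" and \<Phi>="Collect test_function", OF mD r C(1) bD])
      fix \<phi> assume "\<phi> \<in> Collect (test_function :: (real ^ 'n \<Rightarrow> real) \<Rightarrow> bool)"
      then have \<phi>: "test_function \<phi>" by simp
      obtain R where R: "\<And>x. R < norm x \<Longrightarrow> \<phi> x = 0" using test_function_support[OF \<phi>] by metis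
      obtain M where M: "0 < M" "\<And>x. \<bar>\<phi> x\<bar> \<le> M" using test_function_bounded[OF \<phi>] by metis
      show "\<phi> \<in> borel_measurable borel \<and> (\<exists>M>0. \<forall>x. \<bar>\<phi> x\<bar> \<le> M) \<and> (\<exists>R. \<forall>x. R < norm x \<longrightarrow> \<phi> x = 0)"
        using test_function_borel(1)[OF \<phi>] R M by blast
      show "(\<lambda>j. LBINT x. ?D j x * \<phi> x) \<longlonglongrightarrow> - (LBINT x. u x * partial_deriv i \<phi> x)"
        by (rule difference_quotient_pairing_tendsto[OF mu int r t(1) tlim t1 \<phi>])
    qed blast
    then show ?thesis unfolding P_def by auto
  qed
  then obtain G where "\<And>i. P i (G i)" by metis
  then have G: "\<And>i. G i \<in> borel_measurable borel" "\<And>i. (NBINT x. ennreal (\<bar>G i x\<bar> powr r)) \<le> ennreal C"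
      "\<And>i \<phi>. test_function \<phi> \<Longrightarrow> (LBINT x. G i x * \<phi> x) = - (LBINT x. u x * partial_deriv i \<phi> x)"
    unfolding P_def by blast+
  define g where "g x = (\<chi> i. G i x)" for x
  have mg: "g \<in> borel_measurable borel"
    unfolding g_def using G(1) by (rule borel_measurable_vec_lambda)
  have "integrable lborel (\<lambda>x. norm (g x) powr r)"
  proof (rule Bochner_Integration.integrable_bound)
    have "integrable lborel (\<lambda>x. \<bar>G i x\<bar> powr r)" for i
      using G(1)[of i] G(2)[of i] by (intro integrableI_bounded) (auto simp: order_le_less_trans)
    then show "integrable lborel (\<lambda>x. real CARD('n) powr r * (\<Sum>i\<in>UNIV. \<bar>G i x\<bar> powr r))" by simp
    show "AE x in lborel. norm (norm (g x) powr r) \<le> norm (real CARD('n) powr r * (\<Sum>i\<in>UNIV. \<bar>G i x\<bar> powr r))"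
    proof (intro AE_I2)
      fix x
      define m where "m = Max (range (\<lambda>i. \<bar>G i x\<bar>))"
      have "m \<in> range (\<lambda>i. \<bar>G i x\<bar>)" unfolding m_def by (rule Max_in) auto
      then obtain i0 where i0: "m = \<bar>G i0 x\<bar>" by auto
      have "norm (g x) \<le> (\<Sum>i\<in>UNIV. \<bar>g x $ i\<bar>)" by (rule norm_le_l1_cart)
      also have "\<dots> \<le> (\<Sum>i\<in>(UNIV :: 'n set). m)" unfolding m_def g_def by (intro sum_mono) auto
      finally have "norm (g x) \<le> real CARD('n) * m" by simp
      then have "norm (g x) powr r \<le> (real CARD('n) * m) powr r" using r by (intro powr_mono2) auto
      also have "\<dots> = real CARD('n) powr r * \<bar>G i0 x\<bar> powr r" by (simp add: i0 powr_mult)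
      also have "\<dots> \<le> real CARD('n) powr r * (\<Sum>i\<in>UNIV. \<bar>G i x\<bar> powr r)"
        by (intro mult_left_mono member_le_sum) auto
      finally show "norm (norm (g x) powr r) \<le> norm (real CARD('n) powr r * (\<Sum>i\<in>UNIV. \<bar>G i x\<bar> powr r))"
        by (simp add: sum_nonneg)
    qed
    show "(\<lambda>x. norm (g x) powr r) \<in> borel_measurable lborel" using mg by measurable
  qed
  then have "sobolev_pair r u g"
    unfolding sobolev_pair_def using mu mg int G(3) by (simp add: g_def)
  then show ?thesis by blast
qed

section \<open>Coefficients depending on both variables\<close>

lemma nn_integral_lborel_shear:
  fixes F :: "'a::euclidean_space \<times> 'a \<Rightarrow> ennreal"
  assumes F: "F \<in> borel_measurable borel"
  shows "(NBINT p. F p) = (NBINT z. NBINT x. F (x, x + z))"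
proof -
  have m: "F \<in> borel_measurable (lborel \<Otimes>\<^sub>M lborel)" using F by (simp add: lborel_prod)
  have mp: "(\<lambda>p :: 'a \<times> 'a. (fst p, fst p + snd p)) \<in> borel \<rightarrow>\<^sub>M borel"
    by (intro borel_measurable_continuous_onI continuous_intros)
  have "(\<lambda>p. F (fst p, fst p + snd p)) \<in> borel_measurable borel"
    by (rule measurable_compose[OF mp F])
  then have ms: "(\<lambda>(x, z). F (x, x + z)) \<in> borel_measurable (lborel \<Otimes>\<^sub>M lborel)"
    by (simp add: lborel_prod case_prod_beta')
  have mF: "(\<lambda>y. F (x, y)) \<in> borel_measurable borel" for x
    by (rule measurable_compose[OF _ F]) (intro borel_measurable_continuous_onI continuous_intros)
  have "(NBINT p. F p) = (NBINT x. NBINT y. F (x, y))"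
    using lborel.nn_integral_fst[OF m] by (simp add: lborel_prod)
  also have "\<dots> = (NBINT x. NBINT z. F (x, x + z))"
    using nn_integral_lborel_translate[OF mF] by simp
  also have "\<dots> = (NBINT z. NBINT x. F (x, x + z))"
    using lborel_pair.Fubini'[OF ms] by simp
  finally show ?thesis .
qed

text \<open>The map \<open>(x, z) \<mapsto> (x, x + z)\<close> preserves null sets, and almost every section of
  a null set is one.\<close>

lemma AE_lborel_shear:
  fixes Q :: "'a::euclidean_space \<times> 'a \<Rightarrow> bool"
  assumes "AE p in lborel. Q p"
  shows "AE z in lborel. AE x in lborel. Q (x, x + z)"
proof -
  obtain N where N: "{p. \<not> Q p} \<subseteq> N" "emeasure lborel N = 0" "N \<in> sets borel"
    using assms unfolding eventually_ae_filter by (auto simp: null_sets_def)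
  have mN: "(indicator N :: _ \<Rightarrow> ennreal) \<in> borel_measurable borel" using N(3) by simp
  have mp: "(\<lambda>p :: 'a \<times> 'a. (snd p, snd p + fst p)) \<in> borel \<rightarrow>\<^sub>M borel"
    by (intro borel_measurable_continuous_onI continuous_intros)
  have m2: "(\<lambda>p. indicator N (snd p, snd p + fst p) :: ennreal) \<in> borel_measurable (lborel \<Otimes>\<^sub>M lborel)"
    using measurable_compose[OF mp mN] by (simp add: lborel_prod)
  then have m: "(\<lambda>z. \<integral>\<^sup>+x. indicator N (x, x + z) \<partial>lborel) \<in> borel_measurable lborel"
    using lborel.borel_measurable_nn_integral[of "\<lambda>z x. indicator N (x, x + z)" lborel] by (simp add: case_prod_beta')
  have mp1: "(\<lambda>x :: 'a. (x, x + z)) \<in> borel \<rightarrow>\<^sub>M borel" for z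
    by (intro borel_measurable_continuous_onI continuous_intros)
  have m1: "(\<lambda>x. indicator N (x, x + z) :: ennreal) \<in> borel_measurable lborel" for z
    using measurable_compose[OF mp1 mN] by simp
  have "(NBINT z. NBINT x. indicator N (x, x + z)) = 0"
    using nn_integral_lborel_shear[OF mN] N by simp
  then have "AE z in lborel. (NBINT x. indicator N (x, x + z)) = 0"
    using nn_integral_0_iff_AE[OF m] by simp
  then show ?thesis
  proof eventually_elim
    case (elim z)
    then have "AE x in lborel. indicator N (x, x + z) = (0 :: ennreal)" using nn_integral_0_iff_AE[OF m1] by simp
    then show ?case by eventually_elim (use N(1) in \<open>auto simp: indicator_def split: if_splits\<close>)
  qed
qed

lemma AE_imp_dense:
  fixes Z :: "'a::euclidean_space set"
  assumes "AE z in lborel. z \<in> Z"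
  shows "closure Z = UNIV"
proof (rule ccontr)
  assume "closure Z \<noteq> UNIV"
  then have "\<not> negligible (- closure Z)" by (intro open_not_negligible) auto
  moreover have "AE z in lebesgue. z \<notin> - closure Z"
    using assms by (intro AE_completion) (auto elim!: eventually_mono dest: closure_subset[THEN subsetD])
  then have "- closure Z \<in> null_sets lebesgue" by (subst AE_iff_null_sets) auto
  ultimately show False by (simp add: negligible_iff_null_sets)
qed

text \<open>The coefficient \<open>a\<close> agrees with the Borel function \<open>c\<close> only almost
  everywhere. For almost every shift \<open>z\<close> the two agree at \<open>(x, x + z)\<close> for
  almost all \<open>x\<close>, and there is a countable dense set of such shifts. The supremum of
  \<open>c (x, x + d)\<close> over the small \<open>d\<close> in this set is a Borel function of
  \<open>x\<close>; by continuity of \<open>a x\<close> it is an upper bound for all small shifts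
  and tends to \<open>a x x\<close>.\<close>

lemma upper_envelope:
  fixes a :: "'a::euclidean_space \<Rightarrow> 'a \<Rightarrow> real" and c :: "'a \<times> 'a \<Rightarrow> real"
  assumes mc: "c \<in> borel_measurable borel" and cont: "\<And>x. continuous_on UNIV (a x)"
    and eq: "AE p in lborel. a (fst p) (snd p) = c p" and bd: "\<And>p. lo \<le> c p" "\<And>p. c p \<le> hi"
  obtains b :: "nat \<Rightarrow> 'a \<Rightarrow> real" where "\<And>j. b j \<in> borel_measurable borel" "\<And>j x. lo \<le> b j x" "\<And>j x. b j x \<le> hi"
    "AE z in lborel. AE x in lborel. \<forall>j. norm z < 1 / real (Suc j) \<longrightarrow> c (x, x + z) \<le> b j x"
    "AE x in lborel. (\<lambda>j. b j x) \<longlonglongrightarrow> a x x"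
proof -
  define Z where "Z = {z. AE x in lborel. a x (x + z) = c (x, x + z)}"
  have Z: "AE z in lborel. z \<in> Z" using AE_lborel_shear[OF eq] by (simp add: Z_def)
  obtain D where D: "countable D" "D \<subseteq> Z" "Z \<subseteq> closure D" by (rule separable)
  have dense: "closure D = UNIV"
    using AE_imp_dense[OF Z] closure_mono[OF D(3)] by auto
  have hit: "\<exists>d\<in>D. d \<in> U" if "open U" "z \<in> U" for U z
  proof -
    have "z \<in> closure D" using dense by simp
    then have "D \<inter> U \<noteq> {}" using that by (metis IntI Int_commute closure_iff_nhds_not_empty empty_iff subset_refl)
    then show ?thesis by blast
  qed
  define B where "B j = D \<inter> ball 0 (1 / real (Suc j))" for j
  have Bne: "B j \<noteq> {}" for j using hit[of "ball 0 (1 / real (Suc j))" 0] by (auto simp: B_def)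
  define b where "b j x = (SUP d\<in>B j. c (x, x + d))" for j x
  have bda: "bdd_above ((\<lambda>d. c (x, x + d)) ` B j)" for x j using bd(2) by (intro bdd_aboveI2[of _ _ hi])
  have upper: "c (x, x + d) \<le> b j x" if "d \<in> B j" for d j x unfolding b_def by (rule cSUP_upper[OF that bda])
  define good where "good x \<longleftrightarrow> (\<forall>d\<in>D. a x (x + d) = c (x, x + d))" for x
  have AEg: "AE x in lborel. good x"
    unfolding good_def by (rule AE_ball_countable'[OF _ D(1)]) (use D(2) in \<open>auto simp: Z_def\<close>)
  have ale: "a x (x + z) \<le> b j x" if x: "good x" and z: "norm z < 1 / real (Suc j)" for x z j
  proof (rule ccontr)
    assume neg: "\<not> a x (x + z) \<le> b j x"
    let ?U = "{y. b j x < a x (x + y)} \<inter> ball 0 (1 / real (Suc j))"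
    have "continuous_on UNIV (\<lambda>y. a x (x + y))"
      by (rule continuous_on_compose2[OF cont]) (auto intro!: continuous_intros)
    then have "open {y. b j x < a x (x + y)}" by (intro open_Collect_less continuous_on_const)
    then have "open ?U" by blast
    moreover have "z \<in> ?U" using z neg by (simp add: not_le)
    ultimately obtain d where d: "d \<in> D" "d \<in> ?U" using hit by blast
    have "a x (x + d) = c (x, x + d)" using x d(1) unfolding good_def by blast
    also have "\<dots> \<le> b j x" using d by (intro upper) (simp add: B_def)
    finally show False using d(2) by simp
  qed
  show thesis
  proof (rule that[of b])
    show "b j \<in> borel_measurable borel" for j unfolding b_def
    proof (rule borel_measurable_cSUP[OF _ _ bda])
      show "countable (B j)" using D(1) by (simp add: B_def)
      show "(\<lambda>x. c (x, x + d)) \<in> borel_measurable borel" for d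
        by (rule measurable_compose[OF _ mc]) (intro borel_measurable_continuous_onI continuous_intros)
    qed
    show "lo \<le> b j x" for j x
    proof -
      obtain d where "d \<in> B j" using Bne[of j] by blast
      from upper[OF this, of x] show ?thesis using bd(1)[of "(x, x + d)"] by linarith
    qed
    show "b j x \<le> hi" for j x unfolding b_def using Bne[of j] bd(2) by (intro cSUP_least) auto
    show "AE z in lborel. AE x in lborel. \<forall>j. norm z < 1 / real (Suc j) \<longrightarrow> c (x, x + z) \<le> b j x"
      using Z
    proof eventually_elim
      case (elim z)
      then have "AE x in lborel. a x (x + z) = c (x, x + z)" by (simp add: Z_def)
      with AEg show ?case
      proof eventually_elim
        case (elim x)
        then show ?case using ale[of x z] by (metis elim(2))
      qed
    qed
    show "AE x in lborel. (\<lambda>j. b j x) \<longlonglongrightarrow> a x x"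
      using AEg
    proof eventually_elim
      case (elim x)
      show ?case unfolding LIMSEQ_iff
      proof (intro allI impI)
        fix e :: real assume e: "0 < e"
        have "continuous (at x) (a x)" using cont[of x] by (simp add: continuous_on_eq_continuous_at)
        then obtain d where d: "0 < d" "\<And>y. dist y x < d \<Longrightarrow> dist (a x y) (a x x) < e / 2"
          unfolding continuous_at_eps_delta using half_gt_zero[OF e] by blast
        obtain n where n: "1 / real (Suc n) < d" using nat_approx_posE[OF d(1)] by metis
        show "\<exists>n. \<forall>j\<ge>n. norm (b j x - a x x) < e"
        proof (intro exI[of _ n] allI impI)
          fix j assume j: "n \<le> j"
          have "1 / real (Suc j) \<le> 1 / real (Suc n)" using j by (simp add: frac_le)
          then have jd: "1 / real (Suc j) < d" using n by linarith
          have "b j x \<le> a x x + e / 2" unfolding b_def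
          proof (rule cSUP_least[OF Bne])
            fix z assume z: "z \<in> B j"
            then have "dist (x + z) x < d" using jd by (simp add: B_def dist_norm)
            from d(2)[OF this] have "a x (x + z) - a x x < e / 2" unfolding dist_real_def abs_less_iff by (rule conjunct1)
            moreover have "a x (x + z) = c (x, x + z)" using elim z unfolding good_def B_def by blast
            ultimately show "c (x, x + z) \<le> a x x + e / 2" by linarith
          qed
          moreover have "a x x \<le> b j x" using ale[OF elim, of 0 j] by simp
          ultimately show "norm (b j x - a x x) < e" using e by simp
        qed
      qed
    qed
  qed
qed

lemma ennreal_sandwich_tendsto:
  fixes E :: "real \<Rightarrow> ennreal"
  assumes UV: "U \<longlonglongrightarrow> L" "V \<longlonglongrightarrow> L" and fin: "\<And>j. V j < top"
    and lim: "\<And>j. (P j \<longlongrightarrow> U j) (at_left 1)" "\<And>j. (Q j \<longlongrightarrow> V j) (at_left 1)" "\<And>j. (R j \<longlongrightarrow> 0) (at_left 1)"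
    and le: "\<And>j. \<forall>\<^sub>F s in at_left 1. E s \<le> P j s + R j s" "\<And>j. \<forall>\<^sub>F s in at_left 1. Q j s \<le> E s + R j s"
  shows "(E \<longlongrightarrow> L) (at_left 1)"
proof -
  have nb: "at_left (1::real) \<noteq> bot" by simp
  have "Limsup (at_left 1) E \<le> U j" for j
  proof -
    have "((\<lambda>s. P j s + R j s) \<longlongrightarrow> U j + 0) (at_left 1)" by (intro tendsto_add lim)
    then have "Limsup (at_left 1) (\<lambda>s. P j s + R j s) = U j" using lim_imp_Limsup[OF nb] by simp
    then show ?thesis using Limsup_mono[OF le(1)[of j]] by simp
  qed
  then have up: "Limsup (at_left 1) E \<le> L" by (intro LIMSEQ_le_const[OF UV(1)]) auto
  have "V j \<le> Liminf (at_left 1) E" for j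
  proof -
    have "((\<lambda>s. Q j s - R j s) \<longlongrightarrow> V j - 0) (at_left 1)"
      using fin[of j] by (intro tendsto_diff_ennreal lim) auto
    then have "Liminf (at_left 1) (\<lambda>s. Q j s - R j s) = V j" using lim_imp_Liminf[OF nb] by simp
    moreover have "\<forall>\<^sub>F s in at_left 1. Q j s - R j s \<le> E s"
      using le(2)[of j] order_tendstoD(2)[OF lim(2) fin, of j] by eventually_elim (auto simp: ennreal_minus_le_iff add.commute)
    from Liminf_mono[OF this] have "Liminf (at_left 1) (\<lambda>s. Q j s - R j s) \<le> Liminf (at_left 1) E" .
    ultimately show ?thesis by simp
  qed
  then have "L \<le> Liminf (at_left 1) E" by (intro LIMSEQ_le_const2[OF UV(2)]) auto
  moreover have "Liminf (at_left 1) E \<le> Limsup (at_left 1) E" by (rule Liminf_le_Limsup[OF nb])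
  ultimately have "Liminf (at_left 1) E = L" "Limsup (at_left 1) E = L" using up by auto
  then show ?thesis using tendsto_Limsup[OF nb] by metis
qed

lemma weighted_integral_tendsto:
  fixes w :: "'a::euclidean_space \<Rightarrow> real"
  assumes mb[measurable]: "\<And>j. b j \<in> borel_measurable borel" and b: "\<And>j x. b j x \<le> hi"
    and lim: "AE x in lborel. (\<lambda>j. b j x) \<longlonglongrightarrow> f x" and w: "integrable lborel w" "\<And>x. 0 \<le> w x"
  shows "(\<lambda>j. \<integral>\<^sup>+x. ennreal (b j x * w x) \<partial>lborel) \<longlonglongrightarrow> (NBINT x. ennreal (f x * w x))"
proof -
  have mw[measurable]: "w \<in> borel_measurable borel" using borel_measurable_integrable[OF w(1)] by simp
  have eq: "AE x in lborel. lim (\<lambda>j. b j x) = f x" using lim by eventually_elim (rule limI)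
  have "(\<lambda>j. \<integral>\<^sup>+x. ennreal (b j x * w x) \<partial>lborel) \<longlonglongrightarrow> (NBINT x. ennreal (lim (\<lambda>j. b j x) * w x))"
  proof (rule nn_integral_dominated_convergence[where w="\<lambda>x. ennreal (\<bar>hi\<bar> * w x)"])
    show "(NBINT x. ennreal (\<bar>hi\<bar> * w x)) < \<infinity>"
      using integrable_iff_bounded[THEN iffD1, THEN conjunct2, OF integrable_mult_right[OF w(1), of "\<bar>hi\<bar>"]] w(2)
      by (simp add: abs_mult)
    show "AE x in lborel. ennreal (b j x * w x) \<le> ennreal (\<bar>hi\<bar> * w x)" for j
      using b w(2) by (intro AE_I2 ennreal_leI mult_right_mono) (auto intro: order_trans[OF _ abs_ge_self])
    show "AE x in lborel. (\<lambda>j. ennreal (b j x * w x)) \<longlonglongrightarrow> ennreal (lim (\<lambda>j. b j x) * w x)"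
      using lim eq
    proof eventually_elim
      case (elim x)
      show ?case unfolding elim(2) by (intro tendsto_ennrealI tendsto_mult elim(1) tendsto_const)
    qed
  qed measurable
  also have "(NBINT x. ennreal (lim (\<lambda>j. b j x) * w x)) = (NBINT x. ennreal (f x * w x))"
    using eq by (intro nn_integral_cong_AE) (auto elim: eventually_mono)
  finally show ?thesis .
qed

lemma increment_mono_AE:
  assumes "AE x in lborel. b x \<le> b' x"
  shows "increment b r u z \<le> increment b' r u z"
  unfolding increment_def
  using assms by (intro nn_integral_mono_AE) (auto elim!: eventually_mono intro!: ennreal_leI mult_right_mono)

lemma increment_variable_measurable:
  fixes u :: "real ^ 'n \<Rightarrow> real" and c :: "(real ^ 'n) \<times> (real ^ 'n) \<Rightarrow> real"
  assumes mu: "u \<in> borel_measurable borel" and mc: "c \<in> borel_measurable borel"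
  shows "(\<lambda>z. increment (\<lambda>x. c (x, x + z)) r u z) \<in> borel_measurable borel"
proof -
  have "(\<lambda>p. ennreal (c (snd p, snd p + fst p) * \<bar>u (snd p + fst p) - u (snd p)\<bar> powr r)) \<in> borel_measurable borel"
  proof -
    have "(\<lambda>p. c (snd p, snd p + fst p)) \<in> borel_measurable borel"
      by (rule measurable_compose[OF _ mc]) (intro borel_measurable_continuous_onI continuous_intros)
    moreover have "(\<lambda>p. u (snd p + fst p)) \<in> borel_measurable (borel :: ((real ^ 'n) \<times> (real ^ 'n)) measure)"
      by (rule measurable_compose[OF _ mu]) (intro borel_measurable_continuous_onI continuous_intros)
    moreover have "(\<lambda>p. u (snd p)) \<in> borel_measurable (borel :: ((real ^ 'n) \<times> (real ^ 'n)) measure)"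
      by (rule measurable_compose[OF _ mu]) (intro borel_measurable_continuous_onI continuous_intros)
    ultimately show ?thesis by measurable
  qed
  then show ?thesis unfolding increment_def
    using lborel.borel_measurable_nn_integral[of "\<lambda>z x. ennreal (c (x, x + z) * \<bar>u (x + z) - u x\<bar> powr r)" lborel]
    by (simp add: lborel_prod case_prod_beta')
qed

text \<open>The lower weights are obtained from the upper ones of \<open>- a\<close>. For each of them the limit
  is known, and the part of the energy outside a ball, where the sandwich fails, vanishes in the
  limit.\<close>

theorem variable_energy_tendsto:
  fixes a :: "real ^ 'n \<Rightarrow> real ^ 'n \<Rightarrow> real" and c :: "(real ^ 'n) \<times> (real ^ 'n) \<Rightarrow> real" and k :: 'n
  assumes S: "sobolev_pair r u g" and r: "1 < r"
    and mc: "c \<in> borel_measurable borel" and cont: "\<And>x. continuous_on UNIV (a x)"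
    and eq: "AE p in lborel. a (fst p) (snd p) = c p" and lo: "0 \<le> lo" and bd: "\<And>p. lo \<le> c p" "\<And>p. c p \<le> hi"
  shows "((\<lambda>s. \<integral>\<^sup>+z. ennreal (kern r s z) * increment (\<lambda>x. c (x, x + z)) r u z \<partial>lborel) \<longlongrightarrow>
     K_const k r * (NBINT x. ennreal (a x x * norm (g x) powr r))) (at_left 1)"
proof -
  have mu[measurable]: "u \<in> borel_measurable borel" and intu: "integrable lborel (\<lambda>x. \<bar>u x\<bar> powr r)"
    and intg: "integrable lborel (\<lambda>x. norm (g x) powr r)"
    using S unfolding sobolev_pair_def by auto
  have hi: "0 \<le> hi" using lo bd[of "(0, 0)"] by linarith
  obtain bp :: "nat \<Rightarrow> real ^ 'n \<Rightarrow> real" where bp: "\<And>j. bp j \<in> borel_measurable borel" "\<And>j x. lo \<le> bp j x" "\<And>j x. bp j x \<le> hi"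
    "AE z in lborel. AE x in lborel. \<forall>j. norm z < 1 / real (Suc j) \<longrightarrow> c (x, x + z) \<le> bp j x"
    "AE x in lborel. (\<lambda>j. bp j x) \<longlonglongrightarrow> a x x"
    by (rule upper_envelope[OF mc cont eq bd], rule that)
  have mc': "(\<lambda>p. - c p) \<in> borel_measurable borel" using mc by simp
  have cont': "continuous_on UNIV (\<lambda>y. - a x y)" for x using cont by (rule continuous_on_minus)
  have eq': "AE p in lborel. - a (fst p) (snd p) = - c p" using eq by eventually_elim simp
  obtain bn :: "nat \<Rightarrow> real ^ 'n \<Rightarrow> real" where bn: "\<And>j. bn j \<in> borel_measurable borel" "\<And>j x. - hi \<le> bn j x" "\<And>j x. bn j x \<le> - lo"
    "AE z in lborel. AE x in lborel. \<forall>j. norm z < 1 / real (Suc j) \<longrightarrow> - c (x, x + z) \<le> bn j x"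
    "AE x in lborel. (\<lambda>j. bn j x) \<longlonglongrightarrow> - a x x"
    by (rule upper_envelope[OF mc' cont' eq', of "- hi" "- lo"]) (use bd in auto)
  define bm where "bm j x = - bn j x" for j x
  have mbm: "bm j \<in> borel_measurable borel" for j unfolding bm_def using bn(1)[of j] by simp
  have bm: "0 \<le> bm j x" "bm j x \<le> hi" for j x using bn(2,3)[of j x] lo by (auto simp: bm_def)
  have bp0: "0 \<le> bp j x" for j x using bp(2)[of j x] lo by linarith
  have bmlim: "AE x in lborel. (\<lambda>j. bm j x) \<longlonglongrightarrow> a x x"
    using bn(5) by eventually_elim (drule tendsto_minus, simp add: bm_def)
  let ?K = "K_const k r" and ?I = "\<lambda>z. increment (\<lambda>x. c (x, x + z)) r u z"
  \<comment> \<open>Every \<open>z\<close> outside the open ball of radius \<open>1 / Suc j\<close> lies in the far region.\<close>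
  let ?\<delta> = "\<lambda>j. 1 / real (Suc (Suc j))"
  have K: "?K < top" using r by (rule K_const_finite)
  let ?R = "\<lambda>j s. \<integral>\<^sup>+z. ennreal (kern r s z) * increment (\<lambda>_. hi) r u z * indicator (far (?\<delta> j)) z \<partial>lborel"
  have \<delta>: "?\<delta> j < 1 / real (Suc j)" for j by (simp add: frac_less2)
  have AEp: "AE z in lborel. \<forall>j. norm z < 1 / real (Suc j) \<longrightarrow> ?I z \<le> increment (bp j) r u z"
    using bp(4) by eventually_elim (auto intro!: increment_mono_AE elim!: eventually_mono)
  have AEm: "AE z in lborel. \<forall>j. norm z < 1 / real (Suc j) \<longrightarrow> increment (bm j) r u z \<le> ?I z"
    using bn(4)
  proof eventually_elim
    case (elim z)
    then have "AE x in lborel. \<forall>j. norm z < 1 / real (Suc j) \<longrightarrow> bm j x \<le> c (x, x + z)"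
      by eventually_elim (auto simp: bm_def minus_le_iff)
    then show ?case by (auto intro!: increment_mono_AE elim!: eventually_mono)
  qed
  show ?thesis
  proof (rule ennreal_sandwich_tendsto[where R="?R"
      and P="\<lambda>j s. \<integral>\<^sup>+z. ennreal (kern r s z) * increment (bp j) r u z \<partial>lborel" and U="\<lambda>j. ?K * (NBINT x. ennreal (bp j x * norm (g x) powr r))"
      and Q="\<lambda>j s. \<integral>\<^sup>+z. ennreal (kern r s z) * increment (bm j) r u z \<partial>lborel" and V="\<lambda>j. ?K * (NBINT x. ennreal (bm j x * norm (g x) powr r))"])
    show "(\<lambda>j. ?K * (NBINT x. ennreal (bp j x * norm (g x) powr r))) \<longlonglongrightarrow> ?K * (NBINT x. ennreal (a x x * norm (g x) powr r))"
      by (intro ennreal_tendsto_cmult K weighted_integral_tendsto[OF bp(1,3,5) intg]) simp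
    show "(\<lambda>j. ?K * (NBINT x. ennreal (bm j x * norm (g x) powr r))) \<longlonglongrightarrow> ?K * (NBINT x. ennreal (a x x * norm (g x) powr r))"
      by (intro ennreal_tendsto_cmult K weighted_integral_tendsto[OF mbm bm(2) bmlim intg]) simp
    show "?K * (NBINT x. ennreal (bm j x * norm (g x) powr r)) < top" for j
    proof -
      have "(NBINT x. ennreal (bm j x * norm (g x) powr r)) \<le> (NBINT x. ennreal (hi * norm (g x) powr r))"
        using bm(2) by (intro nn_integral_mono ennreal_leI mult_right_mono) auto
      also have "\<dots> < top" using integrable_iff_bounded[THEN iffD1, THEN conjunct2, OF integrable_mult_right[OF intg, of hi]] hi
        by (simp add: abs_mult)
      finally show ?thesis using K by (simp add: ennreal_mult_less_top)
    qed
    show "((\<lambda>s. \<integral>\<^sup>+z. ennreal (kern r s z) * increment (bp j) r u z \<partial>lborel) \<longlongrightarrow> ?K * (NBINT x. ennreal (bp j x * norm (g x) powr r))) (at_left 1)" for j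
      by (rule weighted_energy_tendsto[OF S r bp(1) bp0 bp(3)])
    show "((\<lambda>s. \<integral>\<^sup>+z. ennreal (kern r s z) * increment (bm j) r u z \<partial>lborel) \<longlongrightarrow> ?K * (NBINT x. ennreal (bm j x * norm (g x) powr r))) (at_left 1)" for j
      by (rule weighted_energy_tendsto[OF S r mbm bm])
    show "(?R j \<longlongrightarrow> 0) (at_left 1)" for j
      by (rule far_energy_tendsto_0[where B=hi]) (use mu hi r intu in auto)
    note m[measurable] = increment_measurable[OF bp(1) mu] increment_measurable[OF mbm mu]
    have mk: "(\<lambda>z. ennreal (kern r s z)) \<in> borel_measurable borel" for s by measurable
    have mh: "increment (\<lambda>_. hi) r u \<in> borel_measurable borel" by (intro increment_measurable) auto
    have mR: "(\<lambda>z. ennreal (kern r s z) * increment (\<lambda>_. hi) r u z * indicator (far (?\<delta> j)) z) \<in> borel_measurable borel" for s j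
      by (intro borel_measurable_times_ennreal mk mh borel_measurable_indicator near_far_measurable)
    have mP: "(\<lambda>z. ennreal (kern r s z) * increment (bp j) r u z) \<in> borel_measurable borel" for s j
      by (intro borel_measurable_times_ennreal mk m)
    have "?I \<in> borel_measurable borel" by (rule increment_variable_measurable[OF mu mc])
    then have mI: "(\<lambda>z. ennreal (kern r s z) * ?I z) \<in> borel_measurable borel" for s
      by (intro borel_measurable_times_ennreal mk)
    have le_hi: "?I z \<le> increment (\<lambda>_. hi) r u z" "increment (bm j) r u z \<le> increment (\<lambda>_. hi) r u z" for z j
      using bd(2) bm(2) by (auto intro!: increment_mono_AE)
    have compare: "(NBINT z. ennreal (kern r s z) * X z) \<le> (NBINT z. ennreal (kern r s z) * Y z) + ?R j s"
      if XY: "AE z in lborel. norm z < 1 / real (Suc j) \<longrightarrow> X z \<le> Y z" and X: "\<And>z. X z \<le> increment (\<lambda>_. hi) r u z"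
        and Y: "(\<lambda>z. ennreal (kern r s z) * Y z) \<in> borel_measurable borel" for X Y s j
    proof -
      have "(NBINT z. ennreal (kern r s z) * X z) \<le> (NBINT z. ennreal (kern r s z) * Y z +
          ennreal (kern r s z) * increment (\<lambda>_. hi) r u z * indicator (far (?\<delta> j)) z)"
      proof (rule nn_integral_mono_AE, use XY in eventually_elim)
        case (elim z)
        show ?case
        proof (cases "norm z < 1 / real (Suc j)")
          case True
          then show ?thesis using elim by (intro add_increasing2 mult_left_mono) auto
        next
          case False
          then have "z \<in> far (?\<delta> j)" using \<delta>[of j] unfolding far_def by simp
          then show ?thesis using X[of z] by (auto intro!: add_increasing mult_left_mono)
        qed
      qed
      also have "\<dots> = (NBINT z. ennreal (kern r s z) * Y z) + ?R j s"
        using Y mR by (intro nn_integral_add) auto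
      finally show ?thesis .
    qed
    have AEp1: "AE z in lborel. norm z < 1 / real (Suc j) \<longrightarrow> ?I z \<le> increment (bp j) r u z" for j
      using AEp by (rule eventually_mono) blast
    have AEm1: "AE z in lborel. norm z < 1 / real (Suc j) \<longrightarrow> increment (bm j) r u z \<le> ?I z" for j
      using AEm by (rule eventually_mono) blast
    show "\<forall>\<^sub>F s in at_left 1. (NBINT z. ennreal (kern r s z) * ?I z) \<le> (NBINT z. ennreal (kern r s z) * increment (bp j) r u z) + ?R j s" for j
      by (intro always_eventually allI compare[OF AEp1 le_hi(1) mP])
    show "\<forall>\<^sub>F s in at_left 1. (NBINT z. ennreal (kern r s z) * increment (bm j) r u z) \<le> (NBINT z. ennreal (kern r s z) * ?I z) + ?R j s" for j
      by (intro always_eventually allI compare[OF AEm1 le_hi(2) mI])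
  qed
qed

section \<open>Borel representatives and weak gradients\<close>

lemma borel_representative:
  fixes f :: "'a::euclidean_space \<Rightarrow> real"
  assumes "f \<in> borel_measurable lebesgue"
  obtains f' where "f' \<in> borel_measurable borel" "AE x in lborel. f x = f' x"
  using completion_ex_borel_measurable_real[OF assms] by auto

lemma borel_representative_vec:
  fixes g :: "'a::euclidean_space \<Rightarrow> real ^ 'n"
  assumes g: "g \<in> borel_measurable lebesgue"
  obtains g' where "g' \<in> borel_measurable borel" "AE x in lborel. g x = g' x"
proof -
  have "\<exists>f'. f' \<in> borel_measurable borel \<and> (AE x in lborel. g x $ i = f' x)" for i
  proof -
    have "(\<lambda>v :: real ^ 'n. v $ i) \<in> borel_measurable borel"
      by (intro borel_measurable_continuous_onI continuous_intros)
    from measurable_compose[OF g this] show ?thesis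
      using borel_representative[of "\<lambda>x. g x $ i"] by blast
  qed
  then obtain G where G: "\<And>i. G i \<in> borel_measurable borel" "\<And>i. AE x in lborel. g x $ i = G i x" by metis
  have "AE x in lborel. \<forall>i\<in>UNIV. g x $ i = G i x"
    by (rule AE_ball_countable'[OF G(2)]) simp
  then have "AE x in lborel. g x = (\<chi> i. G i x)" by eventually_elim (simp add: vec_eq_iff)
  with borel_measurable_vec_lambda[OF G(1)] show thesis by (rule that)
qed

lemma integrable_mult_test_function:
  fixes f :: "real ^ 'n \<Rightarrow> real"
  assumes f: "locally_integrable f" and \<phi>: "test_function \<phi>"
  shows "integrable lebesgue (\<lambda>x. f x * \<phi> x)"
proof -
  obtain R where R: "\<And>x. R < norm x \<Longrightarrow> \<phi> x = 0" using test_function_support[OF \<phi>] by metis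
  obtain M where M: "0 < M" "\<And>x. \<bar>\<phi> x\<bar> \<le> M" using test_function_bounded[OF \<phi>] by metis
  let ?F = "\<lambda>x. indicator (cball 0 R) x *\<^sub>R f x"
  have F: "integrable lebesgue ?F" by (rule locally_integrableD[OF f compact_cball])
  have eq: "(\<lambda>x. f x * \<phi> x) = (\<lambda>x. ?F x * \<phi> x)" using R by (auto simp: fun_eq_iff indicator_def not_le)
  show ?thesis unfolding eq
  proof (rule Bochner_Integration.integrable_bound[OF integrable_mult_right[OF F, of M]])
    have "\<phi> \<in> borel_measurable lebesgue" using test_function_borel(1)[OF \<phi>] by (intro measurable_completion) simp
    then show "(\<lambda>x. ?F x * \<phi> x) \<in> borel_measurable lebesgue"
      using borel_measurable_integrable[OF F] by (rule borel_measurable_times[rotated])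
    show "AE x in lebesgue. norm (?F x * \<phi> x) \<le> norm (M * ?F x)"
      using M by (intro AE_I2) (auto simp: abs_mult mult.commute intro!: mult_mono)
  qed
qed

lemma locally_integrable_nth:
  fixes g :: "real ^ 'n \<Rightarrow> real ^ 'm"
  assumes "locally_integrable g"
  shows "locally_integrable (\<lambda>x. g x $ i)"
  unfolding locally_integrable_def cart_eq_inner_axis
proof (intro allI impI)
  fix K :: "(real ^ 'n) set" assume "compact K"
  then have "g absolutely_integrable_on K" using assms by (simp add: locally_integrable_def)
  then show "(\<lambda>x. g x \<bullet> axis i 1) absolutely_integrable_on K" by (rule absolutely_integrable_component)
qed

text \<open>The difference of the components annihilates all test functions.\<close>

lemma weak_gradient_unique:
  fixes u :: "real ^ 'n \<Rightarrow> real"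
  assumes g: "weak_gradient u g" and h: "weak_gradient u h"
  shows "AE x in lborel. g x = h x"
proof -
  have "AE x in lborel. g x $ i = h x $ i" for i
  proof -
    have li: "locally_integrable (\<lambda>x. g x $ i)" "locally_integrable (\<lambda>x. h x $ i)"
      using g h by (auto simp: weak_gradient_def intro: locally_integrable_nth)
    have "\<exists>N. negligible N \<and> (\<forall>x. x \<notin> N \<longrightarrow> g x $ i - h x $ i = 0)"
    proof (rule fundamental_lemma)
      show "locally_integrable (\<lambda>x. g x $ i - h x $ i)"
        using li by (auto simp: locally_integrable_def intro: set_integral_diff)
      fix \<phi> :: "real ^ 'n \<Rightarrow> real" assume \<phi>: "test_function \<phi>"
      have "(LINT x|lebesgue. (g x $ i - h x $ i) * \<phi> x) = (LINT x|lebesgue. g x $ i * \<phi> x) - (LINT x|lebesgue. h x $ i * \<phi> x)"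
        using integrable_mult_test_function[OF li(1) \<phi>] integrable_mult_test_function[OF li(2) \<phi>]
        by (simp add: left_diff_distrib)
      also have "(LINT x|lebesgue. g x $ i * \<phi> x) = - (LINT x|lebesgue. u x * partial_deriv i \<phi> x)"
        using g \<phi> by (simp add: weak_gradient_def)
      also have "(LINT x|lebesgue. h x $ i * \<phi> x) = - (LINT x|lebesgue. u x * partial_deriv i \<phi> x)"
        using h \<phi> by (simp add: weak_gradient_def)
      finally show "(LINT x|lebesgue. (g x $ i - h x $ i) * \<phi> x) = 0" by simp
    qed
    then obtain N where N: "N \<in> null_sets lebesgue" "\<And>x. x \<notin> N \<Longrightarrow> g x $ i = h x $ i"
      by (auto simp: negligible_iff_null_sets)
    have "AE x in lebesgue. g x $ i = h x $ i"
      using AE_not_in[OF N(1)] by eventually_elim (rule N(2))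
    then show ?thesis by (simp add: AE_completion_iff)
  qed
  then have "AE x in lborel. \<forall>i\<in>UNIV. g x $ i = h x $ i"
    by (intro AE_ball_countable') auto
  then show ?thesis by eventually_elim (simp add: vec_eq_iff)
qed

text \<open>By uniqueness the given weak gradient is the one in \<open>L\<^sup>r\<close>; in particular a single
  gradient serves for both exponents.\<close>

lemma sobolev_pair_of_in_W1:
  fixes u :: "real ^ 'n \<Rightarrow> real"
  assumes W: "in_W1 r u" and G: "weak_gradient u G"
    and m: "u' \<in> borel_measurable borel" "g' \<in> borel_measurable borel"
    and ae: "AE x in lborel. u x = u' x" "AE x in lborel. G x = g' x"
  shows "sobolev_pair r u' g'"
proof -
  obtain g where u: "in_Lp r u" and g: "weak_gradient u g" "in_Lp r g" using W by (auto simp: in_W1_def)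
  have aeg: "AE x in lborel. g x = g' x"
    using ae(2) weak_gradient_unique[OF g(1) G] by eventually_elim simp
  note ae' = AE_completion[OF ae(1)] AE_completion[OF aeg]
  have mu: "u \<in> borel_measurable lebesgue" and mg: "g \<in> borel_measurable lebesgue"
    using u g by (auto simp: in_Lp_def)
  have m': "u' \<in> borel_measurable lebesgue" "g' \<in> borel_measurable lebesgue"
    using m by (auto intro!: measurable_completion)
  have nth: "(\<lambda>v :: real ^ 'n. v $ i) \<in> borel_measurable borel" for i
    by (intro borel_measurable_continuous_onI continuous_intros)
  have "integrable lebesgue (\<lambda>x. norm (u' x) powr r)"
    by (rule integrable_cong_AE_imp[of _ "\<lambda>x. norm (u x) powr r"]) (use u m' ae' in \<open>auto simp: in_Lp_def elim: eventually_mono\<close>)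
  then have iu: "integrable lborel (\<lambda>x. norm (u' x) powr r)" using m by (subst (asm) integrable_completion) auto
  have "integrable lebesgue (\<lambda>x. norm (g' x) powr r)"
    by (rule integrable_cong_AE_imp[of _ "\<lambda>x. norm (g x) powr r"]) (use g m' ae' in \<open>auto simp: in_Lp_def elim: eventually_mono\<close>)
  then have ig: "integrable lborel (\<lambda>x. norm (g' x) powr r)" using m by (subst (asm) integrable_completion) auto
  have "(LBINT x. u' x * partial_deriv i \<phi> x) = - (LBINT x. g' x $ i * \<phi> x)" if \<phi>: "test_function \<phi>" for \<phi> i
  proof -
    note b = test_function_borel[OF \<phi>]
    have b': "\<phi> \<in> borel_measurable lebesgue" "partial_deriv i \<phi> \<in> borel_measurable lebesgue"
      using b by (auto intro!: measurable_completion)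
    have "(LBINT x. u' x * partial_deriv i \<phi> x) = (LINT x|lebesgue. u' x * partial_deriv i \<phi> x)"
      using b m by (intro integral_completion[symmetric]) simp
    also have "\<dots> = (LINT x|lebesgue. u x * partial_deriv i \<phi> x)"
      using mu m' b' ae' by (intro integral_cong_AE) (auto elim: eventually_mono)
    also have "\<dots> = - (LINT x|lebesgue. g x $ i * \<phi> x)"
      using g(1) \<phi> by (simp add: weak_gradient_def)
    also have "(LINT x|lebesgue. g x $ i * \<phi> x) = (LINT x|lebesgue. g' x $ i * \<phi> x)"
      using b'(1) ae' measurable_compose[OF mg nth] measurable_compose[OF m'(2) nth]
      by (intro integral_cong_AE) (auto elim: eventually_mono)
    also have "\<dots> = (LBINT x. g' x $ i * \<phi> x)"
      using b(1) measurable_compose[OF m(2) nth] by (intro integral_completion) simp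
    finally show ?thesis .
  qed
  then show ?thesis using m iu ig by (simp add: sobolev_pair_def)
qed

lemma in_W1_of_sobolev_pair:
  fixes u :: "real ^ 'n \<Rightarrow> real"
  assumes u: "in_Lp r u" and r: "1 < r" and ae: "AE x in lborel. u x = u' x" and S: "sobolev_pair r u' g"
  shows "in_W1 r u"
proof -
  have m: "u' \<in> borel_measurable borel" "g \<in> borel_measurable borel"
    and i: "integrable lborel (\<lambda>x. \<bar>u' x\<bar> powr r)" "integrable lborel (\<lambda>x. norm (g x) powr r)"
    using S by (auto simp: sobolev_pair_def)
  have mu: "u \<in> borel_measurable lebesgue" using u by (simp add: in_Lp_def)
  have m': "u' \<in> borel_measurable lebesgue" "g \<in> borel_measurable lebesgue"
    using m by (auto intro!: measurable_completion)
  note ae' = AE_completion[OF ae]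
  have nth: "(\<lambda>v :: real ^ 'n. v $ i) \<in> borel_measurable borel" for i
    by (intro borel_measurable_continuous_onI continuous_intros)
  have Lg: "in_Lp r g"
    using m m' i by (simp add: in_Lp_def integrable_completion)
  have lg: "locally_integrable g" using locally_integrable_Lr[OF m(2) i(2)] r by simp
  have lu': "locally_integrable u'" using locally_integrable_Lr[OF m(1), of r] i(1) r by simp
  have lu: "locally_integrable u"
    unfolding locally_integrable_def set_integrable_def
  proof (intro allI impI)
    fix K :: "(real ^ 'n) set" assume K: "compact K"
    have "K \<in> sets lebesgue" using borel_compact[OF K] by (auto intro: sets_completionI_sets)
    then have "(\<lambda>x. indicator K x *\<^sub>R u x) \<in> borel_measurable lebesgue"
      using mu by (intro borel_measurable_scaleR borel_measurable_indicator)
    then show "integrable lebesgue (\<lambda>x. indicator K x *\<^sub>R u x)"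
      by (rule integrable_cong_AE_imp[OF locally_integrableD[OF lu' K]]) (use ae' in \<open>auto elim: eventually_mono\<close>)
  qed
  have "(LINT x|lebesgue. u x * partial_deriv i \<phi> x) = - (LINT x|lebesgue. g x $ i * \<phi> x)" if \<phi>: "test_function \<phi>" for \<phi> i
  proof -
    note b = test_function_borel[OF \<phi>]
    have b': "partial_deriv i \<phi> \<in> borel_measurable lebesgue" using b by (auto intro!: measurable_completion)
    have "(LINT x|lebesgue. u x * partial_deriv i \<phi> x) = (LINT x|lebesgue. u' x * partial_deriv i \<phi> x)"
      using mu m' b' ae' by (intro integral_cong_AE) (auto elim: eventually_mono)
    also have "\<dots> = (LBINT x. u' x * partial_deriv i \<phi> x)"
      using b m by (intro integral_completion) simp
    also have "\<dots> = - (LBINT x. g x $ i * \<phi> x)" using S \<phi> by (simp add: sobolev_pair_def)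
    also have "(LBINT x. g x $ i * \<phi> x) = (LINT x|lebesgue. g x $ i * \<phi> x)"
      using b(1) measurable_compose[OF m(2) nth] by (intro integral_completion[symmetric]) simp
    finally show ?thesis .
  qed
  then show ?thesis using u Lg lu lg by (auto simp: in_W1_def weak_gradient_def)
qed

section \<open>The functional as a pair of energies\<close>

lemma AE_lborel_coordinates:
  fixes P :: "'a::euclidean_space \<Rightarrow> bool"
  assumes "AE x in lborel. P x"
  shows "AE p in lborel. P (fst p) \<and> P (snd p)"
proof -
  obtain N where N: "{x. \<not> P x} \<subseteq> N" "N \<in> null_sets lborel"
    using assms unfolding eventually_ae_filter by auto
  have "N \<times> UNIV \<in> null_sets (lborel \<Otimes>\<^sub>M (lborel :: 'a measure))"
    by (rule lborel.times_in_null_sets1[OF N(2)]) simp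
  moreover have "UNIV \<times> N \<in> null_sets ((lborel :: 'a measure) \<Otimes>\<^sub>M lborel)"
    by (rule lborel.times_in_null_sets2[OF _ N(2)]) simp
  ultimately have "N \<times> UNIV \<union> UNIV \<times> N \<in> null_sets (lborel :: ('a \<times> 'a) measure)"
    unfolding lborel_prod by (rule null_sets.Un)
  then show ?thesis by (rule AE_I') (use N(1) in auto)
qed

text \<open>The shear \<open>y = x + z\<close>; the second factor of the integrand depends on \<open>z\<close>
  only.\<close>

lemma kern_energy_eq:
  fixes u :: "real ^ 'n \<Rightarrow> real" and c :: "(real ^ 'n) \<times> (real ^ 'n) \<Rightarrow> real"
  assumes mu: "u \<in> borel_measurable borel" and mc: "c \<in> borel_measurable borel" and s: "s \<le> 1"
  shows "(\<lambda>p. ennreal (c p * (\<bar>u (fst p) - u (snd p)\<bar> powr r / norm (fst p - snd p) powr (real CARD('n) + s * r)))) \<in> borel_measurable borel" (is "?F \<in> _")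
    and "ennreal (1 - s) * (NBINT p. ennreal (c p * (\<bar>u (fst p) - u (snd p)\<bar> powr r / norm (fst p - snd p) powr (real CARD('n) + s * r)))) =
      (NBINT z. ennreal (kern r s z) * increment (\<lambda>x. c (x, x + z)) r u z)"
proof -
  have "(\<lambda>p. u (fst p)) \<in> borel_measurable (borel :: ((real ^ 'n) \<times> (real ^ 'n)) measure)"
    by (rule measurable_compose[OF _ mu]) (intro borel_measurable_continuous_onI continuous_intros)
  moreover have "(\<lambda>p. u (snd p)) \<in> borel_measurable (borel :: ((real ^ 'n) \<times> (real ^ 'n)) measure)"
    by (rule measurable_compose[OF _ mu]) (intro borel_measurable_continuous_onI continuous_intros)
  moreover have "(\<lambda>p. norm (fst p - snd p)) \<in> borel_measurable (borel :: ((real ^ 'n) \<times> (real ^ 'n)) measure)"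
    by (intro borel_measurable_continuous_onI continuous_intros)
  ultimately show mF: "?F \<in> borel_measurable borel" using mc by measurable
  have "ennreal (1 - s) * (NBINT p. ?F p) = (NBINT p. ennreal (1 - s) * ?F p)"
    using mF by (intro nn_integral_cmult[symmetric]) simp
  also have "\<dots> = (NBINT z. NBINT x. ennreal (1 - s) * ?F (x, x + z))"
    using mF by (intro nn_integral_lborel_shear) simp
  also have "\<dots> = (NBINT z. ennreal (kern r s z) * increment (\<lambda>x. c (x, x + z)) r u z)"
  proof (rule nn_integral_cong)
    fix z :: "real ^ 'n"
    have "ennreal (1 - s) * ?F (x, x + z) = ennreal (kern r s z) * ennreal (c (x, x + z) * \<bar>u (x + z) - u x\<bar> powr r)" for x
    proof -
      have "norm z powr (- real CARD('n) - s * r) = inverse (norm z powr (real CARD('n) + s * r))"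
        by (simp flip: powr_minus)
      then have "(1 - s) * (c (x, x + z) * (\<bar>u x - u (x + z)\<bar> powr r / norm z powr (real CARD('n) + s * r))) =
          kern r s z * (c (x, x + z) * \<bar>u (x + z) - u x\<bar> powr r)"
        by (simp add: kern_def abs_minus_commute divide_inverse mult_ac)
      then show ?thesis using s kern_nonneg[OF s, of r z] by (simp flip: ennreal_mult')
    qed
    moreover have "(\<lambda>x. ennreal (c (x, x + z) * \<bar>u (x + z) - u x\<bar> powr r)) \<in> borel_measurable lborel"
    proof -
      have "(\<lambda>x. c (x, x + z)) \<in> borel_measurable borel"
        by (rule measurable_compose[OF _ mc]) (intro borel_measurable_continuous_onI continuous_intros)
      moreover have "(\<lambda>x. u (x + z)) \<in> borel_measurable borel"
        by (rule measurable_compose[OF _ mu]) (intro borel_measurable_continuous_onI continuous_intros)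
      ultimately show ?thesis using mu by measurable
    qed
    ultimately show "(NBINT x. ennreal (1 - s) * ?F (x, x + z)) = ennreal (kern r s z) * increment (\<lambda>x. c (x, x + z)) r u z"
      unfolding increment_def by (simp only: nn_integral_cmult)
  qed
  finally show "ennreal (1 - s) * (NBINT p. ?F p) =
      (NBINT z. ennreal (kern r s z) * increment (\<lambda>x. c (x, x + z)) r u z)" .
qed

lemma J_functional_eq_energies:
  fixes u :: "real ^ 'n \<Rightarrow> real"
  assumes mu: "u' \<in> borel_measurable borel" and mc: "c \<in> borel_measurable borel" and s: "s \<le> 1"
    and ae: "AE x in lborel. u x = u' x" "AE p in lborel. a (fst p) (snd p) = c p" and c: "\<And>p. 0 \<le> c p"
  shows "ennreal (1 - s) * J_functional a s p q u =
      (NBINT z. ennreal (kern q s z) * modulus q u' z) +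
      (NBINT z. ennreal (kern p s z) * increment (\<lambda>x. c (x, x + z)) p u' z)"
proof -
  let ?T = "\<lambda>r p. \<bar>u' (fst p) - u' (snd p)\<bar> powr r / norm (fst p - snd p) powr (real CARD('n) + s * r)"
  have "J_functional a s p q u = (NBINT w. ennreal (1 * ?T q w) + ennreal (c w * ?T p w))"
    unfolding J_functional_def nn_integral_completion
  proof (rule nn_integral_cong_AE, use AE_lborel_coordinates[OF ae(1)] ae(2) in eventually_elim)
    case (elim w)
    then show ?case using c[of w] by (simp add: case_prod_beta' ennreal_plus)
  qed
  also have "\<dots> = (NBINT w. ennreal (1 * ?T q w)) + (NBINT w. ennreal (c w * ?T p w))"
    using kern_energy_eq(1)[OF mu _ s, of "\<lambda>_. 1" q] kern_energy_eq(1)[OF mu mc s, of p]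
    by (intro nn_integral_add) simp_all
  finally show ?thesis
    using kern_energy_eq(2)[OF mu _ s, of "\<lambda>_. 1" q] kern_energy_eq(2)[OF mu mc s, of p]
    by (simp add: distrib_left)
qed

section \<open>The limit theorem\<close>

theorem proposition4p1:
  fixes a :: "real ^ 'n \<Rightarrow> real ^ 'n \<Rightarrow> real" and u :: "real ^ 'n \<Rightarrow> real"
    and p q a_minus a_plus :: real and k :: 'n
  assumes "1 < q" and "q \<le> p"
    and "(\<lambda>(x, y). a x y) \<in> borel_measurable lebesgue"
    and "\<forall>x. continuous_on UNIV (a x)"
    and "0 < a_minus" and "\<forall>x y. a_minus \<le> a x y \<and> a x y \<le> a_plus"
  shows
    "(in_W1 p u \<and> in_W1 q u \<longrightarrow>
        (\<forall>grad_u. weak_gradient u grad_u \<longrightarrow>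
          ((\<lambda>s. ennreal (1 - s) * J_functional a s p q u) \<longlongrightarrow>
             K_const k q * (\<integral>\<^sup>+ x. ennreal (norm (grad_u x) powr q) \<partial>lebesgue)
             + K_const k p * (\<integral>\<^sup>+ x. ennreal (a x x * norm (grad_u x) powr p) \<partial>lebesgue))
          (at_left 1)))
     \<and> (in_Lp p u \<and> in_Lp q u
          \<and> Liminf (at_left 1) (\<lambda>s. ennreal (1 - s) * J_functional a s p q u) < \<infinity> \<longrightarrow>
        in_W1 p u \<and> in_W1 q u)"
proof -
  have q: "1 < q" and p: "1 < p" using assms(1,2) by auto
  have am: "0 \<le> a_minus" using assms(5) by simp
  have cont: "continuous_on UNIV (a x)" for x using assms(4) by blast
  obtain c0 where c0: "c0 \<in> borel_measurable borel" "AE w in lborel. (case w of (x, y) \<Rightarrow> a x y) = c0 w"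
    by (rule borel_representative[OF assms(3)])
  \<comment> \<open>Truncation makes the bounds hold everywhere, not only almost everywhere.\<close>
  define c where "c w = max a_minus (min a_plus (c0 w))" for w
  have mc: "c \<in> borel_measurable borel" unfolding c_def using c0(1) by measurable
  have le: "a_minus \<le> a_plus" using assms(6) by (meson order_trans)
  have c: "a_minus \<le> c w" "c w \<le> a_plus" for w using le by (auto simp: c_def)
  have c_nn: "0 \<le> c w" for w using c(1)[of w] am by linarith
  have ac: "AE w in lborel. a (fst w) (snd w) = c w"
    using c0(2)
  proof eventually_elim
    case (elim w)
    have "c0 w = a (fst w) (snd w)" using elim by (simp add: case_prod_beta')
    then show ?case using assms(6) by (simp add: c_def min_absorb2 max_absorb2)
  qed
  have s1: "\<forall>\<^sub>F s in at_left (1::real). s \<le> 1" by (auto simp: eventually_at_left_field intro!: exI[of _ 0])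
  have part1: "((\<lambda>s. ennreal (1 - s) * J_functional a s p q u) \<longlongrightarrow>
       K_const k q * (\<integral>\<^sup>+ x. ennreal (norm (G x) powr q) \<partial>lebesgue)
       + K_const k p * (\<integral>\<^sup>+ x. ennreal (a x x * norm (G x) powr p) \<partial>lebesgue)) (at_left 1)"
    if W: "in_W1 p u" "in_W1 q u" and G: "weak_gradient u G" for G
  proof -
    obtain g where g: "in_Lp p u" "weak_gradient u g" "in_Lp p g" using W(1) by (auto simp: in_W1_def)
    obtain u' where u': "u' \<in> borel_measurable borel" "AE x in lborel. u x = u' x"
      using borel_representative[of u] g(1) by (auto simp: in_Lp_def)
    obtain g' where g': "g' \<in> borel_measurable borel" "AE x in lborel. g x = g' x"
      using borel_representative_vec[of g] g(3) by (auto simp: in_Lp_def)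
    have Gg: "AE x in lborel. G x = g' x"
      using weak_gradient_unique[OF G g(2)] g'(2) by eventually_elim simp
    note S = sobolev_pair_of_in_W1[OF W(1) G u'(1) g'(1) u'(2) Gg] sobolev_pair_of_in_W1[OF W(2) G u'(1) g'(1) u'(2) Gg]
    have "((\<lambda>s. (NBINT z. ennreal (kern q s z) * modulus q u' z) +
        (NBINT z. ennreal (kern p s z) * increment (\<lambda>x. c (x, x + z)) p u' z)) \<longlongrightarrow>
        K_const k q * (NBINT x. ennreal (1 * norm (g' x) powr q)) +
        K_const k p * (NBINT x. ennreal (a x x * norm (g' x) powr p))) (at_left 1)"
      by (intro tendsto_add variable_energy_tendsto[OF S(1) p mc cont ac am c]
            weighted_energy_tendsto[OF S(2) q, where B=1]) auto
    moreover have "\<forall>\<^sub>F s in at_left 1. (NBINT z. ennreal (kern q s z) * modulus q u' z) +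
        (NBINT z. ennreal (kern p s z) * increment (\<lambda>x. c (x, x + z)) p u' z) = ennreal (1 - s) * J_functional a s p q u"
      using s1 by eventually_elim (rule J_functional_eq_energies[OF u'(1) mc _ u'(2) ac c_nn, symmetric])
    moreover have "(NBINT x. ennreal (1 * norm (g' x) powr q)) = (\<integral>\<^sup>+ x. ennreal (norm (G x) powr q) \<partial>lebesgue)"
      unfolding nn_integral_completion using Gg by (intro nn_integral_cong_AE) (auto elim: eventually_mono)
    moreover have "(NBINT x. ennreal (a x x * norm (g' x) powr p)) = (\<integral>\<^sup>+ x. ennreal (a x x * norm (G x) powr p) \<partial>lebesgue)"
      unfolding nn_integral_completion using Gg by (intro nn_integral_cong_AE) (auto elim: eventually_mono)
    ultimately show ?thesis by (simp only: tendsto_cong)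
  qed
  have part2: "in_W1 p u \<and> in_W1 q u"
    if L: "in_Lp p u" "in_Lp q u" and fin: "Liminf (at_left 1) (\<lambda>s. ennreal (1 - s) * J_functional a s p q u) < \<infinity>"
  proof -
    obtain u' where u': "u' \<in> borel_measurable borel" "AE x in lborel. u x = u' x"
      using borel_representative[of u] L(1) by (auto simp: in_Lp_def)
    have int: "integrable lborel (\<lambda>x. \<bar>u' x\<bar> powr r)" if "in_Lp r u" for r
    proof -
      have "integrable lebesgue (\<lambda>x. \<bar>u' x\<bar> powr r)"
        by (rule integrable_cong_AE_imp[of _ "\<lambda>x. norm (u x) powr r"])
          (use that measurable_completion[of u' lborel borel] u' AE_completion[OF u'(2)] in \<open>auto simp: in_Lp_def elim: eventually_mono\<close>)
      then show ?thesis using u'(1) by (subst (asm) integrable_completion) auto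
    qed
    obtain M where M: "Liminf (at_left 1) (\<lambda>s. ennreal (1 - s) * J_functional a s p q u) < M" "M < \<infinity>"
      using dense[OF fin] by blast
    define K where "K = enn2real M"
    have MK: "M = ennreal K" "0 \<le> K" using M(2) by (auto simp: K_def)
    have freq: "\<exists>\<^sub>F s in at_left 1. ennreal (1 - s) * J_functional a s p q u \<le> ennreal K"
    proof (rule ccontr)
      assume "\<not> ?thesis"
      then have "\<forall>\<^sub>F s in at_left 1. M \<le> ennreal (1 - s) * J_functional a s p q u"
        by (auto simp: frequently_def MK not_le elim!: eventually_mono intro: less_imp_le)
      then have "M \<le> Liminf (at_left 1) (\<lambda>s. ennreal (1 - s) * J_functional a s p q u)" by (rule Liminf_bounded)
      with M(1) show False by simp
    qed
    have freq_q: "\<exists>\<^sub>F s in at_left 1. (NBINT z. ennreal (kern q s z) * modulus q u' z) \<le> ennreal K"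
      using freq
    proof (rule frequently_rev_mp, use s1 in eventually_elim)
      case (elim s)
      show ?case unfolding J_functional_eq_energies[OF u'(1) mc elim u'(2) ac c_nn]
        by (auto intro: order_trans[OF add_increasing2[OF _ order_refl]])
    qed
    have freq_p: "\<exists>\<^sub>F s in at_left 1. (NBINT z. ennreal (kern p s z) * modulus p u' z) \<le> ennreal (K / a_minus)"
      using freq
    proof (rule frequently_rev_mp, use s1 in eventually_elim)
      case (elim s)
      show ?case
      proof
        assume "ennreal (1 - s) * J_functional a s p q u \<le> ennreal K"
        then have b: "(NBINT z. ennreal (kern p s z) * increment (\<lambda>x. c (x, x + z)) p u' z) \<le> ennreal K"
          unfolding J_functional_eq_energies[OF u'(1) mc elim u'(2) ac c_nn]
          by (auto intro: order_trans[OF add_increasing[OF _ order_refl]])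
        have "modulus p u' z \<le> ennreal (1 / a_minus) * increment (\<lambda>x. c (x, x + z)) p u' z" for z
        proof -
          have "(\<lambda>x. c (x, x + z)) \<in> borel_measurable borel"
            by (rule measurable_compose[OF _ mc]) (intro borel_measurable_continuous_onI continuous_intros)
          moreover have "(\<lambda>x. u' (x + z)) \<in> borel_measurable borel"
            by (rule measurable_compose[OF _ u'(1)]) (intro borel_measurable_continuous_onI continuous_intros)
          ultimately have m: "(\<lambda>x. ennreal (c (x, x + z) * \<bar>u' (x + z) - u' x\<bar> powr p)) \<in> borel_measurable lborel"
            using u'(1) by measurable
          have "1 * X \<le> 1 / a_minus * (c w * X)" if "0 \<le> X" for X w
            using mult_right_mono[OF c(1)[of w] that] assms(5) by (simp add: field_simps)
          then have "ennreal (1 * \<bar>u' (x + z) - u' x\<bar> powr p) \<le> ennreal (1 / a_minus) * ennreal (c (x, x + z) * \<bar>u' (x + z) - u' x\<bar> powr p)" for x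
            using am by (simp add: ennreal_mult'[symmetric] ennreal_leI del: times_divide_eq_left)
          then have "modulus p u' z \<le> (NBINT x. ennreal (1 / a_minus) * ennreal (c (x, x + z) * \<bar>u' (x + z) - u' x\<bar> powr p))"
            unfolding increment_def by (rule nn_integral_mono)
          also have "\<dots> = ennreal (1 / a_minus) * increment (\<lambda>x. c (x, x + z)) p u' z"
            unfolding increment_def by (rule nn_integral_cmult[OF m])
          finally show ?thesis .
        qed
        then have "(NBINT z. ennreal (kern p s z) * modulus p u' z) \<le>
            (NBINT z. ennreal (kern p s z) * (ennreal (1 / a_minus) * increment (\<lambda>x. c (x, x + z)) p u' z))"
          by (intro nn_integral_mono mult_left_mono) auto
        also have "\<dots> = ennreal (1 / a_minus) * (NBINT z. ennreal (kern p s z) * increment (\<lambda>x. c (x, x + z)) p u' z)"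
        proof -
          have "(\<lambda>z. ennreal (kern p s z) * increment (\<lambda>x. c (x, x + z)) p u' z) \<in> borel_measurable lborel"
            using increment_variable_measurable[OF u'(1) mc, of p] by simp
          from nn_integral_cmult[OF this, of "ennreal (1 / a_minus)"] show ?thesis by (simp only: mult_ac)
        qed
        also have "\<dots> \<le> ennreal (1 / a_minus) * ennreal K" by (intro mult_left_mono b) simp
        also have "\<dots> = ennreal (K / a_minus)" using am MK(2) by (simp add: ennreal_mult'[symmetric])
        finally show "(NBINT z. ennreal (kern p s z) * modulus p u' z) \<le> ennreal (K / a_minus)" .
      qed
    qed
    have "\<exists>g. sobolev_pair p u' g"
      by (rule sobolev_pair_of_energy_bound[OF u'(1) int[OF L(1)] p _ freq_p]) (use MK(2) am in simp)
    then have "in_W1 p u" using in_W1_of_sobolev_pair[OF L(1) p u'(2)] by blast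
    moreover have "\<exists>g. sobolev_pair q u' g"
      by (rule sobolev_pair_of_energy_bound[OF u'(1) int[OF L(2)] q MK(2) freq_q])
    then have "in_W1 q u" using in_W1_of_sobolev_pair[OF L(2) q u'(2)] by blast
    ultimately show ?thesis ..
  qed
  show ?thesis using part1 part2 by blast
qed

end
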